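(* Let $\Theta=\sum_{k=1}^{K}\theta_k\delta_{\psi_k}$ be a completely random signed measure on a complete separable metric space $\Psi$ satisfying Assumptions A00, A0, A1 and A2' stated in the context. Assume that $\nu(d\theta)=g(\theta)d\theta$ for some function $g:\mathbb{R}\setminus\{0\}\to(0,\infty)$. Let $X_1,\dots,X_m$ be generated i.i.d. conditionally on $\Theta$ according to $X_1=\sum_{k=1}^{K}x_k\delta_{\psi_k}$ with, independently across $k$, $x_k\mid\theta_k\sim H_{fix}(dx\mid\theta_k)$ if $\psi_k$ is a fixed atom and $x_k\mid\theta_k\sim H_{ord}(dx\mid\theta_k)$ otherwise. Let $\Theta_{post}$ be a random signed measure with the distribution of $\Theta\mid X_1,\dots,X_m$. Then $\Theta_{post}$ is a completely random signed measure with three parts. 1. For each $k\in\{1,\dots,K_{fix}\}$, $\Theta_{post}$ has a fixed atom at $\psi_{fix,k}$ with weight $\theta_{post,fix,k}$ with density $f_{post,fix,k}(\theta)\propto f_{fix,k}(\theta)\prod_{j=1}^{m}h_{fix}(x_{fix,j,k}\mid\theta)$. 2. For each $k\in\{1,\dots,K_{new}\}$, $\Theta_{post}$ has a fixed atom at $\psi_{new,k}$ with weight $\theta_{post,new,k}$, whose density is proportional to $g(\theta)\prod_{j=1}^{m}h_{ord}(x_{new,j,k}\mid\theta)$. 3. The ordinary component of $\Theta_{post}$ has weight measure $\nu_{post}(d\theta):=\nu(d\theta)\,H_{ord}(\{0\}\mid\theta)^m$.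
   Context: A completely random signed measure (CRSM) is a random signed measure (random real-valued countably additive set function on bounded Borel sets) whose values on disjoint bounded sets are jointly independent. It has an a.s. unique representation as $\sum_j Y_j\delta_{s_j}+\alpha+\int x\,N(\cdot\times dx)$, with independent random weights $Y_j$ at deterministic locations $s_j$ (fixed component), a deterministic atomless signed part $\alpha$, and a Poisson process $N$ on $\Psi\times(\mathbb{R}\setminus\{0\})$, independent of the $Y_j$, with intensity (Lévy) measure $F$ satisfying $\int(1\wedge|x|)F(B\times dx)<\infty$ for bounded $B$ and $F(\{s\}\times(\mathbb{R}\setminus\{0\}))=0$ for every $s$; the last term is the ordinary component. Prior: $\Theta=\sum_{k=1}^K\theta_k\delta_{\psi_k}$ is a CRSM on $\Psi$, where $K$ may be finite or infinite, and $K=K_{fix}+K_{ord}$ counts fixed and non-fixed atoms. The fixed component is $\sum_{k=1}^{K_{fix}}\theta_{fix,k}\delta_{\psi_{fix,k}}$, and the law $F_{fix,k}$ of $\theta_{fix,k}$ has density $f_{fix,k}$. Likelihood: for each $\theta$, $H_{fix}(\cdot\mid\theta)$ is a continuous probability distribution on $\mathbb{R}$ with density $h_{fix}(\cdot\mid\theta)$, and $H_{ord}(\cdot\mid\theta)$ is a probability distribution on $\mathbb{R}$ that is continuous except for a point mass at zero, with density $h_{ord}(\cdot\mid\theta)$ on $\mathbb{R}\setminus\{0\}$. Data notation: $x_{fix,j,k}$ is the weight of $X_j$ at $\psi_{fix,k}$; $\{\psi_{new,k}:k=1,\dots,K_{new}\}$ is the union of the atom locations of $X_1,\dots,X_m$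 minus the fixed atom locations of the prior; $x_{new,j,k}$ is the weight of the atom in $X_j$ located at $\psi_{new,k}$. Assumptions. A00: the deterministic part of $\Theta$ is zero, and its Lévy measure is $\mu(d\theta\times d\psi)=\nu(d\theta)\,G(d\psi)$, with $\nu$ a $\sigma$-finite measure on $\mathbb{R}\setminus\{0\}$ (the weight measure) and $G$ a probability distribution on $\Psi$ without atoms. A0: $\Theta$ has finitely many fixed atoms. A1: $\nu(\mathbb{R}\setminus\{0\})=\infty$. A2': $\int_{\mathbb{R}\setminus\{0\}}\int_{\mathbb{R}\setminus\{0\}}h_{ord}(x\mid\theta)\,dx\,\nu(d\theta)<\infty$.
   Formalization: In part 2, if X_j has no atom at ψ_new,k then x_new,j,k = 0, where the density h_ord(·|θ) on ℝ∖{0} is undefined; the factor h_ord(0|θ) is taken to be the point mass H_ord({0}|θ). *)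

theory Defs
  imports "HOL-Probability.Probability"
begin

section \<open>Random signed measures\<close>

definition bounded_borel :: "'a::metric_space set set" where
  "bounded_borel = {B \<in> sets borel. bounded B}"

text \<open>The sigma-algebra is the one generated by the evaluations at bounded Borel sets. Elements are
  extensional: they take the value \<^const>\<open>undefined\<close> outside \<^const>\<open>bounded_borel\<close>.\<close>

definition signed_measure_space :: "('a::metric_space set \<Rightarrow> real) measure" where
  "signed_measure_space =
     restrict_space (\<Pi>\<^sub>M B\<in>bounded_borel. borel)
       {\<xi>. \<forall>A::nat \<Rightarrow> 'a set. disjoint_family A \<and> range A \<subseteq> bounded_borel \<and> (\<Union>i. A i) \<in> bounded_borel
             \<longrightarrow> (\<lambda>i. \<xi> (A i)) sums \<xi> (\<Union>i. A i)}"

definition zero_signed_measure :: "'a::metric_space set \<Rightarrow> real" where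
  "zero_signed_measure = (\<lambda>B\<in>bounded_borel. 0)"

text \<open>Finite families of disjoint sets are covered by padding with empty sets.\<close>

definition crsm :: "'w measure \<Rightarrow> ('w \<Rightarrow> 'a::metric_space set \<Rightarrow> real) \<Rightarrow> bool" where
  "crsm M \<Xi> \<longleftrightarrow> prob_space M \<and> \<Xi> \<in> M \<rightarrow>\<^sub>M signed_measure_space \<and>
     (\<forall>A::nat \<Rightarrow> 'a set. range A \<subseteq> bounded_borel \<and> disjoint_family A \<longrightarrow>
        prob_space.indep_vars M (\<lambda>_. borel) (\<lambda>i \<omega>. \<Xi> \<omega> (A i)) UNIV)"

section \<open>Poisson processes and the representation of a CRSM\<close>

definition poisson_process :: "'w measure \<Rightarrow> ('w \<Rightarrow> 'b measure) \<Rightarrow> 'b measure \<Rightarrow> bool" where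
  "poisson_process M N F \<longleftrightarrow>
     (\<forall>\<omega>\<in>space M. sets (N \<omega>) = sets F) \<and>
     (\<forall>A\<in>sets F. (\<lambda>\<omega>. emeasure (N \<omega>) A) \<in> borel_measurable M) \<and>
     (\<forall>A\<in>sets F. emeasure F A < \<infinity> \<longrightarrow>
        (\<forall>n. measure M {\<omega>\<in>space M. emeasure (N \<omega>) A = of_nat n}
             = exp (- measure F A) * measure F A ^ n / fact n)) \<and>
     (\<forall>A\<in>sets F. emeasure F A = \<infinity> \<longrightarrow> (AE \<omega> in M. emeasure (N \<omega>) A = \<infinity>)) \<and>
     (\<forall>A::nat \<Rightarrow> 'b set. range A \<subseteq> sets F \<and> disjoint_family A \<longrightarrow>
        prob_space.indep_vars M (\<lambda>_. borel) (\<lambda>i \<omega>. emeasure (N \<omega>) (A i)) UNIV)"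

definition nonzero_borel :: "real measure" where
  "nonzero_borel = restrict_space borel (- {0})"

definition nonzero_lborel :: "real measure" where
  "nonzero_lborel = restrict_space lborel (- {0})"

definition levy_measure :: "('a::metric_space \<times> real) measure \<Rightarrow> bool" where
  "levy_measure F \<longleftrightarrow> sets F = sets (borel \<Otimes>\<^sub>M nonzero_borel) \<and>
     (\<forall>B\<in>bounded_borel. (\<integral>\<^sup>+ p. indicator B (fst p) * ennreal (min 1 \<bar>snd p\<bar>) \<partial>F) < \<infinity>) \<and>
     (\<forall>s. emeasure F ({s} \<times> (- {0})) = 0)"

text \<open>\<open>\<Xi> = (\<Sum>s\<in>S. Y\<^sub>s \<delta>\<^sub>s) + \<alpha> + \<integral> x N(\<cdot> \<times> dx)\<close> almost surely, with fixed locations \<open>S\<close>,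
  independent weights \<open>Y\<^sub>s\<close> of law \<open>L s\<close>, deterministic atomless part \<open>\<alpha>\<close>, and a Poisson process \<open>N\<close>
  of intensity \<open>F\<close> independent of the family of weights.\<close>

definition crsm_representation ::
  "'w measure \<Rightarrow> ('w \<Rightarrow> 'a::metric_space set \<Rightarrow> real) \<Rightarrow>
   'a set \<Rightarrow> ('a \<Rightarrow> real measure) \<Rightarrow> ('a set \<Rightarrow> real) \<Rightarrow> ('a \<times> real) measure \<Rightarrow> bool" where
  "crsm_representation M \<Xi> S L \<alpha> F \<longleftrightarrow>
     countable S \<and> \<alpha> \<in> space signed_measure_space \<and> (\<forall>s. \<alpha> {s} = 0) \<and> levy_measure F \<and>
     (\<exists>(Y :: 'a \<Rightarrow> 'w \<Rightarrow> real) (N :: 'w \<Rightarrow> ('a \<times> real) measure).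
        prob_space.indep_vars M (\<lambda>_. borel) Y S \<and>
        (\<forall>s\<in>S. distr M borel (Y s) = L s) \<and>
        poisson_process M N F \<and>
        prob_space.indep_set M
          (sets (vimage_algebra (space M) (\<lambda>\<omega>. \<lambda>s\<in>S. Y s \<omega>) (\<Pi>\<^sub>M s\<in>S. borel)))
          (sets (vimage_algebra (space M) (\<lambda>\<omega>. \<lambda>A\<in>sets F. emeasure (N \<omega>) A) (\<Pi>\<^sub>M A\<in>sets F. borel))) \<and>
        (AE \<omega> in M. \<forall>B\<in>bounded_borel.
           (\<lambda>s. Y s \<omega>) summable_on (S \<inter> B) \<and>
           integrable (N \<omega>) (\<lambda>p. indicator B (fst p) * snd p) \<and>
           \<Xi> \<omega> B = (\<Sum>\<^sub>\<infinity>s\<in>S \<inter> B. Y s \<omega>) + \<alpha> B + (\<integral>p. indicator B (fst p) * snd p \<partial>N \<omega>)))"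

section \<open>The hierarchical model\<close>

text \<open>\<open>\<Xi> = (\<Sum>k<K. w\<^sub>k \<delta>(\<psi>\<^sub>k))\<close> almost surely, where \<open>K\<close> may be random and infinite.\<close>

definition atomic_series ::
  "'w measure \<Rightarrow> ('w \<Rightarrow> enat) \<Rightarrow> (nat \<Rightarrow> 'w \<Rightarrow> 'a::metric_space) \<Rightarrow> (nat \<Rightarrow> 'w \<Rightarrow> real) \<Rightarrow>
   ('w \<Rightarrow> 'a set \<Rightarrow> real) \<Rightarrow> bool" where
  "atomic_series M K \<psi> w \<Xi> \<longleftrightarrow>
     K \<in> M \<rightarrow>\<^sub>M count_space UNIV \<and> (\<forall>k. \<psi> k \<in> borel_measurable M) \<and> (\<forall>k. w k \<in> borel_measurable M) \<and>
     \<Xi> \<in> M \<rightarrow>\<^sub>M signed_measure_space \<and>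
     (AE \<omega> in M. \<forall>B\<in>bounded_borel.
        ((\<lambda>k. w k \<omega>) has_sum \<Xi> \<omega> B) {k. enat k < K \<omega> \<and> \<psi> k \<omega> \<in> B})"

text \<open>Conditionally on all \<open>K\<close>, \<open>\<psi>\<^sub>k\<close>, \<open>\<theta>\<^sub>k\<close>, the weights \<open>x j k\<close> with \<open>j < m\<close> and \<open>k < K\<close> are independent
  with \<open>x j k \<sim> H k \<theta>\<^sub>k\<close>. The event \<open>D\<close> ranges over the sigma-algebra generated by the atoms; on it
  the first \<open>n\<close> atoms are required to exist, so nothing is said about \<open>x j k\<close> with \<open>k \<ge> K\<close>.\<close>

definition conditionally_independent_weights ::
  "'w measure \<Rightarrow> nat \<Rightarrow> ('w \<Rightarrow> enat) \<Rightarrow> (nat \<Rightarrow> 'w \<Rightarrow> 'a::metric_space) \<Rightarrow> (nat \<Rightarrow> 'w \<Rightarrow> real) \<Rightarrow>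
   (nat \<Rightarrow> real \<Rightarrow> real measure) \<Rightarrow> (nat \<Rightarrow> nat \<Rightarrow> 'w \<Rightarrow> real) \<Rightarrow> bool" where
  "conditionally_independent_weights M m K \<psi> \<theta> H x \<longleftrightarrow>
     (\<forall>n D E. D \<in> sets (count_space UNIV \<Otimes>\<^sub>M (\<Pi>\<^sub>M k\<in>(UNIV :: nat set). borel \<Otimes>\<^sub>M borel)) \<and>
        (\<forall>t\<in>D. enat n \<le> fst t) \<and> (\<forall>j<m. \<forall>k<n. E j k \<in> sets borel) \<longrightarrow>
        emeasure M {\<omega>\<in>space M. (K \<omega>, \<lambda>k. (\<psi> k \<omega>, \<theta> k \<omega>)) \<in> D \<and> (\<forall>j<m. \<forall>k<n. x j k \<omega> \<in> E j k)}
        = (\<integral>\<^sup>+ \<omega>. indicator D (K \<omega>, \<lambda>k. (\<psi> k \<omega>, \<theta> k \<omega>)) *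
                   (\<Prod>j<m. \<Prod>k<n. emeasure (H k (\<theta> k \<omega>)) (E j k)) \<partial>M))"

text \<open>\<open>\<kappa>\<close> is a version of the conditional distribution of \<open>Y\<close> given \<open>X\<close>.\<close>

definition regular_conditional_distribution ::
  "'w measure \<Rightarrow> 'b measure \<Rightarrow> ('w \<Rightarrow> 'b) \<Rightarrow> 'c measure \<Rightarrow> ('w \<Rightarrow> 'c) \<Rightarrow> ('b \<Rightarrow> 'c measure) \<Rightarrow> bool" where
  "regular_conditional_distribution M MX X MY Y \<kappa> \<longleftrightarrow>
     X \<in> M \<rightarrow>\<^sub>M MX \<and> Y \<in> M \<rightarrow>\<^sub>M MY \<and> \<kappa> \<in> MX \<rightarrow>\<^sub>M prob_algebra MY \<and>
     (\<forall>A\<in>sets MX. \<forall>B\<in>sets MY.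
        emeasure M {\<omega>\<in>space M. X \<omega> \<in> A \<and> Y \<omega> \<in> B}
        = (\<integral>\<^sup>+ \<omega>. indicator A (X \<omega>) * emeasure (\<kappa> (X \<omega>)) B \<partial>M))"

definition has_density_proportional_to :: "real measure \<Rightarrow> (real \<Rightarrow> real) \<Rightarrow> bool" where
  "has_density_proportional_to P u \<longleftrightarrow>
     prob_space P \<and> u \<in> borel_measurable borel \<and> (\<forall>\<theta>. 0 \<le> u \<theta>) \<and>
     (\<exists>c>0. P = density lborel (\<lambda>\<theta>. ennreal (c * u \<theta>)))"

text \<open>Density of \<open>H \<theta>\<close> with respect to Lebesgue measure plus a unit mass at zero, where \<open>h \<theta>\<close> is the
  Lebesgue density away from zero; the value at zero is \<open>H({0} | \<theta>)\<close>, whatever \<open>h \<theta> 0\<close> is. It is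
  needed because an observation \<open>X\<^sub>j\<close> may have weight zero at an atom location of another
  observation.\<close>

definition mixed_density ::
  "(real \<Rightarrow> real measure) \<Rightarrow> (real \<Rightarrow> real \<Rightarrow> real) \<Rightarrow> real \<Rightarrow> real \<Rightarrow> real" where
  "mixed_density H h \<theta> x = (if x = 0 then measure (H \<theta>) {0} else h \<theta> x)"

end

theory Submission imports Defs "HOL-Library.Ramsey" begin

text \<open>A point process is determined by its Laplace functional, so the posterior is identified through
Laplace functionals. Mark every atom \<open>(\<psi>\<^sub>k, \<theta>\<^sub>k)\<close> of the prior with the vector \<open>v\<close> of its observed
weights. Integrating out \<open>\<theta>\<^sub>k\<close> given location and mark splits the joint Laplace functional of the prior
and the data into a deterministic factor, contributed by the atoms that are observed as zero \<open>m\<close> times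
(a Poisson process thinned by \<open>H({0} | t)^m\<close>), and one factor for every observed atom, the Laplace
transform of the normalised density \<open>g(t) \<Prod>\<^sub>j h(v\<^sub>j | t)\<close>. Assumption A2' makes these normalising constants
and the number of observed atoms finite. Hence, for every test function, the conditional distribution
has this Laplace functional at almost every data point. Countably many test functions suffice to get
all of them outside one null set, and the independence, Poisson and density properties are then read
off from the product form.\<close>

\<comment> \<open>The sigma-algebra on signed measures is generated by evaluations at bounded Borel
  sets, so observed locations and weights do not come as measurable data: they are extracted from
  evaluations on the cells of a countable base. Data and prior are almost surely purely atomic, so
  nothing is lost by passing to their point processes; the abstract Poisson process of the
  representation is almost surely the point process of \<open>\<Theta>\<close> off the fixed
  locations.

  No formula with normalised densities covers all atoms at once, because the constant that belongs
  to \<open>m\<close> zero observations may be infinite. The computation is therefore done in the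
  exponent, where this case stays a separate integral of \<open>1 - eneg f\<close>. Exponents take
  values in [0, \<infinity>], and \<open>lneg\<close> turns an integrated factor back into an
  exponent. What remains is a Laplace functional of the data alone, which identifies the kernel on
  every event of the data.\<close>
syntax "_nn_int" :: "pttrn \<Rightarrow> 'a measure \<Rightarrow> ennreal \<Rightarrow> ennreal" ("(3NN (1_)/|(_)./ _)" [0,110,60] 60)

translations "NN x|M. f" \<rightharpoonup> "CONST nn_integral M (\<lambda>x. f)"

abbreviation (input) point_borel :: "('a::topological_space \<times> real) measure" where
 "point_borel \<equiv> borel \<Otimes>\<^sub>M nonzero_borel"

abbreviation (input) vec_borel :: "nat \<Rightarrow> (nat \<Rightarrow> real) measure" where
 "vec_borel m \<equiv> \<Pi>\<^sub>M j\<in>{..<m}. borel"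

abbreviation (input) pair_borel :: "('a::topological_space \<times> 'b::topological_space) measure" where
 "pair_borel \<equiv> borel \<Otimes>\<^sub>M borel"

abbreviation (input) vec_box :: "nat \<Rightarrow> (nat \<Rightarrow> 'a set) \<Rightarrow> (nat \<Rightarrow> 'a) set" where
 "vec_box m E \<equiv> \<Pi>\<^sub>E j\<in>{..<m}. E j"

section \<open>Negative exponential and logarithm on the extended half-line\<close>

text \<open>The value 0 at infinity makes a Laplace functional meaningful for every nonnegative test
  function, integrable or not. Test functions with the value infinity then compute probabilities
  that a set contains no point.\<close>

definition eneg :: "ennreal \<Rightarrow> ennreal" where
 "eneg z = (if z = \<top> then 0 else ennreal (exp (- enn2real z)))"

text \<open>The inverse of \<open>eneg\<close> on [0, 1], the only range on which its values matter.
  It presents a factor in [0, 1], such as a conditional expectation of \<open>eneg\<close>, as the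
  exponential of a new test function.\<close>

definition lneg :: "ennreal \<Rightarrow> ennreal" where
 "lneg u = (if u = 0 then \<top> else ennreal (- ln (enn2real u)))"

lemma eneg_top [simp]: "eneg \<top> = 0" by (simp add: eneg_def)
lemma eneg_0 [simp]: "eneg 0 = 1" by (simp add: eneg_def)
lemma eneg_ennreal: "0 \<le> r \<Longrightarrow> eneg (ennreal r) = ennreal (exp (- r))" by (simp add: eneg_def)
lemma eneg_le_1 [simp]: "eneg z \<le> 1"
 by (cases z) (auto simp: eneg_def ennreal_le_1)
lemma eneg_neq_top [simp]: "eneg z \<noteq> \<top>" "eneg z < \<top>"
 by (auto simp: eneg_def)
lemma eneg_eq_0_iff [simp]: "eneg z = 0 \<longleftrightarrow> z = \<top>" by (auto simp: eneg_def)
lemma eneg_add: "eneg (a + b) = eneg a * eneg b"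
proof (cases a; cases b)
 fix r s :: real assume "0 \<le> r" "a = ennreal r" "0 \<le> s" "b = ennreal s"
 moreover then have "a + b = ennreal (r + s)" by simp
 ultimately show ?thesis
  using mult_exp_exp[of "-r" "-s"]
  by (simp add: eneg_ennreal ennreal_mult[symmetric] del: ennreal_plus)
qed auto
lemma eneg_sum: "finite I \<Longrightarrow> eneg (\<Sum>i\<in>I. f i) = (\<Prod>i\<in>I. eneg (f i))"
 by (induction I rule: finite_induct) (auto simp: eneg_add)
lemma eneg_mono: "a \<le> b \<Longrightarrow> eneg b \<le> eneg a"
 by (cases a; cases b) (auto simp: eneg_ennreal ennreal_le_iff top_unique)
lemma eneg_lneg [simp]: "u \<le> 1 \<Longrightarrow> eneg (lneg u) = u"
proof (cases u)
 case (real r)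
 assume "u \<le> 1"
 with real have "r \<le> 1" by (simp add: ennreal_le_1)
 with real show ?thesis
  by (cases "r = 0") (auto simp: lneg_def eneg_ennreal ln_le_zero_iff)
qed (simp add: top_unique)

lemma measurable_eneg [measurable]: "eneg \<in> borel_measurable borel"
 unfolding eneg_def[abs_def] by measurable
lemma measurable_lneg [measurable]: "lneg \<in> borel_measurable borel"
 unfolding lneg_def[abs_def] by measurable

text \<open>Continuity includes divergence to infinity, where the values tend to 0. In this form
  monotone and dominated limits of integrals carry over to Laplace functionals.\<close>

lemma tendsto_eneg:
 assumes "(f \<longlongrightarrow> l) F"
 shows "((\<lambda>x. eneg (f x)) \<longlongrightarrow> eneg l) F"
proof (cases "l = \<top>")
 case False
 have ev: "eventually (\<lambda>x. f x < \<top>) F"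
  using assms False by (intro order_tendstoD(2)) (auto simp: less_top)
 have "((\<lambda>x. ennreal (exp (- enn2real (f x)))) \<longlongrightarrow> ennreal (exp (- enn2real l))) F"
  using assms False
  by (intro tendsto_intros tendsto_enn2real) (auto simp: ennreal_enn2real_if)
 moreover have "eventually (\<lambda>x. ennreal (exp (- enn2real (f x))) = eneg (f x)) F"
  using ev by eventually_elim (auto simp: eneg_def)
 ultimately have "((\<lambda>x. eneg (f x)) \<longlongrightarrow> ennreal (exp (- enn2real l))) F"
  by (rule Lim_transform_eventually)
 with False show ?thesis by (simp add: eneg_def)
next
 case True
 show ?thesis unfolding True eneg_top
 proof (rule order_tendstoI)
  fix a :: ennreal assume "0 < a"
  \<comment> \<open>With \<open>r \<le> 1\<close> the threshold \<open>- ln r + 1\<close> is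
    positive, and its summand 1 makes the final inequality strict.\<close>
  obtain r where r: "0 < r" "ennreal r \<le> a" "r \<le> 1"
   using \<open>0 < a\<close> 
   by (cases a) (auto intro: that[of 1] that[of "min 1 x" for x] simp: ennreal_le_iff)
  have lr: "ln r \<le> 0" using r by simp
  have "eventually (\<lambda>x. ennreal (- ln r + 1) < f x) F"
   using assms True by (intro order_tendstoD(1)[where y=\<top>]) (auto simp: less_top)
  then show "eventually (\<lambda>x. eneg (f x) < a) F"
  proof (rule eventually_mono)
   fix x assume "ennreal (- ln r + 1) < f x"
   then have "eneg (f x) \<le> eneg (ennreal (- ln r + 1))" by (intro eneg_mono) simp
   also have "\<dots> = ennreal (exp (ln r - 1))"
    using eneg_ennreal[of "- ln r + 1"] lr by (simp add: add.commute)
   also have "\<dots> < ennreal r"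
    using r exp_less_mono[of "ln r - 1" "ln r"] by (subst ennreal_less_iff) auto
   finally show "eneg (f x) < a" using r by simp
  qed
 qed auto
qed

section \<open>Signed measures\<close>

lemma bounded_borel_sets: "B \<in> bounded_borel \<Longrightarrow> B \<in> sets borel"
 by (simp add: bounded_borel_def)

lemma bounded_borel_subset:
 "B \<in> bounded_borel \<Longrightarrow> C \<in> sets borel \<Longrightarrow> C \<subseteq> B \<Longrightarrow> C \<in> bounded_borel"
 by (auto simp: bounded_borel_def intro: bounded_subset)

lemma bounded_borel_empty [simp, intro]: "{} \<in> bounded_borel"
 by (simp add: bounded_borel_def)

lemma bounded_borel_singleton [simp, intro]: "{s} \<in> bounded_borel"
 by (simp add: bounded_borel_def)

lemma bounded_borel_Int: "B \<in> bounded_borel \<Longrightarrow> C \<in> sets borel \<Longrightarrow> C \<inter> B \<in> bounded_borel"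
 by (auto simp: bounded_borel_def)

lemma space_signed_measure_space:
 "space signed_measure_space = {\<xi>. \<xi> \<in> extensional bounded_borel \<and>
   (\<forall>A. disjoint_family A \<and> range A \<subseteq> bounded_borel \<and> (\<Union>i. A i) \<in> bounded_borel
       \<longrightarrow> (\<lambda>i. \<xi> (A i)) sums \<xi> (\<Union>i. A i))}"
 unfolding signed_measure_space_def
 by (auto simp: space_restrict_space space_PiM PiE_def)

lemma measurable_signed_measure_eval [measurable (raw)]:
 assumes "B \<in> bounded_borel"
 shows "(\<lambda>\<xi>. \<xi> B) \<in> borel_measurable signed_measure_space"
 unfolding signed_measure_space_def
 by (intro measurable_restrict_space1 measurable_component_singleton assms)

lemma measurable_signed_measure_spaceI:
 assumes "\<And>B. B \<in> bounded_borel \<Longrightarrow> (\<lambda>w. \<Xi> w B) \<in> borel_measurable M"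
  and "\<And>w. w \<in> space M \<Longrightarrow> \<Xi> w \<in> space signed_measure_space"
 shows "\<Xi> \<in> M \<rightarrow>\<^sub>M signed_measure_space"
proof -
 have "\<Xi> \<in> M \<rightarrow>\<^sub>M (\<Pi>\<^sub>M B\<in>bounded_borel. borel)"
  using assms by (intro measurable_PiM_single') (auto simp: space_signed_measure_space PiE_def)
 with assms(2) show ?thesis
  unfolding signed_measure_space_def
  by (auto simp: measurable_restrict_space2_iff space_restrict_space)
qed

context
 fixes \<xi> :: "'a::metric_space set \<Rightarrow> real"
 assumes \<xi>: "\<xi> \<in> space signed_measure_space"
begin

lemma signed_measure_sums:
 "disjoint_family A \<Longrightarrow> range A \<subseteq> bounded_borel \<Longrightarrow> (\<Union>i. A i) \<in> bounded_borel
   \<Longrightarrow> (\<lambda>i::nat. \<xi> (A i)) sums \<xi> (\<Union>i. A i)"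
 using \<xi> by (auto simp: space_signed_measure_space)

lemma signed_measure_empty [simp]: "\<xi> {} = 0"
proof -
 have "(\<lambda>i::nat. \<xi> {}) sums \<xi> {}"
  using signed_measure_sums[of "\<lambda>_. {}"] by (simp add: disjoint_family_on_def)
 then show ?thesis by (auto dest: sums_summable simp: summable_const_iff)
qed

lemma signed_measure_Un:
 assumes "A \<in> bounded_borel" "B \<in> bounded_borel" "A \<inter> B = {}"
 shows "\<xi> (A \<union> B) = \<xi> A + \<xi> B"
proof -
 define C where "C i = (if i = 0 then A else if i = 1 then B else {})" for i :: nat
 have U: "(\<Union>i. C i) = A \<union> B" by (auto simp: C_def split: if_splits)
 have "(\<lambda>i. \<xi> (C i)) sums \<xi> (\<Union>i. C i)"
  using assms by (intro signed_measure_sums)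
   (auto simp: C_def disjoint_family_on_def bounded_borel_def U)
 moreover have "(\<lambda>i. \<xi> (C i)) sums (\<Sum>i\<in>{0,1}. \<xi> (C i))"
  by (intro sums_finite) (auto simp: C_def)
 ultimately have "\<xi> (\<Union>i. C i) = (\<Sum>i\<in>{0,1}. \<xi> (C i))" by (rule sums_unique2)
 then show ?thesis unfolding U by (simp add: C_def)
qed

lemma signed_measure_Diff:
 assumes "A \<in> bounded_borel" "B \<in> bounded_borel" "B \<subseteq> A"
 shows "\<xi> (A - B) = \<xi> A - \<xi> B"
proof -
 have "\<xi> ((A - B) \<union> B) = \<xi> (A - B) + \<xi> B"
  using assms by (intro signed_measure_Un) (auto simp: bounded_borel_def)
 moreover have "(A - B) \<union> B = A" using assms by auto
 ultimately show ?thesis by simp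
qed

text \<open>The differences of consecutive sets partition \<open>A 0\<close> minus the intersection,
  so their masses telescope. Signed masses are not monotone, hence the detour through a series;
  boundedness of the sets plays the part of a finiteness assumption.\<close>

lemma signed_measure_decseq:
 assumes A: "\<And>n. A n \<in> bounded_borel" "\<And>n. A (Suc n) \<subseteq> A n"
 shows "(\<lambda>n. \<xi> (A n)) \<longlonglongrightarrow> \<xi> (\<Inter>n. A n)"
proof -
 have dec: "A n \<subseteq> A m" if "m \<le> n" for m n
  using that by (induction rule: dec_induct) (use A in blast)+
 have "A n \<in> sets borel" for n using A(1) by (rule bounded_borel_sets)
 then have "(\<Inter>n. A n) \<in> sets borel" by (intro sets.countable_INT) auto
 then have I: "(\<Inter>n. A n) \<in> bounded_borel"
  by (rule bounded_borel_subset[OF A(1)[of 0]]) auto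
 define D where "D n = A n - A (Suc n)" for n
 have D: "D n \<in> bounded_borel" for n
  using A[of n] A[of "Suc n"] by (auto simp: D_def bounded_borel_def)
 have U: "(\<Union>n. D n) = A 0 - (\<Inter>n. A n)"
 proof (intro equalityI subsetI)
  fix x assume "x \<in> A 0 - (\<Inter>n. A n)"
  then obtain n where "x \<in> A 0" "x \<notin> A n" by blast
  \<comment> \<open>\<open>k\<close> is the first index whose set misses \<open>x\<close>; it is
    positive because \<open>x\<close> lies in \<open>A 0\<close>, so \<open>x\<close> leaves the
    sequence at the step before \<open>k\<close>.\<close>
  define k where "k = (LEAST k. x \<notin> A k)"
  have "x \<notin> A k" unfolding k_def using \<open>x \<notin> A n\<close> by (rule LeastI)
  moreover have "k \<noteq> 0" using \<open>x \<in> A 0\<close> \<open>x \<notin> A k\<close> by metis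
  then obtain l where l: "k = Suc l" by (cases k) auto
  moreover have "x \<in> A l" using not_less_Least[of l "\<lambda>k. x \<notin> A k"] l by (auto simp: k_def)
  ultimately show "x \<in> (\<Union>n. D n)" by (auto simp: D_def)
 qed (use dec[of 0] in \<open>auto simp: D_def\<close>)
 have "disjoint_family D"
 proof (unfold disjoint_family_on_def, safe)
  fix i j x assume "i \<noteq> j" "x \<in> D i" "x \<in> D j"
  then show "x \<in> {}"
   using dec[of "Suc i" j] dec[of "Suc j" i] by (cases i j rule: linorder_cases) (auto simp: D_def)
 qed
 moreover have "A 0 - (\<Inter>n. A n) \<in> bounded_borel"
  using A(1)[of 0] I by (auto simp: bounded_borel_def)
 ultimately have "(\<lambda>n. \<xi> (D n)) sums \<xi> (A 0 - (\<Inter>n. A n))"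
  using D unfolding U[symmetric] by (intro signed_measure_sums) auto
 moreover have "\<xi> (A 0 - (\<Inter>n. A n)) = \<xi> (A 0) - \<xi> (\<Inter>n. A n)"
  using A I by (intro signed_measure_Diff) auto
 moreover have "\<xi> (D n) = \<xi> (A n) - \<xi> (A (Suc n))" for n
  unfolding D_def by (intro signed_measure_Diff A)
 ultimately have "(\<lambda>n. \<Sum>i<n. \<xi> (A i) - \<xi> (A (Suc i))) \<longlonglongrightarrow> \<xi> (A 0) - \<xi> (\<Inter>n. A n)"
  by (simp add: sums_def)
 then have "(\<lambda>n. \<xi> (A 0) - (\<Sum>i<n. \<xi> (A i) - \<xi> (A (Suc i)))) \<longlonglongrightarrow> \<xi> (A 0) - (\<xi> (A 0) - \<xi> (\<Inter>n. A n))"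
  by (intro tendsto_intros)
 moreover have "(\<Sum>i<n. \<xi> (A i) - \<xi> (A (Suc i))) = \<xi> (A 0) - \<xi> (A n)" for n
  by (induction n) auto
 ultimately show ?thesis by simp
qed

text \<open>The masses are the terms of a convergent series. The common bounded superset
  \<open>C\<close> keeps the union in the domain of the signed measure.\<close>

lemma signed_measure_disjoint_tendsto_0:
 assumes "disjoint_family A" "\<And>n. A n \<in> sets borel" "\<And>n. A n \<subseteq> C" "C \<in> bounded_borel"
 shows "(\<lambda>n::nat. \<xi> (A n)) \<longlonglongrightarrow> 0"
proof -
 have "(\<Union>n. A n) \<in> bounded_borel"
  using assms by (intro bounded_borel_subset[OF assms(4)]) auto
 then have "(\<lambda>n. \<xi> (A n)) sums \<xi> (\<Union>n. A n)"
  using assms by (intro signed_measure_sums) (auto intro: bounded_borel_subset)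
 then show ?thesis by (intro summable_LIMSEQ_zero) (auto simp: sums_iff)
qed

text \<open>Infinitely many such atoms would give a disjoint sequence of singletons whose masses do
  not tend to 0. This is the local finiteness used throughout, obtained without a total
  variation.\<close>

lemma finite_large_atoms:
 assumes "C \<in> bounded_borel" "0 < \<epsilon>"
 shows "finite {s\<in>C. \<epsilon> \<le> \<bar>\<xi> {s}\<bar>}"
proof (rule ccontr)
 assume "infinite {s\<in>C. \<epsilon> \<le> \<bar>\<xi> {s}\<bar>}"
 then obtain f :: "nat \<Rightarrow> 'a" where f: "inj f" "range f \<subseteq> {s\<in>C. \<epsilon> \<le> \<bar>\<xi> {s}\<bar>}"
  using infinite_countable_subset by blast
 then have fC: "f n \<in> C" "\<epsilon> \<le> \<bar>\<xi> {f n}\<bar>" for n by auto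
 have "(\<lambda>n. \<xi> {f n}) \<longlonglongrightarrow> 0"
  using assms f fC by (intro signed_measure_disjoint_tendsto_0[of _ C])
(auto simp: disjoint_family_on_def inj_def)
 then have "eventually (\<lambda>n. \<bar>\<xi> {f n}\<bar> < \<epsilon>) sequentially"
  using order_tendstoD(2)[OF tendsto_rabs] assms(2) by fastforce
 then obtain n where "\<bar>\<xi> {f n}\<bar> < \<epsilon>" by (auto simp: eventually_sequentially)
 with fC(2)[of n] show False by simp
qed

end

section \<open>Cells of a countable base\<close>

text \<open>One countable base is fixed by choice and enumerated, possibly with repetitions, so that
  base sets are addressed by natural numbers.\<close>

definition base_seq :: "nat \<Rightarrow> 'a::second_countable_topology set" where
 "base_seq = from_nat_into (SOME B. countable B \<and> topological_basis B)"

lemma topological_basis_base_seq: "topological_basis (range (base_seq :: nat \<Rightarrow> 'a::second_countable_topology set))"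
proof -
 define B :: "'a set set" where "B = (SOME B. countable B \<and> topological_basis B)"
 have B: "countable B" "topological_basis B"
  using someI_ex[OF ex_countable_basis] unfolding B_def by blast+
 have "B \<noteq> {}"
 proof
  assume "B = {}"
  with B(2) have "(UNIV :: 'a set) = {}" by (auto simp: topological_basis_def)
  then show False by simp
 qed
 with B show ?thesis
  unfolding base_seq_def B_def[symmetric] by (simp add: range_from_nat_into)
qed

lemma open_base_seq [simp]: "open (base_seq k)"
 using topological_basis_base_seq by (rule topological_basis_open) simp

lemma base_seq_sets [measurable, simp]: "base_seq k \<in> sets borel"
 by (intro borel_open) simp

lemma base_seq_separates:
 fixes x y :: "'a::{second_countable_topology, t1_space}"
 assumes "\<And>k. x \<in> base_seq k \<longleftrightarrow> y \<in> base_seq k"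
 shows "x = y"
proof (rule ccontr)
 assume "x \<noteq> y"
 then obtain W where "open W" "x \<in> W" "y \<notin> W" using t1_space by blast
 then obtain B where "B \<in> range base_seq" "x \<in> B" "B \<subseteq> W"
  using topological_basisE[OF topological_basis_base_seq] by metis
 with assms \<open>y \<notin> W\<close> show False by auto
qed

lemma borel_eq_sigma_base_seq:
 "(borel :: 'a::second_countable_topology measure) = sigma UNIV (range base_seq)"
 by (intro borel_eq_countable_basis topological_basis_base_seq) simp

text \<open>Points with equal codes are not told apart by the first \<open>n\<close> sets. The
  classes, the cells below, form finite partitions that become finer with \<open>n\<close>; an index
  outside \<open>Pow {..<n}\<close> gives an empty cell, so quantifiers over cells can be kept
  finite.\<close>

definition code :: "(nat \<Rightarrow> 'a set) \<Rightarrow> nat \<Rightarrow> 'a \<Rightarrow> nat set" where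
 "code V n x = {k. k < n \<and> x \<in> V k}"

definition cell :: "(nat \<Rightarrow> 'a set) \<Rightarrow> nat \<Rightarrow> nat set \<Rightarrow> 'a set" where
 "cell V n I = {x. code V n x = I}"

lemma code_in_Pow: "code V n x \<in> Pow {..<n}"
 by (auto simp: code_def)

lemma code_mono: "n \<le> n' \<Longrightarrow> code V n' x = code V n' y \<Longrightarrow> code V n x = code V n y"
proof -
 assume "n \<le> n'" "code V n' x = code V n' y"
 moreover have "code V n z = code V n' z \<inter> {..<n}" if "n \<le> n'" for z
  using that by (auto simp: code_def)
 ultimately show ?thesis by simp
qed

lemma in_cell_iff: "x \<in> cell V n I \<longleftrightarrow> code V n x = I"
 by (simp add: cell_def)

lemma cell_sets [measurable]:
 assumes "\<And>k. V k \<in> sets M" "space M = UNIV"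
 shows "cell V n I \<in> sets M"
proof (cases "I \<subseteq> {..<n}")
 case True
 then have "cell V n I = {x\<in>space M. \<forall>k\<in>{..<n}. x \<in> V k \<longleftrightarrow> k \<in> I}"
  using assms by (auto simp: cell_def code_def set_eq_iff)
 moreover have "{x\<in>space M. x \<in> V k \<longleftrightarrow> k \<in> I} \<in> sets M" for k
  using assms(1)[of k] sets.sets_into_space[OF assms(1)[of k]]
  by (cases "k \<in> I") (auto simp: set_diff_eq[symmetric] Collect_conj_eq intro!: sets.Diff)
 then have "{x\<in>space M. \<forall>k\<in>{..<n}. x \<in> V k \<longleftrightarrow> k \<in> I} \<in> sets M"
  by (intro sets.sets_Collect_finite_All) auto
 ultimately show ?thesis by simp
next
 case False
 then have "cell V n I = {}" using code_in_Pow[of V n] by (auto simp: cell_def)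
 then show ?thesis by simp
qed

lemma cell_base_seq_sets [measurable, simp]: "cell base_seq n I \<in> sets borel"
 by (intro cell_sets) auto

text \<open>The finer code determines the coarser one, so the cells of all levels form a
  tree.\<close>

lemma cell_eq_or_disjoint: "n \<le> n' \<Longrightarrow> cell V n I \<inter> cell V n' I' \<noteq> {} \<Longrightarrow> cell V n' I' \<subseteq> cell V n I"
proof
 fix x assume "n \<le> n'" "cell V n I \<inter> cell V n' I' \<noteq> {}" "x \<in> cell V n' I'"
 moreover then obtain y where "y \<in> cell V n I" "y \<in> cell V n' I'" by blast
 ultimately show "x \<in> cell V n I"
  using code_mono[of n n' V x y] by (simp add: in_cell_iff)
qed

text \<open>Agreement of codes descends to lower levels, so agreement at arbitrarily high levels is
  enough. This form fits subsequences of levels, as they arise from the Ramsey argument.\<close>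

lemma code_base_seq_eqD:
 fixes x y :: "'a::{second_countable_topology, t1_space}"
 assumes "\<And>n. \<exists>n'\<ge>n. code base_seq n' x = code base_seq n' y"
 shows "x = y"
proof (rule base_seq_separates)
 fix k
 obtain n where "n \<ge> Suc k" "code base_seq n x = code base_seq n y" using assms by blast
 then have "code base_seq (Suc k) x = code base_seq (Suc k) y" by (rule code_mono)
 then show "x \<in> base_seq k \<longleftrightarrow> y \<in> base_seq k" by (auto simp: code_def set_eq_iff)
qed

lemma signed_measure_cells_tendsto:
 fixes \<xi> :: "'a::{metric_space, second_countable_topology} set \<Rightarrow> real"
 assumes "\<xi> \<in> space signed_measure_space" "C \<in> bounded_borel" "s \<in> C"
 shows "(\<lambda>n. \<xi> (cell base_seq n (code base_seq n s) \<inter> C)) \<longlonglongrightarrow> \<xi> {s}"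
proof -
 have "(\<Inter>n. cell base_seq n (code base_seq n s) \<inter> C) = {s}"
  using assms(3) by (auto simp: in_cell_iff intro!: code_base_seq_eqD)
 moreover have "(\<lambda>n. \<xi> (cell base_seq n (code base_seq n s) \<inter> C)) \<longlonglongrightarrow>
   \<xi> (\<Inter>n. cell base_seq n (code base_seq n s) \<inter> C)"
 proof (rule signed_measure_decseq[OF assms(1)])
  fix n
  show "cell base_seq n (code base_seq n s) \<inter> C \<in> bounded_borel"
   using assms by (intro bounded_borel_Int) auto
  have "cell base_seq (Suc n) (code base_seq (Suc n) s) \<subseteq> (cell base_seq n (code base_seq n s) :: 'a set)"
  proof (rule cell_eq_or_disjoint)
   have "s \<in> cell base_seq n (code base_seq n s) \<inter> cell base_seq (Suc n) (code base_seq (Suc n) s)"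
    by (simp add: in_cell_iff)
   then show "cell base_seq n (code base_seq n s) \<inter> (cell base_seq (Suc n) (code base_seq (Suc n) s) :: 'a set) \<noteq> {}"
    by blast
  qed simp
  then show "cell base_seq (Suc n) (code base_seq (Suc n) s) \<inter> C \<subseteq> cell base_seq n (code base_seq n s) \<inter> C"
   by blast
 qed
 ultimately show ?thesis by simp
qed

text \<open>Infinitely many cells form, by Ramsey's theorem, an infinite chain or an infinite antichain. An
 antichain of cells of large mass contradicts countable additivity, and a chain shrinks to a point.\<close>

lemma atom_from_large_cells:
 fixes \<xi> :: "nat \<Rightarrow> 'a::{metric_space, second_countable_topology} set \<Rightarrow> real"
 assumes \<xi>: "\<And>j. j < m \<Longrightarrow> \<xi> j \<in> space signed_measure_space"
  and C: "C \<in> bounded_borel"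
  and E: "\<And>j. j < m \<Longrightarrow> closed (E j)"
  and j0: "j0 < m" "E j0 \<subseteq> {y. \<delta> \<le> \<bar>y\<bar>}" "0 < \<delta>"
  and inf: "infinite {n. \<exists>I. \<forall>j<m. \<xi> j (cell base_seq n I \<inter> C) \<in> E j}"
 shows "\<exists>s\<in>C. \<forall>j<m. \<xi> j {s} \<in> E j"
proof -
 define Z where "Z = {n. \<exists>I. \<forall>j<m. \<xi> j (cell base_seq n I \<inter> C) \<in> E j}"
 have "\<forall>n\<in>Z. \<exists>I. \<forall>j<m. \<xi> j (cell base_seq n I \<inter> C) \<in> E j" by (simp add: Z_def)
 then obtain I where I: "\<forall>n\<in>Z. \<forall>j<m. \<xi> j (cell base_seq n (I n) \<inter> C) \<in> E j"
  by (rule bchoice[THEN exE])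
 define e where "e n = cell base_seq n (I n) \<inter> C" for n
 have e: "e n \<in> bounded_borel" "e n \<subseteq> C" for n
  unfolding e_def using C by (auto intro: bounded_borel_Int)
 have eE: "\<xi> j (e n) \<in> E j" if "n \<in> Z" "j < m" for n j
  using I that by (simp add: e_def)
 have large: "\<delta> \<le> \<bar>\<xi> j0 (e n)\<bar>" if "n \<in> Z" for n
  using eE[OF that j0(1)] j0(2) by auto
 \<comment> \<open>The colour of a pair of levels records whether the two chosen cells are disjoint:
   a homogeneous set of colour 0 is an antichain, one of colour 1 a chain.\<close>
 define f :: "nat set \<Rightarrow> nat" where "f S = (if \<exists>x\<in>S. \<exists>y\<in>S. x \<noteq> y \<and> e x \<inter> e y = {} then 0 else 1)" for S
 have "\<exists>Y t. Y \<subseteq> Z \<and> infinite Y \<and> t < 2 \<and> (\<forall>x\<in>Y. \<forall>y\<in>Y. x \<noteq> y \<longrightarrow> f {x, y} = t)"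
  using inf unfolding Z_def[symmetric] by (intro Ramsey2) (auto simp: f_def)
 then obtain Y t where Y: "Y \<subseteq> Z" "infinite Y" and "\<forall>x\<in>Y. \<forall>y\<in>Y. x \<noteq> y \<longrightarrow> f {x, y} = t"
  by (elim exE conjE)
 then have Yf: "f {x, y} = t" if "x \<in> Y" "y \<in> Y" "x \<noteq> y" for x y
  using that by simp
 define r where "r = enumerate Y"
 have rY: "r n \<in> Y" for n unfolding r_def using Y(2) by (rule enumerate_in_set)
 have rm: "strict_mono r" unfolding r_def using Y(2) by (intro strict_monoI enumerate_mono) auto
 have rZ: "r n \<in> Z" for n using rY Y(1) by blast
 have disj_iff: "(e (r i) \<inter> e (r k) = {}) \<longleftrightarrow> t = 0" if "i \<noteq> k" for i k
 proof -
  have ne: "r i \<noteq> r k" using that strict_mono_eq[OF rm] by simp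
  show ?thesis using Yf[OF rY rY ne] ne by (auto simp: f_def Int_commute split: if_splits)
 qed
 show ?thesis
 proof (cases "t = 0")
  case True
  then have "disjoint_family (\<lambda>n. e (r n))"
   using disj_iff by (auto simp: disjoint_family_on_def)
  then have "(\<lambda>n. \<xi> j0 (e (r n))) \<longlonglongrightarrow> 0"
   using e C \<xi>[OF j0(1)] by (intro signed_measure_disjoint_tendsto_0[of _ _ C]) (auto simp: bounded_borel_def)
  then have "(\<lambda>n. \<bar>\<xi> j0 (e (r n))\<bar>) \<longlonglongrightarrow> 0" by (rule tendsto_rabs_zero)
  from LIMSEQ_le_const[OF this, of \<delta>] large[OF rZ] j0(3) show ?thesis by auto
 next
  case False
  have dec: "e (r (Suc n)) \<subseteq> e (r n)" for n
  proof -
   have "e (r n) \<inter> e (r (Suc n)) \<noteq> {}" using disj_iff[of n "Suc n"] False by simp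
   then have "cell base_seq (r n) (I (r n)) \<inter> cell base_seq (r (Suc n)) (I (r (Suc n))) \<noteq> ({} :: 'a set)"
    by (auto simp: e_def)
   moreover have "r n \<le> r (Suc n)" using strict_mono_less_eq[OF rm] by simp
   ultimately have "cell base_seq (r (Suc n)) (I (r (Suc n))) \<subseteq> (cell base_seq (r n) (I (r n)) :: 'a set)"
    by (intro cell_eq_or_disjoint)
   then show ?thesis by (auto simp: e_def)
  qed
  define D where "D = (\<Inter>n. e (r n))"
  have lim: "(\<lambda>n. \<xi> j (e (r n))) \<longlonglongrightarrow> \<xi> j D" if "j < m" for j
   unfolding D_def by (rule signed_measure_decseq[OF \<xi>[OF that], of "\<lambda>n. e (r n)", OF e(1) dec])
  have DE: "\<xi> j D \<in> E j" if "j < m" for j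
   by (rule closed_sequentially[OF E[OF that] eE[OF rZ that] lim[OF that]])
  \<comment> \<open>The nonzero limit mass only serves to show that the intersection is nonempty.
    Its points share codes of unbounded length, so it is a singleton.\<close>
  have "\<xi> j0 D \<noteq> 0" using DE[OF j0(1)] j0 by auto
  then obtain s where s: "s \<in> D" using signed_measure_empty[OF \<xi>[OF j0(1)]] by fastforce
  have "y = s" if "y \<in> D" for y
  proof (rule code_base_seq_eqD)
   fix n
   have "code base_seq (r n) y = code base_seq (r n) s"
    using that s by (auto simp: D_def e_def in_cell_iff)
   then show "\<exists>n'\<ge>n. code base_seq n' y = code base_seq n' s"
    using strict_mono_imp_increasing[OF rm] by (intro exI[of _ "r n"]) auto
  qed
  with s have "D = {s}" by blast
  moreover have "s \<in> C" using s e by (auto simp: D_def)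
  ultimately show ?thesis using DE by auto
 qed
qed

text \<open>The left side quantifies over uncountably many locations, the right side evaluates the
  signed measures on countably many sets and is therefore measurable. From left to right, the masses
  of the cells around \<open>s\<close> converge to the mass of \<open>{s}\<close>. Conversely,
  \<open>atom_from_large_cells\<close> gives for each tolerance a location that meets it; all these
  locations are large atoms of \<open>\<xi> j0\<close>, hence finitely many, and one of them serves
  infinitely many tolerances.\<close>

lemma exists_atom_iff:
 fixes \<xi> :: "nat \<Rightarrow> 'a::{metric_space, second_countable_topology} set \<Rightarrow> real"
 assumes \<xi>: "\<And>j. j < m \<Longrightarrow> \<xi> j \<in> space signed_measure_space"
  and C: "C \<in> bounded_borel"
  and F: "\<And>j. j < m \<Longrightarrow> closed (F j)" "\<And>j. j < m \<Longrightarrow> F j \<noteq> {}"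
  and j0: "j0 < m" "F j0 \<subseteq> {y. \<delta> \<le> \<bar>y\<bar>}" "0 < \<delta>"
 shows "(\<exists>s\<in>C. \<forall>j<m. \<xi> j {s} \<in> F j) \<longleftrightarrow>
  (\<forall>i. \<exists>n0. \<forall>n\<ge>n0. \<exists>I\<in>Pow {..<n}. \<forall>j\<in>{..<m}. infdist (\<xi> j (cell base_seq n I \<inter> C)) (F j) \<le> 1 / Suc i)"
proof (intro iffI allI)
 fix i
 assume "\<exists>s\<in>C. \<forall>j<m. \<xi> j {s} \<in> F j"
 then obtain s where s: "s \<in> C" "\<And>j. j < m \<Longrightarrow> \<xi> j {s} \<in> F j" by blast
 have "eventually (\<lambda>n. infdist (\<xi> j (cell base_seq n (code base_seq n s) \<inter> C)) (F j) < 1 / Suc i) sequentially"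
  if "j \<in> {..<m}" for j
 proof (rule order_tendstoD(2))
  show "(\<lambda>n. infdist (\<xi> j (cell base_seq n (code base_seq n s) \<inter> C)) (F j)) \<longlonglongrightarrow> infdist (\<xi> j {s}) (F j)"
   using that \<xi> C s by (intro tendsto_infdist signed_measure_cells_tendsto) auto
  show "infdist (\<xi> j {s}) (F j) < 1 / Suc i"
   using that s by simp
 qed
 then have "eventually (\<lambda>n. \<forall>j\<in>{..<m}. infdist (\<xi> j (cell base_seq n (code base_seq n s) \<inter> C)) (F j) < 1 / Suc i) sequentially"
  by (intro eventually_ball_finite) auto
 then obtain n0 where n0: "\<And>n j. n \<ge> n0 \<Longrightarrow> j \<in> {..<m} \<Longrightarrow>
   infdist (\<xi> j (cell base_seq n (code base_seq n s) \<inter> C)) (F j) < 1 / Suc i"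
  by (auto simp: eventually_sequentially)
 show "\<exists>n0. \<forall>n\<ge>n0. \<exists>I\<in>Pow {..<n}. \<forall>j\<in>{..<m}. infdist (\<xi> j (cell base_seq n I \<inter> C)) (F j) \<le> 1 / Suc i"
  by (intro exI[of _ n0] allI impI bexI[OF _ code_in_Pow]) (use n0 in \<open>auto intro: less_imp_le\<close>)
next
 assume R: "\<forall>i. \<exists>n0. \<forall>n\<ge>n0. \<exists>I\<in>Pow {..<n}. \<forall>j\<in>{..<m}. infdist (\<xi> j (cell base_seq n I \<inter> C)) (F j) \<le> 1 / Suc i"
 \<comment> \<open>From index \<open>i0\<close> on, the tolerance is below half of
   \<open>\<delta>\<close>, so even the enlarged target set for \<open>j0\<close> keeps distance
   \<open>\<delta> / 2\<close> from 0.\<close>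
 obtain i0 where i0: "1 / Suc i0 < \<delta> / 2" 
  using j0(3) by (metis half_gt_zero nat_approx_posE)
 have "\<exists>s\<in>C. \<forall>j<m. infdist (\<xi> j {s}) (F j) \<le> 1 / Suc (i + i0)" for i
 proof -
  define E where "E j = {y. infdist y (F j) \<le> 1 / Suc (i + i0)}" for j
  have "\<exists>s\<in>C. \<forall>j<m. \<xi> j {s} \<in> E j"
  proof (rule atom_from_large_cells[OF \<xi> C _ j0(1)])
   show "closed (E j)" for j unfolding E_def by (intro closed_Collect_le continuous_intros)
   show "0 < \<delta> / 2" using j0(3) by simp
   show "E j0 \<subseteq> {y. \<delta> / 2 \<le> \<bar>y\<bar>}"
   proof safe
    fix y assume "y \<in> E j0"
    then have "infdist y (F j0) \<le> 1 / Suc (i + i0)" by (simp add: E_def)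
    also have "\<dots> \<le> 1 / Suc i0" by (intro divide_left_mono) auto
    also have "\<dots> < \<delta> / 2" by (rule i0)
    finally have "(INF a\<in>F j0. dist y a) < \<delta> / 2"
     using F(2)[OF j0(1)] by (simp add: infdist_def)
    then obtain a where "a \<in> F j0" "dist y a < \<delta> / 2"
     using F(2)[OF j0(1)] by (subst (asm) cINF_less_iff) auto
    moreover from this j0(2) have "\<delta> \<le> \<bar>a\<bar>" by auto
    ultimately show "\<delta> / 2 \<le> \<bar>y\<bar>" unfolding dist_real_def by linarith
   qed
   obtain n0 where n0: "\<forall>n\<ge>n0. \<exists>I\<in>Pow {..<n}. \<forall>j\<in>{..<m}.
     infdist (\<xi> j (cell base_seq n I \<inter> C)) (F j) \<le> 1 / Suc (i + i0)"
    using R by blast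
   have "{n0..} \<subseteq> {n. \<exists>I. \<forall>j<m. \<xi> j (cell base_seq n I \<inter> C) \<in> E j}"
   proof
    fix n assume "n \<in> {n0..}"
    with n0 obtain I where "\<forall>j\<in>{..<m}. infdist (\<xi> j (cell base_seq n I \<inter> C)) (F j) \<le> 1 / Suc (i + i0)"
     by (meson atLeast_iff)
    then show "n \<in> {n. \<exists>I. \<forall>j<m. \<xi> j (cell base_seq n I \<inter> C) \<in> E j}"
     unfolding E_def by blast
   qed
   then show "infinite {n. \<exists>I. \<forall>j<m. \<xi> j (cell base_seq n I \<inter> C) \<in> E j}"
    using infinite_Ici infinite_super by blast
  qed
  then show ?thesis by (simp add: E_def)
 qed
 then obtain s where s: "\<And>i. s i \<in> C" "\<And>i j. j < m \<Longrightarrow> infdist (\<xi> j {s i}) (F j) \<le> 1 / Suc (i + i0)"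
  by metis
 have large: "s i \<in> {s\<in>C. \<delta> / 2 \<le> \<bar>\<xi> j0 {s}\<bar>}" for i
 proof -
  have "infdist (\<xi> j0 {s i}) (F j0) \<le> 1 / Suc (i + i0)" using s j0 by blast
  also have "\<dots> \<le> 1 / Suc i0" by (intro divide_left_mono) auto
  also have "\<dots> < \<delta> / 2" by (rule i0)
  finally have "(INF a\<in>F j0. dist (\<xi> j0 {s i}) a) < \<delta> / 2"
   using F(2)[OF j0(1)] by (simp add: infdist_def)
  then obtain a where "a \<in> F j0" "dist (\<xi> j0 {s i}) a < \<delta> / 2"
   using F(2)[OF j0(1)] by (subst (asm) cINF_less_iff) auto
  moreover from this j0(2) have "\<delta> \<le> \<bar>a\<bar>" by auto
  ultimately have "\<delta> / 2 \<le> \<bar>\<xi> j0 {s i}\<bar>" unfolding dist_real_def by linarith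
  then show ?thesis using s by simp
 qed
 \<comment> \<open>A single location that meets tolerances tending to 0 has distance 0 from every
   closed \<open>F j\<close>.\<close>
 have "finite (range s)"
  using finite_large_atoms[OF \<xi>[OF j0(1)] C, of "\<delta> / 2"] j0(3) large by (auto elim!: finite_subset[rotated])
 then obtain i1 where i1: "infinite {i. s i = s i1}"
  using pigeonhole_infinite[of UNIV s] by auto
 have "\<xi> j {s i1} \<in> F j" if "j < m" for j
 proof -
  have "infdist (\<xi> j {s i1}) (F j) \<le> 0"
  proof (rule field_le_epsilon)
   fix e :: real assume "0 < e"
   then obtain n where n: "1 / Suc n < e" using nat_approx_posE by blast
   obtain i where "i \<ge> n" "s i = s i1" using i1 by (auto simp: infinite_nat_iff_unbounded_le)
   then have "infdist (\<xi> j {s i1}) (F j) \<le> 1 / Suc (i + i0)" using s(2)[OF that, of i] by simp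
   also have "\<dots> \<le> 1 / Suc n" using \<open>i \<ge> n\<close> by (intro divide_left_mono) auto
   finally show "infdist (\<xi> j {s i1}) (F j) \<le> 0 + e" using n by simp
  qed
  then have "infdist (\<xi> j {s i1}) (F j) = 0" using infdist_nonneg[of "\<xi> j {s i1}" "F j"] by simp
  then show ?thesis using F that by (simp add: in_closed_iff_infdist_zero)
 qed
 with s(1) show "\<exists>s\<in>C. \<forall>j<m. \<xi> j {s} \<in> F j" by blast
qed

section \<open>Measurability of the atoms of a signed measure\<close>

text \<open>A unit mass at every pair of a location and its vector of \<open>m\<close> weights,
  taken over the locations at which some weight is nonzero. An atom of the prior with
  \<open>m\<close> zero observations leaves no trace here.\<close>

definition vector_atoms :: "nat \<Rightarrow> (nat \<Rightarrow> 'a::metric_space set \<Rightarrow> real) \<Rightarrow> ('a \<times> (nat \<Rightarrow> real)) measure" where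
 "vector_atoms m \<xi> = distr (count_space {s. \<exists>j<m. \<xi> j {s} \<noteq> 0}) (borel \<Otimes>\<^sub>M (vec_borel m))
   (\<lambda>s. (s, \<lambda>j\<in>{..<m}. \<xi> j {s}))"

lemma sets_vector_atoms [simp, measurable_cong]:
 "sets (vector_atoms m \<xi>) = sets (borel \<Otimes>\<^sub>M (vec_borel m))"
 by (simp add: vector_atoms_def)

lemma space_vector_atoms: "space (vector_atoms m \<xi>) = UNIV \<times> (\<Pi>\<^sub>E j\<in>{..<m}. UNIV)"
 by (simp add: vector_atoms_def space_pair_measure space_PiM)

lemma measurable_vector_atoms_point:
 "(\<lambda>s. (s, \<lambda>j\<in>{..<m}. \<xi> j {s})) \<in> count_space A \<rightarrow>\<^sub>M (borel \<Otimes>\<^sub>M (vec_borel m))"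
 by (auto simp: space_pair_measure space_PiM)

lemma emeasure_vector_atoms:
 assumes "A \<in> sets (borel \<Otimes>\<^sub>M (vec_borel m))"
 shows "emeasure (vector_atoms m \<xi>) A =
  emeasure (count_space UNIV) {s. (\<exists>j<m. \<xi> j {s} \<noteq> 0) \<and> (s, \<lambda>j\<in>{..<m}. \<xi> j {s}) \<in> A}"
proof -
 have "(\<lambda>s. (s, \<lambda>j\<in>{..<m}. \<xi> j {s})) -` A \<inter> space (count_space {s. \<exists>j<m. \<xi> j {s} \<noteq> 0}) =
   {s. (\<exists>j<m. \<xi> j {s} \<noteq> 0) \<and> (s, \<lambda>j\<in>{..<m}. \<xi> j {s}) \<in> A}"
  by auto
 then show ?thesis
  unfolding vector_atoms_def emeasure_distr[OF measurable_vector_atoms_point assms]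
  by (simp only:) (subst (1 2) emeasure_count_space, auto)
qed

lemma nn_integral_vector_atoms:
 assumes [measurable]: "f \<in> borel_measurable (borel \<Otimes>\<^sub>M (vec_borel m))"
 shows "(NN p|(vector_atoms m \<xi>). f p) =
  (NN s|(count_space {s. \<exists>j<m. \<xi> j {s} \<noteq> 0}). f (s, \<lambda>j\<in>{..<m}. \<xi> j {s}))"
 unfolding vector_atoms_def
 by (subst nn_integral_distr[OF measurable_vector_atoms_point]) auto

text \<open>A Dynkin argument for a family of measures. Finiteness is needed only on
  \<open>\<Omega>\<close>, to subtract for complements; the applications below first restrict the
  measures so that it holds.\<close>

lemma measurable_emeasure_generated:
 assumes sets: "\<And>a. a \<in> space M \<Longrightarrow> sets (K a) = sigma_sets \<Omega> G"
  and G: "Int_stable G" "G \<subseteq> Pow \<Omega>"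
  and fin: "\<And>a. a \<in> space M \<Longrightarrow> emeasure (K a) \<Omega> \<noteq> \<top>"
  and gen: "\<And>A. A \<in> G \<Longrightarrow> (\<lambda>a. emeasure (K a) A) \<in> borel_measurable M"
  and \<Omega>: "(\<lambda>a. emeasure (K a) \<Omega>) \<in> borel_measurable M"
  and A: "A \<in> sigma_sets \<Omega> G"
 shows "(\<lambda>a. emeasure (K a) A) \<in> borel_measurable M"
proof -
 interpret G: sigma_algebra \<Omega> "sigma_sets \<Omega> G"
  using G(2) by (rule sigma_algebra_sigma_sets)
 show ?thesis using G A
 proof (induction rule: sigma_sets_induct_disjoint)
  case (compl A)
  have "emeasure (K a) (\<Omega> - A) = emeasure (K a) \<Omega> - emeasure (K a) A" if "a \<in> space M" for a
  proof (rule emeasure_Diff)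
   have "emeasure (K a) A \<le> emeasure (K a) \<Omega>"
    using sets[OF that] compl(1) by (intro emeasure_mono G.sets_into_space) auto
   then show "emeasure (K a) A \<noteq> \<infinity>" using fin[OF that] by (auto simp: top_unique)
  qed (use sets[OF that] compl(1) G.sets_into_space in auto)
  then have "(\<lambda>a. emeasure (K a) (\<Omega> - A)) \<in> borel_measurable M \<longleftrightarrow>
    (\<lambda>a. emeasure (K a) \<Omega> - emeasure (K a) A) \<in> borel_measurable M"
   by (intro measurable_cong)
  with compl \<Omega> show ?case by simp
 next
  case (union F)
  have "(\<Sum>i. emeasure (K a) (F i)) = emeasure (K a) (\<Union>i. F i)" if "a \<in> space M" for a
   using sets[OF that] union by (intro suminf_emeasure) auto
  then have "(\<lambda>a. emeasure (K a) (\<Union>i. F i)) \<in> borel_measurable M \<longleftrightarrow>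
    (\<lambda>a. \<Sum>i. emeasure (K a) (F i)) \<in> borel_measurable M"
   by (intro measurable_cong) simp
  with union show ?case by simp
 qed (use gen in auto)
qed

lemma space_vec: "\<xi> \<in> space (\<Pi>\<^sub>M j\<in>{..<m}. signed_measure_space) \<Longrightarrow> j < m \<Longrightarrow> \<xi> j \<in> space signed_measure_space"
 for m :: nat
 by (auto simp: space_PiM PiE_iff)

text \<open>Finitely many points lie in different cells from some level on, so they can be counted
  by counting occupied cells.\<close>

lemma eventually_inj_on_code:
 fixes Z :: "'a::{second_countable_topology, t1_space} set"
 assumes "finite Z"
 shows "eventually (\<lambda>n. inj_on (code base_seq n) Z) sequentially"
proof -
 have "eventually (\<lambda>n. s \<noteq> s' \<longrightarrow> code base_seq n s \<noteq> code base_seq n s') sequentially" for s s' :: 'a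
 proof (cases "s = s'")
  case False
  then obtain n0 where "\<And>n. n \<ge> n0 \<Longrightarrow> code base_seq n s \<noteq> code base_seq n s'"
   using code_base_seq_eqD by metis
  then show ?thesis by (auto simp: eventually_sequentially)
 qed simp
 with assms have "eventually (\<lambda>n. \<forall>s\<in>Z. \<forall>s'\<in>Z. s \<noteq> s' \<longrightarrow> code base_seq n s \<noteq> code base_seq n s') sequentially"
  by (intro eventually_ball_finite ballI)
 then show ?thesis by eventually_elim (auto simp: inj_on_def)
qed

text \<open>The number of atoms in the box is the limit of the numbers of cells that contain one,
  and occupation of a cell is measurable by \<open>exists_atom_iff\<close>. The coordinate
  \<open>j0\<close> is kept away from 0, which makes the number finite.\<close>

lemma measurable_vector_atoms_closed_box:
 fixes C :: "'a::{metric_space, second_countable_topology} set"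
 assumes C: "C \<in> bounded_borel"
  and F: "\<And>j. j < m \<Longrightarrow> closed (F j)"
  and j0: "j0 < m" "F j0 \<subseteq> {y. \<delta> \<le> \<bar>y\<bar>}" "0 < \<delta>"
 shows "(\<lambda>\<xi>. emeasure (vector_atoms m \<xi>) (C \<times> (vec_box m F))) \<in> borel_measurable (\<Pi>\<^sub>M j\<in>{..<m}. signed_measure_space)"
  and "\<And>\<xi>. \<xi> \<in> space (\<Pi>\<^sub>M j\<in>{..<m}. signed_measure_space) \<Longrightarrow>
   emeasure (vector_atoms m \<xi>) (C \<times> (vec_box m F)) < \<top>"
proof -
 define MX :: "(nat \<Rightarrow> 'a set \<Rightarrow> real) measure" where "MX = (\<Pi>\<^sub>M j\<in>{..<m}. signed_measure_space)"
 define Z where "Z \<xi> = {s\<in>C. \<forall>j<m. \<xi> j {s} \<in> F j}" for \<xi> :: "nat \<Rightarrow> 'a set \<Rightarrow> real"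
 have sp: "\<xi> j \<in> space signed_measure_space" if "\<xi> \<in> space MX" "j < m" for \<xi> j
  using that space_vec by (auto simp: MX_def)
 have [measurable]: "C \<in> sets borel" using C by (rule bounded_borel_sets)
 have [measurable]: "F j \<in> sets borel" if "j < m" for j using F[OF that] by simp
 have [measurable]: "(vec_box m F) \<in> sets (vec_borel m)"
  by (intro sets_PiM_I_finite) auto
 have finZ: "finite (Z \<xi>)" if "\<xi> \<in> space MX" for \<xi>
 proof (rule finite_subset)
  show "Z \<xi> \<subseteq> {s\<in>C. \<delta> \<le> \<bar>\<xi> j0 {s}\<bar>}" using j0 by (auto simp: Z_def)
  show "finite {s\<in>C. \<delta> \<le> \<bar>\<xi> j0 {s}\<bar>}" using finite_large_atoms[OF sp[OF that j0(1)] C j0(3)] .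
 qed
 have em: "emeasure (vector_atoms m \<xi>) (C \<times> (vec_box m F)) = of_nat (card (Z \<xi>))" if "\<xi> \<in> space MX" for \<xi>
 proof -
  have "{s. (\<exists>j<m. \<xi> j {s} \<noteq> 0) \<and> (s, \<lambda>j\<in>{..<m}. \<xi> j {s}) \<in> C \<times> (vec_box m F)} = Z \<xi>"
   using j0 by (force simp: Z_def)
  with finZ[OF that] show ?thesis
   by (subst emeasure_vector_atoms) (auto intro!: pair_measureI)
 qed
 show "emeasure (vector_atoms m \<xi>) (C \<times> (vec_box m F)) < \<top>"
  if "\<xi> \<in> space (\<Pi>\<^sub>M j\<in>{..<m}. signed_measure_space)" for \<xi>
  using em[of \<xi>] that by (simp add: MX_def of_nat_less_top)
 have ex_meas: "{\<xi>\<in>space MX. \<exists>s\<in>C'. \<forall>j<m. \<xi> j {s} \<in> F j} \<in> sets MX" if C': "C' \<in> bounded_borel" for C'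
 proof (cases "\<exists>j<m. F j = {}")
  case True
  then have "{\<xi>\<in>space MX. \<exists>s\<in>C'. \<forall>j<m. \<xi> j {s} \<in> F j} = {}" by auto
  then show ?thesis by (simp del: Collect_empty_eq)
 next
  case False
  have meas: "(\<lambda>\<xi>. infdist (\<xi> j (cell base_seq n I \<inter> C')) (F j)) \<in> borel_measurable MX" if "j \<in> {..<m}" for j n I
  proof -
   have "(\<lambda>\<xi>. \<xi> j (cell base_seq n I \<inter> C')) \<in> borel_measurable MX"
    unfolding MX_def
    by (rule measurable_compose[OF measurable_component_singleton[OF that]
      measurable_signed_measure_eval[OF bounded_borel_Int[OF C']]]) simp
   moreover have "(\<lambda>y. infdist y (F j)) \<in> borel_measurable borel"
    by (intro borel_measurable_continuous_onI continuous_intros)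
   ultimately show ?thesis by (rule measurable_compose)
  qed
  have iff: "(\<exists>s\<in>C'. \<forall>j<m. \<xi> j {s} \<in> F j) \<longleftrightarrow>
   (\<forall>i. \<exists>n0. \<forall>n\<ge>n0. \<exists>I\<in>Pow {..<n}. \<forall>j\<in>{..<m}. infdist (\<xi> j (cell base_seq n I \<inter> C')) (F j) \<le> 1 / Suc i)"
   if "\<xi> \<in> space MX" for \<xi>
   using False by (intro exists_atom_iff[of m \<xi> C' F j0 \<delta>] sp[OF that] C' F j0) auto
  have "{\<xi>\<in>space MX. \<exists>s\<in>C'. \<forall>j<m. \<xi> j {s} \<in> F j} = {\<xi>\<in>space MX. \<forall>i. \<exists>n0. \<forall>n\<in>{n0..}. \<exists>I\<in>Pow {..<n}. \<forall>j\<in>{..<m}.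
    infdist (\<xi> j (cell base_seq n I \<inter> C')) (F j) \<le> 1 / Suc i}"
   by (intro Collect_cong conj_cong refl) (simp only: iff, simp add: Ball_def)
  also have "\<dots> \<in> sets MX"
   using meas by (intro sets.sets_Collect_countable_All sets.sets_Collect_countable_Ex
     sets.sets_Collect_countable_Ball sets.sets_Collect_finite_Ex sets.sets_Collect_finite_All)
     (auto intro!: borel_measurable_le)
  finally show ?thesis .
 qed
 \<comment> \<open>\<open>c n\<close> counts the cells of level \<open>n\<close> that contain an
   atom with weights in the box.\<close>
 define c where "c n \<xi> = (\<Sum>I\<in>Pow {..<n}. of_bool (\<exists>s\<in>cell base_seq n I \<inter> C. \<forall>j<m. \<xi> j {s} \<in> F j) :: ennreal)" for n \<xi>
 have c_meas: "c n \<in> borel_measurable MX" for n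
  unfolding c_def
 proof (rule borel_measurable_sum)
  fix I
  have "{\<xi>\<in>space MX. \<exists>s\<in>cell base_seq n I \<inter> C. \<forall>j<m. \<xi> j {s} \<in> F j} \<in> sets MX"
   by (intro ex_meas bounded_borel_Int C) simp
  then have "Measurable.pred MX (\<lambda>\<xi>. \<exists>s\<in>cell base_seq n I \<inter> C. \<forall>j<m. \<xi> j {s} \<in> F j)"
   by (simp add: pred_def)
  then show "(\<lambda>\<xi>. of_bool (\<exists>s\<in>cell base_seq n I \<inter> C. \<forall>j<m. \<xi> j {s} \<in> F j) :: ennreal) \<in> borel_measurable MX"
   unfolding of_bool_def by measurable
 qed
 have c_eq: "c n \<xi> = of_nat (card (code base_seq n ` Z \<xi>))" for n \<xi>
 proof -
  have *: "(\<exists>s\<in>cell base_seq n I \<inter> C. \<forall>j<m. \<xi> j {s} \<in> F j) \<longleftrightarrow> I \<in> code base_seq n ` Z \<xi>" for I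
   by (auto simp: Z_def in_cell_iff)
  have "c n \<xi> = of_nat (card (Pow {..<n} \<inter> {I. I \<in> code base_seq n ` Z \<xi>}))"
   unfolding c_def * by (rule sum_of_bool_eq; simp)
  also have "Pow {..<n} \<inter> {I. I \<in> code base_seq n ` Z \<xi>} = code base_seq n ` Z \<xi>"
   using code_in_Pow[of base_seq n] by blast
  finally show ?thesis .
 qed
 have lim: "(\<lambda>n. c n \<xi>) \<longlonglongrightarrow> of_nat (card (Z \<xi>))" if "\<xi> \<in> space MX" for \<xi>
 proof (rule tendsto_eventually)
  show "\<forall>\<^sub>F n in sequentially. c n \<xi> = of_nat (card (Z \<xi>))"
   using eventually_inj_on_code[OF finZ[OF that]] by eventually_elim (simp add: c_eq card_image)
 qed
 have "(\<lambda>\<xi>. of_nat (card (Z \<xi>)) :: ennreal) \<in> borel_measurable MX"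
  by (rule borel_measurable_LIMSEQ_order[where u = c, OF lim c_meas])
 then show "(\<lambda>\<xi>. emeasure (vector_atoms m \<xi>) (C \<times> (vec_box m F))) \<in> borel_measurable (\<Pi>\<^sub>M j\<in>{..<m}. signed_measure_space)"
  unfolding MX_def[symmetric] using em by (subst measurable_cong[of MX]) auto
qed

text \<open>The criterion for the existence of an atom needs closed targets, so the mark space is
  generated by boxes with closed sides.\<close>

lemma sets_PiM_borel_closed:
 "sets (\<Pi>\<^sub>M j\<in>{..<m::nat}. (borel :: real measure)) =
  sigma_sets (\<Pi>\<^sub>E j\<in>{..<m}. UNIV) {vec_box m F | F. \<forall>j<m. closed (F j)}"
proof -
 have "sets (\<Pi>\<^sub>M j\<in>{..<m}. (borel :: real measure)) = sets (\<Pi>\<^sub>M j\<in>{..<m}. sigma UNIV (Collect closed))"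
  by (simp add: borel_eq_closed)
 also have "\<dots> = sets (sigma (\<Pi>\<^sub>E j\<in>{..<m}. UNIV)
   {{f\<in>(\<Pi>\<^sub>E i\<in>{..<m}. UNIV). \<forall>i\<in>j. f i \<in> A i} | A j. j \<in> {{..<m}} \<and> A \<in> (\<Pi> i\<in>j. Collect closed)})"
  by (intro sets_PiM_sigma) (auto intro!: exI[of _ "{UNIV}"])
 also have "{{f\<in>(\<Pi>\<^sub>E i\<in>{..<m}. UNIV). \<forall>i\<in>j. f i \<in> A i} | A j. j \<in> {{..<m}} \<and> A \<in> (\<Pi> i\<in>j. Collect (closed :: real set \<Rightarrow> bool))}
   = {vec_box m F | F. \<forall>j<m. closed (F j)}"
 proof -
  have "{f\<in>(\<Pi>\<^sub>E i\<in>{..<m}. UNIV). \<forall>i\<in>{..<m}. f i \<in> A i} = Pi\<^sub>E {..<m} A" for A :: "nat \<Rightarrow> real set"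
   by (rule set_eqI) (simp add: PiE_iff, blast)
  then show ?thesis by (simp add: Pi_iff lessThan_def)
 qed
 also have "sets (sigma (\<Pi>\<^sub>E j\<in>{..<m}. UNIV) {vec_box m F | F. \<forall>j<m. closed (F j :: real set)}) =
   sigma_sets (\<Pi>\<^sub>E j\<in>{..<m}. UNIV) {vec_box m F | F. \<forall>j<m. closed (F j :: real set)}"
 proof (rule sets_measure_of, rule subsetI)
  fix A assume "A \<in> {vec_box m F | F. \<forall>j<m. closed (F j :: real set)}"
  then obtain F where "A = (vec_box m F)" by blast
  then show "A \<in> Pow (\<Pi>\<^sub>E j\<in>{..<m}. UNIV)" by (auto simp: PiE_iff)
 qed
 finally show ?thesis .
qed

text \<open>Two applications of \<open>measurable_emeasure_generated\<close>: from closed boxes to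
  all measurable sets of marks, with the set of locations fixed, and then from rectangles to the
  product sigma-algebra. Intersecting with the box, whose count is finite, supplies the
  finiteness.\<close>

lemma measurable_vector_atoms_box:
 fixes C :: "'a::{metric_space, second_countable_topology} set"
 assumes C: "C \<in> bounded_borel"
  and F: "\<And>j. j < m \<Longrightarrow> closed (F j)"
  and j0: "j0 < m" "F j0 \<subseteq> {y. \<delta> \<le> \<bar>y\<bar>}" "0 < \<delta>"
  and A: "A \<in> sets (borel \<Otimes>\<^sub>M (vec_borel m))"
 shows "(\<lambda>\<xi>. emeasure (vector_atoms m \<xi>) ((C \<times> (vec_box m F)) \<inter> A)) \<in> borel_measurable (\<Pi>\<^sub>M j\<in>{..<m}. signed_measure_space)"
proof -
 define MX :: "(nat \<Rightarrow> 'a set \<Rightarrow> real) measure" where "MX = (\<Pi>\<^sub>M j\<in>{..<m}. signed_measure_space)"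
 define R :: "(nat \<Rightarrow> real) measure" where "R = (vec_borel m)"
 define W where "W C' = C' \<times> (vec_box m F)" for C' :: "'a set"
 have spR: "space R = (\<Pi>\<^sub>E j\<in>{..<m}. UNIV)" by (simp add: R_def space_PiM)
 have F_sets: "(vec_box m F) \<in> sets R"
  unfolding R_def using F by (intro sets_PiM_I_finite) auto
 have W_sets: "W C' \<in> sets (borel \<Otimes>\<^sub>M R)" if "C' \<in> sets borel" for C'
  unfolding W_def using that F_sets by (rule pair_measureI)
 have sts: "sets (vector_atoms m \<xi>) = sets (borel \<Otimes>\<^sub>M R)" for \<xi> :: "nat \<Rightarrow> 'a set \<Rightarrow> real" by (simp add: R_def)
 have step1: "(\<lambda>\<xi>. emeasure (vector_atoms m \<xi>) (W C' \<inter> (UNIV \<times> b))) \<in> borel_measurable MX"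
  if C': "C' \<in> bounded_borel" and b: "b \<in> sets R" for C' b
 proof -
  \<comment> \<open>Restriction to \<open>W C'\<close> makes the measure finite, and projection to
    the marks leaves one sigma-algebra to be generated.\<close>
  let ?D = "\<lambda>\<xi>. distr (density (vector_atoms m \<xi>) (indicator (W C'))) R snd"
  have sndm: "snd \<in> density (vector_atoms m \<xi>) (indicator (W C')) \<rightarrow>\<^sub>M R" for \<xi> :: "nat \<Rightarrow> 'a set \<Rightarrow> real"
   by (subst measurable_cong_sets[of _ "borel \<Otimes>\<^sub>M R"]) (auto simp: R_def)
  have D: "emeasure (?D \<xi>) b = emeasure (vector_atoms m \<xi>) (W C' \<inter> (UNIV \<times> b))" if b: "b \<in> sets R" for \<xi> b
  proof -
   have "emeasure (?D \<xi>) b = emeasure (density (vector_atoms m \<xi>) (indicator (W C'))) (snd -` b \<inter> space (vector_atoms m \<xi>))"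
    by (subst emeasure_distr[OF sndm b]) simp
   also have "snd -` b \<inter> space (vector_atoms m \<xi>) = UNIV \<times> b"
    using sets.sets_into_space[OF b] by (auto simp: space_vector_atoms spR)
   also have "emeasure (density (vector_atoms m \<xi>) (indicator (W C'))) (UNIV \<times> b) =
     emeasure (vector_atoms m \<xi>) (W C' \<inter> (UNIV \<times> b))"
    using b C' by (intro emeasure_restricted) (auto simp: R_def[symmetric] intro!: W_sets bounded_borel_sets)
   finally show ?thesis .
  qed
  have gen: "(\<lambda>\<xi>. emeasure (?D \<xi>) (vec_box m F')) \<in> borel_measurable MX"
   and fin: "\<And>\<xi>. \<xi> \<in> space MX \<Longrightarrow> emeasure (?D \<xi>) (vec_box m F') < \<top>" if F': "\<forall>j<m. closed (F' j)" for F'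
  proof -
   have s: "(vec_box m F') \<in> sets R"
    unfolding R_def using F' by (intro sets_PiM_I_finite) auto
   have eq: "W C' \<inter> (UNIV \<times> (vec_box m F')) = C' \<times> (\<Pi>\<^sub>E j\<in>{..<m}. F j \<inter> F' j)"
    by (simp add: W_def Times_Int_Times PiE_Int)
   have F'': "\<And>j. j < m \<Longrightarrow> closed (F j \<inter> F' j)" using F F' by auto
   have j0': "F j0 \<inter> F' j0 \<subseteq> {y. \<delta> \<le> \<bar>y\<bar>}" using j0 by auto
   show "(\<lambda>\<xi>. emeasure (?D \<xi>) (vec_box m F')) \<in> borel_measurable MX"
    unfolding D[OF s] eq MX_def
    by (rule measurable_vector_atoms_closed_box(1)[where F = "\<lambda>j. F j \<inter> F' j", OF C' F'' j0(1) j0' j0(3)])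
   show "\<And>\<xi>. \<xi> \<in> space MX \<Longrightarrow> emeasure (?D \<xi>) (vec_box m F') < \<top>"
    unfolding D[OF s] eq MX_def
    by (rule measurable_vector_atoms_closed_box(2)[where F = "\<lambda>j. F j \<inter> F' j", OF C' F'' j0(1) j0' j0(3)])
  qed
  have "(\<lambda>\<xi>. emeasure (?D \<xi>) b) \<in> borel_measurable MX"
  proof (rule measurable_emeasure_generated)
   show "sets (?D a) = sigma_sets (\<Pi>\<^sub>E j\<in>{..<m}. UNIV) {vec_box m F | F. \<forall>j<m. closed (F j)}" for a
    using sets_PiM_borel_closed[of m] by (simp add: R_def)
   show "b \<in> sigma_sets (\<Pi>\<^sub>E j\<in>{..<m}. UNIV) {vec_box m F | F. \<forall>j<m. closed (F j)}"
    using sets_PiM_borel_closed[of m] b by (simp add: R_def)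
   show "Int_stable {vec_box m F | F. \<forall>j<m. closed (F j :: real set)}"
   proof (rule Int_stableI)
    fix A B :: "(nat \<Rightarrow> real) set"
    assume "A \<in> {vec_box m F | F. \<forall>j<m. closed (F j)}" "B \<in> {vec_box m F | F. \<forall>j<m. closed (F j)}"
    then obtain F F' where "A = (vec_box m F)" "B = (vec_box m F')"
     "\<forall>j<m. closed (F j)" "\<forall>j<m. closed (F' j)" by blast
    then show "A \<inter> B \<in> {vec_box m F | F. \<forall>j<m. closed (F j)}"
     by (intro CollectI exI[of _ "\<lambda>j. F j \<inter> F' j"]) (simp add: PiE_Int closed_Int)
   qed
   show "emeasure (?D a) (\<Pi>\<^sub>E j\<in>{..<m}. UNIV) \<noteq> \<top>" if "a \<in> space MX" for a
    using fin[of "\<lambda>_. UNIV", OF _ that] by simp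
   show "(\<lambda>a. emeasure (?D a) (\<Pi>\<^sub>E j\<in>{..<m}. UNIV)) \<in> borel_measurable MX"
    using gen[of "\<lambda>_. UNIV"] by simp
  qed (use gen in auto)
  with D[OF b] show ?thesis by simp
 qed
 let ?D = "\<lambda>\<xi>. density (vector_atoms m \<xi>) (indicator (W C))"
 have D: "emeasure (?D \<xi>) A = emeasure (vector_atoms m \<xi>) (W C \<inter> A)" if "A \<in> sets (borel \<Otimes>\<^sub>M R)" for \<xi> A
  using that C by (intro emeasure_restricted) (auto simp: R_def[symmetric] intro!: W_sets bounded_borel_sets)
 have top: "space borel \<times> space R = UNIV \<times> space R" by simp
 have gen: "(\<lambda>\<xi>. emeasure (?D \<xi>) (a \<times> b)) \<in> borel_measurable MX" if "a \<in> sets borel" "b \<in> sets R" for a b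
 proof -
  have "W C \<inter> (a \<times> b) = W (a \<inter> C) \<inter> (UNIV \<times> b)" by (auto simp: W_def)
  then show ?thesis
   using that C by (simp add: D step1 bounded_borel_Int)
 qed
 have "(\<lambda>\<xi>. emeasure (?D \<xi>) A) \<in> borel_measurable MX"
 proof (rule measurable_emeasure_generated)
  show "sets (?D \<xi>) = sigma_sets (space borel \<times> space R) {a \<times> b |a b. a \<in> sets borel \<and> b \<in> sets R}" for \<xi>
   by (simp add: R_def sets_pair_measure)
  show "A \<in> sigma_sets (space borel \<times> space R) {a \<times> b |a b. a \<in> sets borel \<and> b \<in> sets R}"
   using A by (simp add: R_def sets_pair_measure)
  show "Int_stable {a \<times> b |a b. a \<in> sets borel \<and> b \<in> sets R}"
   by (rule Int_stable_pair_measure_generator)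
  show "{a \<times> b |a b. a \<in> sets borel \<and> b \<in> sets R} \<subseteq> Pow (space borel \<times> space R)"
   by (rule pair_measure_closed)
  show "emeasure (?D \<xi>) (space borel \<times> space R) \<noteq> \<top>" if "\<xi> \<in> space MX" for \<xi>
  proof -
   have "emeasure (?D \<xi>) (space borel \<times> space R) = emeasure (vector_atoms m \<xi>) (W C \<inter> (space borel \<times> space R))"
    by (rule D) auto
   also have "W C \<inter> (space borel \<times> space R) = W C" by (auto simp: W_def spR)
   finally show ?thesis
    using measurable_vector_atoms_closed_box(2)[where F = F and \<xi> = \<xi>, OF C F j0] that by (simp add: W_def MX_def)
  qed
  show "(\<lambda>\<xi>. emeasure (?D \<xi>) (space borel \<times> space R)) \<in> borel_measurable MX"
   by (rule gen) auto
 qed (use gen in auto)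
 moreover have "emeasure (?D \<xi>) A = emeasure (vector_atoms m \<xi>) (W C \<inter> A)" for \<xi>
  using A by (intro D) (simp add: R_def)
 ultimately show ?thesis by (simp add: W_def MX_def)
qed

text \<open>Every observed atom lies in one of countably many boxes: a ball of integer radius, with
  one coordinate bounded below by \<open>1 / Suc p\<close>. The boxes are made disjoint and the
  counts are added.\<close>

lemma measurable_emeasure_vector_atoms:
 fixes A :: "('a::{metric_space, second_countable_topology} \<times> (nat \<Rightarrow> real)) set"
 assumes A: "A \<in> sets (borel \<Otimes>\<^sub>M (vec_borel m))"
 shows "(\<lambda>\<xi>. emeasure (vector_atoms m \<xi>) A) \<in> borel_measurable (\<Pi>\<^sub>M j\<in>{..<m}. signed_measure_space)"
proof -
 define x0 :: 'a where "x0 = undefined"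
 define B where "B j p i = (if i = j then {y::real. 1 / Suc p \<le> \<bar>y\<bar>} else UNIV)" for i j p :: nat
 define W where "W r j p = (if j < m then ball x0 (real r) \<times> (\<Pi>\<^sub>E i\<in>{..<m}. B j p i) else {})" for r j p :: nat
 \<comment> \<open>One index \<open>k\<close> encodes radius \<open>r\<close>, coordinate
   \<open>j\<close> and bound \<open>p\<close>; the codes with \<open>m \<le> j\<close> are given
   the empty set.\<close>
 define V where "V k = (case prod_decode k of (r, q) \<Rightarrow> case prod_decode q of (j, p) \<Rightarrow> W r j p)" for k
 have clB: "closed (B j p i)" for j p i
  by (auto simp: B_def intro!: closed_Collect_le continuous_intros)
 have "B j p i \<in> sets borel" for j p i using clB by (rule borel_closed)
 then have W: "W r j p \<in> sets (borel \<Otimes>\<^sub>M (vec_borel m))" for r j p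
  unfolding W_def by (auto intro!: pair_measureI sets_PiM_I_finite)
 have V: "V k \<in> sets (borel \<Otimes>\<^sub>M (vec_borel m))" for k
  unfolding V_def by (auto split: prod.split intro: W)
 have dV: "disjointed V k \<in> sets (borel \<Otimes>\<^sub>M (vec_borel m))" for k
  using sets.range_disjointed_sets[of V] V by blast
 have in_V: "\<exists>k. (s, v) \<in> V k" if jv: "j < m" "v j \<noteq> 0" "v \<in> extensional {..<m}" for s v j
 proof -
  obtain p where p: "1 / Suc p < \<bar>v j\<bar>" using nat_approx_posE[of "\<bar>v j\<bar>"] jv(2) by auto
  obtain r where "dist x0 s < real r" using reals_Archimedean2 by blast
  with p jv have "(s, v) \<in> W r j p" by (auto simp: W_def B_def PiE_iff)
  then have "(s, v) \<in> V (prod_encode (r, prod_encode (j, p)))" by (simp add: V_def)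
  then show ?thesis by blast
 qed
 have sum_eq: "emeasure (vector_atoms m \<xi>) A = (\<Sum>k. emeasure (vector_atoms m \<xi>) (A \<inter> disjointed V k))" for \<xi>
 proof -
  have "emeasure (vector_atoms m \<xi>) A = emeasure (vector_atoms m \<xi>) (\<Union>k. A \<inter> disjointed V k)"
  proof -
   have "(\<Union>k. A \<inter> disjointed V k) = A \<inter> (\<Union>k. V k)" by (simp only: Int_UN_distrib[symmetric] UN_disjointed_eq)
   moreover have "emeasure (vector_atoms m \<xi>) A = emeasure (vector_atoms m \<xi>) (A \<inter> (\<Union>k. V k))"
    using A V in_V
    by (subst (1 2) emeasure_vector_atoms) (auto intro!: arg_cong[where f = "emeasure (count_space UNIV)"])
   ultimately show ?thesis by simp
  qed
  also have "\<dots> = (\<Sum>k. emeasure (vector_atoms m \<xi>) (A \<inter> disjointed V k))"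
  proof (rule suminf_emeasure[symmetric])
   show "disjoint_family (\<lambda>k. A \<inter> disjointed V k)"
    using disjoint_family_disjointed[of V] by (auto simp: disjoint_family_on_def)
  qed (use A dV in auto)
  finally show ?thesis .
 qed
 have "(\<lambda>\<xi>. emeasure (vector_atoms m \<xi>) (A \<inter> disjointed V k)) \<in> borel_measurable (\<Pi>\<^sub>M j\<in>{..<m}. signed_measure_space)" for k
 proof -
  obtain r q where "prod_decode k = (r, q)" by (cases "prod_decode k")
  moreover obtain j p where "prod_decode q = (j, p)" by (cases "prod_decode q")
  ultimately have VW: "V k = W r j p" by (simp add: V_def)
  show ?thesis
  proof (cases "j < m")
   case True
   have "(\<lambda>\<xi>. emeasure (vector_atoms m \<xi>) ((ball x0 (real r) \<times> (\<Pi>\<^sub>E i\<in>{..<m}. B j p i)) \<inter> (A \<inter> disjointed V k)))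
     \<in> borel_measurable (\<Pi>\<^sub>M j\<in>{..<m}. signed_measure_space)"
   proof (rule measurable_vector_atoms_box)
    show "B j p j \<subseteq> {y. 1 / Suc p \<le> \<bar>y\<bar>}" by (simp add: B_def)
    show "ball x0 (real r) \<in> bounded_borel" by (simp add: bounded_borel_def)
    show "A \<inter> disjointed V k \<in> sets (borel \<Otimes>\<^sub>M (vec_borel m))"
     using A dV by (rule sets.Int)
   qed (use True clB in auto)
   moreover have "(ball x0 (real r) \<times> (\<Pi>\<^sub>E i\<in>{..<m}. B j p i)) \<inter> (A \<inter> disjointed V k) = A \<inter> disjointed V k"
    using disjointed_subset[of V k] VW True by (auto simp: W_def)
   ultimately show ?thesis by simp
  next
   case False
   then have "V k = {}" using VW by (simp add: W_def)
   then show ?thesis using disjointed_subset[of V k] by simp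
  qed
 qed
 then show ?thesis unfolding sum_eq by measurable
qed

section \<open>Integrals of measurable families of measures and the atom process of one signed
  measure\<close>

text \<open>Point processes may have infinite mass, so only the measurability of each count is
  assumed, and the claim is built up along the induction for nonnegative measurable
  functions.\<close>

lemma measurable_nn_integral_kernel:
 assumes sets: "\<And>w. w \<in> space \<Omega> \<Longrightarrow> sets (N w) = sets F"
  and N: "\<And>A. A \<in> sets F \<Longrightarrow> (\<lambda>w. emeasure (N w) A) \<in> borel_measurable \<Omega>"
  and f: "f \<in> borel_measurable F"
 shows "(\<lambda>w. NN p|(N w). f p) \<in> borel_measurable \<Omega>"
proof -
 have mN: "borel_measurable (N w) = borel_measurable F" if "w \<in> space \<Omega>" for w
  using sets[OF that] by (intro measurable_cong_sets) auto
 have spN: "space (N w) = space F" if "w \<in> space \<Omega>" for w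
  using sets[OF that] by (rule sets_eq_imp_space_eq)
 show ?thesis using f
 proof (induction rule: borel_measurable_induct)
  case (cong f g)
  then have "(NN p|(N w). f p) = (NN p|(N w). g p)" if "w \<in> space \<Omega>" for w
   using spN[OF that] by (intro nn_integral_cong) simp
  then have "(\<lambda>w. NN p|(N w). f p) \<in> borel_measurable \<Omega> \<longleftrightarrow> (\<lambda>w. NN p|(N w). g p) \<in> borel_measurable \<Omega>"
   by (intro measurable_cong)
  with cong show ?case by simp
 next
  case (set A)
  then have "(\<lambda>w. NN p|(N w). indicator A p) \<in> borel_measurable \<Omega> \<longleftrightarrow> (\<lambda>w. emeasure (N w) A) \<in> borel_measurable \<Omega>"
   using sets by (intro measurable_cong) simp
  with N[OF set] show ?case by simp
 next
  case (mult u c)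
  then have "(\<lambda>w. NN p|(N w). c * u p) \<in> borel_measurable \<Omega> \<longleftrightarrow> (\<lambda>w. c * (NN p|(N w). u p)) \<in> borel_measurable \<Omega>"
   by (intro measurable_cong nn_integral_cmult) (simp add: mN)
  with mult show ?case by simp
 next
  case (add u v)
  then have "(\<lambda>w. NN p|(N w). v p + u p) \<in> borel_measurable \<Omega> \<longleftrightarrow>
    (\<lambda>w. (NN p|(N w). v p) + (NN p|(N w). u p)) \<in> borel_measurable \<Omega>"
   by (intro measurable_cong nn_integral_add) (simp_all add: mN)
  with add show ?case by simp
 next
  case (seq U)
  have eq: "(NN p|(N w). (SUP i. U i) p) = (SUP i. NN p|(N w). U i p)" if "w \<in> space \<Omega>" for w
   unfolding SUP_apply using seq that
   by (intro nn_integral_monotone_convergence_SUP) (simp_all add: mN)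
  have "(\<lambda>w. SUP i. NN p|(N w). U i p) \<in> borel_measurable \<Omega>"
   using seq by measurable
  then show ?case by (subst measurable_cong[OF eq])
 qed
qed

text \<open>The graph of the atom weights as a point process. Its second coordinate lives on the
  nonzero reals, so that it has the same state space as the Poisson process of the
  representation.\<close>

definition atom_process :: "('a::metric_space set \<Rightarrow> real) \<Rightarrow> ('a \<times> real) measure" where
 "atom_process \<xi> = distr (count_space {s. \<xi> {s} \<noteq> 0}) point_borel (\<lambda>s. (s, \<xi> {s}))"

lemma space_nonzero_borel [simp]: "space nonzero_borel = - {0}"
 by (simp add: nonzero_borel_def space_restrict_space)

lemma sets_nonzero_borel: "sets nonzero_borel = {A \<in> sets borel. A \<subseteq> - {0}}"
 unfolding nonzero_borel_def by (rule set_eqI) (auto simp: sets_restrict_space_iff)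

lemma sets_pair_nonzero_borel:
 "A \<in> sets ((borel :: 'a::topological_space measure) \<Otimes>\<^sub>M nonzero_borel) \<longleftrightarrow> A \<in> sets pair_borel \<and> A \<subseteq> UNIV \<times> - {0}"
proof
 assume "A \<in> sets ((borel :: 'a measure) \<Otimes>\<^sub>M nonzero_borel)"
 then have "A \<in> sigma_sets (UNIV \<times> - {0}) {a \<times> b |a b. a \<in> sets borel \<and> b \<in> sets nonzero_borel}"
  by (simp add: sets_pair_measure)
 then show "A \<in> sets pair_borel \<and> A \<subseteq> UNIV \<times> - {0}"
 proof (induction rule: sigma_sets.induct)
  case (Compl a)
  moreover have "UNIV \<times> - {0} \<in> sets ((borel :: 'a measure) \<Otimes>\<^sub>M (borel :: real measure))"
   by (intro pair_measureI) auto
  ultimately show ?case by auto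
 qed (auto simp: sets_nonzero_borel intro!: pair_measureI)
next
 assume A: "A \<in> sets ((borel :: 'a measure) \<Otimes>\<^sub>M borel) \<and> A \<subseteq> UNIV \<times> - {0}"
 have "(\<lambda>p. (fst p, snd p)) \<in> (borel :: 'a measure) \<Otimes>\<^sub>M nonzero_borel \<rightarrow>\<^sub>M borel \<Otimes>\<^sub>M (borel :: real measure)"
 proof (rule measurable_Pair)
  have "(\<lambda>x. x) \<in> nonzero_borel \<rightarrow>\<^sub>M borel"
   unfolding nonzero_borel_def by (intro measurable_restrict_space1) simp
  then show "snd \<in> (borel :: 'a measure) \<Otimes>\<^sub>M nonzero_borel \<rightarrow>\<^sub>M borel"
   by (rule measurable_compose[OF measurable_snd])
 qed simp
 then have "(\<lambda>p. (fst p, snd p)) -` A \<inter> space ((borel :: 'a measure) \<Otimes>\<^sub>M nonzero_borel) \<in> sets point_borel"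
  using A by (intro measurable_sets) auto
 also have "(\<lambda>p. (fst p, snd p)) -` A \<inter> space ((borel :: 'a measure) \<Otimes>\<^sub>M nonzero_borel) = A"
  using A by (auto simp: space_pair_measure)
 finally show "A \<in> sets point_borel" .
qed

lemma measurable_pair_nonzero_borel:
 assumes "f \<in> borel_measurable ((borel :: 'a::topological_space measure) \<Otimes>\<^sub>M borel)"
 shows "f \<in> borel_measurable point_borel"
proof (rule measurableI)
 fix A :: "'b set" assume "A \<in> sets borel"
 then have "f -` A \<inter> space pair_borel \<in> sets ((borel :: 'a measure) \<Otimes>\<^sub>M borel)"
  using assms by (rule measurable_sets[rotated])
 moreover have "UNIV \<times> - {0} \<in> sets ((borel :: 'a measure) \<Otimes>\<^sub>M (borel :: real measure))"
  by (intro pair_measureI) auto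
 moreover have "f -` A \<inter> space point_borel = f -` A \<inter> space pair_borel \<inter> (UNIV \<times> - {0})"
  by (auto simp: space_pair_measure)
 ultimately show "f -` A \<inter> space point_borel \<in> sets ((borel :: 'a measure) \<Otimes>\<^sub>M nonzero_borel)"
  by (simp add: sets_pair_nonzero_borel)
qed simp

lemma sets_atom_process [simp, measurable_cong]: "sets (atom_process \<xi>) = sets point_borel"
 by (simp add: atom_process_def)

lemma space_atom_process: "space (atom_process \<xi>) = UNIV \<times> - {0}"
 by (simp add: atom_process_def space_pair_measure)

lemma measurable_atom_process_point:
 "(\<lambda>s. (s, \<xi> {s})) \<in> count_space {s. \<xi> {s} \<noteq> 0} \<rightarrow>\<^sub>M point_borel"
 by (auto simp: space_pair_measure)

lemma emeasure_atom_process: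
 assumes "A \<in> sets point_borel"
 shows "emeasure (atom_process \<xi>) A = emeasure (count_space UNIV) {s. (s, \<xi> {s}) \<in> A}"
proof -
 have "(\<lambda>s. (s, \<xi> {s})) -` A \<inter> space (count_space {s. \<xi> {s} \<noteq> 0}) = {s. (s, \<xi> {s}) \<in> A}"
  using assms by (auto simp: sets_pair_nonzero_borel)
 moreover have "{s. (s, \<xi> {s}) \<in> A} \<subseteq> {s. \<xi> {s} \<noteq> 0}"
  using assms by (auto simp: sets_pair_nonzero_borel)
 ultimately show ?thesis
  unfolding atom_process_def emeasure_distr[OF measurable_atom_process_point assms]
  by (simp only:) (subst (1 2) emeasure_count_space, auto)
qed

lemma nn_integral_atom_process:
 assumes "f \<in> borel_measurable point_borel"
 shows "(NN p|(atom_process \<xi>). f p) = (NN s|(count_space {s. \<xi> {s} \<noteq> 0}). f (s, \<xi> {s}))"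
 unfolding atom_process_def by (rule nn_integral_distr[OF measurable_atom_process_point]) (use assms in simp)

text \<open>The case \<open>m = 1\<close> of \<open>vector_atoms\<close>, a vector with one
  component being identified with its entry.\<close>

lemma measurable_emeasure_atom_process:
 fixes A :: "('a::{metric_space, second_countable_topology} \<times> real) set"
 assumes A: "A \<in> sets point_borel"
 shows "(\<lambda>\<xi>. emeasure (atom_process \<xi>) A) \<in> borel_measurable signed_measure_space"
proof -
 let ?R = "(borel :: 'a measure) \<Otimes>\<^sub>M (\<Pi>\<^sub>M j\<in>{..<1::nat}. (borel :: real measure))"
 define A' where "A' = (\<lambda>(s, v). (s, v 0)) -` A \<inter> space ?R"
 have "(\<lambda>(s, v). (s, v 0)) \<in> ?R \<rightarrow>\<^sub>M borel \<Otimes>\<^sub>M borel" by measurable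
 then have A': "A' \<in> sets ?R"
  unfolding A'_def using A by (intro measurable_sets) (auto simp: sets_pair_nonzero_borel)
 have "emeasure (atom_process \<xi>) A = emeasure (vector_atoms 1 (\<lambda>j\<in>{..<1}. \<xi>)) A'" for \<xi> :: "'a set \<Rightarrow> real"
  using A
  by (subst emeasure_vector_atoms[OF A'], subst emeasure_atom_process[OF A])
    (auto simp: A'_def space_pair_measure space_PiM PiE_iff sets_pair_nonzero_borel
     intro!: arg_cong[where f = "emeasure (count_space UNIV)"])
 moreover have "(\<lambda>\<xi>. \<lambda>j\<in>{..<1}. \<xi>) \<in> signed_measure_space \<rightarrow>\<^sub>M (\<Pi>\<^sub>M j\<in>{..<1::nat}. (signed_measure_space :: ('a set \<Rightarrow> real) measure))"
  by (intro measurable_restrict) simp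
 note measurable_compose[OF this measurable_emeasure_vector_atoms[OF A']]
 ultimately show ?thesis by simp
qed

section \<open>Laplace functionals of point processes\<close>

definition enat_valued :: "ennreal \<Rightarrow> bool" where
 "enat_valued z \<longleftrightarrow> z = \<top> \<or> (\<exists>n. z = of_nat n)"

lemma enat_valued_emeasure_count_space: "enat_valued (emeasure (count_space A) X)" if "X \<subseteq> A"
 using that by (auto simp: enat_valued_def emeasure_count_space)

text \<open>The series without its constant term is dominated by a geometric series and tends to 0
  with \<open>u\<close>, while its sum is \<open>- e 0\<close>.\<close>

lemma power_series_zero_coeff_0:
 fixes e :: "nat \<Rightarrow> real"
 assumes bnd: "\<And>n. \<bar>e n\<bar> \<le> C"
  and zero: "\<And>u. 0 < u \<Longrightarrow> u < 1 \<Longrightarrow> (\<lambda>n. e n * u ^ n) sums 0"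
 shows "e 0 = 0"
proof -
 have C: "0 \<le> C" using bnd[of 0] by linarith
 have "\<bar>e 0\<bar> \<le> C / Suc j" for j
 proof -
  \<comment> \<open>Chosen so that \<open>u / (1 - u)\<close> equals
    \<open>1 / Suc j\<close>.\<close>
  define u :: real where "u = 1 / (real j + 2)"
  have u: "0 < u" "u < 1" by (auto simp: u_def)
  have s: "(\<lambda>n. e (Suc n) * u ^ Suc n) sums (- e 0)"
   using zero[OF u] sums_Suc_iff[of "\<lambda>n. e n * u ^ n" "- e 0"] by simp
  have g: "(\<lambda>n. C * u * u ^ n) sums (C * u * (1 / (1 - u)))"
   using u by (intro sums_mult geometric_sums) auto
  have "\<bar>- e 0\<bar> \<le> C * u * (1 / (1 - u))"
  proof (rule abs_leI)
   have le: "\<bar>e (Suc n) * u ^ Suc n\<bar> \<le> C * u * u ^ n" for n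
    using mult_right_mono[OF bnd[of "Suc n"], of "u ^ Suc n"] u by (simp add: abs_mult mult.assoc)
   show "- e 0 \<le> C * u * (1 / (1 - u))"
    by (rule sums_le[OF _ s g]) (use le abs_le_iff in blast)
   show "- (- e 0) \<le> C * u * (1 / (1 - u))"
    by (rule sums_le[OF _ sums_minus[OF s] g]) (use le abs_le_iff in blast)
  qed
  also have "u * (1 / (1 - u)) = 1 / Suc j"
   by (simp add: u_def field_simps)
  then have "C * u * (1 / (1 - u)) = C * (1 / Suc j)" by (simp only: mult.assoc)
  finally show ?thesis by simp
 qed
 moreover have "(\<lambda>j. C / Suc j) \<longlonglongrightarrow> 0"
  by (rule LIMSEQ_Suc[OF lim_const_over_n])
 ultimately have "\<bar>e 0\<bar> \<le> 0" by (intro LIMSEQ_le_const) auto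
 then show ?thesis by simp
qed

text \<open>Once a coefficient is known to vanish, the series can be divided by \<open>u\<close>;
  the shifted coefficients obey the same bound, so the argument repeats.\<close>

lemma power_series_zero_coeff:
 fixes d :: "nat \<Rightarrow> real"
 assumes bnd: "\<And>n. \<bar>d n\<bar> \<le> C"
  and zero: "\<And>u. 0 < u \<Longrightarrow> u < 1 \<Longrightarrow> (\<lambda>n. d n * u ^ n) sums 0"
 shows "d k = 0"
proof -
 have "\<forall>u. 0 < u \<and> u < 1 \<longrightarrow> (\<lambda>n. d (n + k) * u ^ n) sums 0" for k
 proof (induction k)
  case (Suc k)
  have 0: "d (0 + k) = 0"
   by (rule power_series_zero_coeff_0[of "\<lambda>n. d (n + k)" C]) (use bnd Suc in auto)
  show ?case
  proof (intro allI impI, elim conjE)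
   fix u :: real assume u: "0 < u" "u < 1"
   have "(\<lambda>n. d (Suc n + k) * u ^ Suc n) sums 0"
    using Suc u 0 sums_Suc_iff[of "\<lambda>n. d (n + k) * u ^ n" 0] by simp
   then have "(\<lambda>n. d (Suc n + k) * u ^ Suc n / u) sums (0 / u)" by (rule sums_divide)
   then show "(\<lambda>n. d (n + Suc k) * u ^ n) sums 0" using u by simp
  qed
 qed (use zero in auto)
 then show ?thesis
  using power_series_zero_coeff_0[of "\<lambda>n. d (n + k)" C] bnd by auto
qed

abbreviation "level M V n \<equiv> {w\<in>space M. V w = (of_nat n :: ennreal)}"

text \<open>Since \<open>c\<close> is positive, the outcomes with an infinite count contribute 0.
  The transform is thus a power series in the number \<open>eneg c\<close> whose coefficients are
  the masses of the finite levels.\<close>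

lemma nn_integral_eneg_enat_valued:
 assumes V [measurable]: "V \<in> borel_measurable \<mu>" and vals: "AE w in \<mu>. enat_valued (V w)" and c: "0 < c"
 shows "(NN w|\<mu>. eneg (c * V w)) = (\<Sum>n. eneg (c * of_nat n) * emeasure \<mu> (level \<mu> V n))"
proof -
 have "(NN w|\<mu>. eneg (c * V w)) = (NN w|\<mu>. (\<Sum>n. eneg (c * of_nat n) * indicator (level \<mu> V n) w))"
 proof (rule nn_integral_cong_AE)
  show "AE w in \<mu>. eneg (c * V w) = (\<Sum>n. eneg (c * of_nat n) * indicator (level \<mu> V n) w)"
   using vals AE_space
  proof eventually_elim
   case (elim w)
   show ?case
   proof (cases "V w = \<top>")
    case True
    then have "eneg (c * of_nat n) * indicator (level \<mu> V n) w = 0" for n :: nat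
     by (metis (mono_tags, lifting) ennreal_of_nat_neq_top indicator_simps(2) mem_Collect_eq mult_zero_right)
    moreover have "eneg (c * V w) = 0" using True c by (simp add: ennreal_mult_top)
    ultimately show ?thesis by (simp only: suminf_zero)
   next
    case False
    then obtain k where k: "V w = of_nat k" using elim by (auto simp: enat_valued_def)
    have "(\<Sum>n. eneg (c * of_nat n) * indicator (level \<mu> V n) w) =
      (\<Sum>n\<in>{k}. eneg (c * of_nat n) * indicator (level \<mu> V n) w)"
     by (intro suminf_finite) (auto simp: k)
    also have "\<dots> = eneg (c * V w)" using elim k by simp
    finally show ?thesis by simp
   qed
  qed
 qed
 also have "\<dots> = (\<Sum>n. eneg (c * of_nat n) * emeasure \<mu> (level \<mu> V n))"
  by (subst nn_integral_suminf) (auto simp: nn_integral_cmult_indicator)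
 finally show ?thesis .
qed

lemma eneg_of_nat: "0 \<le> t \<Longrightarrow> eneg (ennreal t * of_nat n) = ennreal (exp (- t) ^ n)"
proof -
 assume "0 \<le> t"
 then have "ennreal t * of_nat n = ennreal (t * real n)"
  by (simp add: ennreal_mult ennreal_of_nat_eq_real_of_nat)
 with \<open>0 \<le> t\<close> show ?thesis by (simp add: eneg_ennreal exp_of_nat_mult[symmetric] mult.commute)
qed

text \<open>For \<open>u = exp (- t)\<close> both transforms are power series in \<open>u\<close>,
  and equality on (0, 1) gives equal masses of all finite levels. The level at infinity is invisible
  for positive \<open>t\<close>; its mass is the difference to the total mass, which comes from
  \<open>t = 0\<close>.\<close>

lemma enat_valued_laplace_unique:
 assumes fin: "finite_measure \<mu>" "finite_measure \<mu>'" and sets: "sets \<mu>' = sets \<mu>"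
  and V: "V \<in> borel_measurable \<mu>" and vals: "\<And>w. w \<in> space \<mu> \<Longrightarrow> enat_valued (V w)"
  and eq: "\<And>t. 0 \<le> t \<Longrightarrow> (NN w|\<mu>. eneg (ennreal t * V w)) = (NN w|\<mu>'. eneg (ennreal t * V w))"
  and E: "E \<in> sets borel"
 shows "emeasure \<mu> {w\<in>space \<mu>. V w \<in> E} = emeasure \<mu>' {w\<in>space \<mu>. V w \<in> E}"
proof -
 interpret \<mu>: finite_measure \<mu> by fact
 interpret \<mu>': finite_measure \<mu>' by fact
 have sp: "space \<mu>' = space \<mu>" using sets by (rule sets_eq_imp_space_eq)
 note V [measurable]
 have V' [measurable]: "V \<in> borel_measurable \<mu>'" using V sets by (simp cong: measurable_cong_sets)
 define d where "d n = measure \<mu> (level \<mu> V n) - measure \<mu>' (level \<mu> V n)" for n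
 define C where "C = measure \<mu> (space \<mu>) + measure \<mu>' (space \<mu>)"
 have ms: "measure \<mu> (level \<mu> V n) \<le> C" "measure \<mu>' (level \<mu> V n) \<le> C" for n
  using \<mu>.bounded_measure \<mu>'.bounded_measure unfolding C_def sp
  by (meson add_increasing add_increasing2 measure_nonneg)+
 have ser: "(\<lambda>n. measure \<mu>'' (level \<mu> V n) * u ^ n) sums enn2real (NN w|\<mu>''. eneg (ennreal (- ln u) * V w))"
  if u: "0 < u" "u < 1" and \<mu>'': "\<mu>'' \<in> {\<mu>, \<mu>'}" for u \<mu>''
 proof -
  interpret \<mu>'': finite_measure \<mu>'' using \<mu>'' fin by auto
  have [measurable]: "V \<in> borel_measurable \<mu>''" and sp'': "space \<mu>'' = space \<mu>" using \<mu>'' V V' sp by auto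
  have t: "0 < - ln u" using u by simp
  have sm: "summable (\<lambda>n. measure \<mu>'' (level \<mu> V n) * u ^ n)"
  proof (rule summable_comparison_test')
   show "summable (\<lambda>n. C * u ^ n)" using u by (intro summable_mult summable_geometric) auto
   show "norm (measure \<mu>'' (level \<mu> V n) * u ^ n) \<le> C * u ^ n" for n
    using ms[of n] \<mu>'' u by (auto simp: abs_mult intro!: mult_right_mono)
  qed
  have "eneg (ennreal (- ln u) * of_nat n) * emeasure \<mu>'' {w\<in>space \<mu>''. V w = of_nat n} =
    ennreal (measure \<mu>'' (level \<mu> V n) * u ^ n)" for n
  proof -
   have "eneg (ennreal (- ln u) * of_nat n) = ennreal (u ^ n)"
    using t u by (subst eneg_of_nat) auto
   then show ?thesis
    using u by (simp add: sp'' \<mu>''.emeasure_eq_measure ennreal_mult[symmetric] mult.commute)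
  qed
  moreover have "AE w in \<mu>''. enat_valued (V w)" using vals by (intro AE_I2) (simp add: sp'')
  ultimately have "(NN w|\<mu>''. eneg (ennreal (- ln u) * V w)) = (\<Sum>n. ennreal (measure \<mu>'' (level \<mu> V n) * u ^ n))"
   using t by (subst nn_integral_eneg_enat_valued) auto
  also have "\<dots> = ennreal (\<Sum>n. measure \<mu>'' (level \<mu> V n) * u ^ n)"
   using u sm by (intro suminf_ennreal2) auto
  finally have "enn2real (NN w|\<mu>''. eneg (ennreal (- ln u) * V w)) = (\<Sum>n. measure \<mu>'' (level \<mu> V n) * u ^ n)"
   using u sm by (simp add: suminf_nonneg)
  then show ?thesis using sm by (simp add: summable_sums)
 qed
 have "d n = 0" for n
 proof (rule power_series_zero_coeff)
  show "\<bar>d n\<bar> \<le> C" for n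
   using ms[of n] measure_nonneg[of \<mu> "(level \<mu> V n)"]
    measure_nonneg[of \<mu>' "(level \<mu> V n)"]
   unfolding d_def by linarith
  show "(\<lambda>n. d n * u ^ n) sums 0" if u: "0 < u" "u < 1" for u
   using sums_diff[OF ser[OF u, of \<mu>] ser[OF u, of \<mu>']] eq[of "- ln u"] u by (simp add: d_def left_diff_distrib)
 qed
 then have n: "emeasure \<mu> (level \<mu> V n) = emeasure \<mu>' (level \<mu> V n)" for n
  by (simp add: d_def \<mu>.emeasure_eq_measure \<mu>'.emeasure_eq_measure)
 have split: "emeasure \<mu>'' {w\<in>space \<mu>. V w \<in> E'} =
   (\<Sum>n. indicator E' (of_nat n) * emeasure \<mu>'' (level \<mu> V n)) + indicator E' \<top> * emeasure \<mu>'' {w\<in>space \<mu>. V w = \<top>}"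
  if E': "E' \<in> sets borel" and \<mu>'': "\<mu>'' \<in> {\<mu>, \<mu>'}" for E' \<mu>''
 proof -
  have [measurable]: "V \<in> borel_measurable \<mu>''" "E' \<in> sets borel" and sp'': "space \<mu>'' = space \<mu>" using \<mu>'' V V' sp E' by auto
  have "emeasure \<mu>'' {w\<in>space \<mu>. V w \<in> E'} = (NN w|\<mu>''. indicator {w\<in>space \<mu>. V w \<in> E'} w)"
   unfolding sp''[symmetric] by simp
  also have "\<dots> = (NN w|\<mu>''. (\<Sum>n. indicator E' (of_nat n) * indicator (level \<mu> V n) w) +
    indicator E' \<top> * indicator {w\<in>space \<mu>. V w = \<top>} w)"
  proof (rule nn_integral_cong)
   fix w assume "w \<in> space \<mu>''"
   then have w: "w \<in> space \<mu>" by (simp add: sp'')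
   show "indicator {w\<in>space \<mu>. V w \<in> E'} w = (\<Sum>n. indicator E' (of_nat n) * indicator (level \<mu> V n) w) +
    (indicator E' \<top> * indicator {w\<in>space \<mu>. V w = \<top>} w :: ennreal)"
   proof (cases "V w = \<top>")
    case True
    then have "indicator (level \<mu> V n) w = (0::ennreal)" for n :: nat
     by (metis (mono_tags, lifting) ennreal_of_nat_neq_top indicator_simps(2) mem_Collect_eq)
    with True w show ?thesis by (simp add: indicator_def)
   next
    case False
    then obtain k where k: "V w = of_nat k" using vals[OF w] by (auto simp: enat_valued_def)
    have "(\<Sum>n. indicator E' (of_nat n) * indicator (level \<mu> V n) w :: ennreal) =
      (\<Sum>n\<in>{k}. indicator E' (of_nat n) * indicator (level \<mu> V n) w)"
     by (intro suminf_finite) (auto simp: k)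
    then show ?thesis using k w False by (simp add: indicator_def)
   qed
  qed
  also have "\<dots> = (\<Sum>n. indicator E' (of_nat n) * emeasure \<mu>'' (level \<mu> V n)) + indicator E' \<top> * emeasure \<mu>'' {w\<in>space \<mu>. V w = \<top>}"
   unfolding sp''[symmetric]
   by (simp add: nn_integral_add nn_integral_suminf nn_integral_cmult_indicator)
  finally show ?thesis .
 qed
 have "emeasure \<mu> {w\<in>space \<mu>. V w = \<top>} = emeasure \<mu>' {w\<in>space \<mu>. V w = \<top>}"
 proof -
  \<comment> \<open>At \<open>t = 0\<close> the integrand is 1 even where the count is infinite,
    because 0 times infinity is 0.\<close>
  have "emeasure \<mu> (space \<mu>) = emeasure \<mu>' (space \<mu>')"
   using eq[of 0] by simp
  then have "emeasure \<mu> {w\<in>space \<mu>. V w \<in> UNIV} = emeasure \<mu>' {w\<in>space \<mu>. V w \<in> UNIV}" by (simp add: sp)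
  then have "(\<Sum>n. emeasure \<mu> (level \<mu> V n)) + emeasure \<mu> {w\<in>space \<mu>. V w = \<top>} =
    (\<Sum>n. emeasure \<mu> (level \<mu> V n)) + emeasure \<mu>' {w\<in>space \<mu>. V w = \<top>}"
   using split[of UNIV \<mu>] split[of UNIV \<mu>'] by (simp add: n)
  moreover have "(\<Sum>n. emeasure \<mu> (level \<mu> V n)) \<noteq> \<top>"
  proof -
   have "(\<Sum>n. emeasure \<mu> (level \<mu> V n)) \<le> emeasure \<mu> {w\<in>space \<mu>. V w \<in> UNIV}"
    using split[of UNIV \<mu>] by simp
   then show ?thesis using \<mu>.emeasure_finite by (auto simp: top_unique)
  qed
  ultimately show ?thesis by (simp add: ennreal_add_left_cancel)
 qed
 with E show ?thesis by (simp add: split n)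
qed

abbreviation process_sigma :: "'w measure \<Rightarrow> ('w \<Rightarrow> 'b measure) \<Rightarrow> 'b measure \<Rightarrow> 'w measure" where
 "process_sigma M N F \<equiv> vimage_algebra (space M) (\<lambda>w. \<lambda>A\<in>sets F. emeasure (N w) A) (\<Pi>\<^sub>M A\<in>sets F. borel)"

text \<open>One count after the other is conditioned on, its law being read off a power series.\<close>

lemma counting_laplace_unique:
 fixes N :: "'w \<Rightarrow> 'b measure"
 assumes fin: "finite_measure \<mu>" "finite_measure \<mu>'" and sets: "sets \<mu>' = sets \<mu>"
  and setsN: "\<And>w. w \<in> space \<mu> \<Longrightarrow> sets (N w) = sets F"
  and meas: "\<And>A. A \<in> sets F \<Longrightarrow> (\<lambda>w. emeasure (N w) A) \<in> borel_measurable \<mu>"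
  and vals: "\<And>w A. w \<in> space \<mu> \<Longrightarrow> A \<in> sets F \<Longrightarrow> enat_valued (emeasure (N w) A)"
  and eq: "\<And>f. f \<in> borel_measurable F \<Longrightarrow> (NN w|\<mu>. eneg (NN p|(N w). f p)) = (NN w|\<mu>'. eneg (NN p|(N w). f p))"
  and W: "W \<in> sets (process_sigma \<mu> N F)"
 shows "emeasure \<mu> W = emeasure \<mu>' W"
proof -
 interpret \<mu>: finite_measure \<mu> by fact
 interpret \<mu>': finite_measure \<mu>' by fact
 have sp: "space \<mu>' = space \<mu>" using sets by (rule sets_eq_imp_space_eq)
 have bm: "borel_measurable \<mu>' = (borel_measurable \<mu> :: ('w \<Rightarrow> ennreal) set)" using sets by (intro measurable_cong_sets) auto
 have mN: "borel_measurable (N w) = (borel_measurable F :: ('b \<Rightarrow> ennreal) set)" if "w \<in> space \<mu>" for w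
  using setsN[OF that] by (intro measurable_cong_sets) auto
 have mI: "(\<lambda>w. NN p|(N w). f p) \<in> borel_measurable \<mu>" if "f \<in> borel_measurable F" for f
  by (rule measurable_nn_integral_kernel[OF setsN meas that])
 \<comment> \<open>The induction carries an arbitrary test function \<open>f\<close>: adding
   \<open>t\<close> times the indicator of \<open>A\<close> to it is what produces the transform of
   the next count.\<close>
 have cyl: "\<forall>f\<in>borel_measurable F. (NN w|\<mu>. eneg (NN p|(N w). f p) * (\<Prod>A\<in>J. indicator (E A) (emeasure (N w) A))) =
   (NN w|\<mu>'. eneg (NN p|(N w). f p) * (\<Prod>A\<in>J. indicator (E A) (emeasure (N w) A)))"
  if "finite J" "J \<subseteq> sets F" "\<And>A. A \<in> J \<Longrightarrow> E A \<in> sets borel" for J and E :: "'b set \<Rightarrow> ennreal set"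
  using that
 proof (induction J rule: finite_induct)
  case empty
  then show ?case using eq by simp
 next
  case (insert A J)
  have A [measurable]: "A \<in> sets F" and EA: "E A \<in> sets borel" using insert by auto
  show ?case
  proof
   fix f :: "'b \<Rightarrow> ennreal" assume f [measurable]: "f \<in> borel_measurable F"
   \<comment> \<open>\<open>h\<close> is absorbed into the two measures as a density, which leaves a
     comparison of the law of a single count.\<close>
   define h where "h w = eneg (NN p|(N w). f p) * (\<Prod>A\<in>J. indicator (E A) (emeasure (N w) A))" for w
   have h [measurable]: "h \<in> borel_measurable \<mu>"
    unfolding h_def using insert mI[OF f] meas
    by (intro borel_measurable_times_ennreal borel_measurable_prod_ennreal measurable_compose[OF mI[OF f] measurable_eneg]
      measurable_compose[OF _ borel_measurable_indicator]) auto
   have h' [measurable]: "h \<in> borel_measurable \<mu>'" using h bm by simp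
   have h1: "h w \<le> 1" for w
    unfolding h_def by (intro mult_le_one prod_le_1) (auto simp: indicator_def)
   have VA [measurable]: "(\<lambda>w. emeasure (N w) A) \<in> borel_measurable \<mu>" by (rule meas[OF A])
   have VA' [measurable]: "(\<lambda>w. emeasure (N w) A) \<in> borel_measurable \<mu>'" using VA bm by simp
   have hfin: "finite_measure (density \<mu> h)" "finite_measure (density \<mu>' h)"
   proof -
    have "(NN w|\<mu>. h w) \<le> (NN w|\<mu>. 1)" "(NN w|\<mu>'. h w) \<le> (NN w|\<mu>'. 1)"
     by (intro nn_integral_mono h1)+
    then show "finite_measure (density \<mu> h)" "finite_measure (density \<mu>' h)"
     using \<mu>.emeasure_finite \<mu>'.emeasure_finite
     by (auto intro!: finite_measureI simp: emeasure_density top_unique cong: nn_integral_cong)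
   qed
   have "emeasure (density \<mu> h) {w\<in>space (density \<mu> h). emeasure (N w) A \<in> E A} =
     emeasure (density \<mu>' h) {w\<in>space (density \<mu> h). emeasure (N w) A \<in> E A}"
   proof (rule enat_valued_laplace_unique[OF hfin])
    fix t :: real assume "0 \<le> t"
    have ft: "(\<lambda>p. f p + ennreal t * indicator A p) \<in> borel_measurable F" by measurable
    have ht: "h w * eneg (ennreal t * emeasure (N w) A) =
      eneg (NN p|(N w). f p + ennreal t * indicator A p) * (\<Prod>A\<in>J. indicator (E A) (emeasure (N w) A))"
     if "w \<in> space \<mu>" for w
    proof -
     have "(NN p|(N w). f p + ennreal t * indicator A p) = (NN p|(N w). f p) + ennreal t * emeasure (N w) A"
      using f A setsN[OF that]
      by (subst nn_integral_add) (auto simp: mN[OF that] nn_integral_cmult_indicator)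
     then show ?thesis by (simp add: h_def eneg_add mult_ac)
    qed
    have "(NN w|(density \<mu> h). eneg (ennreal t * emeasure (N w) A)) = (NN w|\<mu>. h w * eneg (ennreal t * emeasure (N w) A))"
     by (rule nn_integral_density) measurable
    also have "\<dots> = (NN w|\<mu>. eneg (NN p|(N w). f p + ennreal t * indicator A p) * (\<Prod>A\<in>J. indicator (E A) (emeasure (N w) A)))"
     by (intro nn_integral_cong ht)
    also have "\<dots> = (NN w|\<mu>'. eneg (NN p|(N w). f p + ennreal t * indicator A p) * (\<Prod>A\<in>J. indicator (E A) (emeasure (N w) A)))"
     using insert ft by simp
    also have "\<dots> = (NN w|\<mu>'. h w * eneg (ennreal t * emeasure (N w) A))"
     by (intro nn_integral_cong ht[symmetric]) (simp add: sp)
    also have "\<dots> = (NN w|(density \<mu>' h). eneg (ennreal t * emeasure (N w) A))"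
     by (rule nn_integral_density[symmetric]) measurable
    finally show "(NN w|(density \<mu> h). eneg (ennreal t * emeasure (N w) A)) = (NN w|(density \<mu>' h). eneg (ennreal t * emeasure (N w) A))" .
   qed (use sets vals A EA VA in auto)
   moreover have "(NN w|\<mu>''. eneg (NN p|(N w). f p) * (\<Prod>A\<in>insert A J. indicator (E A) (emeasure (N w) A))) =
     emeasure (density \<mu>'' h) {w\<in>space \<mu>. emeasure (N w) A \<in> E A}" if "\<mu>'' \<in> {\<mu>, \<mu>'}" for \<mu>''
   proof -
    have [measurable]: "h \<in> borel_measurable \<mu>''" "(\<lambda>w. emeasure (N w) A) \<in> borel_measurable \<mu>''" "E A \<in> sets borel"
     and sp'': "space \<mu>'' = space \<mu>"
     using that EA sp by auto
    have "emeasure (density \<mu>'' h) {w\<in>space \<mu>''. emeasure (N w) A \<in> E A} =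
      (NN w|\<mu>''. h w * indicator {w\<in>space \<mu>''. emeasure (N w) A \<in> E A} w)"
     by (rule emeasure_density) measurable
    also have "\<dots> = (NN w|\<mu>''. eneg (NN p|(N w). f p) * (\<Prod>A\<in>insert A J. indicator (E A) (emeasure (N w) A)))"
     using insert(1,2) by (intro nn_integral_cong) (simp add: h_def mult_ac indicator_def)
    finally show ?thesis by (simp add: sp'')
   qed
   ultimately show "(NN w|\<mu>. eneg (NN p|(N w). f p) * (\<Prod>A\<in>insert A J. indicator (E A) (emeasure (N w) A))) =
     (NN w|\<mu>'. eneg (NN p|(N w). f p) * (\<Prod>A\<in>insert A J. indicator (E A) (emeasure (N w) A)))"
    by simp
  qed
 qed
 define \<eta> where "\<eta> w = (\<lambda>A\<in>sets F. emeasure (N w) A)" for w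
 let ?P = "\<Pi>\<^sub>M A\<in>sets F. (borel :: ennreal measure)"
 have \<eta>: "\<eta> \<in> \<mu> \<rightarrow>\<^sub>M ?P" unfolding \<eta>_def by (intro measurable_restrict meas)
 have \<eta>': "\<eta> \<in> \<mu>' \<rightarrow>\<^sub>M ?P" using \<eta> sets by (simp cong: measurable_cong_sets)
 have "distr \<mu> ?P \<eta> = distr \<mu>' ?P \<eta>"
 proof (rule measure_eqI_PiM_infinite)
  show "finite_measure (distr \<mu> ?P \<eta>)" using \<eta> by (rule \<mu>.finite_measure_distr)
  fix E :: "'b set \<Rightarrow> ennreal set" and J assume J: "finite J" "J \<subseteq> sets F" "\<And>i. i \<in> J \<Longrightarrow> E i \<in> sets borel"
  have "emeasure (distr \<mu>'' ?P \<eta>) (prod_emb (sets F) (\<lambda>A. borel) J (Pi\<^sub>E J E)) =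
    (NN w|\<mu>''. eneg (NN p|(N w). 0) * (\<Prod>A\<in>J. indicator (E A) (emeasure (N w) A)))" if "\<mu>'' \<in> {\<mu>, \<mu>'}" for \<mu>''
  proof -
   have m: "\<eta> \<in> \<mu>'' \<rightarrow>\<^sub>M ?P" using that \<eta> \<eta>' by auto
   have s: "prod_emb (sets F) (\<lambda>A. borel) J (Pi\<^sub>E J E) \<in> sets ?P"
    using J by (intro sets_PiM_I) auto
   have "emeasure (distr \<mu>'' ?P \<eta>) (prod_emb (sets F) (\<lambda>A. borel) J (Pi\<^sub>E J E)) =
     emeasure \<mu>'' (\<eta> -` prod_emb (sets F) (\<lambda>A. borel) J (Pi\<^sub>E J E) \<inter> space \<mu>'')"
    by (rule emeasure_distr[OF m s])
   also have "\<dots> = (NN w|\<mu>''. indicator (\<eta> -` prod_emb (sets F) (\<lambda>A. borel) J (Pi\<^sub>E J E) \<inter> space \<mu>'') w)"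
    using measurable_sets[OF m s] by simp
   also have "\<dots> = (NN w|\<mu>''. eneg (NN p|(N w). 0) * (\<Prod>A\<in>J. indicator (E A) (emeasure (N w) A)))"
   proof (rule nn_integral_cong)
    fix w assume w: "w \<in> space \<mu>''"
    have "w \<in> \<eta> -` prod_emb (sets F) (\<lambda>A. borel) J (Pi\<^sub>E J E) \<longleftrightarrow> (\<forall>A\<in>J. emeasure (N w) A \<in> E A)"
     using J(2) by (auto simp: prod_emb_def \<eta>_def PiE_iff restrict_def extensional_def Pi_iff subset_iff)
    moreover have "(\<Prod>A\<in>J. indicator (E A) (emeasure (N w) A)) = (indicator {w. \<forall>A\<in>J. emeasure (N w) A \<in> E A} w :: ennreal)"
     using J(1) by (auto simp: indicator_def prod_zero_iff)
    ultimately show "indicator (\<eta> -` prod_emb (sets F) (\<lambda>A. borel) J (Pi\<^sub>E J E) \<inter> space \<mu>'') w =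
      eneg (NN p|(N w). 0) * (\<Prod>A\<in>J. indicator (E A) (emeasure (N w) A))"
     using w by (simp add: indicator_def)
   qed
   finally show ?thesis .
  qed
  then show "emeasure (distr \<mu> ?P \<eta>) (prod_emb (sets F) (\<lambda>A. borel) J (Pi\<^sub>E J E)) =
    emeasure (distr \<mu>' ?P \<eta>) (prod_emb (sets F) (\<lambda>A. borel) J (Pi\<^sub>E J E))"
   using bspec[OF cyl[of J E, OF J], of "\<lambda>_. 0"] by simp
 qed auto
 moreover obtain B where B: "B \<in> sets ?P" "W = \<eta> -` B \<inter> space \<mu>"
  using W \<eta> by (subst (asm) sets_vimage_algebra2) (auto simp: \<eta>_def[abs_def] dest: measurable_space)
 ultimately have "emeasure (distr \<mu> ?P \<eta>) B = emeasure (distr \<mu>' ?P \<eta>) B" by simp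
 then show ?thesis
  using B \<eta> \<eta>' by (simp add: emeasure_distr sp)
qed

section \<open>Poisson processes\<close>

lemma eneg_lt_1: "0 < c \<Longrightarrow> eneg c < 1"
proof (cases c)
 case (real r)
 assume "0 < c"
 with real have "0 < r" by simp
 with real show ?thesis by (simp add: eneg_ennreal ennreal_less_one_iff)
qed simp

text \<open>The Laplace transform of a Poisson variable, with \<open>c\<close> allowed to be
  infinite. For infinite intensity both sides are 0, except for \<open>c = 0\<close>, where both are
  1.\<close>

lemma (in prob_space) poisson_count_eneg:
 assumes N: "poisson_process M N F" and A: "A \<in> sets F"
 shows "(NN w|M. eneg (c * emeasure (N w) A)) = eneg ((1 - eneg c) * emeasure F A)"
  and "emeasure F A < \<infinity> \<Longrightarrow> AE w in M. \<exists>n. emeasure (N w) A = of_nat n"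
proof -
 have m [measurable]: "(\<lambda>w. emeasure (N w) A) \<in> borel_measurable M"
  using N A by (auto simp: poisson_process_def)
 have pr: "measure M {w\<in>space M. emeasure (N w) A = of_nat n} = exp (- measure F A) * measure F A ^ n / fact n"
  if "emeasure F A < \<infinity>" for n
  using N A that unfolding poisson_process_def by blast
 have expo: "(\<lambda>n. exp (- l) * (l * u) ^ n / fact n) sums (exp (- l) * exp (l * u))" for l u :: real
  using sums_mult[OF exp_converges[of "l * u"], of "exp (- l)"] by (simp add: divide_inverse mult_ac)
 show ae: "AE w in M. \<exists>n. emeasure (N w) A = of_nat n" if fin: "emeasure F A < \<infinity>"
 proof -
  have "(\<lambda>n. measure M {w\<in>space M. emeasure (N w) A = of_nat n}) sums measure M (\<Union>n. {w\<in>space M. emeasure (N w) A = of_nat n})"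
   by (intro finite_measure_UNION) (auto simp: disjoint_family_on_def)
  moreover have "(\<lambda>n. measure M {w\<in>space M. emeasure (N w) A = of_nat n}) sums 1"
   using expo[of "measure F A" 1] by (simp add: pr[OF fin] exp_minus)
  ultimately have "measure M (\<Union>n. {w\<in>space M. emeasure (N w) A = of_nat n}) = 1"
   by (rule sums_unique2)
  then have "AE w in M. w \<in> (\<Union>n. {w\<in>space M. emeasure (N w) A = of_nat n})"
   by (subst (asm) prob_eq_1) auto
  then show ?thesis by eventually_elim auto
 qed
 show "(NN w|M. eneg (c * emeasure (N w) A)) = eneg ((1 - eneg c) * emeasure F A)"
 proof (cases "c = 0")
  case True
  then show ?thesis by (simp add: emeasure_space_1)
 next
  case False
  then have c: "0 < c" by (simp add: zero_less_iff_neq_zero)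
  show ?thesis
  proof (cases "emeasure F A < \<infinity>")
   case True
   define l where "l = measure F A"
   have l: "emeasure F A = ennreal l" "0 \<le> l"
    using True by (auto simp: l_def measure_def less_top)
   define u where "u = enn2real (eneg c)"
   have u: "eneg c = ennreal u" "0 \<le> u" "u \<le> 1"
    using eneg_le_1[of c] by (auto simp: u_def enn2real_leI)
   have cn: "eneg (c * of_nat n) = ennreal (u ^ n)" for n
   proof (induction n)
    case (Suc n)
    have "c * of_nat (Suc n) = c + c * of_nat n" by (simp add: distrib_left)
    then show ?case using Suc u by (simp add: eneg_add ennreal_mult)
   qed simp
   have "(NN w|M. eneg (c * emeasure (N w) A)) =
     (\<Sum>n. eneg (c * of_nat n) * emeasure M {w\<in>space M. emeasure (N w) A = of_nat n})"
    using ae[OF True] c by (intro nn_integral_eneg_enat_valued) (auto simp: enat_valued_def)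
   also have "\<dots> = (\<Sum>n. ennreal (exp (- l) * (l * u) ^ n / fact n))"
    using u l by (intro suminf_cong)
     (simp add: cn emeasure_eq_measure pr[OF True] ennreal_mult[symmetric] l_def[symmetric] power_mult_distrib mult_ac)
   also have "\<dots> = ennreal (exp (- l) * exp (l * u))"
    using expo[of l u] u l by (subst suminf_ennreal2) (auto simp: sums_iff)
   also have "exp (- l) * exp (l * u) = exp (- ((1 - u) * l))"
    by (simp add: mult_exp_exp algebra_simps)
   also have "ennreal (exp (- ((1 - u) * l))) = eneg ((1 - eneg c) * emeasure F A)"
    using u l by (simp add: eneg_ennreal[symmetric] ennreal_mult ennreal_minus[symmetric])
   finally show ?thesis .
  next
   case False
   then have top: "emeasure F A = \<infinity>" by (simp add: less_top[symmetric])
   then have "AE w in M. emeasure (N w) A = \<infinity>"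
    using N A by (auto simp: poisson_process_def)
   then have "(NN w|M. eneg (c * emeasure (N w) A)) = (NN w|M. 0)"
   proof (intro nn_integral_cong_AE)
    assume "AE w in M. emeasure (N w) A = \<infinity>"
    then show "AE w in M. eneg (c * emeasure (N w) A) = 0"
     by eventually_elim (use c in \<open>simp add: ennreal_mult_top\<close>)
   qed
   moreover have "1 - eneg c > 0" using eneg_lt_1[OF c] by (simp add: diff_gr0_ennreal)
   ultimately show ?thesis using top by (simp add: ennreal_mult_top)
  qed
 qed
qed

text \<open>For a simple function the integral is a weighted sum of counts on disjoint level sets,
  so independence factors the transform. Increasing simple functions give the general case: the left
  side converges because its integrands are bounded by 1, the exponent on the right because it
  increases.\<close>

lemma (in prob_space) poisson_process_laplace:
 assumes N: "poisson_process M N F" and f: "f \<in> borel_measurable F"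
 shows "(NN w|M. eneg (NN p|(N w). f p)) = eneg (NN p|F. 1 - eneg (f p))"
proof -
 have setsN: "sets (N w) = sets F" if "w \<in> space M" for w
  using N that by (auto simp: poisson_process_def)
 have mA: "(\<lambda>w. emeasure (N w) A) \<in> borel_measurable M" if "A \<in> sets F" for A
  using N that by (auto simp: poisson_process_def)
 have mN: "borel_measurable (N w) = (borel_measurable F :: ('b \<Rightarrow> ennreal) set)" if "w \<in> space M" for w
  using setsN[OF that] by (intro measurable_cong_sets) auto
 have spN: "space (N w) = space F" if "w \<in> space M" for w
  using setsN[OF that] by (rule sets_eq_imp_space_eq)
 have simple: "(NN w|M. eneg (NN p|(N w). u p)) = eneg (NN p|F. 1 - eneg (u p))"
  if u: "simple_function F u" for u :: "'b \<Rightarrow> ennreal"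
 proof -
  have finY: "finite (u ` space F)" using u by (rule simple_functionD)
  then obtain y where y: "bij_betw y {0..<card (u ` space F)} (u ` space F)"
   using ex_bij_betw_nat_finite by blast
  define k where "k = card (u ` space F)"
  \<comment> \<open>The finitely many level sets are padded with empty sets, to match the sequences
    in \<open>poisson_process\<close>.\<close>
  define A where "A i = (if i < k then u -` {y i} \<inter> space F else {})" for i
  have A: "A i \<in> sets F" for i using simple_functionD(2)[OF u] by (simp add: A_def)
  have disj: "disjoint_family A"
   using y by (auto simp: disjoint_family_on_def A_def k_def bij_betw_def inj_on_def split: if_splits)
  have exi: "\<exists>i<k. p \<in> A i" if "p \<in> space F" for p
  proof -
   have "u p \<in> y ` {0..<k}" using y that by (auto simp: bij_betw_def k_def)
   then obtain i where "i < k" "u p = y i" by auto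
   with that show ?thesis by (auto simp: A_def)
  qed
  have rep: "g (u p) = (\<Sum>i<k. g (y i) * indicator (A i) p)" if "p \<in> space F" for g :: "ennreal \<Rightarrow> ennreal" and p
  proof -
   obtain i where i: "i < k" "p \<in> A i" using exi[OF \<open>p \<in> space F\<close>] by blast
   have "(\<Sum>j<k. g (y j) * indicator (A j) p) = (\<Sum>j\<in>{i}. g (y j) * indicator (A j) p)"
   proof (rule sum.mono_neutral_right)
    have "p \<notin> A j" if "j \<noteq> i" for j
     using disj i that by (auto simp: disjoint_family_on_def)
    then show "\<forall>j\<in>{..<k} - {i}. g (y j) * indicator (A j) p = 0" by simp
   qed (use i in auto)
   also have "\<dots> = g (u p)" using i by (auto simp: A_def)
   finally show ?thesis by simp
  qed
  have int: "(NN p|N'. g (u p)) = (\<Sum>i<k. g (y i) * emeasure N' (A i))"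
   if N': "sets N' = sets F" for g :: "ennreal \<Rightarrow> ennreal" and N' :: "'b measure"
  proof -
   have "(NN p|N'. g (u p)) = (NN p|N'. (\<Sum>i<k. g (y i) * indicator (A i) p))"
    using sets_eq_imp_space_eq[OF N'] by (intro nn_integral_cong rep) simp
   also have "\<dots> = (\<Sum>i<k. g (y i) * emeasure N' (A i))"
    using A N' by (subst nn_integral_sum) (auto simp: nn_integral_cmult_indicator)
   finally show ?thesis .
  qed
  have ind: "indep_vars (\<lambda>_. borel) (\<lambda>i w. emeasure (N w) (A i)) {..<k}"
  proof (rule indep_vars_subset)
   show "indep_vars (\<lambda>_. borel) (\<lambda>i w. emeasure (N w) (A i)) UNIV"
    using N A disj unfolding poisson_process_def by blast
  qed simp
  have "(NN w|M. eneg (NN p|(N w). u p)) = (NN w|M. (\<Prod>i<k. eneg (y i * emeasure (N w) (A i))))"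
   by (intro nn_integral_cong) (simp add: int[of _ "\<lambda>x. x"] setsN eneg_sum)
  also have "\<dots> = (\<Prod>i<k. NN w|M. eneg (y i * emeasure (N w) (A i)))"
  proof (rule indep_vars_nn_integral)
   show "indep_vars (\<lambda>_. borel) (\<lambda>i w. eneg (y i * emeasure (N w) (A i))) {..<k}"
    by (rule indep_vars_compose2[OF ind, where Y = "\<lambda>i z. eneg (y i * z)"]) measurable
  qed auto
  also have "\<dots> = (\<Prod>i<k. eneg ((1 - eneg (y i)) * emeasure F (A i)))"
   by (intro prod.cong refl poisson_count_eneg(1)[OF N A])
  also have "\<dots> = eneg (\<Sum>i<k. (1 - eneg (y i)) * emeasure F (A i))"
   by (simp add: eneg_sum)
  also have "\<dots> = eneg (NN p|F. 1 - eneg (u p))"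
   by (simp add: int[of F "\<lambda>z. 1 - eneg z"])
  finally show ?thesis .
 qed
 obtain U :: "nat \<Rightarrow> 'b \<Rightarrow> ennreal" where U: "\<And>i. simple_function F (U i)" "incseq U" "\<And>x. (SUP i. U i x) = f x"
  using borel_measurable_implies_simple_function_sequence'[OF f] by metis
 have Um: "U i \<in> borel_measurable F" for i using U(1) by (rule borel_measurable_simple_function)
 have lim1: "(\<lambda>i. NN p|(N w). U i p) \<longlonglongrightarrow> (NN p|(N w). f p)" if "w \<in> space M" for w
 proof -
  have "(NN p|(N w). f p) = (SUP i. NN p|(N w). U i p)"
   unfolding U(3)[symmetric] using U(2) Um that by (intro nn_integral_monotone_convergence_SUP) (simp_all add: mN)
  moreover have "incseq (\<lambda>i. NN p|(N w). U i p)"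
   using U(2) by (auto simp: incseq_def le_fun_def intro!: nn_integral_mono)
  ultimately show ?thesis by (simp add: LIMSEQ_SUP)
 qed
 have "(\<lambda>i. NN w|M. eneg (NN p|(N w). U i p)) \<longlonglongrightarrow> (NN w|M. eneg (NN p|(N w). f p))"
 proof (rule nn_integral_dominated_convergence)
  show "(\<lambda>w. eneg (NN p|(N w). U i p)) \<in> borel_measurable M" for i
   by (intro measurable_compose[OF measurable_nn_integral_kernel[OF setsN mA Um] measurable_eneg])
  show "(\<lambda>w. eneg (NN p|(N w). f p)) \<in> borel_measurable M"
   by (intro measurable_compose[OF measurable_nn_integral_kernel[OF setsN mA f] measurable_eneg])
  show "AE w in M. (\<lambda>i. eneg (NN p|(N w). U i p)) \<longlonglongrightarrow> eneg (NN p|(N w). f p)"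
   using lim1 by (intro AE_I2 tendsto_eneg)
  show "(\<lambda>_. 1) \<in> borel_measurable M" "(NN w|M. 1) < \<infinity>" by (auto simp: emeasure_space_1)
  show "AE w in M. eneg (NN p|(N w). U i p) \<le> 1" for i by simp
 qed
 moreover have "(\<lambda>i. NN p|F. 1 - eneg (U i p)) \<longlonglongrightarrow> (NN p|F. 1 - eneg (f p))"
 proof (rule nn_integral_LIMSEQ)
  show "incseq (\<lambda>i p. 1 - eneg (U i p))"
   using U(2) by (auto simp: incseq_def le_fun_def intro!: ennreal_minus_mono eneg_mono)
  show "(\<lambda>p. 1 - eneg (U i p)) \<in> borel_measurable F" for i using Um[of i] by measurable
  show "(\<lambda>i. 1 - eneg (U i p)) \<longlonglongrightarrow> 1 - eneg (f p)" for p
  proof -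
   have "(\<lambda>i. U i p) \<longlonglongrightarrow> f p"
    unfolding U(3)[symmetric] using U(2) by (intro LIMSEQ_SUP) (auto simp: incseq_def le_fun_def)
   then show ?thesis by (intro tendsto_diff_ennreal tendsto_eneg tendsto_const) auto
  qed
 qed
 then have "(\<lambda>i. eneg (NN p|F. 1 - eneg (U i p))) \<longlonglongrightarrow> eneg (NN p|F. 1 - eneg (f p))"
  by (rule tendsto_eneg)
 ultimately show ?thesis
  unfolding simple[OF U(1)] by (rule LIMSEQ_unique)
qed

lemma sigma_nn_integral_process:
 fixes N :: "'w \<Rightarrow> 'b measure"
 assumes "\<And>w. w \<in> space M \<Longrightarrow> sets (N w) = sets F"
  and "f \<in> borel_measurable F"
 shows "(\<lambda>w. NN p|(N w). f p) \<in>
  borel_measurable (process_sigma M N F)"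
proof (rule measurable_nn_integral_kernel[where F = F])
 fix A assume A: "A \<in> sets F"
 have "(\<lambda>w. \<lambda>A\<in>sets F. emeasure (N w) A) \<in>
   process_sigma M N F \<rightarrow>\<^sub>M (\<Pi>\<^sub>M A\<in>sets F. borel)"
  by (rule measurable_vimage_algebra1) (auto simp: space_PiM)
 from measurable_compose[OF this measurable_component_singleton[OF A]] A
 show "(\<lambda>w. emeasure (N w) A) \<in> borel_measurable (process_sigma M N F)"
  by simp
qed (use assms in auto)

section \<open>Simplicity of the Poisson process and its recovery from the signed measure\<close>

lemma cell_code_Suc: "cell V (Suc n) (code V (Suc n) s) \<subseteq> cell V n (code V n s)"
 by (rule subsetI, unfold in_cell_iff, rule code_mono[of n "Suc n"]) simp_all

text \<open>These sets increase to the nonzero reals and have finite weight measure, so they are the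
  windows in which the points of an infinite process are counted.\<close>

definition away :: "nat \<Rightarrow> real set" where
 "away p = {x. 1 / Suc p \<le> \<bar>x\<bar>}"

lemma away_sets [measurable, simp]: "away p \<in> sets borel"
 unfolding away_def by (intro borel_closed closed_Collect_le continuous_intros)

lemma away_nonzero: "away p \<subseteq> - {0}"
 by (auto simp: away_def)

lemma away_mono: "p \<le> q \<Longrightarrow> away p \<subseteq> away q"
 unfolding away_def by (auto elim!: order_trans[rotated] intro!: divide_left_mono)

lemma in_away: "x \<noteq> 0 \<Longrightarrow> \<exists>p. x \<in> away p"
 using nat_approx_posE[of "\<bar>x\<bar>"] by (auto simp: away_def intro: less_imp_le)

lemma pair_nonzero_setsI:
 "A \<in> sets borel \<Longrightarrow> B \<in> sets borel \<Longrightarrow> B \<subseteq> - {0} \<Longrightarrow> A \<times> B \<in> sets point_borel"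
 by (intro pair_measureI) (auto simp: sets_nonzero_borel)

text \<open>Almost every point \<open>(s, x)\<close> lies in no null cell, so that all cells around it have mass at least
 one, and, the ground process being simple, eventually mass exactly one.\<close>

lemma simple_point_measure:
 fixes N :: "('a::{metric_space, second_countable_topology} \<times> real) measure"
 assumes sets: "sets N = sets point_borel"
  and int: "\<And>n I I' p. \<exists>k. emeasure N (cell base_seq n I \<times> (away p \<inter> cell base_seq n I')) = of_nat k"
  and simple: "\<And>p. \<exists>n. \<forall>I. emeasure N (cell base_seq n I \<times> away p) \<le> 1"
  and S: "S \<in> sets borel" "emeasure N (S \<times> - {0}) = 0"
  and \<theta>: "\<And>s. s \<notin> S \<Longrightarrow> \<theta> s = (\<integral>p. indicator {s} (fst p) * snd p \<partial>N)"
  and A: "A \<in> sets N"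
 shows "emeasure N A = emeasure (count_space UNIV) {s. s \<notin> S \<and> (s, \<theta> s) \<in> A}"
proof -
 have sp: "space N = UNIV \<times> - {0}"
  using sets_eq_imp_space_eq[OF sets] by (simp add: space_pair_measure)
 have rect: "C \<times> B \<in> sets N" if "C \<in> sets borel" "B \<in> sets borel" "B \<subseteq> - {0}" for C and B :: "real set"
  using that unfolding sets by (rule pair_nonzero_setsI)
 have cells: "cell base_seq n I \<times> (away p \<inter> cell base_seq n I') \<in> sets N" for n I p I'
  using away_nonzero[of p] by (intro rect) auto
 have single: "{(s, x)} \<in> sets N" if "x \<noteq> 0" for s x
  using rect[of "{s}" "{x}"] that by simp
 \<comment> \<open>\<open>good s x\<close> says that \<open>N\<close> restricted to the fibre over
   \<open>s\<close> is a unit mass at \<open>(s, x)\<close>.\<close>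
 define good where "good s x \<longleftrightarrow> x \<noteq> 0 \<and> emeasure N {(s, x)} = 1 \<and> emeasure N ({s} \<times> - {0} - {(s, x)}) = 0" for s x
 \<comment> \<open>There are only countably many cells, so almost every point avoids all those of
   measure zero at once.\<close>
 have "AE q in N. \<forall>n p. \<forall>I\<in>Pow {..<n}. \<forall>I'\<in>Pow {..<n}. emeasure N (cell base_seq n I \<times> (away p \<inter> cell base_seq n I')) = 0 \<longrightarrow>
   q \<notin> cell base_seq n I \<times> (away p \<inter> cell base_seq n I')"
  unfolding AE_all_countable
 proof (intro allI AE_ball_countable' AE_impI)
  fix n p I I'
  assume "emeasure N (cell base_seq n I \<times> (away p \<inter> cell base_seq n I')) = 0"
  then have "cell base_seq n I \<times> (away p \<inter> cell base_seq n I') \<in> null_sets N"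
   using cells by (auto simp: null_sets_def)
  then show "AE q in N. q \<notin> cell base_seq n I \<times> (away p \<inter> cell base_seq n I')"
   by (rule AE_not_in)
 qed (auto simp: countable_finite)
 then have AE_good: "AE q in N. good (fst q) (snd q)"
  using AE_space
 proof eventually_elim
  case (elim q)
  obtain s x where q: "q = (s, x)" by (cases q)
  have x: "x \<noteq> 0" using elim(2) by (simp add: q sp)
  then obtain p0 where p0: "x \<in> away p0" using in_away by blast
  define c :: "nat \<Rightarrow> nat \<Rightarrow> ('a \<times> real) set" where "c p n = cell base_seq n (code base_seq n s) \<times> (away p \<inter> cell base_seq n (code base_seq n x))" for p n
  have c_sets: "c p n \<in> sets N" for p n unfolding c_def by (rule cells)
  have qc: "(s, x) \<in> c p n" if "p0 \<le> p" for p n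
   using p0 away_mono[OF that] by (auto simp: c_def in_cell_iff)
  have ge1: "1 \<le> emeasure N (c p n)" if "p0 \<le> p" for p n
  proof -
   have "emeasure N (c p n) \<noteq> 0"
    using bspec[OF bspec[OF spec[OF spec[OF elim(1), of n], of p], OF code_in_Pow], OF code_in_Pow, of base_seq s base_seq x]
     qc[OF that, of n] unfolding c_def q by blast
   moreover obtain k where k: "emeasure N (c p n) = of_nat k" using int unfolding c_def by blast
   ultimately have "1 \<le> k" by (cases k) auto
   then show ?thesis unfolding k by (metis of_nat_1 of_nat_le_iff)
  qed
  have upper: "emeasure N ({s} \<times> away p) \<le> 1" for p
  proof -
   obtain n where "emeasure N (cell base_seq n (code base_seq n s) \<times> away p) \<le> 1" using simple by blast
   moreover have "emeasure N ({s} \<times> away p) \<le> emeasure N (cell base_seq n (code base_seq n s) \<times> away p)"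
    using away_nonzero[of p] by (intro emeasure_mono rect) (auto simp: in_cell_iff)
   ultimately show ?thesis by simp
  qed
  have "(\<Inter>n. c p0 n) = {(s, x)}"
  proof -
   have "s' = s" "x' = x" if "\<forall>n. (s', x') \<in> c p0 n" for s' x'
    using that by (auto simp: c_def in_cell_iff intro!: code_base_seq_eqD)
   with qc[of p0] show ?thesis by auto
  qed
  moreover obtain n0 where n0: "emeasure N (c p0 n0) < \<infinity>"
  proof -
   obtain k where "emeasure N (c p0 0) = of_nat k" using int unfolding c_def by blast
   then show ?thesis using that[of 0] by (simp add: of_nat_less_top)
  qed
  have cdec: "decseq (c p0)"
  proof (rule decseq_SucI)
   fix n
   have "cell base_seq (Suc n) (code base_seq (Suc n) s) \<subseteq> (cell base_seq n (code base_seq n s) :: 'a set)"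
    by (rule cell_code_Suc)
   moreover have "cell base_seq (Suc n) (code base_seq (Suc n) x) \<subseteq> (cell base_seq n (code base_seq n x) :: real set)"
    by (rule cell_code_Suc)
   ultimately show "c p0 (Suc n) \<le> c p0 n" by (auto simp: c_def)
  qed
  have "(INF n. emeasure N (c p0 n)) = emeasure N (\<Inter>n. c p0 n)"
  proof (rule INF_emeasure_decseq)
   show "range (c p0) \<subseteq> sets N" using c_sets by auto
   show "emeasure N (c p0 n) \<noteq> \<infinity>" for n
   proof -
    obtain k where "emeasure N (c p0 n) = of_nat k" using int unfolding c_def by blast
    then show ?thesis by simp
   qed
  qed (rule cdec)
  ultimately have lower: "1 \<le> emeasure N {(s, x)}"
   using ge1[of p0] by (metis INF_greatest order_refl)
  have one: "emeasure N {(s, x)} = 1"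
  proof (rule antisym[OF _ lower])
   have "emeasure N {(s, x)} \<le> emeasure N ({s} \<times> away p0)"
    using p0 away_nonzero[of p0] by (intro emeasure_mono rect) auto
   with upper[of p0] show "emeasure N {(s, x)} \<le> 1" by simp
  qed
  have zero: "emeasure N ({s} \<times> away p - {(s, x)}) = 0" if "p0 \<le> p" for p
  proof -
   have sub: "{(s, x)} \<subseteq> {s} \<times> away p" using p0 away_mono[OF that] by auto
   have "emeasure N ({s} \<times> away p - {(s, x)}) = emeasure N ({s} \<times> away p) - emeasure N {(s, x)}"
    using one sub away_nonzero[of p] by (intro emeasure_Diff rect single x) auto
   with upper[of p] one show ?thesis
    by (simp add: diff_eq_0_iff_ennreal order_le_less_trans[OF upper])
  qed
  have "{s} \<times> - {0} - {(s, x)} = (\<Union>p\<in>{p0..}. {s} \<times> away p - {(s, x)})"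
  proof (intro equalityI subsetI)
   fix r assume r: "r \<in> {s} \<times> - {0} - {(s, x)}"
   then have "snd r \<noteq> 0" by auto
   then obtain p where "snd r \<in> away p" using in_away by blast
   then have "snd r \<in> away (max p p0)" using away_mono[of p "max p p0"] by auto
   with r show "r \<in> (\<Union>p\<in>{p0..}. {s} \<times> away p - {(s, x)})" by (auto intro!: bexI[of _ "max p p0"])
  qed (use away_nonzero in auto)
  moreover have "(\<Union>p\<in>{p0..}. {s} \<times> away p - {(s, x)}) \<in> null_sets N"
   using zero away_nonzero single[OF x]
   by (intro null_sets_UN') (auto simp: null_sets_def intro!: sets.Diff rect)
  ultimately have "emeasure N ({s} \<times> - {0} - {(s, x)}) = 0" by (simp add: null_setsD1)
  with one x show ?case by (simp add: good_def q)
 qed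
 have good_\<theta>: "\<theta> s = x" if "good s x" "s \<notin> S" for s x
 proof -
  from that have x: "x \<noteq> 0" and one: "emeasure N {(s, x)} = 1" and zero: "emeasure N ({s} \<times> - {0} - {(s, x)}) = 0"
   by (auto simp: good_def)
  have "{s} \<times> - {0} - {(s, x)} \<in> null_sets N"
   using zero x by (auto simp: null_sets_def intro!: sets.Diff rect single)
  from AE_not_in[OF this] have ae: "AE q in N. indicator {s} (fst q) * snd q = indicator {(s, x)} q * x"
   using AE_space by eventually_elim (auto simp: indicator_def sp split: if_splits)
  have "(\<integral>q. indicator {s} (fst q) * snd q \<partial>N) = (\<integral>q. indicator {(s, x)} q * x \<partial>N)"
  proof (rule integral_cong_AE)
   have "(\<lambda>q. indicator {s} (fst q) * snd q) \<in> borel_measurable ((borel :: 'a measure) \<Otimes>\<^sub>M nonzero_borel)"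
    by (intro measurable_pair_nonzero_borel) measurable
   then show "(\<lambda>q. indicator {s} (fst q) * snd q) \<in> borel_measurable N"
    using sets by (simp cong: measurable_cong_sets)
   show "(\<lambda>q. indicator {(s, x)} q * x) \<in> borel_measurable N"
    using single[OF x, of s] by simp
  qed (rule ae)
  also have "\<dots> = x"
   using one single[OF x, of s] by (simp add: measure_def)
  finally show ?thesis using \<theta>[OF that(2)] by simp
 qed
 have AE_S: "AE q in N. fst q \<notin> S"
 proof -
  have "S \<times> - {0} \<in> null_sets N" using S by (auto simp: null_sets_def intro!: rect)
  from AE_not_in[OF this] show ?thesis
   using AE_space by eventually_elim (auto simp: sp)
 qed
 \<comment> \<open>The graph of the nonzero values of \<open>\<theta>\<close> off \<open>S\<close>.
   \<open>N\<close> is concentrated on it and gives unit mass to each of its points; it has finitely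
   many points in each window, hence is countable, and \<open>N\<close> is the counting measure on
   it.\<close>
 define Gr where "Gr = {(s, \<theta> s) | s. s \<notin> S \<and> \<theta> s \<noteq> 0}"
 have AE_Gr: "AE q in N. q \<in> Gr"
  using AE_good AE_S
 proof eventually_elim
  case (elim q)
  with good_\<theta>[OF elim] show ?case by (cases q) (auto simp: Gr_def good_def)
 qed
 have Gr_one: "emeasure N {q} = 1" if "q \<in> Gr" for q
 proof -
  from that obtain s where q: "q = (s, \<theta> s)" and s: "s \<notin> S" "\<theta> s \<noteq> 0" by (auto simp: Gr_def)
  \<comment> \<open>Otherwise \<open>N\<close> would not charge the fibre over \<open>s\<close>, and
    the integral that defines \<open>\<theta> s\<close> would be 0.\<close>
  have "\<exists>x. good s x"
  proof (rule ccontr)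
   assume no: "\<nexists>x. good s x"
   have "AE q in N. indicator {s} (fst q) * snd q = 0"
    using AE_good by eventually_elim (use no in \<open>auto simp: indicator_def\<close>)
   then have "(\<integral>q. indicator {s} (fst q) * snd q \<partial>N) = 0" by (rule integral_eq_zero_AE)
   with \<theta>[OF s(1)] s(2) show False by simp
  qed
  then obtain x where "good s x" by blast
  with good_\<theta>[OF this s(1)] show ?thesis by (simp add: q good_def)
 qed
 have Gr_single: "{q} \<in> sets N" if "q \<in> Gr" for q
  using that by (auto simp: Gr_def intro!: single)
 have finGr: "finite (Gr \<inter> (UNIV \<times> away p))" for p
 proof -
  obtain n where n: "\<And>I. emeasure N (cell base_seq n I \<times> away p) \<le> 1" using simple by blast
  have "UNIV \<times> away p = (\<Union>I\<in>Pow {..<n}. (cell base_seq n I :: 'a set) \<times> away p)"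
   using code_in_Pow[of base_seq n] by (auto simp: in_cell_iff) blast
  then have "emeasure N (UNIV \<times> away p) \<le> (\<Sum>I\<in>Pow {..<n}. emeasure N ((cell base_seq n I :: 'a set) \<times> away p))"
   using away_nonzero[of p] by (simp only:) (intro emeasure_subadditive_finite; auto intro!: rect)
  also have "\<dots> \<le> of_nat (card (Pow {..<n}))"
   using sum_bounded_above[of "Pow {..<n}" "\<lambda>I. emeasure N ((cell base_seq n I :: 'a set) \<times> away p)" 1] n by simp
  finally have bnd: "emeasure N (UNIV \<times> away p) \<le> of_nat (card (Pow {..<n}))" .
  have "finite (Gr \<inter> (UNIV \<times> away p)) \<and> card (Gr \<inter> (UNIV \<times> away p)) \<le> card (Pow {..<n})"
  proof (rule finite_if_finite_subsets_card_bdd)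
   fix X assume X: "X \<subseteq> Gr \<inter> (UNIV \<times> away p)" "finite X"
   have "emeasure N X = (\<Sum>q\<in>X. emeasure N {q})"
    using X Gr_single by (intro emeasure_eq_sum_singleton) auto
   also have "\<dots> = (\<Sum>q\<in>X. 1)"
    using X(1) by (intro sum.cong refl Gr_one) blast
   also have "\<dots> = of_nat (card X)" by simp
   finally have "of_nat (card X) = emeasure N X" by simp
   also have "\<dots> \<le> emeasure N (UNIV \<times> away p)"
    using X away_nonzero[of p] by (intro emeasure_mono rect) auto
   also note bnd
   finally show "card X \<le> card (Pow {..<n})" by simp
  qed
  then show ?thesis by blast
 qed
 have "Gr = (\<Union>p. Gr \<inter> (UNIV \<times> away p))"
  using in_away by (auto simp: Gr_def)
 moreover have "countable (\<Union>p. Gr \<inter> (UNIV \<times> away p))"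
  by (rule countable_UN) (auto intro: countable_finite finGr)
 ultimately have cGr: "countable Gr" by (simp only:)
 have cAGr: "countable (A \<inter> Gr)" using cGr by (rule countable_Int2)
 have Gr_sets: "A \<inter> Gr \<in> sets N"
  by (rule sets.countable[OF _ cAGr]) (simp add: Gr_single)
 have "emeasure N A = emeasure N (A \<inter> Gr)"
  using AE_Gr A Gr_sets by (intro emeasure_eq_AE) auto
 also have "\<dots> = (NN q|(count_space (A \<inter> Gr)). emeasure N {q})"
  by (rule emeasure_countable_singleton[OF _ cAGr]) (simp add: Gr_single)
 also have "\<dots> = (NN q|(count_space (A \<inter> Gr)). 1)"
  by (intro nn_integral_cong) (simp add: Gr_one)
 also have "\<dots> = (NN s|(count_space {s. s \<notin> S \<and> (s, \<theta> s) \<in> A}). 1)"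
 proof (rule nn_integral_bij_count_space[symmetric])
  have "A \<subseteq> UNIV \<times> - {0}" using sets.sets_into_space[OF A] by (simp add: sp)
  then show "bij_betw (\<lambda>s. (s, \<theta> s)) {s. s \<notin> S \<and> (s, \<theta> s) \<in> A} (A \<inter> Gr)"
   by (auto simp: bij_betw_def inj_on_def Gr_def image_iff)
 qed
 also have "\<dots> = emeasure (count_space UNIV) {s. s \<notin> S \<and> (s, \<theta> s) \<in> A}"
  by (simp, subst (1 2) emeasure_count_space) auto
 finally show ?thesis .
qed

lemma cell_empty: "I \<notin> Pow {..<n} \<Longrightarrow> cell V n I = {}"
 using code_in_Pow[of V n] by (auto simp: cell_def)

lemma (in prob_space) AE_poisson_null:
 assumes N: "poisson_process M N F" and A: "A \<in> sets F" "emeasure F A = 0"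
 shows "AE w in M. emeasure (N w) A = 0"
proof -
 have [measurable]: "(\<lambda>w. emeasure (N w) A) \<in> borel_measurable M"
  using N A by (auto simp: poisson_process_def)
 have "emeasure F A < \<infinity>" using A by simp
 then have "measure M {w\<in>space M. emeasure (N w) A = of_nat 0} = exp (- measure F A) * measure F A ^ 0 / fact 0"
  using N A(1) unfolding poisson_process_def by blast
 then have "prob {w\<in>space M. emeasure (N w) A = 0} = 1" using A by (simp add: measure_def)
 then have "AE w in M. w \<in> {w\<in>space M. emeasure (N w) A = 0}" by (subst (asm) prob_eq_1) auto
 then show ?thesis by eventually_elim auto
qed

text \<open>With \<open>l\<close> the intensity of \<open>A\<close>, the probability is at most
  \<open>1 - exp (- l) * (1 + l)\<close>, and \<open>exp (- l) \<ge> 1 - l\<close> turns this into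
  the bound \<open>l\<^sup>2\<close>.\<close>

lemma (in prob_space) prob_poisson_gt_1:
 assumes N: "poisson_process M N F" and A: "A \<in> sets F" "emeasure F A < \<infinity>"
 shows "prob {w\<in>space M. 1 < emeasure (N w) A} \<le> (measure F A)\<^sup>2"
proof -
 define l where "l = measure F A"
 have l: "0 \<le> l" by (simp add: l_def)
 have [measurable]: "(\<lambda>w. emeasure (N w) A) \<in> borel_measurable M"
  using N A by (auto simp: poisson_process_def)
 have pr: "measure M {w\<in>space M. emeasure (N w) A = of_nat n} = exp (- l) * l ^ n / fact n" for n
  using N A unfolding poisson_process_def l_def by blast
 have "prob {w\<in>space M. 1 < emeasure (N w) A} \<le>
   prob (space M - ({w\<in>space M. emeasure (N w) A = of_nat 0} \<union> {w\<in>space M. emeasure (N w) A = of_nat 1}))"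
  by (intro finite_measure_mono) auto
 also have "\<dots> = 1 - prob ({w\<in>space M. emeasure (N w) A = of_nat 0} \<union> {w\<in>space M. emeasure (N w) A = of_nat 1})"
  by (intro prob_compl) auto
 also have "prob ({w\<in>space M. emeasure (N w) A = of_nat 0} \<union> {w\<in>space M. emeasure (N w) A = of_nat 1}) =
   exp (- l) * l ^ 0 / fact 0 + exp (- l) * l ^ 1 / fact 1"
  unfolding pr[symmetric] by (intro finite_measure_Union) auto
 also have "1 - (exp (- l) * l ^ 0 / fact 0 + exp (- l) * l ^ 1 / fact 1) \<le> l\<^sup>2"
 proof -
  have "(1 - l) * (1 + l) \<le> exp (- l) * (1 + l)"
   using exp_ge_add_one_self[of "- l"] l by (intro mult_right_mono) auto
  then show ?thesis by (simp add: algebra_simps power2_eq_square)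
 qed
 finally show ?thesis by (simp add: l_def)
qed

text \<open>The probability that some cell of level \<open>n\<close> contains two points is at most
  a constant times the sum of the squared \<open>G\<close>-masses of the cells. That sum is the
  integral of the mass of the cell around \<open>s\<close>, which tends to 0 because
  \<open>G\<close> has no atoms.\<close>

lemma (in prob_space) AE_poisson_simple:
 fixes N :: "'a \<Rightarrow> ('b::{metric_space, second_countable_topology} \<times> real) measure"
 assumes N: "poisson_process M N (G \<Otimes>\<^sub>M \<nu>)"
  and G: "sets G = sets borel" "prob_space G" "\<And>s. emeasure G {s} = 0"
  and \<nu>: "sets \<nu> = sets nonzero_borel" "sigma_finite_measure \<nu>" "emeasure \<nu> (away p) < \<infinity>"
 shows "AE w in M. \<exists>n. \<forall>I. emeasure (N w) (cell base_seq n I \<times> away p) \<le> 1"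
proof -
 interpret G: prob_space G by fact
 interpret \<nu>: sigma_finite_measure \<nu> by fact
 have sF: "sets (G \<Otimes>\<^sub>M \<nu>) = sets point_borel" using G \<nu> by (intro sets_pair_measure_cong) auto
 have rect: "cell base_seq n I \<times> away p \<in> sets (G \<Otimes>\<^sub>M \<nu>)" for n I
  unfolding sF using away_nonzero[of p] by (intro pair_nonzero_setsI) auto
 have [measurable]: "(\<lambda>w. emeasure (N w) (cell base_seq n I \<times> away p)) \<in> borel_measurable M" for n I
  using N rect by (auto simp: poisson_process_def)
 define r where "r = measure \<nu> (away p)"
 have r: "emeasure \<nu> (away p) = ennreal r" using \<nu>(3) by (simp add: r_def measure_def less_top)
 have em: "emeasure (G \<Otimes>\<^sub>M \<nu>) (cell base_seq n I \<times> away p) = ennreal (measure G (cell base_seq n I) * r)" for n I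
  using G \<nu> away_nonzero[of p]
  by (subst \<nu>.emeasure_pair_measure_Times) (auto simp: sets_nonzero_borel r G.emeasure_eq_measure ennreal_mult r_def)
 define bad where "bad n = {w\<in>space M. \<exists>I\<in>Pow {..<n}. 1 < emeasure (N w) (cell base_seq n I \<times> away p)}" for n
 have bad_sets: "bad n \<in> events" for n
  unfolding bad_def by (intro sets.sets_Collect_finite_Ex) auto
 \<comment> \<open>The integral of \<open>g n\<close> with respect to \<open>G\<close> is the sum of
   the squared cell masses, and \<open>g n\<close> tends to 0 pointwise.\<close>
 define g where "g n s = measure G (cell base_seq n (code base_seq n s))" for n and s :: 'b
 have gI: "g n s = (\<Sum>I\<in>Pow {..<n}. measure G (cell base_seq n I) * indicator (cell base_seq n I) s)" for n s
 proof -
  have "(\<Sum>I\<in>Pow {..<n}. measure G (cell base_seq n I) * indicator (cell base_seq n I) s) =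
   (\<Sum>I\<in>{code base_seq n s}. measure G (cell base_seq n I) * indicator (cell base_seq n I) s)"
   using code_in_Pow[of base_seq n s] by (intro sum.mono_neutral_right) (auto simp: in_cell_iff indicator_def)
  then show ?thesis by (simp add: g_def in_cell_iff)
 qed
 have cG [measurable]: "cell base_seq n I \<in> sets G" for n I using G by simp
 have g_meas: "g n \<in> borel_measurable G" for n
  unfolding gI[abs_def] by measurable
 have g_int: "(\<integral>s. g n s \<partial>G) = (\<Sum>I\<in>Pow {..<n}. (measure G (cell base_seq n I))\<^sup>2)" for n
  unfolding gI by (subst Bochner_Integration.integral_sum)
   (auto simp: power2_eq_square G.emeasure_finite less_top[symmetric])
 have prob_bad: "prob (bad n) \<le> (\<integral>s. g n s \<partial>G) * r\<^sup>2" for n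
 proof -
  have "bad n = (\<Union>I\<in>Pow {..<n}. {w\<in>space M. 1 < emeasure (N w) (cell base_seq n I \<times> away p)})"
   by (auto simp: bad_def)
  then have "prob (bad n) \<le> (\<Sum>I\<in>Pow {..<n}. prob {w\<in>space M. 1 < emeasure (N w) (cell base_seq n I \<times> away p)})"
   by (simp only:) (intro finite_measure_subadditive_finite; auto)
  also have "\<dots> \<le> (\<Sum>I\<in>Pow {..<n}. (measure (G \<Otimes>\<^sub>M \<nu>) (cell base_seq n I \<times> away p))\<^sup>2)"
   by (intro sum_mono prob_poisson_gt_1[OF N rect]) (simp add: em)
  also have "\<dots> = (\<Sum>I\<in>Pow {..<n}. (measure G (cell base_seq n I))\<^sup>2 * r\<^sup>2)"
   by (intro sum.cong refl) (simp add: measure_def[of "G \<Otimes>\<^sub>M \<nu>"] em power_mult_distrib r_def)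
  also have "\<dots> = (\<integral>s. g n s \<partial>G) * r\<^sup>2" by (simp add: g_int sum_distrib_right)
  finally show ?thesis .
 qed
 have "(\<lambda>n. \<integral>s. g n s \<partial>G) \<longlonglongrightarrow> (\<integral>s. 0 \<partial>G)"
 proof (rule integral_dominated_convergence)
  show "AE s in G. (\<lambda>n. g n s) \<longlonglongrightarrow> 0"
  proof (rule AE_I2)
   fix s :: 'b
   have "decseq (\<lambda>n. cell base_seq n (code base_seq n s) :: 'b set)"
    by (rule decseq_SucI) (rule cell_code_Suc)
   then have "(\<lambda>n. measure G (cell base_seq n (code base_seq n s))) \<longlonglongrightarrow> measure G (\<Inter>n. cell base_seq n (code base_seq n s))"
    by (intro G.finite_Lim_measure_decseq) auto
   moreover have "(\<Inter>n. cell base_seq n (code base_seq n s)) = ({s} :: 'b set)"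
    by (auto simp: in_cell_iff intro!: code_base_seq_eqD)
   ultimately show "(\<lambda>n. g n s) \<longlonglongrightarrow> 0" by (simp add: g_def measure_def G(3))
  qed
  show "integrable G (\<lambda>_. 1)" by simp
  show "AE s in G. norm (g n s) \<le> 1" for n by (simp add: g_def G.prob_le_1)
 qed (use g_meas in auto)
 then have "(\<lambda>n. (\<integral>s. g n s \<partial>G) * r\<^sup>2) \<longlonglongrightarrow> 0 * r\<^sup>2" by (intro tendsto_mult tendsto_const) simp
 then have lim: "(\<lambda>n. (\<integral>s. g n s \<partial>G) * r\<^sup>2) \<longlonglongrightarrow> 0" by simp
 have "prob (\<Inter>n. bad n) \<le> 0"
 proof (rule LIMSEQ_le_const[OF lim], intro exI allI impI)
  fix n
  have "prob (\<Inter>n. bad n) \<le> prob (bad n)" by (intro finite_measure_mono bad_sets) auto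
  with prob_bad[of n] show "prob (\<Inter>n. bad n) \<le> (\<integral>s. g n s \<partial>G) * r\<^sup>2" by simp
 qed
 then have "prob (\<Inter>n. bad n) = 0" by (rule antisym[OF _ measure_nonneg])
 then have "(\<Inter>n. bad n) \<in> null_sets M"
  using bad_sets
  by (auto simp: null_sets_def emeasure_eq_measure intro!: sets.countable_INT)
 from AE_not_in[OF this] show ?thesis
  using AE_space
 proof eventually_elim
  case (elim w)
  then obtain n where n: "\<forall>I\<in>Pow {..<n}. \<not> 1 < emeasure (N w) (cell base_seq n I \<times> away p)" by (auto simp: bad_def)
  have "emeasure (N w) (cell base_seq n I \<times> away p) \<le> 1" for I
   using n cell_empty[of I n "base_seq :: nat \<Rightarrow> 'b set"] by (cases "I \<in> Pow {..<n}") (auto simp: not_less)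
  then show ?case by blast
 qed
qed

text \<open>The Poisson process is only asserted to exist in the representation. As its points
  almost surely have different locations, none of them in \<open>S\<close>, the weights of
  \<open>\<Theta>\<close> off \<open>S\<close> determine it.\<close>

lemma (in prob_space) poisson_process_eq_atom_process:
 fixes N :: "'a \<Rightarrow> ('b::{metric_space, second_countable_topology} \<times> real) measure"
 assumes N: "poisson_process M N (G \<Otimes>\<^sub>M \<nu>)"
  and G: "sets G = sets borel" "prob_space G" "\<And>s. emeasure G {s} = 0"
  and \<nu>: "sets \<nu> = sets nonzero_borel" "sigma_finite_measure \<nu>" "\<And>p. emeasure \<nu> (away p) < \<infinity>"
  and S: "finite S"
  and \<Theta>: "AE w in M. \<forall>s. s \<notin> S \<longrightarrow> \<Theta> w {s} = (\<integral>p. indicator {s} (fst p) * snd p \<partial>N w)"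
 shows "AE w in M. N w = density (atom_process (\<Theta> w)) (indicator ((- S) \<times> UNIV))"
  and "AE w in M. emeasure (N w) (S \<times> - {0}) = 0"
proof -
 interpret G: prob_space G by fact
 interpret \<nu>: sigma_finite_measure \<nu> by fact
 have sF: "sets (G \<Otimes>\<^sub>M \<nu>) = sets point_borel" using G \<nu> by (intro sets_pair_measure_cong) auto
 have setsN: "sets (N w) = sets point_borel" if "w \<in> space M" for w
  using N that sF by (auto simp: poisson_process_def)
 have S_borel: "S \<in> sets borel" using S by (intro borel_closed finite_imp_closed)
 have S_sets: "S \<times> - {0} \<in> sets (G \<Otimes>\<^sub>M \<nu>)"
  unfolding sF using S_borel by (intro pair_nonzero_setsI) auto
 have "emeasure G S = 0"
  using S G by (subst emeasure_eq_sum_singleton) auto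
 then have "emeasure (G \<Otimes>\<^sub>M \<nu>) (S \<times> - {0}) = 0"
  using S_borel G(1) \<nu>(1) by (subst \<nu>.emeasure_pair_measure_Times) (auto simp: sets_nonzero_borel)
 then show null: "AE w in M. emeasure (N w) (S \<times> - {0}) = 0"
  by (rule AE_poisson_null[OF N S_sets])
 have int: "AE w in M. \<forall>n p. \<forall>I\<in>Pow {..<n}. \<forall>I'\<in>Pow {..<n}.
   \<exists>k. emeasure (N w) (cell base_seq n I \<times> (away p \<inter> cell base_seq n I')) = of_nat k"
  unfolding AE_all_countable
 proof (intro allI AE_ball_countable')
  fix n p I I'
  have s: "cell base_seq n I \<times> (away p \<inter> cell base_seq n I') \<in> sets (G \<Otimes>\<^sub>M \<nu>)"
   unfolding sF using away_nonzero[of p] by (intro pair_nonzero_setsI) auto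
  have "emeasure (G \<Otimes>\<^sub>M \<nu>) (cell base_seq n I \<times> (away p \<inter> cell base_seq n I')) \<le> emeasure (G \<Otimes>\<^sub>M \<nu>) (UNIV \<times> away p)"
   unfolding sF using away_nonzero[of p] by (intro emeasure_mono) (auto simp: sF intro!: pair_nonzero_setsI)
  also have "\<dots> = emeasure \<nu> (away p)"
   using G \<nu> away_nonzero[of p] G.emeasure_space_1 sets_eq_imp_space_eq[OF G(1)]
   by (subst \<nu>.emeasure_pair_measure_Times) (auto simp: sets_nonzero_borel)
  finally have "emeasure (G \<Otimes>\<^sub>M \<nu>) (cell base_seq n I \<times> (away p \<inter> cell base_seq n I')) < \<infinity>"
   using \<nu>(3)[of p] by (rule order_le_less_trans)
  then show "AE w in M. \<exists>k. emeasure (N w) (cell base_seq n I \<times> (away p \<inter> cell base_seq n I')) = of_nat k"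
   by (rule poisson_count_eneg(2)[OF N s])
 qed (auto simp: countable_finite)
 have "AE w in M. \<forall>p. \<exists>n. \<forall>I. emeasure (N w) (cell base_seq n I \<times> away p) \<le> 1"
  unfolding AE_all_countable using AE_poisson_simple[OF N G \<nu>(1,2,3)] by blast
 with null int \<Theta> AE_space show "AE w in M. N w = density (atom_process (\<Theta> w)) (indicator ((- S) \<times> UNIV))"
 proof eventually_elim
  case (elim w)
  have Sc: "(- S) \<times> - {0} \<in> sets ((borel :: 'b measure) \<Otimes>\<^sub>M nonzero_borel)"
   using S_borel by (intro pair_nonzero_setsI) auto
  show ?case
  proof (rule measure_eqI)
   show "sets (N w) = sets (density (atom_process (\<Theta> w)) (indicator ((- S) \<times> UNIV)))"
    using setsN elim by simp
   fix A assume A: "A \<in> sets (N w)"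
   then have A': "A \<in> sets point_borel" using setsN elim by simp
   then have Asub: "A \<subseteq> UNIV \<times> - {0}" by (simp add: sets_pair_nonzero_borel)
   have int': "\<exists>k. emeasure (N w) (cell base_seq n I \<times> (away p \<inter> cell base_seq n I')) = of_nat k" for n p I I'
   proof (cases "I \<in> Pow {..<n} \<and> I' \<in> Pow {..<n}")
    case True
    with elim(2) show ?thesis by blast
   next
    case False
    then have "cell base_seq n I \<times> (away p \<inter> cell base_seq n I') = ({} :: ('b \<times> real) set)"
     using cell_empty[of I n "base_seq :: nat \<Rightarrow> 'b set"] cell_empty[of I' n "base_seq :: nat \<Rightarrow> real set"] by auto
    then show ?thesis by (auto intro!: exI[of _ 0])
   qed
   have "emeasure (N w) A = emeasure (count_space UNIV) {s. s \<notin> S \<and> (s, \<Theta> w {s}) \<in> A}"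
    using elim A S_borel setsN int' by (intro simple_point_measure) auto
   also have "{s. s \<notin> S \<and> (s, \<Theta> w {s}) \<in> A} = {s. (s, \<Theta> w {s}) \<in> ((- S) \<times> - {0}) \<inter> A}"
    using Asub by auto
   also have "emeasure (count_space UNIV) \<dots> = emeasure (atom_process (\<Theta> w)) (((- S) \<times> - {0}) \<inter> A)"
    using A' Sc by (intro emeasure_atom_process[symmetric] sets.Int)
   also have "\<dots> = emeasure (density (atom_process (\<Theta> w)) (indicator ((- S) \<times> - {0}))) A"
    using A' Sc by (intro emeasure_restricted[symmetric]) auto
   also have "density (atom_process (\<Theta> w)) (indicator ((- S) \<times> - {0})) =
     density (atom_process (\<Theta> w)) (indicator ((- S) \<times> UNIV))"
   proof (rule density_cong)
    show "indicator ((- S) \<times> - {0}) \<in> borel_measurable (atom_process (\<Theta> w))"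
     using Sc by (intro borel_measurable_indicator) simp
    have "indicator ((- S) \<times> (UNIV :: real set)) \<in> borel_measurable ((borel :: 'b measure) \<Otimes>\<^sub>M nonzero_borel)"
     using S_borel by (intro measurable_pair_nonzero_borel borel_measurable_indicator pair_measureI) auto
    then show "indicator ((- S) \<times> (UNIV :: real set)) \<in> borel_measurable (atom_process (\<Theta> w))"
     by (simp cong: measurable_cong_sets)
    show "AE q in atom_process (\<Theta> w). indicator ((- S) \<times> - {0}) q = (indicator ((- S) \<times> UNIV) q :: ennreal)"
     by (rule AE_I2) (auto simp: space_atom_process indicator_def)
   qed
   finally show "emeasure (N w) A = emeasure (density (atom_process (\<Theta> w)) (indicator ((- S) \<times> UNIV))) A" .
  qed
 qed
qed

section \<open>The Laplace functional of a completely random signed measure\<close>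

lemma (in prob_space) indep_set_nn_integral_mult:
 assumes ind: "indep_set (sets A) (sets B)"
  and sp: "space A = space M" "space B = space M"
  and U: "U \<in> borel_measurable A" and V: "V \<in> borel_measurable B"
 shows "(NN w|M. U w * V w) = (NN w|M. U w) * (NN w|M. V w :: ennreal)"
proof -
 have ev: "sets A \<subseteq> events" "sets B \<subseteq> events"
  using ind by (auto simp: indep_set_def indep_sets_def split: bool.splits)
 have UM: "U \<in> borel_measurable M" and VM: "V \<in> borel_measurable M"
  using U V ev sp by (auto simp: measurable_def)
 have "sigma_sets (space M) {U -` C \<inter> space M | C. C \<in> sets borel} \<subseteq> sets A"
  using measurable_sets[OF U] sp sets.top[of A] by (intro sets.sigma_sets_subset'[of _ A, unfolded sp]) auto
 moreover have "sigma_sets (space M) {V -` C \<inter> space M | C. C \<in> sets borel} \<subseteq> sets B"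
  using measurable_sets[OF V] sp sets.top[of B] by (intro sets.sigma_sets_subset'[of _ B, unfolded sp]) auto
 ultimately have "indep_set (sigma_sets (space M) {U -` C \<inter> space M | C. C \<in> sets borel})
   (sigma_sets (space M) {V -` C \<inter> space M | C. C \<in> sets borel})"
  using ev by (intro indep_setI) (auto intro: indep_setD[OF ind] dest: subsetD)
 then have iv: "indep_var borel U borel V"
  using UM VM by (simp add: indep_var_eq)
 have "case_bool borel borel = (\<lambda>_. borel :: ennreal measure)"
  by (auto split: bool.split)
 with iv have "indep_vars (\<lambda>_. borel) (case_bool U V) UNIV"
  by (simp add: indep_var_def)
 from indep_vars_nn_integral[OF _ this] show ?thesis by (simp add: UNIV_bool mult.commute)
qed

lemma nn_integral_atom_process_split:
 fixes \<xi> :: "'a::{metric_space, second_countable_topology} set \<Rightarrow> real"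
 assumes f [measurable]: "f \<in> borel_measurable pair_borel" and S: "finite S" and nz: "\<And>s. s \<in> S \<Longrightarrow> \<xi> {s} \<noteq> 0"
 shows "(NN p|(atom_process \<xi>). f p) =
  (NN p|(density (atom_process \<xi>) (indicator ((- S) \<times> UNIV))). f p) + (\<Sum>s\<in>S. f (s, \<xi> {s}))"
proof -
 have S_borel [measurable]: "S \<in> sets borel" using S by (intro borel_closed finite_imp_closed)
 have m: "g \<in> borel_measurable (atom_process \<xi>)" if "g \<in> borel_measurable pair_borel" for g :: "'a \<times> real \<Rightarrow> ennreal"
  using measurable_pair_nonzero_borel[OF that] by (simp cong: measurable_cong_sets)
 have "(NN p|(atom_process \<xi>). f p) =
   (NN p|(atom_process \<xi>). indicator ((- S) \<times> UNIV) p * f p + indicator S (fst p) * f p)"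
  by (intro nn_integral_cong) (auto simp: indicator_def split: if_splits)
 also have "\<dots> = (NN p|(atom_process \<xi>). indicator ((- S) \<times> UNIV) p * f p) + (NN p|(atom_process \<xi>). indicator S (fst p) * f p)"
  by (intro nn_integral_add m) measurable
 also have "(NN p|(atom_process \<xi>). indicator ((- S) \<times> UNIV) p * f p) =
   (NN p|(density (atom_process \<xi>) (indicator ((- S) \<times> UNIV))). f p)"
  by (intro nn_integral_density[symmetric] m) measurable
 also have "(NN p|(atom_process \<xi>). indicator S (fst p) * f p) = (NN s|(count_space {s. \<xi> {s} \<noteq> 0}). indicator S s * f (s, \<xi> {s}))"
  by (subst nn_integral_atom_process) (auto intro!: measurable_pair_nonzero_borel)
 also have "\<dots> = (\<Sum>s\<in>S. indicator S s * f (s, \<xi> {s}))"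
  using S nz by (intro nn_integral_count_space') auto
 also have "\<dots> = (\<Sum>s\<in>S. f (s, \<xi> {s}))" by simp
 finally show ?thesis .
qed

text \<open>Some ball has positive \<open>G\<close>-mass, and on \<open>away p\<close> the integrand
  of the Levy condition is at least \<open>1 / Suc p\<close>; hence the product structure forces the
  weight factor to be finite there.\<close>

lemma levy_measure_pair_finite_away:
 fixes G :: "'a::metric_space measure"
 assumes lm: "levy_measure (G \<Otimes>\<^sub>M \<nu>)" and G: "sets G = sets borel" "prob_space G"
  and \<nu>: "sets \<nu> = sets nonzero_borel" "sigma_finite_measure \<nu>"
 shows "emeasure \<nu> (away p) < \<infinity>"
proof -
 interpret G: prob_space G by fact
 interpret \<nu>: sigma_finite_measure \<nu> by fact
 obtain x0 :: 'a where True by blast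
 have spG: "space G = UNIV" using sets_eq_imp_space_eq[OF G(1)] by simp
 have bG: "ball x0 r \<in> sets G" for r using G(1) by simp
 have aw: "away p \<in> sets \<nu>" using away_nonzero[of p] \<nu>(1) by (simp add: sets_nonzero_borel)
 have "\<exists>r::nat. emeasure G (ball x0 (real r)) \<noteq> 0"
 proof (rule ccontr)
  assume "\<nexists>r::nat. emeasure G (ball x0 (real r)) \<noteq> 0"
  then have "emeasure G (\<Union>r::nat. ball x0 (real r)) = 0"
   using bG by (intro emeasure_UN_eq_0) auto
  moreover have "(\<Union>r::nat. ball x0 (real r)) = UNIV"
   using reals_Archimedean2 by (auto simp: set_eq_iff) 
  ultimately show False using G.emeasure_space_1 by (simp add: spG)
 qed
 then obtain r :: nat where r: "emeasure G (ball x0 (real r)) \<noteq> 0" by blast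
 define B where "B = ball x0 (real r)"
 have B: "B \<in> bounded_borel" by (simp add: B_def bounded_borel_def)
 have "ennreal (1 / Suc p) * (emeasure G B * emeasure \<nu> (away p)) =
   (NN q|(G \<Otimes>\<^sub>M \<nu>). ennreal (1 / Suc p) * indicator (B \<times> away p) q)"
  using bG aw by (subst nn_integral_cmult_indicator) (auto simp: B_def \<nu>.emeasure_pair_measure_Times)
 also have "\<dots> \<le> (NN q|(G \<Otimes>\<^sub>M \<nu>). indicator B (fst q) * ennreal (min 1 \<bar>snd q\<bar>))"
  by (intro nn_integral_mono) (auto simp: indicator_def away_def divide_simps intro!: ennreal_leI)
 also have "\<dots> < \<infinity>" using lm B by (auto simp: levy_measure_def)
 finally have "ennreal (1 / Suc p) * (emeasure G B * emeasure \<nu> (away p)) < \<infinity>" .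
 then show ?thesis
  using r by (auto simp: B_def ennreal_mult_less_top less_top ennreal_mult_eq_top_iff)
qed

text \<open>Independence of the fixed weights and the Poisson process splits the functional. A fixed
  location appears in the atom process only if its weight is nonzero, which the hypothesis on
  \<open>L\<close> ensures almost surely.\<close>

lemma (in prob_space) crsm_laplace:
 fixes \<Theta> :: "'a \<Rightarrow> 'b::{metric_space, second_countable_topology} set \<Rightarrow> real"
 assumes rep: "crsm_representation M \<Theta> S L zero_signed_measure (G \<Otimes>\<^sub>M \<nu>)"
  and G: "sets G = sets borel" "prob_space G" "\<And>s. emeasure G {s} = 0"
  and \<nu>: "sets \<nu> = sets nonzero_borel" "sigma_finite_measure \<nu>"
  and S: "finite S" and L: "\<And>s. s \<in> S \<Longrightarrow> emeasure (L s) {0} = 0"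
  and f [measurable]: "f \<in> borel_measurable pair_borel"
 shows "(NN w|M. eneg (NN p|(atom_process (\<Theta> w)). f p)) =
  eneg (NN p|(G \<Otimes>\<^sub>M \<nu>). 1 - eneg (f p)) * (\<Prod>s\<in>S. NN t|(L s). eneg (f (s, t)))"
  and "AE w in M. \<forall>s\<in>S. \<Theta> w {s} \<noteq> 0"
proof -
 from rep obtain Y :: "'b \<Rightarrow> 'a \<Rightarrow> real" and N :: "'a \<Rightarrow> ('b \<times> real) measure" where
  lm: "levy_measure (G \<Otimes>\<^sub>M \<nu>)" and
  Y: "indep_vars (\<lambda>_. borel) Y S" "\<And>s. s \<in> S \<Longrightarrow> distr M borel (Y s) = L s" and
  N: "poisson_process M N (G \<Otimes>\<^sub>M \<nu>)" and
  ind: "indep_set (sets (vimage_algebra (space M) (\<lambda>w. \<lambda>s\<in>S. Y s w) (\<Pi>\<^sub>M s\<in>S. borel)))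
     (sets (process_sigma M N (G \<Otimes>\<^sub>M \<nu>)))" and
  eq: "AE w in M. \<forall>B\<in>bounded_borel. (\<lambda>s. Y s w) summable_on (S \<inter> B) \<and>
      integrable (N w) (\<lambda>p. indicator B (fst p) * snd p) \<and>
      \<Theta> w B = (\<Sum>\<^sub>\<infinity>s\<in>S \<inter> B. Y s w) + zero_signed_measure B + (\<integral>p. indicator B (fst p) * snd p \<partial>N w)"
  unfolding crsm_representation_def by blast
 have sF: "sets (G \<Otimes>\<^sub>M \<nu>) = sets point_borel" using G \<nu> by (intro sets_pair_measure_cong) auto
 have setsN: "sets (N w) = sets (G \<Otimes>\<^sub>M \<nu>)" if "w \<in> space M" for w
  using N that by (auto simp: poisson_process_def)
 have S_borel: "S \<in> sets borel" using S by (intro borel_closed finite_imp_closed)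
 have single: "\<Theta> w {s} = (if s \<in> S then Y s w else 0) + (\<integral>p. indicator {s} (fst p) * snd p \<partial>N w)"
  if "\<forall>B\<in>bounded_borel. (\<lambda>s. Y s w) summable_on (S \<inter> B) \<and> integrable (N w) (\<lambda>p. indicator B (fst p) * snd p) \<and>
      \<Theta> w B = (\<Sum>\<^sub>\<infinity>s\<in>S \<inter> B. Y s w) + zero_signed_measure B + (\<integral>p. indicator B (fst p) * snd p \<partial>N w)" for w s
 proof -
  have "\<Theta> w {s} = (\<Sum>\<^sub>\<infinity>s\<in>S \<inter> {s}. Y s w) + zero_signed_measure {s} + (\<integral>p. indicator {s} (fst p) * snd p \<partial>N w)"
   using that by blast
  moreover have "(\<Sum>\<^sub>\<infinity>s'\<in>S \<inter> {s}. Y s' w) = (if s \<in> S then Y s w else 0)" by auto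
  ultimately show ?thesis by (simp add: zero_signed_measure_def)
 qed
 have th: "AE w in M. \<forall>s. s \<notin> S \<longrightarrow> \<Theta> w {s} = (\<integral>p. indicator {s} (fst p) * snd p \<partial>N w)"
  using eq by eventually_elim (simp add: single)
 note NP = poisson_process_eq_atom_process[OF N G \<nu> levy_measure_pair_finite_away[OF lm G(1,2) \<nu>] S th]
 have Ym: "Y s \<in> borel_measurable M" if "s \<in> S" for s using Y(1) that by (auto simp: indep_vars_def2)
 have YS: "AE w in M. \<forall>s\<in>S. \<Theta> w {s} = Y s w"
  using eq NP(2) AE_space
 proof eventually_elim
  case (elim w)
  have "S \<times> - {0} \<in> null_sets (N w)"
   using elim(2) S_borel setsN[OF elim(3)] sF by (auto simp: null_sets_def intro!: pair_nonzero_setsI)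
  have spN: "space (N w) = UNIV \<times> - {0}"
   using sets_eq_imp_space_eq[OF setsN[OF elim(3)]] sets_eq_imp_space_eq[OF sF] by (simp add: space_pair_measure)
  have ae: "AE q in N w. fst q \<notin> S"
   using AE_not_in[OF \<open>S \<times> - {0} \<in> null_sets (N w)\<close>] AE_space
   by eventually_elim (auto simp: spN)
  \<comment> \<open>The Poisson process has no point over \<open>S\<close>, so the mass at a fixed
    location is the fixed weight alone.\<close>
  have "(\<integral>p. indicator {s} (fst p) * snd p \<partial>N w) = 0" if "s \<in> S" for s
  proof (rule integral_eq_zero_AE)
   show "AE p in N w. indicator {s} (fst p) * snd p = 0"
    using ae by eventually_elim (use that in \<open>auto simp: indicator_def\<close>)
  qed
  with single[OF elim(1)] show ?case by simp
 qed
 have Y0: "AE w in M. \<forall>s\<in>S. Y s w \<noteq> 0"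
 proof (rule AE_ball_countable')
  fix s assume s: "s \<in> S"
  have "emeasure (distr M borel (Y s)) {0} = 0" using Y(2) L s by simp
  then have "emeasure M (Y s -` {0} \<inter> space M) = 0" using Ym[OF s] by (simp add: emeasure_distr)
  then have "Y s -` {0} \<inter> space M \<in> null_sets M" using Ym[OF s] by (auto simp: null_sets_def)
  from AE_not_in[OF this] show "AE w in M. Y s w \<noteq> 0"
   using AE_space by eventually_elim auto
 qed (use S in \<open>simp add: countable_finite\<close>)
 show "AE w in M. \<forall>s\<in>S. \<Theta> w {s} \<noteq> 0"
  using YS Y0 by eventually_elim auto
 have fF: "f \<in> borel_measurable (G \<Otimes>\<^sub>M \<nu>)"
  using measurable_pair_nonzero_borel[OF f] sF by (simp cong: measurable_cong_sets)
 have "(NN w|M. eneg (NN p|(atom_process (\<Theta> w)). f p)) =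
   (NN w|M. (\<Prod>s\<in>S. eneg (f (s, Y s w))) * eneg (NN p|(N w). f p))"
 proof (rule nn_integral_cong_AE)
  show "AE w in M. eneg (NN p|(atom_process (\<Theta> w)). f p) = (\<Prod>s\<in>S. eneg (f (s, Y s w))) * eneg (NN p|(N w). f p)"
   using YS Y0 NP(1)
  proof eventually_elim
   case (elim w)
   have "(NN p|(atom_process (\<Theta> w)). f p) = (NN p|(N w). f p) + (\<Sum>s\<in>S. f (s, \<Theta> w {s}))"
    unfolding elim(3) using elim(1,2) by (intro nn_integral_atom_process_split f S) auto
   also have "(\<Sum>s\<in>S. f (s, \<Theta> w {s})) = (\<Sum>s\<in>S. f (s, Y s w))"
    using elim(1) by (intro sum.cong) auto
   finally show ?case using S by (simp add: eneg_add eneg_sum mult.commute)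
  qed
 qed
 also have "\<dots> = (NN w|M. (\<Prod>s\<in>S. eneg (f (s, Y s w)))) * (NN w|M. eneg (NN p|(N w). f p))"
 proof (rule indep_set_nn_integral_mult[OF ind])
  show "(\<lambda>w. eneg (NN p|(N w). f p)) \<in> borel_measurable
    (process_sigma M N (G \<Otimes>\<^sub>M \<nu>))"
   by (rule measurable_compose[OF sigma_nn_integral_process[OF setsN fF] measurable_eneg])
  have "(\<lambda>w. \<lambda>s\<in>S. Y s w) \<in> vimage_algebra (space M) (\<lambda>w. \<lambda>s\<in>S. Y s w) (\<Pi>\<^sub>M s\<in>S. borel) \<rightarrow>\<^sub>M (\<Pi>\<^sub>M s\<in>S. borel)"
   by (rule measurable_vimage_algebra1) (auto simp: space_PiM)
  from measurable_compose[OF this measurable_component_singleton]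
  have [measurable]: "Y s \<in> borel_measurable (vimage_algebra (space M) (\<lambda>w. \<lambda>s\<in>S. Y s w) (\<Pi>\<^sub>M s\<in>S. borel))" if "s \<in> S" for s
   using that by simp
  show "(\<lambda>w. \<Prod>s\<in>S. eneg (f (s, Y s w))) \<in> borel_measurable (vimage_algebra (space M) (\<lambda>w. \<lambda>s\<in>S. Y s w) (\<Pi>\<^sub>M s\<in>S. borel))"
   by measurable
 qed simp_all
 also have "(NN w|M. eneg (NN p|(N w). f p)) = eneg (NN p|(G \<Otimes>\<^sub>M \<nu>). 1 - eneg (f p))"
  by (rule poisson_process_laplace[OF N fF])
 also have "(NN w|M. (\<Prod>s\<in>S. eneg (f (s, Y s w)))) = (\<Prod>s\<in>S. NN w|M. eneg (f (s, Y s w)))"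
 proof (rule indep_vars_nn_integral[OF S])
  show "indep_vars (\<lambda>_. borel) (\<lambda>s w. eneg (f (s, Y s w))) S"
   by (rule indep_vars_compose2[OF Y(1), where Y = "\<lambda>s t. eneg (f (s, t))"]) measurable
 qed simp
 also have "\<dots> = (\<Prod>s\<in>S. NN t|(L s). eneg (f (s, t)))"
  using Ym by (intro prod.cong refl) (simp add: Y(2)[symmetric] nn_integral_distr)
 finally show "(NN w|M. eneg (NN p|(atom_process (\<Theta> w)). f p)) =
  eneg (NN p|(G \<Otimes>\<^sub>M \<nu>). 1 - eneg (f p)) * (\<Prod>s\<in>S. NN t|(L s). eneg (f (s, t)))"
  by (simp add: mult.commute)
qed

section \<open>Uniqueness on product spaces and enumerated atoms\<close>

text \<open>The mark space is treated with the first coordinate restricted to \<open>A\<close>; the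
  rectangles obtained in this way generate the product.\<close>

lemma measure_eqI_pair_PiM:
 fixes \<mu> \<mu>' :: "('t \<times> (nat \<Rightarrow> real)) measure"
 assumes sets: "sets \<mu> = sets (T \<Otimes>\<^sub>M (vec_borel m))" "sets \<mu>' = sets (T \<Otimes>\<^sub>M (vec_borel m))"
  and fin: "finite_measure \<mu>"
  and eq: "\<And>A E. A \<in> sets T \<Longrightarrow> (\<And>j. j < m \<Longrightarrow> E j \<in> sets borel) \<Longrightarrow>
    emeasure \<mu> (A \<times> (vec_box m E)) = emeasure \<mu>' (A \<times> (vec_box m E))"
 shows "\<mu> = \<mu>'"
proof -
 interpret finite_measure \<mu> by fact
 define R :: "(nat \<Rightarrow> real) measure" where "R = (vec_borel m)"
 have spR: "space R = (\<Pi>\<^sub>E j\<in>{..<m}. UNIV)" by (simp add: R_def space_PiM)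
 note sets = sets[folded R_def]
 have rect: "emeasure \<mu> (A \<times> b) = emeasure \<mu>' (A \<times> b)" if A: "A \<in> sets T" and b: "b \<in> sets R" for A b
 proof -
  let ?d = "\<lambda>\<mu>. distr (density \<mu> (indicator (A \<times> space R))) R snd"
  have d: "emeasure (?d \<mu>'') b = emeasure \<mu>'' (A \<times> b)"
   if b: "b \<in> sets R" and \<mu>'': "sets \<mu>'' = sets (T \<Otimes>\<^sub>M R)" for \<mu>'' b
  proof -
   have sp: "space \<mu>'' = space T \<times> space R"
    using sets_eq_imp_space_eq[OF \<mu>''] by (simp add: space_pair_measure)
   have AR: "A \<times> space R \<in> sets \<mu>''" "space T \<times> b \<in> sets \<mu>''"
    unfolding \<mu>'' using A b by (auto intro: pair_measureI)
   have "snd \<in> \<mu>'' \<rightarrow>\<^sub>M R" using \<mu>'' by (simp cong: measurable_cong_sets)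
   then have "emeasure (?d \<mu>'') b = emeasure (density \<mu>'' (indicator (A \<times> space R))) (snd -` b \<inter> space \<mu>'')"
    using b by (subst emeasure_distr) auto
   also have "snd -` b \<inter> space \<mu>'' = space T \<times> b"
    using sets.sets_into_space[OF b] by (auto simp: sp)
   also have "emeasure (density \<mu>'' (indicator (A \<times> space R))) (space T \<times> b) = emeasure \<mu>'' ((A \<times> space R) \<inter> (space T \<times> b))"
    by (rule emeasure_restricted[OF AR])
   also have "(A \<times> space R) \<inter> (space T \<times> b) = A \<times> b"
    using sets.sets_into_space[OF b] sets.sets_into_space[OF A] by auto
   finally show ?thesis .
  qed
  have "?d \<mu> = ?d \<mu>'"
  proof (rule measure_eqI_PiM_finite[where I = "{..<m}" and M = "\<lambda>_. borel"])
   fix E :: "nat \<Rightarrow> real set" assume E: "\<And>j. j \<in> {..<m} \<Longrightarrow> E j \<in> sets borel"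
   then have "Pi\<^sub>E {..<m} E \<in> sets R" unfolding R_def by (intro sets_PiM_I_finite) auto
   then show "emeasure (?d \<mu>) (Pi\<^sub>E {..<m} E) = emeasure (?d \<mu>') (Pi\<^sub>E {..<m} E)"
    using A E sets by (simp add: d eq)
  next
   show "range (\<lambda>_::nat. space R) \<subseteq> prod_algebra {..<m} (\<lambda>_. borel)"
    using prod_algebraI_finite[of "{..<m}" "\<lambda>_. UNIV" "\<lambda>_. borel :: real measure"] by (simp add: spR image_subset_iff)
   show "emeasure (?d \<mu>) (space R) \<noteq> \<infinity>"
    using sets(1) by (subst d) auto
  qed (simp_all add: R_def)
  then show ?thesis using d[OF b sets(1)] d[OF b sets(2)] by simp
 qed
 show ?thesis
 proof (rule measure_eqI_generator_eq[OF Int_stable_pair_measure_generator[of T R] pair_measure_closed])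
  show "range (\<lambda>_::nat. space T \<times> space R) \<subseteq> {a \<times> b |a b. a \<in> sets T \<and> b \<in> sets R}" by auto
  show "(\<Union>i::nat. space T \<times> space R) = space T \<times> space R" by simp
  show "emeasure \<mu> (space T \<times> space R) \<noteq> \<infinity>" by simp
 qed (use rect sets in \<open>auto simp: sets_pair_measure\<close>)
qed

text \<open>Links the intrinsic point process with an enumeration of the atoms. Indices with only
  zero weights are dropped, as they are not visible in the signed measures.\<close>

lemma nn_integral_vector_atoms_enum:
 fixes \<xi> :: "nat \<Rightarrow> 'a::metric_space set \<Rightarrow> real"
 assumes inj: "inj_on \<psi> I" and at: "\<And>k j. k \<in> I \<Longrightarrow> j < m \<Longrightarrow> \<xi> j {\<psi> k} = y j k"
  and off: "\<And>s j. s \<notin> \<psi> ` I \<Longrightarrow> j < m \<Longrightarrow> \<xi> j {s} = 0"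
  and f: "f \<in> borel_measurable (borel \<Otimes>\<^sub>M (vec_borel m))"
 shows "(NN p|(vector_atoms m \<xi>). f p) =
  (\<Sum>k. if k \<in> I \<and> (\<exists>j<m. y j k \<noteq> 0) then f (\<psi> k, \<lambda>j\<in>{..<m}. y j k) else 0)"
proof -
 define I' where "I' = {k\<in>I. \<exists>j<m. y j k \<noteq> 0}"
 have bij: "bij_betw \<psi> I' {s. \<exists>j<m. \<xi> j {s} \<noteq> 0}"
 proof (rule bij_betw_imageI)
  show "inj_on \<psi> I'" using inj by (rule inj_on_subset) (auto simp: I'_def)
  show "\<psi> ` I' = {s. \<exists>j<m. \<xi> j {s} \<noteq> 0}"
  proof (intro equalityI subsetI)
   fix s assume "s \<in> \<psi> ` I'"
   then show "s \<in> {s. \<exists>j<m. \<xi> j {s} \<noteq> 0}" using at by (auto simp: I'_def)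
  next
   fix s assume "s \<in> {s. \<exists>j<m. \<xi> j {s} \<noteq> 0}"
   then obtain j where j: "j < m" "\<xi> j {s} \<noteq> 0" by blast
   then obtain k where "k \<in> I" "s = \<psi> k" using off by blast
   with j at show "s \<in> \<psi> ` I'" by (auto simp: I'_def)
  qed
 qed
 have "(NN p|(vector_atoms m \<xi>). f p) = (NN s|(count_space {s. \<exists>j<m. \<xi> j {s} \<noteq> 0}). f (s, \<lambda>j\<in>{..<m}. \<xi> j {s}))"
  by (rule nn_integral_vector_atoms[OF f])
 also have "\<dots> = (NN k|(count_space I'). f (\<psi> k, \<lambda>j\<in>{..<m}. \<xi> j {\<psi> k}))"
  by (rule nn_integral_bij_count_space[OF bij, symmetric])
 also have "\<dots> = (NN k|(count_space I'). f (\<psi> k, \<lambda>j\<in>{..<m}. y j k))"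
 proof (rule nn_integral_cong)
  fix k assume "k \<in> space (count_space I')"
  then have "(\<lambda>j\<in>{..<m}. \<xi> j {\<psi> k}) = (\<lambda>j\<in>{..<m}. y j k)"
   by (intro restrict_ext) (auto simp: I'_def at)
  then show "f (\<psi> k, \<lambda>j\<in>{..<m}. \<xi> j {\<psi> k}) = f (\<psi> k, \<lambda>j\<in>{..<m}. y j k)" by simp
 qed
 also have "\<dots> = (NN k|(count_space UNIV). f (\<psi> k, \<lambda>j\<in>{..<m}. y j k) * indicator I' k)"
  by (rule nn_integral_count_space_indicator) simp
 also have "\<dots> = (\<Sum>k. f (\<psi> k, \<lambda>j\<in>{..<m}. y j k) * indicator I' k)"
  by (rule nn_integral_count_space_nat)
 also have "\<dots> = (\<Sum>k. if k \<in> I \<and> (\<exists>j<m. y j k \<noteq> 0) then f (\<psi> k, \<lambda>j\<in>{..<m}. y j k) else 0)"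
  by (intro suminf_cong) (auto simp: I'_def indicator_def)
 finally show ?thesis .
qed

lemma nn_integral_atom_process_enum:
 fixes \<xi> :: "'a::metric_space set \<Rightarrow> real"
 assumes inj: "inj_on \<psi> I" and at: "\<And>k. k \<in> I \<Longrightarrow> \<xi> {\<psi> k} = y k"
  and off: "\<And>s. s \<notin> \<psi> ` I \<Longrightarrow> \<xi> {s} = 0" and nz: "\<And>k. k \<in> I \<Longrightarrow> y k \<noteq> 0"
  and f: "f \<in> borel_measurable pair_borel"
 shows "(NN p|(atom_process \<xi>). f p) = (\<Sum>k. if k \<in> I then f (\<psi> k, y k) else 0)"
proof -
 have bij: "bij_betw \<psi> I {s. \<xi> {s} \<noteq> 0}"
 proof (rule bij_betw_imageI[OF inj], intro equalityI subsetI)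
  fix s assume "s \<in> \<psi> ` I"
  then show "s \<in> {s. \<xi> {s} \<noteq> 0}" using at nz by auto
 next
  fix s assume "s \<in> {s. \<xi> {s} \<noteq> 0}"
  then show "s \<in> \<psi> ` I" using off by blast
 qed
 have "(NN p|(atom_process \<xi>). f p) = (NN s|(count_space {s. \<xi> {s} \<noteq> 0}). f (s, \<xi> {s}))"
  by (rule nn_integral_atom_process[OF measurable_pair_nonzero_borel[OF f]])
 also have "\<dots> = (NN k|(count_space I). f (\<psi> k, \<xi> {\<psi> k}))"
  by (rule nn_integral_bij_count_space[OF bij, symmetric])
 also have "\<dots> = (NN k|(count_space I). f (\<psi> k, y k))"
  by (intro nn_integral_cong) (simp add: at)
 also have "\<dots> = (NN k|(count_space UNIV). f (\<psi> k, y k) * indicator I k)"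
  by (rule nn_integral_count_space_indicator) simp
 also have "\<dots> = (\<Sum>k. f (\<psi> k, y k) * indicator I k)"
  by (rule nn_integral_count_space_nat)
 also have "\<dots> = (\<Sum>k. if k \<in> I then f (\<psi> k, y k) else 0)"
  by (intro suminf_cong) (auto simp: indicator_def)
 finally show ?thesis .
qed

text \<open>Distinct locations leave at most one term in the sum over a singleton.\<close>

lemma has_sum_enum_singleton:
 assumes hs: "\<forall>B\<in>bounded_borel. ((\<lambda>k. y k) has_sum \<xi> B) {k\<in>I. \<psi> k \<in> B}" and inj: "inj_on \<psi> I"
 shows "k \<in> I \<Longrightarrow> \<xi> {\<psi> k} = (y k :: real)" and "s \<notin> \<psi> ` I \<Longrightarrow> \<xi> {s} = 0"
proof -
 assume k: "k \<in> I"
 have "{k'\<in>I. \<psi> k' \<in> {\<psi> k}} = {k}" using k inj by (auto simp: inj_on_def)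
 moreover have "((\<lambda>k. y k) has_sum \<xi> {\<psi> k}) {k'\<in>I. \<psi> k' \<in> {\<psi> k}}" using hs by blast
 ultimately have "((\<lambda>k. y k) has_sum \<xi> {\<psi> k}) {k}" by simp
 moreover have "((\<lambda>k. y k) has_sum (\<Sum>k\<in>{k}. y k)) {k}" by (rule has_sum_finite) simp
 ultimately show "\<xi> {\<psi> k} = y k" using has_sum_unique by fastforce
next
 assume s: "s \<notin> \<psi> ` I"
 have e: "{k'\<in>I. \<psi> k' \<in> {s}} = {}" using s by auto
 have "((\<lambda>k. y k) has_sum \<xi> {s}) {k'\<in>I. \<psi> k' \<in> {s}}" using hs by blast
 then show "\<xi> {s} = 0" unfolding e using has_sum_unique[OF _ has_sum_finite[of "{}" y]] by simp
qed

section \<open>Integrating out the marks\<close>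

lemma product_density_rectangle:
 fixes h :: "real \<Rightarrow> ennreal" and \<rho> :: "real measure" and E :: "nat \<Rightarrow> real set" and m :: nat
 assumes \<rho>: "sigma_finite_measure \<rho>" "sets \<rho> = sets borel" and h: "h \<in> borel_measurable borel"
  and E: "\<And>j. j < m \<Longrightarrow> E j \<in> sets borel"
 shows "(NN x|(\<Pi>\<^sub>M j\<in>{..<m}. \<rho>). indicator (vec_box m E) x * (\<Prod>j<m. h (x j))) = (\<Prod>j<m. emeasure (density \<rho> h) (E j))"
proof -
 interpret product_sigma_finite "\<lambda>_::nat. \<rho>" by (rule product_sigma_finite.intro) (rule \<rho>)
 have hm: "h \<in> borel_measurable \<rho>" using h \<rho> by (simp cong: measurable_cong_sets)
 have "(NN x|(\<Pi>\<^sub>M j\<in>{..<m}. \<rho>). indicator (vec_box m E) x * (\<Prod>j<m. h (x j))) =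
   (NN x|(\<Pi>\<^sub>M j\<in>{..<m}. \<rho>). (\<Prod>j<m. h (x j) * indicator (E j) (x j)))"
 proof (rule nn_integral_cong)
  fix x assume "x \<in> space (\<Pi>\<^sub>M j\<in>{..<m}. \<rho>)"
  then have "x \<in> extensional {..<m}" by (simp add: space_PiM PiE_iff)
  then have "indicator (vec_box m E) x = (\<Prod>j<m. indicator (E j) (x j) :: ennreal)"
   by (auto simp: indicator_def PiE_iff prod_zero_iff)
  then show "indicator (vec_box m E) x * (\<Prod>j<m. h (x j)) = (\<Prod>j<m. h (x j) * indicator (E j) (x j))"
   by (simp add: prod.distrib mult.commute)
 qed
 also have "\<dots> = (\<Prod>j<m. NN y|\<rho>. h y * indicator (E j) y)"
  using hm E \<rho> by (intro product_nn_integral_prod[where f = "\<lambda>j y. h y * indicator (E j) y"]) auto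
 also have "\<dots> = (\<Prod>j<m. emeasure (density \<rho> h) (E j))"
  using hm E \<rho> by (intro prod.cong refl) (simp add: emeasure_density)
 finally show ?thesis .
qed

text \<open>Fixed and ordinary atoms have different mark laws, hence the index \<open>k\<close> on
  \<open>H\<close> and \<open>h\<close>. One sigma-finite \<open>\<rho>\<close> dominates all of
  them, so conditional laws are handled as densities and Fubini applies.\<close>

locale marked_atoms = prob_space M for M :: "'w measure" +
 fixes m :: nat and K :: "'w \<Rightarrow> enat" and \<psi> :: "nat \<Rightarrow> 'w \<Rightarrow> 'a::{metric_space, second_countable_topology}"
  and \<theta> :: "nat \<Rightarrow> 'w \<Rightarrow> real" and H :: "nat \<Rightarrow> real \<Rightarrow> real measure" and x :: "nat \<Rightarrow> nat \<Rightarrow> 'w \<Rightarrow> real"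
  and \<rho> :: "real measure" and h :: "nat \<Rightarrow> real \<Rightarrow> real \<Rightarrow> ennreal"
 assumes civ: "conditionally_independent_weights M m K \<psi> \<theta> H x"
  and K_meas: "K \<in> M \<rightarrow>\<^sub>M count_space UNIV"
  and \<psi>_meas [measurable]: "\<And>k. \<psi> k \<in> borel_measurable M"
  and \<theta>_meas [measurable]: "\<And>k. \<theta> k \<in> borel_measurable M"
  and x_meas: "\<And>j k. j < m \<Longrightarrow> x j k \<in> borel_measurable M"
  and \<rho>: "sigma_finite_measure \<rho>" "sets \<rho> = sets borel"
  and H_density: "\<And>k t. H k t = density \<rho> (h k t)"
  and H_prob: "\<And>k t. prob_space (H k t)"
  and h_meas: "\<And>k. (\<lambda>(t, y). h k t y) \<in> borel_measurable pair_borel"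
begin

abbreviation "atom k w \<equiv> (\<psi> k w, \<theta> k w)"

definition "lam = (\<Pi>\<^sub>M j\<in>{..<m}. \<rho>)"
definition "hv k t v = (\<Prod>j<m. h k t (v j))"
definition "xv k w = (\<lambda>j\<in>{..<m}. x j k w)"
definition "T w = (K w, \<lambda>k. (atom k w))"
definition TS :: "(enat \<times> (nat \<Rightarrow> 'a \<times> real)) measure" where
 "TS = count_space UNIV \<Otimes>\<^sub>M (\<Pi>\<^sub>M k\<in>UNIV. borel \<Otimes>\<^sub>M borel)"
definition RV :: "(nat \<Rightarrow> real) measure" where "RV = (vec_borel m)"

abbreviation "marked_atom k w \<equiv> (atom k w, xv k w)"

lemma sets_lam [measurable_cong]: "sets lam = sets RV"
 unfolding lam_def RV_def using \<rho>(2) by (intro sets_PiM_cong) auto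

lemma space_RV: "space RV = (\<Pi>\<^sub>E j\<in>{..<m}. UNIV)" by (simp add: RV_def space_PiM)

lemma space_lam: "space lam = space RV"
 using sets_lam by (rule sets_eq_imp_space_eq)

lemma sigma_finite_lam: "sigma_finite_measure lam"
proof -
 interpret product_sigma_finite "\<lambda>_::nat. \<rho>" by (rule product_sigma_finite.intro) (rule \<rho>)
 show ?thesis unfolding lam_def by (rule sigma_finite) simp
qed

lemma h_meas2 [measurable]: "f \<in> borel_measurable N \<Longrightarrow> g \<in> borel_measurable N \<Longrightarrow> (\<lambda>z. h k (f z) (g z)) \<in> borel_measurable N"
 using measurable_compose[OF measurable_Pair[of f N borel g borel] h_meas[of k]] by simp

lemma component_meas: "j < m \<Longrightarrow> (\<lambda>v. v j) \<in> borel_measurable RV"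
 unfolding RV_def by (rule measurable_component_singleton) simp

lemma hv_meas [measurable]:
 assumes "f \<in> borel_measurable N" "g \<in> N \<rightarrow>\<^sub>M RV"
 shows "(\<lambda>z. hv k (f z) (g z)) \<in> borel_measurable N"
 unfolding hv_def
 using measurable_compose[OF assms(2) component_meas] assms(1)
 by (intro borel_measurable_prod_ennreal h_meas2) auto

lemma xv_meas [measurable]: "xv k \<in> M \<rightarrow>\<^sub>M RV"
 unfolding xv_def[abs_def] RV_def using x_meas by (intro measurable_restrict) auto

lemma T_meas [measurable]: "T \<in> M \<rightarrow>\<^sub>M TS"
 unfolding T_def[abs_def] TS_def using K_meas
 by (intro measurable_Pair measurable_PiM_single') (auto simp: space_pair_measure)

lemma hv_rectangle:
 assumes "\<And>j. j < m \<Longrightarrow> E j \<in> sets borel"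
 shows "(NN v|lam. indicator (vec_box m E) v * hv k t v) = (\<Prod>j<m. emeasure (H k t) (E j))"
proof -
 have "h k t \<in> borel_measurable borel" by measurable
 from product_density_rectangle[OF \<rho> this assms] show ?thesis
  by (simp add: hv_def lam_def H_density)
qed

lemma hv_integral: "(NN v|lam. hv k t v) = 1"
proof -
 have sp: "space (H k t) = UNIV"
  using H_density[of k t] sets_eq_imp_space_eq[OF \<rho>(2)] by simp
 have "(NN v|lam. hv k t v) = (NN v|lam. indicator (\<Pi>\<^sub>E j\<in>{..<m}. UNIV) v * hv k t v)"
  by (intro nn_integral_cong) (simp add: space_lam space_RV)
 also have "\<dots> = (\<Prod>j<m. emeasure (H k t) UNIV)" by (rule hv_rectangle) simp
 also have "\<dots> = 1" using prob_space.emeasure_space_1[OF H_prob, of k t] by (simp add: sp)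
 finally show ?thesis .
qed

text \<open>The conditional expectation of \<open>\<phi>\<close> at the \<open>k\<close>-th marked
  atom, given the atom.\<close>

definition mbar :: "(('a \<times> real) \<times> (nat \<Rightarrow> real) \<Rightarrow> ennreal) \<Rightarrow> nat \<Rightarrow> 'a \<times> real \<Rightarrow> ennreal" where
 "mbar \<phi> k p = (NN v|lam. \<phi> (p, v) * hv k (snd p) v)"

lemma mbar_meas [measurable]:
 assumes "\<phi> \<in> borel_measurable (pair_borel \<Otimes>\<^sub>M RV)"
 shows "mbar \<phi> k \<in> borel_measurable pair_borel"
proof -
 interpret lam: sigma_finite_measure lam by (rule sigma_finite_lam)
 have [measurable]: "\<phi> \<in> borel_measurable (pair_borel \<Otimes>\<^sub>M lam)"
  using assms by (simp cong: measurable_cong_sets sets_pair_measure_cong add: sets_lam)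
 have [measurable]: "snd \<in> ((borel :: 'a measure) \<Otimes>\<^sub>M (borel :: real measure)) \<Otimes>\<^sub>M lam \<rightarrow>\<^sub>M RV" by measurable
 show ?thesis unfolding mbar_def[abs_def] by measurable
qed

lemma mbar_le_1: "(\<And>z. \<phi> z \<le> 1) \<Longrightarrow> mbar \<phi> k p \<le> 1"
proof -
 assume "\<And>z. \<phi> z \<le> 1"
 then have "mbar \<phi> k p \<le> (NN v|lam. 1 * hv k (snd p) v)"
  unfolding mbar_def by (intro nn_integral_mono mult_right_mono) auto
 then show ?thesis by (simp add: hv_integral)
qed

text \<open>The marks \<open>xv p\<close> are integrated out one after the other, each time passing from rectangles to
 functions of the atoms and the mark.\<close>

lemma marking_step:
 assumes \<phi>: "\<phi> \<in> borel_measurable (pair_borel \<Otimes>\<^sub>M RV)" "\<And>z. \<phi> z \<le> 1"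
  and n: "p \<le> n" and D: "D \<in> sets TS" "\<And>t. t \<in> D \<Longrightarrow> enat n \<le> fst t"
  and E: "\<And>j k. j < m \<Longrightarrow> k < n \<Longrightarrow> E j k \<in> sets borel"
 shows "(NN w|M. indicator D (T w) * (\<Prod>k<p. \<phi> (marked_atom k w)) * (\<Prod>k=p..<n. \<Prod>j<m. indicator (E j k) (x j k w))) =
  (NN w|M. indicator D (T w) * (\<Prod>k<p. mbar \<phi> k (atom k w)) * (\<Prod>k=p..<n. \<Prod>j<m. emeasure (H k (\<theta> k w)) (E j k)))"
 using n D E
proof (induction p arbitrary: D E)
 case 0
 have "(NN w|M. indicator D (T w) * (\<Prod>k<0. \<phi> (marked_atom k w)) * (\<Prod>k=0..<n. \<Prod>j<m. indicator (E j k) (x j k w))) =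
   (NN w|M. indicator {w\<in>space M. T w \<in> D \<and> (\<forall>j<m. \<forall>k<n. x j k w \<in> E j k)} w)"
 proof (rule nn_integral_cong)
  fix w assume w: "w \<in> space M"
  show "indicator D (T w) * (\<Prod>k<0. \<phi> (marked_atom k w)) * (\<Prod>k=0..<n. \<Prod>j<m. indicator (E j k) (x j k w)) =
    (indicator {w\<in>space M. T w \<in> D \<and> (\<forall>j<m. \<forall>k<n. x j k w \<in> E j k)} w :: ennreal)"
  proof (cases "\<forall>j<m. \<forall>k<n. x j k w \<in> E j k")
   case True
   then have "(\<Prod>k=0..<n. \<Prod>j<m. indicator (E j k) (x j k w)) = (1::ennreal)" by simp
   with True w show ?thesis by (simp add: indicator_def)
  next
   case False
   then obtain j k where jk: "j < m" "k < n" "x j k w \<notin> E j k" by blast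
   have z: "(\<Prod>j<m. indicator (E j k) (x j k w)) = (0::ennreal)"
    by (intro prod_zero bexI[of _ j]) (use jk in auto)
   have "(\<Prod>k=0..<n. \<Prod>j<m. indicator (E j k) (x j k w)) = (0::ennreal)"
   proof (rule prod_zero)
    show "\<exists>k\<in>{0..<n}. (\<Prod>j<m. indicator (E j k) (x j k w)) = (0::ennreal)"
     by (rule bexI[of _ k], rule z) (use jk in simp)
   qed simp
   with False w show ?thesis by (simp add: indicator_def)
  qed
 qed
 also have "\<dots> = emeasure M {w\<in>space M. T w \<in> D \<and> (\<forall>j<m. \<forall>k<n. x j k w \<in> E j k)}"
 proof (rule nn_integral_indicator)
  have "{w\<in>space M. \<forall>j\<in>{..<m}. \<forall>k\<in>{..<n}. x j k w \<in> E j k} \<in> sets M"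
   using 0 x_meas by (intro sets.sets_Collect_finite_All) (auto intro!: measurable_sets_Collect)
  moreover have "{w\<in>space M. T w \<in> D} \<in> sets M"
   using measurable_sets[OF T_meas 0(2)] by (simp add: vimage_def Int_def conj_commute)
  moreover have "{w\<in>space M. T w \<in> D \<and> (\<forall>j<m. \<forall>k<n. x j k w \<in> E j k)} =
    {w\<in>space M. T w \<in> D} \<inter> {w\<in>space M. \<forall>j\<in>{..<m}. \<forall>k\<in>{..<n}. x j k w \<in> E j k}" by auto
  ultimately show "{w\<in>space M. T w \<in> D \<and> (\<forall>j<m. \<forall>k<n. x j k w \<in> E j k)} \<in> sets M" by simp
 qed
 also have "\<dots> = (NN w|M. indicator D (T w) * (\<Prod>j<m. \<Prod>k<n. emeasure (H k (\<theta> k w)) (E j k)))"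
  using civ[unfolded conditionally_independent_weights_def, rule_format, of D n E] 0
  by (simp add: T_def TS_def)
 also have "\<dots> = (NN w|M. indicator D (T w) * (\<Prod>k<0. mbar \<phi> k (atom k w)) * (\<Prod>k=0..<n. \<Prod>j<m. emeasure (H k (\<theta> k w)) (E j k)))"
  by (intro nn_integral_cong) (simp add: atLeast0LessThan prod.swap[of _ "{..<m}"])
 finally show ?case .
next
 case (Suc p)
 interpret lam: sigma_finite_measure lam by (rule sigma_finite_lam)
 interpret MP: pair_sigma_finite M lam by unfold_locales
 note [measurable] = \<phi>(1) Suc.prems(2)
 have [measurable]: "x j k \<in> borel_measurable M" "E j k \<in> sets borel" if "j < m" "k < n" for j k
  using that x_meas Suc.prems by auto
 \<comment> \<open>\<open>A\<close> collects every factor except the one of mark \<open>p\<close>;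
   \<open>A'\<close> is its counterpart with the marks integrated out.\<close>
 define A where "A w = indicator D (T w) * ((\<Prod>k<p. \<phi> (marked_atom k w)) * (\<Prod>k=Suc p..<n. \<Prod>j<m. indicator (E j k) (x j k w)))" for w
 define A' where "A' w = indicator D (T w) * ((\<Prod>k<p. mbar \<phi> k (atom k w)) * (\<Prod>k=Suc p..<n. \<Prod>j<m. emeasure (H k (\<theta> k w)) (E j k)))" for w
 have Hm: "(\<lambda>w. emeasure (H k (\<theta> k w)) (E j k)) \<in> borel_measurable M" if "j < m" "k < n" for j k
 proof -
  interpret l0: sigma_finite_measure \<rho> by (rule \<rho>(1))
  have e: "emeasure (H k t) (E j k) = (NN y|\<rho>. h k t y * indicator (E j k) y)" for t
   using Suc.prems(4)[OF that] \<rho>(2) unfolding H_density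
   by (intro emeasure_density) (simp_all cong: measurable_cong_sets)
  have [measurable]: "(\<lambda>y. y) \<in> \<rho> \<rightarrow>\<^sub>M borel" using \<rho>(2) by (simp cong: measurable_cong_sets)
  have [measurable]: "snd \<in> M \<Otimes>\<^sub>M \<rho> \<rightarrow>\<^sub>M borel" using measurable_compose[OF measurable_snd \<open>(\<lambda>y. y) \<in> \<rho> \<rightarrow>\<^sub>M borel\<close>] by simp
  show ?thesis unfolding e using that by measurable
 qed
 have A_meas [measurable]: "A \<in> borel_measurable M"
  unfolding A_def by measurable
 have A'_meas [measurable]: "A' \<in> borel_measurable M"
  unfolding A'_def by (intro borel_measurable_times_ennreal borel_measurable_prod_ennreal Hm) auto
 have A1: "A w \<le> 1" for w
  unfolding A_def using \<phi>(2) by (intro mult_le_one prod_le_1) (auto simp: indicator_def intro!: prod_le_1)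
 define \<mu> where "\<mu> = distr (density M A) (TS \<Otimes>\<^sub>M RV) (\<lambda>w. (T w, xv p w))"
 define \<mu>' where "\<mu>' = distr (density (M \<Otimes>\<^sub>M lam) (\<lambda>(w, v). A' w * hv p (\<theta> p w) v)) (TS \<Otimes>\<^sub>M RV) (\<lambda>(w, v). (T w, v))"
 have sv [measurable]: "snd \<in> M \<Otimes>\<^sub>M lam \<rightarrow>\<^sub>M RV" using measurable_snd[of M lam] by (simp cong: measurable_cong_sets add: sets_lam)
 have i1: "(NN z|\<mu>. f z) = (NN w|M. A w * f (T w, xv p w))"
  if [measurable]: "f \<in> borel_measurable (TS \<Otimes>\<^sub>M RV)" for f :: "_ \<Rightarrow> ennreal"
  unfolding \<mu>_def by (simp add: nn_integral_distr nn_integral_density)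
 have i2: "(NN z|\<mu>'. f z) = (NN w|M. A' w * (NN v|lam. f (T w, v) * hv p (\<theta> p w) v))"
  if fm [measurable]: "f \<in> borel_measurable (TS \<Otimes>\<^sub>M RV)" for f :: "_ \<Rightarrow> ennreal"
 proof -
  have "(NN z|\<mu>'. f z) = (NN (w, v)|(M \<Otimes>\<^sub>M lam). A' w * hv p (\<theta> p w) v * f (T w, v))"
   unfolding \<mu>'_def by (simp add: nn_integral_distr nn_integral_density split_beta')
  also have "\<dots> = (NN w|M. NN v|lam. A' w * hv p (\<theta> p w) v * f (T w, v))"
   by (subst lam.nn_integral_fst[symmetric]) (simp_all add: split_beta')
  also have "\<dots> = (NN w|M. A' w * (NN v|lam. f (T w, v) * hv p (\<theta> p w) v))"
  proof (rule nn_integral_cong)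
   fix w assume w: "w \<in> space M"
   then have [measurable]: "(\<lambda>v. f (T w, v)) \<in> borel_measurable lam"
    using measurable_compose[OF measurable_Pair1' fm, of "T w"] measurable_space[OF T_meas w]
    by (simp cong: measurable_cong_sets add: sets_lam)
   have [measurable]: "(\<lambda>v. v) \<in> lam \<rightarrow>\<^sub>M RV" by (simp cong: measurable_cong_sets add: sets_lam)
   show "(NN v|lam. A' w * hv p (\<theta> p w) v * f (T w, v)) = A' w * (NN v|lam. f (T w, v) * hv p (\<theta> p w) v)"
    by (subst nn_integral_cmult[symmetric]) (auto simp: mult_ac)
  qed
  finally show ?thesis .
 qed
 have pn: "p < n" using Suc.prems(1) by simp
 have "\<mu> = \<mu>'"
 proof (rule measure_eqI_pair_PiM)
  show "sets \<mu> = sets (TS \<Otimes>\<^sub>M (vec_borel m))" "sets \<mu>' = sets (TS \<Otimes>\<^sub>M (vec_borel m))"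
   by (simp_all add: \<mu>_def \<mu>'_def RV_def)
  show "finite_measure \<mu>"
  proof (rule finite_measureI)
   have "emeasure \<mu> (space \<mu>) = (NN z|\<mu>. 1)" by simp
   also have "\<dots> = (NN w|M. A w)" by (subst i1) auto
   also have "\<dots> \<le> (NN w|M. 1)" by (intro nn_integral_mono A1)
   finally show "emeasure \<mu> (space \<mu>) \<noteq> \<infinity>" by (auto simp: emeasure_space_1 top_unique)
  qed
  fix D' E' assume D' [measurable]: "D' \<in> sets TS" and E': "\<And>j. j < m \<Longrightarrow> E' j \<in> sets (borel :: real measure)"
  have PE [measurable]: "(vec_box m E') \<in> sets RV"
   unfolding RV_def using E' by (intro sets_PiM_I_finite) auto
  have rs: "D' \<times> (vec_box m E') \<in> sets (TS \<Otimes>\<^sub>M RV)" by measurable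
  \<comment> \<open>Inserting \<open>E'\<close> in column \<open>p\<close> brings a rectangle for
    mark \<open>p\<close> into the form of the induction hypothesis, whose event becomes
    \<open>D \<inter> D'\<close>.\<close>
  define E'' where "E'' j k = (if k = p then E' j else E j k)" for j k
  have prE: "(\<Prod>k=p..<n. g k) = g p * (\<Prod>k=Suc p..<n. g k)" for g :: "nat \<Rightarrow> ennreal"
   using pn by (rule prod.atLeast_Suc_lessThan)
  have "emeasure \<mu> (D' \<times> (vec_box m E')) = (NN z|\<mu>. indicator (D' \<times> (vec_box m E')) z)"
   using rs by (simp add: \<mu>_def)
  also have "\<dots> = (NN w|M. A w * indicator (D' \<times> (vec_box m E')) (T w, xv p w))"
   by (rule i1) (use rs in simp)
  also have "\<dots> = (NN w|M. indicator (D \<inter> D') (T w) * (\<Prod>k<p. \<phi> (marked_atom k w)) *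
    (\<Prod>k=p..<n. \<Prod>j<m. indicator (E'' j k) (x j k w)))"
  proof (rule nn_integral_cong)
   fix w
   have "indicator (D' \<times> (vec_box m E')) (T w, xv p w) = (indicator D' (T w) * (\<Prod>j<m. indicator (E' j) (x j p w)) :: ennreal)"
    by (auto simp: indicator_def xv_def PiE_iff prod_zero_iff)
   moreover have "(\<Prod>k=Suc p..<n. \<Prod>j<m. indicator (E'' j k) (x j k w)) = (\<Prod>k=Suc p..<n. \<Prod>j<m. indicator (E j k) (x j k w) :: ennreal)"
    by (intro prod.cong refl) (simp add: E''_def)
   ultimately show "A w * indicator (D' \<times> (vec_box m E')) (T w, xv p w) =
    indicator (D \<inter> D') (T w) * (\<Prod>k<p. \<phi> (marked_atom k w)) * (\<Prod>k=p..<n. \<Prod>j<m. indicator (E'' j k) (x j k w))"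
    unfolding prE A_def indicator_inter_arith by (simp add: E''_def mult_ac)
  qed
  also have "\<dots> = (NN w|M. indicator (D \<inter> D') (T w) * (\<Prod>k<p. mbar \<phi> k (atom k w)) *
    (\<Prod>k=p..<n. \<Prod>j<m. emeasure (H k (\<theta> k w)) (E'' j k)))"
   using Suc.prems E' by (intro Suc.IH) (auto simp: E''_def)
  also have "\<dots> = (NN w|M. A' w * (NN v|lam. indicator (D' \<times> (vec_box m E')) (T w, v) * hv p (\<theta> p w) v))"
  proof (rule nn_integral_cong)
   fix w
   have [measurable]: "(\<lambda>v. v) \<in> lam \<rightarrow>\<^sub>M RV" by (simp cong: measurable_cong_sets add: sets_lam)
   have "(NN v|lam. indicator (D' \<times> (vec_box m E')) (T w, v) * hv p (\<theta> p w) v) =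
     (NN v|lam. indicator D' (T w) * (indicator (vec_box m E') v * hv p (\<theta> p w) v))"
    by (intro nn_integral_cong) (simp add: indicator_def)
   also have "\<dots> = indicator D' (T w) * (NN v|lam. indicator (vec_box m E') v * hv p (\<theta> p w) v)"
    by (rule nn_integral_cmult) measurable
   also have "\<dots> = indicator D' (T w) * (\<Prod>j<m. emeasure (H p (\<theta> p w)) (E' j))"
    by (simp add: hv_rectangle E')
   moreover have "(\<Prod>k=Suc p..<n. \<Prod>j<m. emeasure (H k (\<theta> k w)) (E'' j k)) = (\<Prod>k=Suc p..<n. \<Prod>j<m. emeasure (H k (\<theta> k w)) (E j k))"
    by (intro prod.cong refl) (simp add: E''_def)
   ultimately show "indicator (D \<inter> D') (T w) * (\<Prod>k<p. mbar \<phi> k (atom k w)) *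
    (\<Prod>k=p..<n. \<Prod>j<m. emeasure (H k (\<theta> k w)) (E'' j k)) = A' w * (NN v|lam. indicator (D' \<times> (vec_box m E')) (T w, v) * hv p (\<theta> p w) v)"
    unfolding prE A'_def indicator_inter_arith by (simp add: E''_def mult_ac)
  qed
  also have "\<dots> = (NN z|\<mu>'. indicator (D' \<times> (vec_box m E')) z)"
   by (rule i2[symmetric]) (use rs in simp)
  also have "\<dots> = emeasure \<mu>' (D' \<times> (vec_box m E'))"
   using rs by (simp add: \<mu>'_def)
  finally show "emeasure \<mu> (D' \<times> (vec_box m E')) = emeasure \<mu>' (D' \<times> (vec_box m E'))" .
 qed
 \<comment> \<open>Equality of the two measures allows a general function of the atom and mark
   \<open>p\<close> in place of a rectangle; \<open>\<phi>\<close> is the one that continues the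
   induction.\<close>
 define g where "g z = \<phi> (snd (fst z) p, snd z)" for z :: "(enat \<times> (nat \<Rightarrow> 'a \<times> real)) \<times> (nat \<Rightarrow> real)"
 have g [measurable]: "g \<in> borel_measurable (TS \<Otimes>\<^sub>M RV)"
 proof -
  have "(\<lambda>z. snd (fst z) p) \<in> TS \<Otimes>\<^sub>M RV \<rightarrow>\<^sub>M borel \<Otimes>\<^sub>M borel"
   unfolding TS_def by measurable
  then show ?thesis unfolding g_def[abs_def] by measurable
 qed
 have "(NN w|M. indicator D (T w) * (\<Prod>k<Suc p. \<phi> (marked_atom k w)) * (\<Prod>k=Suc p..<n. \<Prod>j<m. indicator (E j k) (x j k w))) =
   (NN w|M. A w * g (T w, xv p w))"
  by (intro nn_integral_cong) (simp add: A_def g_def T_def mult_ac)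
 also have "\<dots> = (NN w|M. A' w * (NN v|lam. g (T w, v) * hv p (\<theta> p w) v))"
  using i1[OF g] i2[OF g] \<open>\<mu> = \<mu>'\<close> by simp
 also have "\<dots> = (NN w|M. indicator D (T w) * (\<Prod>k<Suc p. mbar \<phi> k (atom k w)) * (\<Prod>k=Suc p..<n. \<Prod>j<m. emeasure (H k (\<theta> k w)) (E j k)))"
  by (intro nn_integral_cong) (simp add: A'_def g_def T_def mbar_def mult_ac)
 finally show ?case .
qed

text \<open>The number of atoms is random, so the sum is cut off at \<open>n\<close> and split
  according to how many of the first \<open>n\<close> atoms exist; \<open>n\<close> then tends to
  infinity under the bound 1. Writing the conditional expectation as \<open>lneg\<close> of it makes
  the right side a Laplace functional of the unmarked atoms.\<close>

lemma marking:
 assumes F: "F \<in> borel_measurable (pair_borel \<Otimes>\<^sub>M RV)"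
 shows "(NN w|M. eneg (\<Sum>k. if enat k < K w then F (marked_atom k w) else 0)) =
  (NN w|M. eneg (\<Sum>k. if enat k < K w then lneg (mbar (\<lambda>z. eneg (F z)) k (atom k w)) else 0))"
proof -
 note [measurable] = F
 have [measurable]: "Measurable.pred M (\<lambda>w. enat k < K w)" for k
  using measurable_compose[OF K_meas, of "\<lambda>z. enat k < z" "count_space UNIV"] by simp
 define \<phi> where "\<phi> z = eneg (F z)" for z
 have \<phi>m [measurable]: "\<phi> \<in> borel_measurable (pair_borel \<Otimes>\<^sub>M RV)" unfolding \<phi>_def[abs_def] by measurable
 have \<phi>1: "\<phi> z \<le> 1" for z by (simp add: \<phi>_def)
 define u where "u k w = F (marked_atom k w)" for k w
 define u' where "u' k w = lneg (mbar \<phi> k (atom k w))" for k w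
 have um [measurable]: "u k \<in> borel_measurable M" "u' k \<in> borel_measurable M" for k
  unfolding u_def[abs_def] u'_def[abs_def] by measurable
 have eu: "eneg (u k w) = \<phi> (marked_atom k w)" "eneg (u' k w) = mbar \<phi> k (atom k w)" for k w
  using mbar_le_1[of \<phi> k, OF \<phi>1] by (simp_all add: u_def u'_def \<phi>_def)
 \<comment> \<open>On \<open>D n l\<close> exactly \<open>l\<close> of the first \<open>n\<close>
   atoms exist; \<open>l = n\<close> collects all outcomes with at least \<open>n\<close>
   atoms.\<close>
 define D where "D n l = {t\<in>space TS. if l < n then fst t = enat l else enat n \<le> fst t}" for n l :: nat
 have D: "D n l \<in> sets TS" for n l
 proof -
  have "fst \<in> TS \<rightarrow>\<^sub>M count_space UNIV" by (simp add: TS_def)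
  from measurable_sets[OF this, of "{z. if l < n then z = enat l else enat n \<le> z}"] show ?thesis
   by (simp add: D_def vimage_def Int_def conj_commute)
 qed
 have Tsp: "T w \<in> space TS" for w by (simp add: TS_def space_pair_measure space_PiM)
 have fst_T: "fst (T w) = K w" for w by (simp add: T_def)
 have split: "eneg (\<Sum>k<n. if enat k < K w then g k else 0) = (\<Sum>l\<le>n. indicator (D n l) (T w) * (\<Prod>k<l. eneg (g k)))" for g :: "nat \<Rightarrow> ennreal" and n w
 proof -
  obtain l0 where l0: "l0 \<le> n" "\<And>l. l \<le> n \<Longrightarrow> T w \<in> D n l \<longleftrightarrow> l = l0" "\<And>k. k < n \<Longrightarrow> enat k < K w \<longleftrightarrow> k < l0"
  proof (cases "enat n \<le> K w")
   case True
   have "enat k < K w" if "k < n" for k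
    using that True by (metis enat_ord_simps(2) order_less_le_trans)
   with True show ?thesis
    by (intro that[of n]) (auto simp: D_def fst_T Tsp)
  next
   case False
   then obtain l where "K w = enat l" "l < n" by (cases "K w") auto
   then show ?thesis by (intro that[of l]) (auto simp: D_def fst_T Tsp)
  qed
  have "(\<Sum>l\<le>n. indicator (D n l) (T w) * (\<Prod>k<l. eneg (g k))) = (\<Sum>l\<in>{l0}. indicator (D n l) (T w) * (\<Prod>k<l. eneg (g k)))"
   using l0 by (intro sum.mono_neutral_right) (auto simp: indicator_def)
  also have "\<dots> = (\<Prod>k<l0. eneg (g k))" using l0 by (simp add: indicator_def)
  also have "\<dots> = eneg (\<Sum>k<l0. g k)" by (simp add: eneg_sum)
  also have "(\<Sum>k<l0. g k) = (\<Sum>k<n. if enat k < K w then g k else 0)"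
   using l0 by (intro sum.mono_neutral_cong_left) auto
  finally show ?thesis by simp
 qed
 have fin: "(NN w|M. eneg (\<Sum>k<n. if enat k < K w then u k w else 0)) =
   (NN w|M. eneg (\<Sum>k<n. if enat k < K w then u' k w else 0))" for n
 proof -
  note [measurable] = D
  have "(NN w|M. indicator (D n l) (T w) * (\<Prod>k<l. eneg (u k w))) = (NN w|M. indicator (D n l) (T w) * (\<Prod>k<l. eneg (u' k w)))" if "l \<le> n" for l
  proof -
   have "enat l \<le> fst t" if "t \<in> D n l" for t
    using that \<open>l \<le> n\<close> by (auto simp: D_def split: if_splits)
   then show ?thesis
    \<comment> \<open>Both bounds are \<open>l\<close>, so no unprocessed marks remain and the sets
      \<open>E\<close> are irrelevant.\<close>
    using marking_step[OF \<phi>m \<phi>1, of l l "D n l" "\<lambda>_ _. UNIV"] D[of n l] by (simp add: eu)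
  qed
  then show ?thesis
   unfolding split by (subst (1 2) nn_integral_sum) auto
 qed
 have lim: "(\<lambda>n. NN w|M. eneg (\<Sum>k<n. if enat k < K w then g k w else 0)) \<longlonglongrightarrow>
   (NN w|M. eneg (\<Sum>k. if enat k < K w then g k w else 0))" if [measurable]: "\<And>k. g k \<in> borel_measurable M" for g :: "nat \<Rightarrow> 'w \<Rightarrow> ennreal"
 proof (rule nn_integral_dominated_convergence)
  show "AE w in M. (\<lambda>n. eneg (\<Sum>k<n. if enat k < K w then g k w else 0)) \<longlonglongrightarrow> eneg (\<Sum>k. if enat k < K w then g k w else 0)"
   by (intro AE_I2 tendsto_eneg summable_LIMSEQ) auto
  show "(\<lambda>_. 1) \<in> borel_measurable M" "(NN w|M. 1) < \<infinity>" by (auto simp: emeasure_space_1)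
 qed (auto simp: AE_I2)
 have "(NN w|M. eneg (\<Sum>k. if enat k < K w then u k w else 0)) = (NN w|M. eneg (\<Sum>k. if enat k < K w then u' k w else 0))"
  using lim[of u] lim[of u'] um unfolding fin by (auto intro: LIMSEQ_unique)
 moreover have "\<phi> = (\<lambda>z. eneg (F z))" by (rule ext) (simp add: \<phi>_def)
 ultimately show ?thesis unfolding u_def u'_def by (simp only:)
qed

end

section \<open>The hierarchical model\<close>

text \<open>A measure dominating both \<open>Hfix\<close> and \<open>Hord\<close>. It charges zero, so the density \<open>lfix\<close> of the former has to
vanish there.\<close>

definition lborel0 :: "real measure" where
 "lborel0 = measure_of UNIV (sets borel) (\<lambda>A. emeasure lborel A + indicator A 0)"

lemma sets_lborel0 [simp, measurable_cong]: "sets lborel0 = sets borel"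
 using sets.sigma_sets_eq[of "borel :: real measure"] by (simp add: lborel0_def)

lemma space_lborel0 [simp]: "space lborel0 = UNIV"
 by (simp add: lborel0_def)

lemma emeasure_lborel0:
 assumes "A \<in> sets borel"
 shows "emeasure lborel0 A = emeasure lborel A + indicator A 0"
proof (rule emeasure_measure_of[OF lborel0_def])
 show "countably_additive (sets lborel0) (\<lambda>A. emeasure lborel A + indicator A 0)"
 proof (rule countably_additiveI)
  fix A :: "nat \<Rightarrow> real set" assume A: "range A \<subseteq> sets lborel0" "disjoint_family A"
  have "(\<Sum>i. indicator (A i) 0 :: ennreal) = indicator (\<Union>i. A i) 0"
   using A(2) by (rule suminf_indicator)
  moreover have "(\<Sum>i. emeasure lborel (A i)) = emeasure lborel (\<Union>i. A i)"
   using A by (intro suminf_emeasure) auto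
  ultimately show "(\<Sum>i. emeasure lborel (A i) + indicator (A i) 0) = emeasure lborel (\<Union>i. A i) + indicator (\<Union>i. A i) 0"
   by (simp add: suminf_add[symmetric])
 qed
qed (use assms in \<open>auto simp: positive_def\<close>)

lemma nn_integral_lborel0:
 assumes "f \<in> borel_measurable borel"
 shows "(NN y|lborel0. f y) = (NN y|lborel. f y) + f 0"
 using assms
proof (induction rule: borel_measurable_induct)
 case (cong f g)
 then have "f = g" by (intro ext) simp
 with cong show ?case by simp
next
 case (set A)
 then show ?case by (simp add: emeasure_lborel0)
next
 case (mult u c)
 then show ?case by (simp add: nn_integral_cmult distrib_left)
next
 case (add u v)
 then show ?case by (simp add: nn_integral_add ac_simps)
next
 case (seq U)
 have inc: "incseq (\<lambda>i. NN y|lborel. U i y)" "incseq (\<lambda>i. U i 0)"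
  using seq(3) by (auto simp: incseq_def le_fun_def intro!: nn_integral_mono)
 have "(NN y|lborel0. (SUP i. U i) y) = (SUP i. NN y|lborel0. U i y)"
  unfolding SUP_apply using seq by (intro nn_integral_monotone_convergence_SUP) auto
 also have "\<dots> = (SUP i. (NN y|lborel. U i y) + U i 0)"
  using seq by simp
 also have "\<dots> = (SUP i. NN y|lborel. U i y) + (SUP i. U i 0)"
  using inc by (rule ennreal_SUP_add)
 also have "(SUP i. NN y|lborel. U i y) = (NN y|lborel. (SUP i. U i) y)"
  unfolding SUP_apply using seq by (intro nn_integral_monotone_convergence_SUP[symmetric]) auto
 finally show ?case by (simp add: SUP_apply image_comp)
qed

lemma sigma_finite_lborel0: "sigma_finite_measure lborel0"
proof
 show "\<exists>A. countable A \<and> A \<subseteq> sets lborel0 \<and> \<Union> A = space lborel0 \<and> (\<forall>a\<in>A. emeasure lborel0 a \<noteq> \<infinity>)"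
 proof (intro exI[of _ "range (\<lambda>n::nat. {- real n .. real n})"] conjI ballI)
  have "\<exists>n. - real n \<le> y \<and> y \<le> real n" for y
   by (meson abs_le_D1 abs_le_D2 minus_le_iff real_arch_simple)
  then show "\<Union> (range (\<lambda>n::nat. {- real n .. real n})) = space lborel0" by auto
 qed (auto simp: emeasure_lborel0 indicator_def)
qed

lemma nn_integral_nonzero_lborel:
 "(NN y|nonzero_lborel. f y) = (NN y|lborel. f y * indicator (- {0}) y)"
 unfolding nonzero_lborel_def by (rule nn_integral_restrict_space) simp

lemma AE_lborel_nonzero: "AE y in lborel. y \<noteq> (0::real)"
 using AE_lborel_singleton[of 0] by simp

locale posterior_model = prob_space M for M :: "'w measure" +
 fixes \<Theta> :: "'w \<Rightarrow> 'a::polish_space set \<Rightarrow> real"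
  and K :: "'w \<Rightarrow> enat" and \<psi> :: "nat \<Rightarrow> 'w \<Rightarrow> 'a" and \<theta> :: "nat \<Rightarrow> 'w \<Rightarrow> real"
  and Kfix :: nat and \<psi>fix :: "nat \<Rightarrow> 'a" and ffix :: "nat \<Rightarrow> real \<Rightarrow> real"
  and L :: "'a \<Rightarrow> real measure"
  and \<nu> :: "real measure" and g :: "real \<Rightarrow> real" and G :: "'a measure"
  and Hfix Hord :: "real \<Rightarrow> real measure" and hfix hord :: "real \<Rightarrow> real \<Rightarrow> real"
  and m :: nat and x :: "nat \<Rightarrow> nat \<Rightarrow> 'w \<Rightarrow> real" and X :: "nat \<Rightarrow> 'w \<Rightarrow> 'a set \<Rightarrow> real"
 assumes fixed_inj: "inj_on \<psi>fix {..<Kfix}"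
  and fixed_density: "\<And>k. k < Kfix \<Longrightarrow> ffix k \<in> borel_measurable borel \<and> (\<forall>t. 0 \<le> ffix k t)
     \<and> L (\<psi>fix k) = density lborel (\<lambda>t. ennreal (ffix k t))"
  and rep: "crsm_representation M \<Theta> (\<psi>fix ` {..<Kfix}) L zero_signed_measure (G \<Otimes>\<^sub>M \<nu>)"
  and nu_sets: "sets \<nu> = sets nonzero_borel" and nu_sigma_finite: "sigma_finite_measure \<nu>"
  and G_sets: "sets G = sets borel" and G_prob: "prob_space G" and G_atomless: "\<And>s. emeasure G {s} = 0"
  and g_measurable: "g \<in> borel_measurable nonzero_borel" and g_pos: "\<And>t. t \<noteq> 0 \<Longrightarrow> 0 < g t"
  and nu_density: "\<nu> = density nonzero_lborel (\<lambda>t. ennreal (g t))"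
  and series: "atomic_series M K \<psi> \<theta> \<Theta>"
  and atoms: "AE w in M. enat Kfix \<le> K w \<and> inj_on (\<lambda>k. \<psi> k w) {k. enat k < K w}
     \<and> (\<forall>k<Kfix. \<psi> k w = \<psi>fix k) \<and> (\<forall>k\<ge>Kfix. enat k < K w \<longrightarrow> \<theta> k w \<noteq> 0)"
  and Hfix_kernel: "Hfix \<in> borel \<rightarrow>\<^sub>M prob_algebra borel"
  and hfix_measurable: "(\<lambda>(t, y). hfix t y) \<in> borel_measurable pair_borel"
  and hfix_nonneg: "\<And>t y. 0 \<le> hfix t y"
  and hfix_density: "\<And>t. Hfix t = density lborel (\<lambda>y. ennreal (hfix t y))"
  and Hord_kernel: "Hord \<in> borel \<rightarrow>\<^sub>M prob_algebra borel"
  and hord_measurable: "(\<lambda>(t, y). hord t y) \<in> borel_measurable point_borel"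
  and hord_nonneg: "\<And>t y. y \<noteq> 0 \<Longrightarrow> 0 \<le> hord t y"
  and hord_density: "\<And>t. restrict_space (Hord t) (- {0}) = density nonzero_lborel (\<lambda>y. ennreal (hord t y))"
  and A2': "(NN t|\<nu>. (NN y|nonzero_lborel. ennreal (hord t y))) < \<infinity>"
  and m_pos: "1 \<le> m"
  and X_series: "\<And>j. j < m \<Longrightarrow> atomic_series M K \<psi> (x j) (X j)"
  and x_cond: "conditionally_independent_weights M m K \<psi> \<theta> (\<lambda>k. if k < Kfix then Hfix else Hord) x"
begin

abbreviation "S \<equiv> \<psi>fix ` {..<Kfix}"

abbreviation "data w \<equiv> \<lambda>j\<in>{..<m}. X j w"

text \<open>The extension of the density of \<open>\<nu>\<close> by 0 at the origin, which turns
  integrals with respect to \<open>\<nu>\<close> into Lebesgue integrals over the whole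
  line.\<close>

definition g0 :: "real \<Rightarrow> ennreal" where "g0 t = (if t = 0 then 0 else ennreal (g t))"

text \<open>The prior density of the weight as a function of the location: the given law at a fixed
  location, the density of the weight measure elsewhere. Together with \<open>lik\<close> it puts
  both kinds of atoms into one formula.\<close>

definition wt :: "'a \<Rightarrow> real \<Rightarrow> ennreal" where
 "wt s t = (\<Sum>k<Kfix. indicator {\<psi>fix k} s * ennreal (ffix k t)) + indicator (- S) s * g0 t"

definition lfix :: "real \<Rightarrow> real \<Rightarrow> ennreal" where "lfix t y = (if y = 0 then 0 else ennreal (hfix t y))"

definition lord :: "real \<Rightarrow> real \<Rightarrow> ennreal" where "lord t y = ennreal (mixed_density Hord hord t y)"

definition lik :: "'a \<Rightarrow> real \<Rightarrow> real \<Rightarrow> ennreal" where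
 "lik s t y = indicator S s * lfix t y + indicator (- S) s * lord t y"

lemma S_borel [measurable]: "S \<in> sets borel"
 by (intro borel_closed finite_imp_closed) simp

lemma g0_measurable [measurable]: "g0 \<in> borel_measurable borel"
proof -
 have "(\<lambda>t. if t \<in> - {0} then ennreal (g t) else 0) \<in> borel_measurable borel"
 proof (rule measurable_If_restrict_space_iff[THEN iffD2])
  show "(\<lambda>t. ennreal (g t)) \<in> borel_measurable (restrict_space borel {t. t \<in> - {0}}) \<and> (\<lambda>t. 0) \<in> borel_measurable (restrict_space borel {t. t \<notin> - {0}})"
   using g_measurable by (auto simp: nonzero_borel_def Compl_eq)
 qed simp
 then show ?thesis by (simp add: g0_def[abs_def] if_distrib cong: if_cong) (auto elim!: measurable_cong[THEN iffD1, rotated])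
qed

lemma wt_fix: "k < Kfix \<Longrightarrow> wt (\<psi>fix k) t = ennreal (ffix k t)"
proof -
 assume k: "k < Kfix"
 have "(\<Sum>k'<Kfix. indicator {\<psi>fix k'} (\<psi>fix k) * ennreal (ffix k' t)) = (\<Sum>k'\<in>{k}. indicator {\<psi>fix k'} (\<psi>fix k) * ennreal (ffix k' t))"
  using k fixed_inj by (intro sum.mono_neutral_right) (auto simp: indicator_def inj_on_def)
 with k show ?thesis by (simp add: wt_def)
qed

lemma wt_ord: "s \<notin> S \<Longrightarrow> wt s t = g0 t"
proof -
 assume s: "s \<notin> S"
 then have "(\<Sum>k<Kfix. indicator {\<psi>fix k} s * ennreal (ffix k t)) = 0" by (intro sum.neutral) (auto simp: indicator_def)
 with s show ?thesis by (simp add: wt_def)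
qed

lemma wt_measurable [measurable]: "(\<lambda>(s, t). wt s t) \<in> borel_measurable pair_borel"
proof -
 have [measurable]: "ffix k \<in> borel_measurable borel" if "k \<in> {..<Kfix}" for k using fixed_density that by simp
 show ?thesis unfolding wt_def[abs_def] by measurable
qed

lemma lfix_measurable: "(\<lambda>(t, y). lfix t y) \<in> borel_measurable pair_borel"
 unfolding lfix_def[abs_def] using hfix_measurable by measurable

lemma Hord_zero_measurable [measurable]: "(\<lambda>t. measure (Hord t) {0}) \<in> borel_measurable borel"
proof -
 have "(\<lambda>t. emeasure (Hord t) {0}) \<in> borel_measurable borel"
  by (rule measurable_compose[OF measurable_prob_algebraD[OF Hord_kernel] measurable_emeasure_subprob_algebra]) simp
 then show ?thesis unfolding measure_def by measurable
qed

lemma lord_measurable: "(\<lambda>(t, y). lord t y) \<in> borel_measurable pair_borel"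
proof -
 have "(\<lambda>p. if p \<in> UNIV \<times> - {0} then ennreal (hord (fst p) (snd p)) else ennreal (measure (Hord (fst p)) {0})) \<in> borel_measurable pair_borel"
 proof (rule measurable_If_restrict_space_iff[THEN iffD2])
  have "sets (restrict_space pair_borel (UNIV \<times> - {0::real})) = sets ((borel :: real measure) \<Otimes>\<^sub>M nonzero_borel)"
   by (rule set_eqI) (subst sets_restrict_space_iff, auto simp: sets_pair_nonzero_borel intro!: pair_measureI)
  then have "(\<lambda>p. ennreal (hord (fst p) (snd p))) \<in> borel_measurable (restrict_space pair_borel (UNIV \<times> - {0}))"
   using hord_measurable by (simp cong: measurable_cong_sets add: split_beta')
  moreover have "(\<lambda>p. ennreal (measure (Hord (fst p)) {0})) \<in> borel_measurable (restrict_space (borel \<Otimes>\<^sub>M (borel :: real measure)) {p. p \<notin> UNIV \<times> - {0}})"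
   by (intro measurable_restrict_space1) measurable
  ultimately show "(\<lambda>p. ennreal (hord (fst p) (snd p))) \<in> borel_measurable (restrict_space pair_borel {p. p \<in> UNIV \<times> - {0}}) \<and>
    (\<lambda>p. ennreal (measure (Hord (fst p)) {0})) \<in> borel_measurable (restrict_space (borel \<Otimes>\<^sub>M (borel :: real measure)) {p. p \<notin> UNIV \<times> - {0}})"
   by (simp only: mem_Collect_eq Collect_mem_eq)
 next
  have "UNIV \<times> - {0} \<in> sets ((borel :: real measure) \<Otimes>\<^sub>M (borel :: real measure))" by (intro pair_measureI) auto
  then show "{p \<in> space pair_borel. p \<in> UNIV \<times> - {0::real}} \<in> sets ((borel :: real measure) \<Otimes>\<^sub>M (borel :: real measure))"
   by (simp add: space_pair_measure)
 qed
 moreover have "(\<lambda>(t, y). lord t y) = (\<lambda>p. if p \<in> UNIV \<times> - {0} then ennreal (hord (fst p) (snd p)) else ennreal (measure (Hord (fst p)) {0}))"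
  by (auto simp: lord_def mixed_density_def fun_eq_iff)
 ultimately show ?thesis by simp
qed

lemma Hfix_prob: "prob_space (Hfix t)" and Hord_prob: "prob_space (Hord t)" and Hord_sets: "sets (Hord t) = sets borel"
 using measurable_space[OF Hfix_kernel, of t] measurable_space[OF Hord_kernel, of t] by (auto simp: space_prob_algebra)

lemma Hfix_lborel0: "Hfix t = density lborel0 (lfix t)"
proof (rule measure_eqI)
 have [measurable]: "lfix t \<in> borel_measurable borel" using measurable_compose[OF measurable_Pair1' lfix_measurable, of t] by simp
 have [measurable]: "hfix t \<in> borel_measurable borel" using measurable_compose[OF measurable_Pair1' hfix_measurable, of t] by simp
 show "sets (Hfix t) = sets (density lborel0 (lfix t))" by (simp add: hfix_density)
 fix A assume "A \<in> sets (Hfix t)"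
 then have [measurable]: "A \<in> sets borel" by (simp add: hfix_density)
 have "emeasure (density lborel0 (lfix t)) A = (NN y|lborel0. lfix t y * indicator A y)"
  by (rule emeasure_density) auto
 also have "\<dots> = (NN y|lborel. lfix t y * indicator A y)"
  by (subst nn_integral_lborel0) (auto simp: lfix_def)
 also have "\<dots> = (NN y|lborel. ennreal (hfix t y) * indicator A y)"
  by (rule nn_integral_cong_AE) (use AE_lborel_nonzero in \<open>eventually_elim, simp add: lfix_def\<close>)
 also have "\<dots> = emeasure (Hfix t) A" unfolding hfix_density by (rule emeasure_density[symmetric]) auto
 finally show "emeasure (Hfix t) A = emeasure (density lborel0 (lfix t)) A" by simp
qed

lemma Hord_lborel0: "Hord t = density lborel0 (lord t)"
proof (rule measure_eqI)
 interpret Ht: prob_space "Hord t" by (rule Hord_prob)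
 have [measurable]: "lord t \<in> borel_measurable borel" using measurable_compose[OF measurable_Pair1' lord_measurable, of t] by simp
 show "sets (Hord t) = sets (density lborel0 (lord t))" by (simp add: Hord_sets)
 fix A assume "A \<in> sets (Hord t)"
 then have A [measurable]: "A \<in> sets borel" by (simp add: Hord_sets)
 have "emeasure (density lborel0 (lord t)) A = (NN y|lborel0. lord t y * indicator A y)"
  by (rule emeasure_density) auto
 also have "\<dots> = (NN y|lborel. lord t y * indicator A y) + lord t 0 * indicator A 0"
  by (subst nn_integral_lborel0) auto
 also have "(NN y|lborel. lord t y * indicator A y) = (NN y|lborel. ennreal (hord t y) * indicator (A - {0}) y * indicator (- {0}) y)"
  by (rule nn_integral_cong_AE) (use AE_lborel_nonzero in \<open>eventually_elim, simp add: lord_def mixed_density_def indicator_def\<close>)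
 also have "\<dots> = (NN y|nonzero_lborel. ennreal (hord t y) * indicator (A - {0}) y)"
  by (simp add: nn_integral_nonzero_lborel)
 also have "\<dots> = emeasure (density nonzero_lborel (\<lambda>y. ennreal (hord t y))) (A - {0})"
 proof (rule emeasure_density[symmetric])
  have s: "sets nonzero_lborel = sets nonzero_borel" by (simp add: nonzero_lborel_def nonzero_borel_def sets_restrict_space)
  have "(\<lambda>y. hord t y) \<in> borel_measurable nonzero_borel"
   using measurable_compose[OF measurable_Pair1' hord_measurable, of t] by simp
  then show "(\<lambda>y. ennreal (hord t y)) \<in> borel_measurable nonzero_lborel" using s by (simp cong: measurable_cong_sets)
  show "A - {0} \<in> sets nonzero_lborel" unfolding s by (auto simp: sets_nonzero_borel)
 qed
 also have "\<dots> = emeasure (Hord t) (A - {0})"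
  unfolding hord_density[symmetric] by (rule emeasure_restrict_space) (auto simp: Hord_sets)
 also have "lord t 0 * indicator A 0 = emeasure (Hord t) (A \<inter> {0})"
  by (auto simp: lord_def mixed_density_def indicator_def Ht.emeasure_eq_measure)
 also have "emeasure (Hord t) (A - {0}) + emeasure (Hord t) (A \<inter> {0}) = emeasure (Hord t) ((A - {0}) \<union> (A \<inter> {0}))"
  by (rule plus_emeasure) (auto simp: Hord_sets)
 also have "(A - {0}) \<union> (A \<inter> {0}) = A" by auto
 finally show "emeasure (Hord t) A = emeasure (density lborel0 (lord t)) A" by simp
qed

lemma lik_fix: "s \<in> S \<Longrightarrow> lik s = lfix" and lik_ord: "s \<notin> S \<Longrightarrow> lik s = lord"
 by (auto simp: lik_def fun_eq_iff)

sublocale marked_atoms M m K \<psi> \<theta> "\<lambda>k. if k < Kfix then Hfix else Hord" x lborel0 "\<lambda>k. if k < Kfix then lfix else lord"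
proof (intro marked_atoms.intro marked_atoms_axioms.intro)
 show "conditionally_independent_weights M m K \<psi> \<theta> (\<lambda>k. if k < Kfix then Hfix else Hord) x" by (rule x_cond)
 show "K \<in> M \<rightarrow>\<^sub>M count_space UNIV" "\<psi> k \<in> borel_measurable M" "\<theta> k \<in> borel_measurable M" for k
  using series by (auto simp: atomic_series_def)
 show "x j k \<in> borel_measurable M" if "j < m" for j k using X_series[OF that] by (auto simp: atomic_series_def)
 show "(if k < Kfix then Hfix else Hord) t = density lborel0 ((if k < Kfix then lfix else lord) t)" for k t
  by (simp add: Hfix_lborel0 Hord_lborel0)
 show "prob_space ((if k < Kfix then Hfix else Hord) t)" for k t by (simp add: Hfix_prob Hord_prob)
 show "(\<lambda>(t, y). (if k < Kfix then lfix else lord) t y) \<in> borel_measurable pair_borel" for k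
  using lfix_measurable lord_measurable by simp
qed (rule prob_space_axioms sigma_finite_lborel0 sets_lborel0)+

end

text \<open>Subtraction of extended values is legitimate because the integral of \<open>q\<close> is
  finite and \<open>e\<close> is bounded by 1.\<close>

lemma nn_integral_one_minus:
 assumes [measurable]: "e \<in> borel_measurable M" "q \<in> borel_measurable M" and e: "\<And>z. e z \<le> (1::ennreal)"
  and fin: "(NN z|M. q z) < \<top>"
 shows "(NN z|M. (1 - e z) * q z) = (NN z|M. q z) - (NN z|M. e z * q z)"
proof -
 have "(NN z|M. q z) = (NN z|M. (1 - e z) * q z + e z * q z)"
  by (intro nn_integral_cong) (simp add: distrib_right[symmetric] diff_add_cancel_ennreal e)
 also have "\<dots> = (NN z|M. (1 - e z) * q z) + (NN z|M. e z * q z)"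
  by (rule nn_integral_add) measurable
 finally have sum: "(NN z|M. q z) = (NN z|M. (1 - e z) * q z) + (NN z|M. e z * q z)" .
 moreover have "(NN z|M. e z * q z) \<noteq> \<top>"
  using fin sum by auto
 ultimately show ?thesis by simp
qed

section \<open>The Laplace functional of the marked atoms\<close>

context posterior_model
begin

text \<open>The outcomes on which the enumeration describes \<open>\<Theta>\<close> and all
  \<open>X j\<close> exactly. Nonzero weights are demanded of every atom: for the ordinary ones this
  is part of the model, for the fixed ones it follows from their densities.\<close>

definition "good w \<longleftrightarrow> enat Kfix \<le> K w \<and> inj_on (\<lambda>k. \<psi> k w) {k. enat k < K w} \<and> (\<forall>k<Kfix. \<psi> k w = \<psi>fix k) \<and>
 (\<forall>k. enat k < K w \<longrightarrow> \<theta> k w \<noteq> 0) \<and>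
 (\<forall>B\<in>bounded_borel. ((\<lambda>k. \<theta> k w) has_sum \<Theta> w B) {k\<in>{k. enat k < K w}. \<psi> k w \<in> B}) \<and>
 (\<forall>j<m. \<forall>B\<in>bounded_borel. ((\<lambda>k. x j k w) has_sum X j w B) {k\<in>{k. enat k < K w}. \<psi> k w \<in> B})"

lemma L_null: "s \<in> S \<Longrightarrow> emeasure (L s) {0} = 0"
proof -
 assume "s \<in> S"
 then obtain k where k: "k < Kfix" "s = \<psi>fix k" by auto
 then have "emeasure (L s) {0} = (NN t|lborel. ennreal (ffix k t) * indicator {0} t)"
  using fixed_density[of k] by (simp add: emeasure_density)
 also have "\<dots> = (NN t|(lborel :: real measure). 0)"
  by (rule nn_integral_cong_AE) (use AE_lborel_nonzero in \<open>eventually_elim, simp\<close>)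
 finally show ?thesis by simp
qed

lemma L_prob: "s \<in> S \<Longrightarrow> prob_space (L s)"
proof -
 assume s: "s \<in> S"
 from rep obtain Y where Y: "indep_vars (\<lambda>_. borel) Y S" "\<forall>s\<in>S. distr M borel (Y s) = L s"
  unfolding crsm_representation_def by blast
 with s have "L s = distr M borel (Y s)" "Y s \<in> borel_measurable M" by (auto simp: indep_vars_def2)
 then show ?thesis by (simp add: prob_space_distr)
qed

lemma nn_integral_L:
 assumes "s \<in> S" "f \<in> borel_measurable borel"
 shows "(NN t|(L s). f t) = (NN t|lborel. f t * wt s t)"
proof -
 obtain k where k: "k < Kfix" "s = \<psi>fix k" using assms(1) by auto
 with assms(2) fixed_density[of k] show ?thesis
  by (simp add: nn_integral_density wt_fix mult.commute)
qed

lemma AE_good: "AE w in M. good w"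
proof -
 have *: "AE w in M. \<forall>s\<in>S. \<Theta> w {s} \<noteq> 0"
  using crsm_laplace(2)[OF rep G_sets G_prob G_atomless nu_sets nu_sigma_finite _ L_null, of "\<lambda>_. 0"] by simp
 have "AE w in M. \<forall>B\<in>bounded_borel. ((\<lambda>k. \<theta> k w) has_sum \<Theta> w B) {k. enat k < K w \<and> \<psi> k w \<in> B}"
  using series by (simp add: atomic_series_def)
 moreover have "AE w in M. \<forall>j\<in>{..<m}. \<forall>B\<in>bounded_borel. ((\<lambda>k. x j k w) has_sum X j w B) {k. enat k < K w \<and> \<psi> k w \<in> B}"
  by (rule AE_ball_countable') (use X_series in \<open>auto simp: atomic_series_def\<close>)
 ultimately show ?thesis using * atoms
 proof eventually_elim
  case (elim w)
  have hs: "\<forall>B\<in>bounded_borel. ((\<lambda>k. \<theta> k w) has_sum \<Theta> w B) {k\<in>{k. enat k < K w}. \<psi> k w \<in> B}"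
   using elim(1) by simp
  have inj: "inj_on (\<lambda>k. \<psi> k w) {k. enat k < K w}" using elim(4) by simp
  have "\<theta> k w \<noteq> 0" if k: "enat k < K w" for k
  proof (cases "k < Kfix")
   case True
   have "\<Theta> w {\<psi> k w} = \<theta> k w" using has_sum_enum_singleton(1)[OF hs inj] k by simp
   with True elim(3,4) show ?thesis by auto
  next
   case False
   with elim(4) k show ?thesis by simp
  qed
  with elim hs show ?case by (simp add: good_def)
 qed
qed

text \<open>The conditional law of a mark depends on the index, whereas \<open>wt\<close> and
  \<open>lik\<close> depend on the location; distinct locations make the two classifications
  agree.\<close>

lemma good_notin_S: "good w \<Longrightarrow> enat k < K w \<Longrightarrow> \<psi> k w \<in> S \<longleftrightarrow> k < Kfix"
proof
 assume g: "good w" and k: "enat k < K w" and "\<psi> k w \<in> S"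
 then obtain k' where k': "k' < Kfix" "\<psi> k w = \<psi> k' w" by (auto simp: good_def)
 moreover have "enat k' < K w" using k'(1) g by (metis good_def enat_ord_simps(2) order_less_le_trans)
 ultimately have "k = k'" using g k by (auto simp: good_def inj_on_def)
 with k' show "k < Kfix" by simp
qed (auto simp: good_def)

lemma good_Theta:
 assumes "good w" "f \<in> borel_measurable pair_borel"
 shows "(NN p|(atom_process (\<Theta> w)). f p) = (\<Sum>k. if enat k < K w then f (atom k w) else 0)"
proof -
 have "(NN p|(atom_process (\<Theta> w)). f p) = (\<Sum>k. if k \<in> {k. enat k < K w} then f (atom k w) else 0)"
  using assms has_sum_enum_singleton[where y = "\<lambda>k. \<theta> k w" and \<xi> = "\<Theta> w" and I = "{k. enat k < K w}" and \<psi> = "\<lambda>k. \<psi> k w"]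
  by (intro nn_integral_atom_process_enum) (auto simp: good_def)
 then show ?thesis by simp
qed

abbreviation "obs w \<equiv> vector_atoms m (data w)"

definition "zero_marks = {v \<in> space RV. \<forall>j<m. v j = 0}"

lemma zero_marks_sets [measurable]: "zero_marks \<in> sets RV"
 unfolding zero_marks_def RV_def by measurable

lemma xv_zero: "xv k w \<in> zero_marks \<longleftrightarrow> (\<forall>j<m. x j k w = 0)"
 by (auto simp: zero_marks_def xv_def space_RV)

lemma good_X:
 assumes "good w" "f \<in> borel_measurable (borel \<Otimes>\<^sub>M RV)"
 shows "(NN p|(obs w). f p) =
  (\<Sum>k. if enat k < K w then if xv k w \<in> zero_marks then 0 else f (\<psi> k w, xv k w) else 0)"
proof -
 have "(NN p|(obs w). f p) =
   (\<Sum>k. if k \<in> {k. enat k < K w} \<and> (\<exists>j<m. x j k w \<noteq> 0) then f (\<psi> k w, \<lambda>j\<in>{..<m}. x j k w) else 0)"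
  using assms has_sum_enum_singleton[where y = "\<lambda>k. x j k w" and \<xi> = "X j w" and I = "{k. enat k < K w}" and \<psi> = "\<lambda>k. \<psi> k w" for j]
  by (intro nn_integral_vector_atoms_enum[where \<psi> = "\<lambda>k. \<psi> k w" and y = "\<lambda>j k. x j k w"]) (auto simp: good_def RV_def)
 also have "\<dots> = (\<Sum>k. if enat k < K w then if xv k w \<in> zero_marks then 0 else f (\<psi> k w, xv k w) else 0)"
  by (intro suminf_cong) (simp only: xv_zero, auto simp: xv_def)
 finally show ?thesis .
qed

lemma AE_G_notin_S: "AE s in G. s \<notin> S"
proof -
 have "emeasure G S = 0"
  using G_sets G_atomless by (subst emeasure_eq_sum_singleton) auto
 then have "S \<in> null_sets G" using G_sets by (auto simp: null_sets_def)
 from AE_not_in[OF this] show ?thesis .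
qed

lemma nn_integral_nu:
 assumes [measurable]: "f \<in> borel_measurable borel"
 shows "(NN t|\<nu>. f t) = (NN t|lborel. f t * g0 t)"
proof -
 have s: "sets nonzero_lborel = sets nonzero_borel" by (simp add: nonzero_lborel_def nonzero_borel_def sets_restrict_space)
 have gm [measurable]: "g \<in> borel_measurable nonzero_lborel" using g_measurable s by (simp cong: measurable_cong_sets)
 have fm [measurable]: "f \<in> borel_measurable nonzero_lborel" unfolding nonzero_lborel_def by (intro measurable_restrict_space1) simp
 have "(NN t|\<nu>. f t) = (NN t|nonzero_lborel. ennreal (g t) * f t)"
  unfolding nu_density by (rule nn_integral_density) measurable
 also have "\<dots> = (NN t|lborel. ennreal (g t) * f t * indicator (- {0}) t)"
  by (rule nn_integral_nonzero_lborel)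
 also have "\<dots> = (NN t|lborel. f t * g0 t)"
  by (intro nn_integral_cong) (auto simp: g0_def mult.commute)
 finally show ?thesis .
qed

lemma nn_integral_G_nu:
 assumes f [measurable]: "f \<in> borel_measurable pair_borel"
 shows "(NN p|(G \<Otimes>\<^sub>M \<nu>). f p) = (NN s|G. NN t|lborel. f (s, t) * g0 t)"
proof -
 interpret nu: sigma_finite_measure \<nu> by (rule nu_sigma_finite)
 have sF: "sets (G \<Otimes>\<^sub>M \<nu>) = sets point_borel" using G_sets nu_sets by (intro sets_pair_measure_cong) auto
 have "f \<in> borel_measurable (G \<Otimes>\<^sub>M \<nu>)" using measurable_pair_nonzero_borel[OF f] sF by (simp cong: measurable_cong_sets)
 then have "(NN p|(G \<Otimes>\<^sub>M \<nu>). f p) = (NN s|G. NN t|\<nu>. f (s, t))"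
  by (rule nu.nn_integral_fst[symmetric])
 also have "\<dots> = (NN s|G. NN t|lborel. f (s, t) * g0 t)"
  by (intro nn_integral_cong nn_integral_nu) measurable
 finally show ?thesis .
qed

text \<open>\<open>wt\<close> may stand in both factors, since \<open>G\<close> does not charge the
  fixed locations and \<open>wt\<close> is \<open>g0\<close> elsewhere.\<close>

lemma prior_laplace:
 assumes f [measurable]: "f \<in> borel_measurable pair_borel"
 shows "(NN w|M. eneg (\<Sum>k. if enat k < K w then f (atom k w) else 0)) =
  eneg (NN s|G. NN t|lborel. (1 - eneg (f (s, t))) * wt s t) * (\<Prod>s\<in>S. NN t|lborel. eneg (f (s, t)) * wt s t)"
proof -
 have "(NN w|M. eneg (\<Sum>k. if enat k < K w then f (atom k w) else 0)) = (NN w|M. eneg (NN p|(atom_process (\<Theta> w)). f p))"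
  by (rule nn_integral_cong_AE) (use AE_good in \<open>eventually_elim, simp add: good_Theta f\<close>)
 also have "\<dots> = eneg (NN p|(G \<Otimes>\<^sub>M \<nu>). 1 - eneg (f p)) * (\<Prod>s\<in>S. NN t|(L s). eneg (f (s, t)))"
  by (rule crsm_laplace(1)[OF rep G_sets G_prob G_atomless nu_sets nu_sigma_finite _ L_null f]) simp
 also have "(\<Prod>s\<in>S. NN t|(L s). eneg (f (s, t))) = (\<Prod>s\<in>S. NN t|lborel. eneg (f (s, t)) * wt s t)"
  by (intro prod.cong refl nn_integral_L) measurable
 also have "(NN p|(G \<Otimes>\<^sub>M \<nu>). 1 - eneg (f p)) = (NN s|G. NN t|lborel. (1 - eneg (f (s, t))) * g0 t)"
  by (rule nn_integral_G_nu) measurable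
 also have "\<dots> = (NN s|G. NN t|lborel. (1 - eneg (f (s, t))) * wt s t)"
  by (rule nn_integral_cong_AE) (use AE_G_notin_S in \<open>eventually_elim, simp add: wt_ord\<close>)
 finally show ?thesis .
qed

text \<open>The joint density of weight and marks of an atom at \<open>s\<close>; as a function of
  \<open>t\<close> alone it is the unnormalised posterior density.\<close>

definition "ulik s t v = wt s t * (\<Prod>j<m. lik s t (v j))"

text \<open>Some index of the right kind, since \<open>hv\<close> depends on its index only through
  the comparison with \<open>Kfix\<close>. The value 0 is such an index for
  \<open>s \<in> S\<close>, because \<open>S\<close> is then nonempty and \<open>Kfix\<close>
  positive.\<close>

definition "kof s = (if s \<in> S then 0 else Kfix)"

lemma lik_hv: "(\<Prod>j<m. lik s t (v j)) = hv (kof s) t v"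
proof (cases "s \<in> S")
 case True
 then have "0 < Kfix" by auto
 with True show ?thesis by (simp add: hv_def kof_def lik_fix)
qed (simp add: hv_def kof_def lik_ord)

lemma wt_meas2 [measurable (raw)]: "f \<in> N \<rightarrow>\<^sub>M borel \<Longrightarrow> b \<in> borel_measurable N \<Longrightarrow> (\<lambda>z. wt (f z) (b z)) \<in> borel_measurable N"
 using measurable_compose[OF measurable_Pair[of f N borel b borel] wt_measurable] by simp

lemma likp_meas [measurable (raw)]:
 assumes [measurable]: "f \<in> N \<rightarrow>\<^sub>M borel" "b \<in> borel_measurable N" "h \<in> N \<rightarrow>\<^sub>M RV"
 shows "(\<lambda>z. \<Prod>j<m. lik (f z) (b z) (h z j)) \<in> borel_measurable N"
proof -
 have "(\<lambda>z. h z j) \<in> borel_measurable N" if "j < m" for j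
  by (rule measurable_compose[OF assms(3) component_meas[OF that]])
 then have "(\<lambda>z. lik (f z) (b z) (h z j)) \<in> borel_measurable N" if "j < m" for j
  unfolding lik_def
  using that measurable_compose[OF measurable_Pair[of b N borel "\<lambda>z. h z j" borel] lfix_measurable]
   measurable_compose[OF measurable_Pair[of b N borel "\<lambda>z. h z j" borel] lord_measurable] by simp
 then show ?thesis by (intro borel_measurable_prod_ennreal) simp
qed

lemma ulik_meas [measurable (raw)]:
 assumes [measurable]: "f \<in> N \<rightarrow>\<^sub>M borel" "b \<in> borel_measurable N" "h \<in> N \<rightarrow>\<^sub>M RV"
 shows "(\<lambda>z. ulik (f z) (b z) (h z)) \<in> borel_measurable N"
 unfolding ulik_def by measurable

lemma id_lam [measurable (raw)]: "(\<lambda>v. v) \<in> lam \<rightarrow>\<^sub>M RV"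
 by (simp cong: measurable_cong_sets add: sets_lam)

lemma ulik_meas_tv [measurable]: "(\<lambda>z. ulik s (fst z) (snd z)) \<in> borel_measurable (borel \<Otimes>\<^sub>M RV)"
 by (rule ulik_meas) simp_all

lemma likp_meas_v: "(\<lambda>v. \<Prod>j<m. lik s t (v j)) \<in> borel_measurable lam"
 by (rule likp_meas[of "\<lambda>_. s" _ "\<lambda>_. t" "\<lambda>v. v"]) (simp_all add: id_lam)

lemma Fubini_lam:
 assumes "(\<lambda>(t, v). f t v) \<in> borel_measurable (borel \<Otimes>\<^sub>M RV)"
 shows "(NN t|lborel. NN v|lam. f t v) = (NN v|lam. NN t|lborel. f t v)"
proof -
 interpret lam: sigma_finite_measure lam by (rule sigma_finite_lam)
 interpret P: pair_sigma_finite lborel lam by unfold_locales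
 have "(\<lambda>(t, v). f t v) \<in> borel_measurable (lborel \<Otimes>\<^sub>M lam)"
  using assms by (simp cong: measurable_cong_sets sets_pair_measure_cong add: sets_lam)
 from P.Fubini'[OF this] show ?thesis by simp
qed

text \<open>The contributions of one location to the Laplace functional of the marked process:
  \<open>mark_gap\<close> is integrated in the Poisson exponent, \<open>mark_mass\<close> is the
  factor of a fixed atom. The marks are outermost, because the Bayes step is done for a given mark
  vector.\<close>

abbreviation "mark_gap F s \<equiv> NN v|lam. NN t|lborel. (1 - eneg (F ((s, t), v))) * ulik s t v"

abbreviation "mark_mass F s \<equiv> NN v|lam. NN t|lborel. eneg (F ((s, t), v)) * ulik s t v"

text \<open>The marking theorem: \<open>marking\<close> reduces the marked functional to the prior
  one, applied to \<open>lneg\<close> of the conditional expectation.\<close>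

lemma marked_laplace:
 assumes F [measurable]: "F \<in> borel_measurable (pair_borel \<Otimes>\<^sub>M RV)"
 shows "(NN w|M. eneg (\<Sum>k. if enat k < K w then F (marked_atom k w) else 0)) =
  eneg (NN s|G. mark_gap F s) *
  (\<Prod>s\<in>S. mark_mass F s)"
proof -
 interpret lam: sigma_finite_measure lam by (rule sigma_finite_lam)
 define Mb where "Mb p = (NN v|lam. eneg (F (p, v)) * (\<Prod>j<m. lik (fst p) (snd p) (v j)))" for p
 have Fl [measurable]: "F \<in> borel_measurable (pair_borel \<Otimes>\<^sub>M lam)"
  using F by (simp cong: measurable_cong_sets sets_pair_measure_cong add: sets_lam)
 have sl [measurable]: "snd \<in> ((borel :: 'a measure) \<Otimes>\<^sub>M (borel :: real measure)) \<Otimes>\<^sub>M lam \<rightarrow>\<^sub>M RV"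
  using measurable_compose[OF measurable_snd id_lam] by simp
 have Mb_meas [measurable]: "Mb \<in> borel_measurable pair_borel"
 proof -
  have [measurable]: "(\<lambda>z. \<Prod>j<m. lik (fst (fst z)) (snd (fst z)) (snd z j)) \<in> borel_measurable (pair_borel \<Otimes>\<^sub>M lam)"
   by (rule likp_meas[OF _ _ sl]) measurable
  have "(\<lambda>(p, v). eneg (F (p, v)) * (\<Prod>j<m. lik (fst p) (snd p) (v j))) \<in> borel_measurable (pair_borel \<Otimes>\<^sub>M lam)"
   unfolding split_beta' by (intro borel_measurable_times_ennreal) simp_all
  then show ?thesis unfolding Mb_def[abs_def] by (rule lam.borel_measurable_nn_integral)
 qed
 have Fv: "(\<lambda>v. eneg (F ((s, t), v))) \<in> borel_measurable lam" for s t
  by (rule measurable_compose[OF measurable_compose[OF measurable_Pair1' Fl] measurable_eneg]) (simp add: space_pair_measure)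
 have Fv1: "(\<lambda>v. 1 - eneg (F ((s, t), v))) \<in> borel_measurable lam" for s t
  using Fv[of s t] by measurable
 have q1: "(NN v|lam. (\<Prod>j<m. lik s t (v j))) = 1" for s t by (simp add: lik_hv hv_integral)
 have Mb1: "Mb p \<le> 1" for p
 proof -
  have "Mb p \<le> (NN v|lam. 1 * (\<Prod>j<m. lik (fst p) (snd p) (v j)))"
   unfolding Mb_def by (intro nn_integral_mono mult_right_mono) auto
  then show ?thesis by (simp add: q1)
 qed
 have "(NN w|M. eneg (\<Sum>k. if enat k < K w then F (marked_atom k w) else 0)) =
  (NN w|M. eneg (\<Sum>k. if enat k < K w then lneg (mbar (\<lambda>z. eneg (F z)) k (atom k w)) else 0))"
  by (rule marking[OF F])
 also have "\<dots> = (NN w|M. eneg (\<Sum>k. if enat k < K w then lneg (Mb (atom k w)) else 0))"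
 proof (rule nn_integral_cong_AE)
  show "AE w in M. eneg (\<Sum>k. if enat k < K w then lneg (mbar (\<lambda>z. eneg (F z)) k (atom k w)) else 0) =
    eneg (\<Sum>k. if enat k < K w then lneg (Mb (atom k w)) else 0)"
   using AE_good
  proof eventually_elim
   case (elim w)
   have "mbar (\<lambda>z. eneg (F z)) k (atom k w) = Mb (atom k w)" if "enat k < K w" for k
    using good_notin_S[OF elim that] by (simp add: mbar_def Mb_def hv_def lik_fix lik_ord)
   then show ?case by (intro arg_cong[where f = eneg] suminf_cong) simp
  qed
 qed
 also have "\<dots> = eneg (NN s|G. NN t|lborel. (1 - eneg (lneg (Mb (s, t)))) * wt s t) *
   (\<Prod>s\<in>S. NN t|lborel. eneg (lneg (Mb (s, t))) * wt s t)"
  by (rule prior_laplace[of "\<lambda>p. lneg (Mb p)"]) measurable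
 also have "(NN s|G. NN t|lborel. (1 - eneg (lneg (Mb (s, t)))) * wt s t) =
   (NN s|G. mark_gap F s)"
 proof (rule nn_integral_cong)
  fix s
  \<comment> \<open>The likelihood integrates to 1 over the marks, so \<open>1 - Mb\<close> is
    itself an integral over the marks, with integrand \<open>1 - eneg F\<close>.\<close>
  have "(1 - eneg (lneg (Mb (s, t)))) * wt s t = (NN v|lam. (1 - eneg (F ((s, t), v))) * ulik s t v)" for t
  proof -
   have "(NN v|lam. (1 - eneg (F ((s, t), v))) * (\<Prod>j<m. lik s t (v j))) =
     (NN v|lam. (\<Prod>j<m. lik s t (v j))) - (NN v|lam. eneg (F ((s, t), v)) * (\<Prod>j<m. lik s t (v j)))"
    by (rule nn_integral_one_minus[OF Fv likp_meas_v]) (auto simp: q1)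
   also have "\<dots> = 1 - Mb (s, t)" by (simp add: q1 Mb_def)
   finally have "(1 - Mb (s, t)) * wt s t = wt s t * (NN v|lam. (1 - eneg (F ((s, t), v))) * (\<Prod>j<m. lik s t (v j)))"
    by (simp add: mult.commute)
   also have "\<dots> = (NN v|lam. wt s t * ((1 - eneg (F ((s, t), v))) * (\<Prod>j<m. lik s t (v j))))"
    by (intro nn_integral_cmult[symmetric] borel_measurable_times_ennreal Fv1 likp_meas_v)
   finally show ?thesis by (simp add: Mb1 ulik_def mult_ac)
  qed
  then have "(NN t|lborel. (1 - eneg (lneg (Mb (s, t)))) * wt s t) = (NN t|lborel. NN v|lam. (1 - eneg (F ((s, t), v))) * ulik s t v)"
   by simp
  also have "\<dots> = (mark_gap F s)"
   by (rule Fubini_lam) measurable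
  finally show "(NN t|lborel. (1 - eneg (lneg (Mb (s, t)))) * wt s t) = (mark_gap F s)" .
 qed
 also have "(\<Prod>s\<in>S. NN t|lborel. eneg (lneg (Mb (s, t))) * wt s t) = (\<Prod>s\<in>S. mark_mass F s)"
 proof (intro prod.cong refl)
  fix s
  have "eneg (lneg (Mb (s, t))) * wt s t = (NN v|lam. eneg (F ((s, t), v)) * ulik s t v)" for t
  proof -
   have "eneg (lneg (Mb (s, t))) * wt s t = wt s t * (NN v|lam. eneg (F ((s, t), v)) * (\<Prod>j<m. lik s t (v j)))"
    by (simp add: Mb1, simp add: Mb_def mult.commute)
   also have "\<dots> = (NN v|lam. wt s t * (eneg (F ((s, t), v)) * (\<Prod>j<m. lik s t (v j))))"
    by (intro nn_integral_cmult[symmetric] borel_measurable_times_ennreal Fv likp_meas_v)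
   finally show ?thesis by (simp add: ulik_def mult_ac)
  qed
  then have "(NN t|lborel. eneg (lneg (Mb (s, t))) * wt s t) = (NN t|lborel. NN v|lam. eneg (F ((s, t), v)) * ulik s t v)"
   by simp
  also have "\<dots> = (mark_mass F s)"
   by (rule Fubini_lam) measurable
  finally show "(NN t|lborel. eneg (lneg (Mb (s, t))) * wt s t) = (mark_mass F s)" .
 qed
 finally show ?thesis .
qed

end

section \<open>Purely atomic signed measures\<close>

lemma countable_atoms:
 assumes "\<xi> \<in> space signed_measure_space" "B \<in> bounded_borel"
 shows "countable {s\<in>B. \<xi> {s} \<noteq> 0}"
proof -
 have "{s\<in>B. \<xi> {s} \<noteq> 0} = (\<Union>n. {s\<in>B. 1 / Suc n \<le> \<bar>\<xi> {s}\<bar>})"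
 proof (intro equalityI subsetI)
  fix s assume s: "s \<in> {s\<in>B. \<xi> {s} \<noteq> 0}"
  then obtain n where "1 / Suc n < \<bar>\<xi> {s}\<bar>" using nat_approx_posE[of "\<bar>\<xi> {s}\<bar>"] by auto
  with s show "s \<in> (\<Union>n. {s\<in>B. 1 / Suc n \<le> \<bar>\<xi> {s}\<bar>})" by (auto intro: less_imp_le)
 qed auto
 moreover have "countable (\<Union>n. {s\<in>B. 1 / Suc n \<le> \<bar>\<xi> {s}\<bar>})"
  by (rule countable_UN) (auto intro!: countable_finite finite_large_atoms[OF assms])
 ultimately show ?thesis by simp
qed

text \<open>A countable subset of a bounded set is again a bounded Borel set, so countable
  additivity makes the series of its atoms converge; with a constant sign this is absolute
  convergence.\<close>

lemma atoms_same_sign_summable: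
 fixes \<xi> :: "'a::metric_space set \<Rightarrow> real"
 assumes \<xi>: "\<xi> \<in> space signed_measure_space" and B: "B \<in> bounded_borel"
  and P: "countable P" "P \<subseteq> B" and c: "c = 1 \<or> c = -1" and pos: "\<And>s. s \<in> P \<Longrightarrow> 0 \<le> c * \<xi> {s}"
 shows "(NN s|(count_space P). ennreal (c * \<xi> {s})) < \<top>"
proof (cases "finite P")
 case True
 then show ?thesis by (simp add: nn_integral_count_space_finite)
next
 case False
 define f where "f = from_nat_into P"
 have bij: "bij_betw f UNIV P" unfolding f_def using P(1) False by (rule bij_betw_from_nat_into)
 have fP: "f n \<in> P" for n using bij by (auto simp: bij_betw_def)
 have U: "(\<Union>n. {f n}) = P" using bij by (auto simp: bij_betw_def)
 have PB: "P \<in> bounded_borel"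
  using P by (intro bounded_borel_subset[OF B]) (auto intro: sets.countable)
 have "(\<lambda>n. \<xi> {f n}) sums \<xi> (\<Union>n. {f n})"
 proof (rule signed_measure_sums[OF \<xi>])
  show "disjoint_family (\<lambda>n. {f n})" using bij by (auto simp: disjoint_family_on_def bij_betw_def inj_def)
  show "range (\<lambda>n. {f n}) \<subseteq> bounded_borel" by auto
  show "(\<Union>n. {f n}) \<in> bounded_borel" unfolding U by (rule PB)
 qed
 then have s: "summable (\<lambda>n. c * \<xi> {f n})" by (intro summable_mult) (auto simp: sums_iff)
 have "(NN s|(count_space P). ennreal (c * \<xi> {s})) = (NN n|(count_space UNIV). ennreal (c * \<xi> {f n}))"
  by (rule nn_integral_bij_count_space[OF bij, symmetric])
 also have "\<dots> = (\<Sum>n. ennreal (c * \<xi> {f n}))" by (rule nn_integral_count_space_nat)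
 also have "\<dots> = ennreal (\<Sum>n. c * \<xi> {f n})" using s pos fP by (intro suminf_ennreal2) auto
 also have "\<dots> < \<top>" by simp
 finally show ?thesis .
qed

lemma measurable_weight [measurable]: "(\<lambda>p. indicator B (fst p) * snd p :: real) \<in> borel_measurable point_borel"
 if "B \<in> sets (borel :: 'a::topological_space measure)" for B
proof (rule measurable_pair_nonzero_borel, rule borel_measurable_times)
 have "(indicator B :: 'a \<Rightarrow> real) \<in> borel_measurable borel" using that by (rule borel_measurable_indicator)
 from measurable_compose[OF measurable_fst this]
 show "(\<lambda>p. indicator B (fst p) :: real) \<in> borel_measurable (borel \<Otimes>\<^sub>M (borel :: real measure))" .
qed (rule measurable_snd)

text \<open>The atoms in \<open>B\<close> are split by sign, and each part is summable by
  \<open>atoms_same_sign_summable\<close>.\<close>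

lemma integrable_atom_process:
 fixes \<xi> :: "'a::{metric_space, second_countable_topology} set \<Rightarrow> real"
 assumes \<xi>: "\<xi> \<in> space signed_measure_space" and B: "B \<in> bounded_borel"
 shows "integrable (atom_process \<xi>) (\<lambda>p. indicator B (fst p) * snd p)"
proof (rule integrableI_bounded)
 have BS: "B \<in> sets borel" using B by (rule bounded_borel_sets)
 show "(\<lambda>p. indicator B (fst p) * snd p) \<in> borel_measurable (atom_process \<xi>)"
  using measurable_weight[OF BS] by (simp cong: measurable_cong_sets)
 define P where "P c = {s\<in>B. 0 < c * \<xi> {s}}" for c :: real
 have fin: "(NN s|(count_space (P c)). ennreal (c * \<xi> {s})) < \<top>" if "c = 1 \<or> c = -1" for c
 proof (rule atoms_same_sign_summable[OF \<xi> B _ _ that])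
  show "countable (P c)" using countable_atoms[OF \<xi> B] by (rule countable_subset[rotated]) (auto simp: P_def)
 qed (auto simp: P_def)
 have "(NN p|(atom_process \<xi>). ennreal (norm (indicator B (fst p) * snd p))) =
   (NN s|(count_space {s. \<xi> {s} \<noteq> 0}). ennreal (norm (indicator B s * \<xi> {s})))"
 proof (subst nn_integral_atom_process)
  show "(\<lambda>p. ennreal (norm (indicator B (fst p) * snd p))) \<in> borel_measurable point_borel"
   using measurable_weight[OF BS] by measurable
 qed simp
 also have "\<dots> = (NN s|(count_space UNIV). ennreal (norm (indicator B s * \<xi> {s})) * indicator {s. \<xi> {s} \<noteq> 0} s)"
  by (rule nn_integral_count_space_indicator) simp
 also have "\<dots> = (NN s|(count_space UNIV). ennreal (1 * \<xi> {s}) * indicator (P 1) s + ennreal (- 1 * \<xi> {s}) * indicator (P (- 1)) s)"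
  by (intro nn_integral_cong) (auto simp: P_def indicator_def abs_if not_less)
 also have "\<dots> = (NN s|(count_space UNIV). ennreal (1 * \<xi> {s}) * indicator (P 1) s) + (NN s|(count_space UNIV). ennreal (- 1 * \<xi> {s}) * indicator (P (- 1)) s)"
  by (rule nn_integral_add) auto
 also have "\<dots> = (NN s|(count_space (P 1)). ennreal (1 * \<xi> {s})) + (NN s|(count_space (P (- 1))). ennreal (- 1 * \<xi> {s}))"
  by (subst (1 2) nn_integral_count_space_indicator) auto
 also have "\<dots> < \<infinity>" using fin[of 1] fin[of "-1"] by simp
 finally show "(NN p|(atom_process \<xi>). ennreal (norm (indicator B (fst p) * snd p))) < \<infinity>" .
qed

text \<open>The signed measure rebuilt from its atoms. It is a measurable function of the counts of
  the atom process, so almost sure equality with it transfers statements about counts to whole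
  signed measures.\<close>

definition atomic_part :: "('a::metric_space set \<Rightarrow> real) \<Rightarrow> 'a set \<Rightarrow> real" where
 "atomic_part \<xi> = (\<lambda>B\<in>bounded_borel. \<integral>p. indicator B (fst p) * snd p \<partial>atom_process \<xi>)"

lemma atomic_part_space:
 fixes \<xi> :: "'a::{metric_space, second_countable_topology} set \<Rightarrow> real"
 assumes \<xi>: "\<xi> \<in> space signed_measure_space"
 shows "atomic_part \<xi> \<in> space signed_measure_space"
 unfolding space_signed_measure_space
proof (safe)
 show "atomic_part \<xi> \<in> extensional bounded_borel" by (simp add: atomic_part_def)
 fix A :: "nat \<Rightarrow> 'a set" assume A: "disjoint_family A" "range A \<subseteq> bounded_borel" "(\<Union>i. A i) \<in> bounded_borel"
 have AB: "A i \<in> bounded_borel" for i using A(2) by blast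
 have m: "(\<lambda>p. indicator B (fst p) * snd p :: real) \<in> borel_measurable (atom_process \<xi>)" if "B \<in> bounded_borel" for B
  using measurable_weight[OF bounded_borel_sets[OF that]] by (simp cong: measurable_cong_sets)
 have "(\<lambda>n. \<integral>p. (\<Sum>i<n. indicator (A i) (fst p) * snd p) \<partial>atom_process \<xi>) \<longlonglongrightarrow> (\<integral>p. indicator (\<Union>i. A i) (fst p) * snd p \<partial>atom_process \<xi>)"
 proof (rule integral_dominated_convergence)
  show "integrable (atom_process \<xi>) (\<lambda>p. norm (indicator (\<Union>i. A i) (fst p) * snd p))"
   by (intro integrable_norm integrable_atom_process \<xi> A)
  show "(\<lambda>p. indicator (\<Union>i. A i) (fst p) * snd p) \<in> borel_measurable (atom_process \<xi>)" by (rule m[OF A(3)])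
  show "(\<lambda>p. \<Sum>i<n. indicator (A i) (fst p) * snd p) \<in> borel_measurable (atom_process \<xi>)" for n
   by (intro borel_measurable_sum m AB)
  have part: "(\<Sum>i<n. indicator (A i) s) = (indicator (\<Union>i<n. A i) s :: real)" for n s
   using A(1) by (intro indicator_UN_disjoint[symmetric]) (auto intro: disjoint_family_on_mono)
  have eq: "(\<Sum>i<n. indicator (A i) (fst p) * snd p) = indicator (\<Union>i<n. A i) (fst p) * (snd p :: real)" for n p
   by (simp only: part[symmetric] sum_distrib_right)
  show "AE p in atom_process \<xi>. (\<lambda>n. \<Sum>i<n. indicator (A i) (fst p) * snd p) \<longlonglongrightarrow> indicator (\<Union>i. A i) (fst p) * snd p"
   unfolding eq
   by (intro AE_I2 tendsto_mult tendsto_const LIMSEQ_indicator_UN)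
  show "AE p in atom_process \<xi>. norm (\<Sum>i<n. indicator (A i) (fst p) * snd p) \<le> norm (indicator (\<Union>i. A i) (fst p) * snd p)" for n
   unfolding eq by (intro AE_I2) (auto simp: indicator_def)
 qed
 moreover have "(\<integral>p. (\<Sum>i<n. indicator (A i) (fst p) * snd p) \<partial>atom_process \<xi>) = (\<Sum>i<n. atomic_part \<xi> (A i))" for n
  using AB by (subst Bochner_Integration.integral_sum) (auto intro!: integrable_atom_process \<xi> simp: atomic_part_def)
 ultimately show "(\<lambda>i. atomic_part \<xi> (A i)) sums atomic_part \<xi> (\<Union>i. A i)"
  using A(3) by (simp add: sums_def atomic_part_def)
qed

lemma measurable_atomic_part_eval:
 fixes \<Xi> :: "'w \<Rightarrow> 'a::{metric_space, second_countable_topology} set \<Rightarrow> real"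
 assumes m: "\<And>A. A \<in> sets point_borel \<Longrightarrow> (\<lambda>w. emeasure (atom_process (\<Xi> w)) A) \<in> borel_measurable \<Omega>"
  and \<Xi>: "\<And>w. w \<in> space \<Omega> \<Longrightarrow> \<Xi> w \<in> space signed_measure_space" and B: "B \<in> bounded_borel"
 shows "(\<lambda>w. \<integral>p. indicator B (fst p) * snd p \<partial>atom_process (\<Xi> w)) \<in> borel_measurable \<Omega>"
proof -
 have w: "(\<lambda>p. indicator B (fst p) * snd p :: real) \<in> borel_measurable point_borel"
  by (rule measurable_weight[OF bounded_borel_sets[OF B]])
 have "(\<lambda>w. enn2real (NN p|(atom_process (\<Xi> w)). ennreal (indicator B (fst p) * snd p)) -
   enn2real (NN p|(atom_process (\<Xi> w)). ennreal (- (indicator B (fst p) * snd p)))) \<in> borel_measurable \<Omega>"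
 proof (intro borel_measurable_diff borel_measurable_enn2real)
  show "(\<lambda>w. NN p|(atom_process (\<Xi> w)). ennreal (indicator B (fst p) * snd p)) \<in> borel_measurable \<Omega>"
   by (rule measurable_nn_integral_kernel[OF sets_atom_process m measurable_compose[OF w measurable_ennreal]])
  show "(\<lambda>w. NN p|(atom_process (\<Xi> w)). ennreal (- (indicator B (fst p) * snd p))) \<in> borel_measurable \<Omega>"
   by (rule measurable_nn_integral_kernel[OF sets_atom_process m measurable_compose[OF borel_measurable_uminus[OF w] measurable_ennreal]])
 qed
 moreover have "(\<integral>p. indicator B (fst p) * snd p \<partial>atom_process (\<Xi> w)) =
   enn2real (NN p|(atom_process (\<Xi> w)). ennreal (indicator B (fst p) * snd p)) -
   enn2real (NN p|(atom_process (\<Xi> w)). ennreal (- (indicator B (fst p) * snd p)))" if "w \<in> space \<Omega>" for w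
  by (rule real_lebesgue_integral_def[OF integrable_atom_process[OF \<Xi>[OF that] B]])
 ultimately show ?thesis by (subst measurable_cong) auto
qed

lemma measurable_atomic_part:
 fixes \<Xi> :: "'w \<Rightarrow> 'a::{metric_space, second_countable_topology} set \<Rightarrow> real"
 assumes m: "\<And>A. A \<in> sets point_borel \<Longrightarrow> (\<lambda>w. emeasure (atom_process (\<Xi> w)) A) \<in> borel_measurable \<Omega>"
  and \<Xi>: "\<And>w. w \<in> space \<Omega> \<Longrightarrow> \<Xi> w \<in> space signed_measure_space"
 shows "(\<lambda>w. atomic_part (\<Xi> w)) \<in> \<Omega> \<rightarrow>\<^sub>M signed_measure_space"
proof (rule measurable_signed_measure_spaceI)
 show "(\<lambda>w. atomic_part (\<Xi> w) B) \<in> borel_measurable \<Omega>" if "B \<in> bounded_borel" for B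
  using measurable_atomic_part_eval[OF m \<Xi> that] that by (simp add: atomic_part_def)
qed (use \<Xi> atomic_part_space in blast)

text \<open>Unconditional sums of reals converge absolutely, so the enumerated sum over
  \<open>B\<close> equals the integral with respect to the atom process.\<close>

lemma atomic_part_enum:
 fixes \<xi> :: "'a::{metric_space, second_countable_topology} set \<Rightarrow> real"
 assumes \<xi>: "\<xi> \<in> space signed_measure_space"
  and hs: "\<forall>B\<in>bounded_borel. ((\<lambda>k. y k) has_sum \<xi> B) {k\<in>I. \<psi> k \<in> B}" and inj: "inj_on \<psi> (I :: nat set)"
 shows "atomic_part \<xi> = \<xi>"
proof (rule extensionalityI)
 show "atomic_part \<xi> \<in> extensional bounded_borel" "\<xi> \<in> extensional bounded_borel"
  using \<xi> by (auto simp: atomic_part_def space_signed_measure_space)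
 fix B :: "'a set" assume B: "B \<in> bounded_borel"
 note at = has_sum_enum_singleton[OF hs inj]
 define J where "J = {k\<in>I. y k \<noteq> 0}"
 have bij: "bij_betw \<psi> J {s. \<xi> {s} \<noteq> 0}"
 proof (rule bij_betw_imageI)
  show "inj_on \<psi> J" using inj by (rule inj_on_subset) (auto simp: J_def)
  show "\<psi> ` J = {s. \<xi> {s} \<noteq> 0}"
  proof (intro equalityI subsetI)
   fix s assume "s \<in> {s. \<xi> {s} \<noteq> 0}"
   then have s: "\<xi> {s} \<noteq> 0" by simp
   then obtain k where "k \<in> I" "s = \<psi> k" using at(2)[of s] by blast
   with s at(1)[of k] show "s \<in> \<psi> ` J" by (auto simp: J_def)
  qed (auto simp: J_def at(1))
 qed
 have w: "(\<lambda>p. indicator B (fst p) * snd p :: real) \<in> borel_measurable point_borel"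
  by (rule measurable_weight[OF bounded_borel_sets[OF B]])
 have "(\<integral>p. indicator B (fst p) * snd p \<partial>atom_process \<xi>) = (\<integral>s. indicator B s * \<xi> {s} \<partial>count_space {s. \<xi> {s} \<noteq> 0})"
  unfolding atom_process_def by (subst integral_distr[OF measurable_atom_process_point w]) simp
 also have "\<dots> = (\<integral>k. indicator B (\<psi> k) * \<xi> {\<psi> k} \<partial>count_space J)"
  by (rule integral_bij_count_space[OF bij, symmetric])
 also have "\<dots> = (\<integral>k. indicator {k\<in>I. \<psi> k \<in> B} k *\<^sub>R y k \<partial>count_space J)"
  by (intro Bochner_Integration.integral_cong) (auto simp: J_def at indicator_def)
 also have "\<dots> = infsetsum (\<lambda>k. indicator {k\<in>I. \<psi> k \<in> B} k *\<^sub>R y k) J" by (simp add: infsetsum_def)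
 also have "\<dots> = infsetsum y {k\<in>I. \<psi> k \<in> B}"
  by (intro infsetsum_cong_neutral) (auto simp: J_def indicator_def)
 also have "\<dots> = infsum y {k\<in>I. \<psi> k \<in> B}"
 proof (rule infsetsum_infsum)
  have "((\<lambda>k. y k) has_sum \<xi> B) {k\<in>I. \<psi> k \<in> B}" using hs B by blast
  then have "y summable_on {k\<in>I. \<psi> k \<in> B}" by (auto simp: summable_on_def)
  then have "(\<lambda>k. norm (y k)) summable_on {k\<in>I. \<psi> k \<in> B}" by (rule summable_on_iff_abs_summable_on_real[THEN iffD1])
  then show "Infinite_Set_Sum.abs_summable_on y {k\<in>I. \<psi> k \<in> B}" by (simp only: abs_summable_equivalent)
 qed
 also have "\<dots> = \<xi> B" using hs B by (intro infsumI) blast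
 finally show "atomic_part \<xi> B = \<xi> B" using B by (simp add: atomic_part_def)
qed

section \<open>Countably many sets determine a signed measure\<close>

lemma Int_stable_cells: "Int_stable {cell V n I | n I. True}"
proof (rule Int_stableI)
 fix A B assume "A \<in> {cell V n I | n I. True}" "B \<in> {cell V n I | n I. True}"
 then obtain n I n' I' where AB: "A = cell V n I" "B = cell V n' I'" by blast
 have e: "{} \<in> {cell V n I | n I. True}"
  using cell_empty[of "{0}" 0 V] by (intro CollectI exI[of _ 0] exI[of _ "{0}"]) simp
 show "A \<inter> B \<in> {cell V n I | n I. True}"
 proof (cases "A \<inter> B = {}")
  case False
  then have "A \<inter> B = A \<or> A \<inter> B = B"
   using cell_eq_or_disjoint[of n n' V I I'] cell_eq_or_disjoint[of n' n V I' I]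
   by (cases "n \<le> n'") (auto simp: AB Int_commute)
  then show ?thesis using AB by auto
 qed (use e in simp)
qed

lemma sets_borel_cells:
 "sets (borel :: 'a::second_countable_topology measure) = sigma_sets UNIV {cell base_seq n I | n I. True}"
proof
 show "sigma_sets UNIV {cell base_seq n I | n I. True} \<subseteq> sets (borel :: 'a measure)"
 proof -
  have "{cell base_seq n I | n I. True} \<subseteq> sets (borel :: 'a measure)" by (auto intro: cell_base_seq_sets)
  from sets.sigma_sets_subset[OF this] show ?thesis by simp
 qed
 have "(base_seq k :: 'a set) \<in> sigma_sets UNIV {cell base_seq n I | n I. True}" for k :: nat
 proof -
  have "(base_seq k :: 'a set) = (\<Union>I\<in>{I\<in>Pow {..<Suc k}. k \<in> I}. cell base_seq (Suc k) I)"
   by (auto simp: in_cell_iff code_def)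
  moreover have "(\<Union>I\<in>{I\<in>Pow {..<Suc k}. k \<in> I}. (cell base_seq (Suc k) I :: 'a set)) \<in> sigma_sets UNIV {cell base_seq n I | n I. True}"
   by (intro sigma_sets_UNION) (auto intro!: countable_image countable_finite sigma_sets.Basic)
  ultimately show ?thesis by simp
 qed
 then show "sets (borel :: 'a measure) \<subseteq> sigma_sets UNIV {cell base_seq n I | n I. True}"
  unfolding borel_eq_sigma_base_seq by (subst sets_measure_of) (auto intro!: sigma_sets_mono)
qed

text \<open>Cells form an intersection-stable generator. The intersections with balls keep all sets
  bounded, and a bounded set lies in one of the balls. The countable criterion makes equality of
  signed measures a measurable event.\<close>

lemma signed_measure_eqI:
 fixes \<xi> \<xi>' :: "'a::{metric_space, second_countable_topology} set \<Rightarrow> real"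
 assumes \<xi>: "\<xi> \<in> space signed_measure_space" and \<xi>': "\<xi>' \<in> space signed_measure_space"
  and eq: "\<And>n I r. I \<in> Pow {..<n} \<Longrightarrow> \<xi> (cell base_seq n I \<inter> ball x0 (real r)) = \<xi>' (cell base_seq n I \<inter> ball x0 (real r))"
 shows "\<xi> = \<xi>'"
proof (rule extensionalityI)
 show "\<xi> \<in> extensional bounded_borel" "\<xi>' \<in> extensional bounded_borel"
  using \<xi> \<xi>' by (auto simp: space_signed_measure_space)
 have bb: "ball x0 (real r) \<in> bounded_borel" for r by (simp add: bounded_borel_def)
 have UN: "cell base_seq 0 {} = (UNIV :: 'a set)" by (auto simp: in_cell_iff code_def)
 have D: "\<xi> (B \<inter> ball x0 (real r)) = \<xi>' (B \<inter> ball x0 (real r))" if "B \<in> sets borel" for B r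
  using Int_stable_cells subset_UNIV[of "{cell base_seq n I | n I. True}", unfolded Pow_UNIV[symmetric]] that[unfolded sets_borel_cells]
 proof (induction rule: sigma_sets_induct_disjoint)
  case (basic A)
  then obtain n I where A: "A = cell base_seq n I" by blast
  then show ?case
   using eq[of I n r] cell_empty[of I n "base_seq :: nat \<Rightarrow> 'a set"] signed_measure_empty[OF \<xi>] signed_measure_empty[OF \<xi>']
   by (cases "I \<in> Pow {..<n}") auto
 next
  case empty
  then show ?case using signed_measure_empty[OF \<xi>] signed_measure_empty[OF \<xi>'] by simp
 next
  case (compl A)
  then have A: "A \<in> sets borel" by (simp add: sets_borel_cells)
  have e: "(UNIV - A) \<inter> ball x0 (real r) = ball x0 (real r) - (A \<inter> ball x0 (real r))" by auto
  have AB: "A \<inter> ball x0 (real r) \<in> bounded_borel" by (rule bounded_borel_Int[OF bb A])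
  have "\<xi> (ball x0 (real r)) = \<xi>' (ball x0 (real r))" using eq[of "{}" 0 r] by (simp add: UN)
  then show ?case
   unfolding e using compl AB bb
   by (subst signed_measure_Diff[OF \<xi>], simp, simp, simp, subst signed_measure_Diff[OF \<xi>']) auto
 next
  case (union A)
  then have A: "A i \<in> sets borel" for i by (auto simp: sets_borel_cells)
  have AB: "A i \<inter> ball x0 (real r) \<in> bounded_borel" "(\<Union>i. A i \<inter> ball x0 (real r)) \<in> bounded_borel" for i
   using bounded_borel_Int[OF bb A] bounded_borel_Int[OF bb, of "\<Union>i. A i" r] A by auto
  have dj: "disjoint_family (\<lambda>i. A i \<inter> ball x0 (real r))" using union(1) by (auto simp: disjoint_family_on_def)
  have e: "(\<Union>i. A i) \<inter> ball x0 (real r) = (\<Union>i. A i \<inter> ball x0 (real r))" by auto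
  have "(\<lambda>i. \<xi> (A i \<inter> ball x0 (real r))) sums \<xi> (\<Union>i. A i \<inter> ball x0 (real r))"
   using AB dj by (intro signed_measure_sums[OF \<xi>]) auto
  moreover have "(\<lambda>i. \<xi>' (A i \<inter> ball x0 (real r))) sums \<xi>' (\<Union>i. A i \<inter> ball x0 (real r))"
   using AB dj by (intro signed_measure_sums[OF \<xi>']) auto
  ultimately show ?case unfolding e union(3) by (rule sums_unique2)
 qed
 fix B :: "'a set" assume B: "B \<in> bounded_borel"
 then obtain r where "B \<subseteq> ball x0 r" by (auto simp: bounded_borel_def dest: bounded_subset_ballD)
 moreover obtain n where "r \<le> real n" using real_arch_simple by blast
 ultimately have "B \<subseteq> ball x0 (real n)" using subset_ball by blast
 then have "B \<inter> ball x0 (real n) = B" by auto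
 with D[OF bounded_borel_sets[OF B], of n] show "\<xi> B = \<xi>' B" by simp
qed

section \<open>Countably many test functions\<close>

text \<open>Names for a countable family of functions: indicators of base sets inside a window,
  closed under rational combinations and maxima. Real combinations and Borel sets are reached by
  limits.\<close>

datatype test_term = Gen nat nat | Box nat | Lin rat rat test_term test_term | Mx test_term test_term

instance test_term :: countable by countable_datatype

primrec test_fun :: "(nat \<Rightarrow> 'b::second_countable_topology set) \<Rightarrow> test_term \<Rightarrow> 'b \<Rightarrow> real" where
 "test_fun D (Gen n p) = indicator (base_seq n \<inter> D p)"
| "test_fun D (Box p) = indicator (D p)"
| "test_fun D (Lin q r t u) = (\<lambda>z. of_rat q * test_fun D t z + of_rat r * test_fun D u z)"
| "test_fun D (Mx t u) = (\<lambda>z. max (test_fun D t z) (test_fun D u z))"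

text \<open>Only limits dominated inside one window are allowed; these are the limits with which
  Laplace functionals of locally finite processes are compatible.\<close>

inductive_set test_closure :: "(nat \<Rightarrow> 'b::second_countable_topology set) \<Rightarrow> ('b \<Rightarrow> real) set" for D where
 Base: "test_fun D t \<in> test_closure D"
| Lim: "(\<And>n. f n \<in> test_closure D) \<Longrightarrow> (\<And>n z. \<bar>f n z\<bar> \<le> real p * indicator (D p) z) \<Longrightarrow>
  (\<And>z. (\<lambda>n. f n z) \<longlonglongrightarrow> g z) \<Longrightarrow> g \<in> test_closure D"

text \<open>The two kinds of limits that are needed: dominated ones inside a window, for
  \<open>test_closure\<close>, and increasing ones, for the passage from bounded functions in a
  window to arbitrary functions.\<close>

definition laplace_cont :: "(nat \<Rightarrow> 'b::topological_space set) \<Rightarrow> (('b \<Rightarrow> ennreal) \<Rightarrow> ennreal) \<Rightarrow> bool" where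
 "laplace_cont D \<Phi> \<longleftrightarrow>
   (\<forall>f g. (\<forall>n::nat. f n \<in> borel_measurable borel) \<and> (\<forall>z. (\<lambda>n. f n z) \<longlonglongrightarrow> g z) \<and>
    ((\<exists>p. \<forall>n z. f n z \<le> of_nat p * indicator (D p) z) \<or> incseq f) \<longrightarrow> (\<lambda>n. \<Phi> (f n)) \<longlonglongrightarrow> \<Phi> g)"

lemma laplace_contD:
 assumes "laplace_cont D \<Phi>" "\<And>n::nat. f n \<in> borel_measurable borel" "\<And>z. (\<lambda>n. f n z) \<longlonglongrightarrow> g z"
 shows "(\<And>n z. f n z \<le> of_nat p * indicator (D p) z) \<Longrightarrow> (\<lambda>n. \<Phi> (f n)) \<longlonglongrightarrow> \<Phi> g"
  and "incseq f \<Longrightarrow> (\<lambda>n. \<Phi> (f n)) \<longlonglongrightarrow> \<Phi> g"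
 using assms unfolding laplace_cont_def by blast+

locale exhaustion =
 fixes D :: "nat \<Rightarrow> 'b::second_countable_topology set"
 assumes D_sets [measurable]: "D n \<in> sets borel" and D_mono: "incseq D"
begin

text \<open>An operation of linear growth maps 0 to 0, so the result is supported in the larger
  window. The obtained \<open>P\<close> does not depend on \<open>f\<close> and \<open>h\<close>,
  hence it serves a whole sequence at once.\<close>

lemma dominated_op:
 assumes op: "\<And>a b. \<bar>op a b\<bar> \<le> c * (\<bar>a\<bar> + \<bar>b\<bar>)"
 obtains P where "\<And>f h z. \<bar>f z\<bar> \<le> real p * indicator (D p) z \<Longrightarrow> \<bar>h z\<bar> \<le> real p' * indicator (D p') z \<Longrightarrow>
  \<bar>op (f z) (h z)\<bar> \<le> real P * indicator (D P) z"
proof -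
 obtain P0 where P0: "c * (real p + real p') \<le> real P0" using real_arch_simple by blast
 define P where "P = max P0 (max p p')"
 have c: "0 \<le> c" using op[of 1 0] by simp
 have sub: "D p \<subseteq> D P" "D p' \<subseteq> D P" using D_mono by (auto simp: P_def incseq_def)
 have "\<bar>op (f z) (h z)\<bar> \<le> real P * indicator (D P) z"
  if f: "\<bar>f z\<bar> \<le> real p * indicator (D p) z" and h: "\<bar>h z\<bar> \<le> real p' * indicator (D p') z" for f h z
 proof (cases "z \<in> D P")
  case True
  have "\<bar>f z\<bar> \<le> real p" using f by (cases "z \<in> D p") auto
  moreover have "\<bar>h z\<bar> \<le> real p'" using h by (cases "z \<in> D p'") auto
  ultimately
  have "c * (\<bar>f z\<bar> + \<bar>h z\<bar>) \<le> c * (real p + real p')" using c by (intro mult_left_mono add_mono)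
  with op[of "f z" "h z"] P0 have "\<bar>op (f z) (h z)\<bar> \<le> real P0" by linarith
  also have "\<dots> \<le> real P" by (simp add: P_def)
  finally show ?thesis using True by simp
 next
  case False
  with sub have "z \<notin> D p" "z \<notin> D p'" by auto
  with f h have "f z = 0" "h z = 0" by auto
  with op[of 0 0] False show ?thesis by simp
 qed
 then show thesis by (rule that)
qed

lemma lin_bound: "\<bar>q * a + r * b\<bar> \<le> (\<bar>q\<bar> + \<bar>r\<bar>) * (\<bar>a\<bar> + \<bar>b\<bar>)" for q a r b :: real
proof -
 have "\<bar>q * a + r * b\<bar> \<le> \<bar>q\<bar> * \<bar>a\<bar> + \<bar>r\<bar> * \<bar>b\<bar>" using abs_triangle_ineq[of "q * a" "r * b"] by (simp add: abs_mult)
 moreover have "0 \<le> \<bar>q\<bar> * \<bar>b\<bar>" "0 \<le> \<bar>r\<bar> * \<bar>a\<bar>" by auto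
 ultimately show ?thesis unfolding distrib_left distrib_right by linarith
qed

lemma max_bound: "\<bar>max a b\<bar> \<le> 1 * (\<bar>a\<bar> + \<bar>b\<bar>)" for a b :: real
 by (simp add: max_def)

lemma test_fun_bound: "\<exists>p. \<forall>z. \<bar>test_fun D t z\<bar> \<le> real p * indicator (D p) z"
proof (induction t)
 case (Gen n p)
 have "\<bar>test_fun D (Gen n p) z\<bar> \<le> real (Suc p) * indicator (D (Suc p)) z" for z
  using incseq_SucD[OF D_mono, of p] by (auto simp: indicator_def)
 then show ?case by blast
next
 case (Box p)
 have "\<bar>test_fun D (Box p) z\<bar> \<le> real (Suc p) * indicator (D (Suc p)) z" for z
  using incseq_SucD[OF D_mono, of p] by (auto simp: indicator_def)
 then show ?case by blast
next
 case (Lin q r t u)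
 then obtain p p' where b: "\<And>z. \<bar>test_fun D t z\<bar> \<le> real p * indicator (D p) z" "\<And>z. \<bar>test_fun D u z\<bar> \<le> real p' * indicator (D p') z" by blast
 obtain P where "\<And>f h z. \<bar>f z\<bar> \<le> real p * indicator (D p) z \<Longrightarrow> \<bar>h z\<bar> \<le> real p' * indicator (D p') z \<Longrightarrow>
  \<bar>of_rat q * f z + of_rat r * h z\<bar> \<le> real P * indicator (D P) z"
  using dominated_op[OF lin_bound[of "of_rat q" _ "of_rat r"], of p p'] by blast
 with b show ?case by (intro exI[of _ P]) simp
next
 case (Mx t u)
 then obtain p p' where b: "\<And>z. \<bar>test_fun D t z\<bar> \<le> real p * indicator (D p) z" "\<And>z. \<bar>test_fun D u z\<bar> \<le> real p' * indicator (D p') z" by blast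
 obtain P where "\<And>f h z. \<bar>f z\<bar> \<le> real p * indicator (D p) z \<Longrightarrow> \<bar>h z\<bar> \<le> real p' * indicator (D p') z \<Longrightarrow>
  \<bar>max (f z) (h z)\<bar> \<le> real P * indicator (D P) z"
  using dominated_op[OF max_bound, of p p'] by blast
 with b show ?case by (intro exI[of _ P]) simp
qed

lemma test_fun_measurable [measurable]: "test_fun D t \<in> borel_measurable borel"
 by (induction t) simp_all

lemma test_closure_measurable: "f \<in> test_closure D \<Longrightarrow> f \<in> borel_measurable borel"
proof (induction rule: test_closure.induct)
 case (Lim f p g)
 show ?case by (rule borel_measurable_LIMSEQ_real[OF Lim.hyps(3) Lim.IH])
qed simp

lemma closure_bound: "f \<in> test_closure D \<Longrightarrow> \<exists>p. \<forall>z. \<bar>f z\<bar> \<le> real p * indicator (D p) z"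
proof (induction rule: test_closure.induct)
 case (Lim f p g)
 have "\<bar>g z\<bar> \<le> real p * indicator (D p) z" for z
  using Lim.hyps(2)[of _ z] by (intro tendsto_upperbound[OF tendsto_rabs[OF Lim.hyps(3)[of z]]]) auto
 then show ?case by blast
qed (rule test_fun_bound)

text \<open>A double induction: with one argument a named function, limits are taken in the other;
  then limits are taken in the first argument with the second arbitrary.\<close>

lemma closure_op:
 assumes f: "f \<in> test_closure D" and h: "h \<in> test_closure D"
  and op: "\<And>a b. \<bar>op a b\<bar> \<le> c * (\<bar>a\<bar> + \<bar>b\<bar>)"
  and cont: "\<And>(a :: nat \<Rightarrow> real) b x y. a \<longlonglongrightarrow> x \<Longrightarrow> b \<longlonglongrightarrow> y \<Longrightarrow> (\<lambda>n. op (a n) (b n)) \<longlonglongrightarrow> op x y"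
  and base: "\<And>t u. (\<lambda>z. op (test_fun D t z) (test_fun D u z)) \<in> test_closure D"
 shows "(\<lambda>z. op (f z) (h z)) \<in> test_closure D"
 using f
proof (induction rule: test_closure.induct)
 case (Base t)
 show ?case using h
 proof (induction rule: test_closure.induct)
  case (Base u)
  show ?case by (rule base)
 next
  case (Lim f p g)
  obtain p' where p': "\<And>z. \<bar>test_fun D t z\<bar> \<le> real p' * indicator (D p') z" using test_fun_bound by blast
  obtain P where P: "\<And>f h z. \<bar>f z\<bar> \<le> real p' * indicator (D p') z \<Longrightarrow> \<bar>h z\<bar> \<le> real p * indicator (D p) z \<Longrightarrow>
   \<bar>op (f z) (h z)\<bar> \<le> real P * indicator (D P) z"
   using dominated_op[of op c p' p, OF op] by blast
  show ?case
  proof (rule test_closure.Lim[of "\<lambda>n z. op (test_fun D t z) (f n z)" _ P])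
   show "\<bar>op (test_fun D t z) (f n z)\<bar> \<le> real P * indicator (D P) z" for n z
    by (rule P[OF p' Lim.hyps(2)])
   show "(\<lambda>n. op (test_fun D t z) (f n z)) \<longlonglongrightarrow> op (test_fun D t z) (g z)" for z
    by (rule cont[OF tendsto_const Lim.hyps(3)])
  qed (rule Lim.IH)
 qed
next
 case (Lim f p g)
 obtain p' where p': "\<And>z. \<bar>h z\<bar> \<le> real p' * indicator (D p') z" using closure_bound[OF h] by blast
 obtain P where P: "\<And>f h z. \<bar>f z\<bar> \<le> real p * indicator (D p) z \<Longrightarrow> \<bar>h z\<bar> \<le> real p' * indicator (D p') z \<Longrightarrow>
  \<bar>op (f z) (h z)\<bar> \<le> real P * indicator (D P) z"
  using dominated_op[of op c p p', OF op] by blast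
 show ?case
 proof (rule test_closure.Lim[of "\<lambda>n z. op (f n z) (h z)" _ P])
  show "\<bar>op (f n z) (h z)\<bar> \<le> real P * indicator (D P) z" for n z
   by (rule P[OF Lim.hyps(2) p'])
  show "(\<lambda>n. op (f n z) (h z)) \<longlonglongrightarrow> op (g z) (h z)" for z
   by (rule cont[OF Lim.hyps(3) tendsto_const])
 qed (rule Lim.IH)
qed

lemma closure_lin: "f \<in> test_closure D \<Longrightarrow> h \<in> test_closure D \<Longrightarrow> (\<lambda>z. of_rat q * f z + of_rat r * h z) \<in> test_closure D"
 by (rule closure_op[where op = "\<lambda>a b. of_rat q * a + of_rat r * b", OF _ _ lin_bound])
   (auto intro!: tendsto_intros test_closure.Base[of D "Lin q r _ _", simplified])

lemma closure_max: "f \<in> test_closure D \<Longrightarrow> h \<in> test_closure D \<Longrightarrow> (\<lambda>z. max (f z) (h z)) \<in> test_closure D"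
 by (rule closure_op[where op = max, OF _ _ max_bound])
   (auto intro!: tendsto_max test_closure.Base[of D "Mx _ _", simplified])

lemma closure_add: "f \<in> test_closure D \<Longrightarrow> h \<in> test_closure D \<Longrightarrow> (\<lambda>z. f z + h z) \<in> test_closure D"
 using closure_lin[of f h 1 1] by simp

lemma closure_diff: "f \<in> test_closure D \<Longrightarrow> h \<in> test_closure D \<Longrightarrow> (\<lambda>z. f z - h z) \<in> test_closure D"
 using closure_lin[of f h 1 "-1"] by (simp add: of_rat_minus)

lemma closure_zero: "(\<lambda>z. 0) \<in> test_closure D"
 using closure_lin[OF test_closure.Base test_closure.Base, of 0 "Box 0" 0 "Box 0"] by simp

lemma closure_min: "f \<in> test_closure D \<Longrightarrow> h \<in> test_closure D \<Longrightarrow> (\<lambda>z. min (f z) (h z)) \<in> test_closure D"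
proof -
 assume f: "f \<in> test_closure D" and h: "h \<in> test_closure D"
 have "(\<lambda>z. f z + h z - max (f z) (h z)) \<in> test_closure D"
  by (intro closure_diff closure_add closure_max f h)
 moreover have "f z + h z - max (f z) (h z) = min (f z) (h z)" for z by (simp add: max_def min_def)
 ultimately show ?thesis by simp
qed

text \<open>Real multiples are limits of rational ones; multiples by rationals are built into the
  named functions.\<close>

lemma closure_scale:
 assumes f: "f \<in> test_closure D"
 shows "(\<lambda>z. c * f z) \<in> test_closure D"
proof -
 have "\<exists>q. c < of_rat q \<and> of_rat q < c + inverse (real (Suc n))" for n by (rule of_rat_dense) simp
 then obtain q where q: "\<And>n. c < of_rat (q n)" "\<And>n. of_rat (q n) < c + inverse (real (Suc n))" by metis
 have lim: "(\<lambda>n. of_rat (q n)) \<longlonglongrightarrow> c"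
 proof (rule tendsto_sandwich[of "\<lambda>_. c" _ _ "\<lambda>n. c + inverse (real (Suc n))"])
  show "(\<lambda>n. c + inverse (real (Suc n))) \<longlonglongrightarrow> c" using LIMSEQ_inverse_real_of_nat_add[of c] .
 qed (use q in \<open>auto intro!: always_eventually less_imp_le simp del: of_nat_Suc\<close>)
 obtain p where p: "\<And>z. \<bar>f z\<bar> \<le> real p * indicator (D p) z" using closure_bound[OF f] by blast
 \<comment> \<open>All approximating rationals are at most \<open>\<bar>c\<bar> + 1\<close> in
   absolute value, so multiplication by this constant dominates the sequence.\<close>
 have op: "\<bar>(\<lambda>a b. (\<bar>c\<bar> + 1) * a) a b\<bar> \<le> (\<bar>c\<bar> + 1) * (\<bar>a\<bar> + \<bar>b\<bar>)" for a b :: real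
  by (simp add: abs_mult mult_left_mono)
 obtain P where P: "\<And>f h z. \<bar>f z\<bar> \<le> real p * indicator (D p) z \<Longrightarrow> \<bar>h z\<bar> \<le> real p * indicator (D p) z \<Longrightarrow>
   \<bar>(\<bar>c\<bar> + 1) * f z\<bar> \<le> real P * indicator (D P) z"
  using dominated_op[OF op, of p p] by blast
 show ?thesis
 proof (rule test_closure.Lim[of "\<lambda>n z. of_rat (q n) * f z" _ P])
  show "(\<lambda>z. of_rat (q n) * f z) \<in> test_closure D" for n using closure_lin[OF f f, of "q n" 0] by simp
  show "(\<lambda>n. of_rat (q n) * f z) \<longlonglongrightarrow> c * f z" for z by (intro tendsto_mult lim tendsto_const)
  show "\<bar>of_rat (q n) * f z\<bar> \<le> real P * indicator (D P) z" for n z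
  proof -
   have "inverse (real (Suc n)) \<le> 1" by (simp add: inverse_eq_divide)
   then have "\<bar>of_rat (q n)\<bar> \<le> \<bar>c\<bar> + 1" using q[of n] by linarith
   then have "\<bar>of_rat (q n) * f z\<bar> \<le> \<bar>(\<bar>c\<bar> + 1) * f z\<bar>" unfolding abs_mult by (intro mult_right_mono) auto
   also have "\<dots> \<le> real P * indicator (D P) z" by (rule P[OF p p])
   finally show ?thesis .
  qed
 qed
qed

text \<open>Induction over the sigma-algebra generated by the base: differences give complements
  within the window, maxima give finite unions, and a dominated limit gives countable ones.\<close>

lemma closure_indicator:
 assumes "A \<in> sets borel"
 shows "indicator (A \<inter> D p) \<in> test_closure D"
proof -
 have "A \<in> sigma_sets UNIV (range base_seq)"
  using assms unfolding borel_eq_sigma_base_seq by (subst (asm) sets_measure_of) auto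
 then show ?thesis
 proof (induction rule: sigma_sets.induct)
  case (Basic A)
  then obtain n where "A = base_seq n" by auto
  then show ?case using test_closure.Base[of D "Gen n p"] by simp
 next
  case Empty
  have "(indicator ({} \<inter> D p) :: 'b \<Rightarrow> real) = (\<lambda>z. 0)" by auto
  then show ?case using closure_zero by simp
 next
  case (Compl A)
  have "(indicator ((UNIV - A) \<inter> D p) :: 'b \<Rightarrow> real) = (\<lambda>z. indicator (D p) z - indicator (A \<inter> D p) z)"
   by (auto simp: indicator_def fun_eq_iff)
  then show ?case using closure_diff[OF test_closure.Base[of D "Box p"] Compl(2)] by simp
 next
  case (Union A)
  have fin: "indicator ((\<Union>i<n. A i) \<inter> D p) \<in> test_closure D" for n
  proof (induction n)
   case 0
   have "(indicator ((\<Union>i<0::nat. A i) \<inter> D p) :: 'b \<Rightarrow> real) = (\<lambda>z. 0)" by auto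
   then show ?case using closure_zero by simp
  next
   case (Suc n)
   have "(indicator ((\<Union>i<Suc n. A i) \<inter> D p) :: 'b \<Rightarrow> real) = (\<lambda>z. max (indicator ((\<Union>i<n. A i) \<inter> D p) z) (indicator (A n \<inter> D p) z))"
    by (auto simp: indicator_def fun_eq_iff less_Suc_eq)
   then show ?case using closure_max[OF Suc Union(2)[of n]] by simp
  qed
  \<comment> \<open>The window index is raised by one because the bound is \<open>real p\<close>
    itself, which would vanish for \<open>p = 0\<close>.\<close>
  have b: "\<bar>indicator ((\<Union>i<n. A i) \<inter> D p) z\<bar> \<le> real (Suc p) * indicator (D (Suc p)) z" for n z
   using incseq_SucD[OF D_mono, of p] by (auto simp: indicator_def)
  have l: "(\<lambda>n. indicator ((\<Union>i<n. A i) \<inter> D p) z :: real) \<longlonglongrightarrow> indicator ((\<Union>i. A i) \<inter> D p) z" for z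
   unfolding indicator_inter_arith by (intro tendsto_mult LIMSEQ_indicator_UN tendsto_const)
  show ?case by (rule test_closure.Lim[OF fin b l])
 qed
qed

text \<open>Truncation at height \<open>p\<close> inside window \<open>p\<close> keeps every
  function of the induction within the domination demanded by \<open>test_closure\<close>.\<close>

lemma closure_truncate:
 assumes "u \<in> borel_measurable borel" "\<And>z. 0 \<le> u z"
 shows "(\<lambda>z. min (u z) (real p) * indicator (D p) z) \<in> test_closure D"
 using assms
proof (induction arbitrary: p rule: borel_measurable_induct_real)
 case (set A)
 have "(\<lambda>z. min (indicator A z) (real p) * indicator (D p) z) = (\<lambda>z. min 1 (real p) * indicator (A \<inter> D p) z)"
  by (auto simp: indicator_def fun_eq_iff)
 then show ?case using closure_scale[OF closure_indicator[OF set], of "min 1 (real p)" p] by simp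
next
 case (mult u c)
 \<comment> \<open>The function \<open>c * u\<close> truncated at \<open>p\<close> depends on
   \<open>u\<close> only below the height \<open>p / c\<close>, so \<open>u\<close> is truncated at
   some \<open>N\<close> with \<open>c * N\<close> at least \<open>p\<close>.\<close>
 obtain N0 where N0: "real p \<le> c * real N0" if "0 < c"
 proof (cases "0 < c")
  case True
  obtain N where "real p / c \<le> real N" using real_arch_simple by blast
  then have "real p \<le> c * real N" using True by (simp add: field_simps)
  then show ?thesis by (intro that)
 qed (use that in blast)
 define N where "N = max N0 p"
 have "c * real N0 \<le> c * real N" using mult.hyps(1) by (intro mult_left_mono) (auto simp: N_def)
 then have N: "real p \<le> c * real N" if "0 < c" using N0 that by linarith
 have DN: "D p \<subseteq> D N" using D_mono by (auto simp: N_def incseq_def)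
 have eq: "min (c * u z) (real p) * indicator (D p) z = min (c * (min (u z) (real N) * indicator (D N) z)) (real p * indicator (D p) z)" for z
 proof (cases "z \<in> D p")
  case True
  then have zN: "z \<in> D N" using DN by blast
  have "min (c * u z) (real p) = min (c * min (u z) (real N)) (real p)"
  proof (cases "0 < c")
   case True
   then have "c * min (u z) (real N) = min (c * u z) (c * real N)" by (simp add: min_def)
   then show ?thesis using N[OF True] by simp
  qed (use mult.hyps(1) in simp)
  with True zN show ?thesis by simp
 next
  case False
  then show ?thesis using mult.hyps(1,3) by (simp add: min_absorb2)
 qed
 have "(\<lambda>z. min (c * (min (u z) (real N) * indicator (D N) z)) (real p * indicator (D p) z)) \<in> test_closure D"
  using test_closure.Base[of D "Box p"] by (intro closure_min closure_scale mult.IH) simp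
 then show ?case by (simp only: eq)
next
 case (add u v)
 \<comment> \<open>Truncation is additive here, since the induction rule adds only functions of
   which one vanishes at each point.\<close>
 have "min (v z + u z) (real p) * indicator (D p) z = min (v z) (real p) * indicator (D p) z + min (u z) (real p) * indicator (D p) z" for z
  using add.hyps(5)[of z] add.hyps(2)[of z] add.hyps(4)[of z] by (auto simp: min_def indicator_def)
 then show ?case using closure_add[OF add.IH(2)[of p] add.IH(1)[of p]] by simp
next
 case (seq U)
 show ?case
 proof (rule test_closure.Lim[of "\<lambda>i z. min (U i z) (real p) * indicator (D p) z" _ p])
  show "(\<lambda>i. min (U i z) (real p) * indicator (D p) z) \<longlonglongrightarrow> min (u z) (real p) * indicator (D p) z" for z
   using seq.hyps(4)[of z] by (intro tendsto_mult tendsto_min tendsto_const) auto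
  show "\<bar>min (U i z) (real p) * indicator (D p) z\<bar> \<le> real p * indicator (D p) z" for i z
   using seq.hyps(2)[of i z] by (auto simp: indicator_def)
 qed (rule seq.IH)
qed

text \<open>Equality on the named functions passes to their closure by dominated limits, and from
  the truncations of \<open>F\<close> to \<open>F\<close> itself by an increasing limit. Nothing is
  learnt outside the union of the windows.\<close>

lemma laplace_extend:
 assumes cont: "laplace_cont D \<Phi>" "laplace_cont D \<Psi>"
  and eq: "\<And>t. \<Phi> (\<lambda>z. ennreal (test_fun D t z)) = \<Psi> (\<lambda>z. ennreal (test_fun D t z))"
  and F: "F \<in> borel_measurable borel"
 shows "\<Phi> (\<lambda>z. F z * indicator (\<Union>n. D n) z) = \<Psi> (\<lambda>z. F z * indicator (\<Union>n. D n) z)"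
proof -
 have C: "\<Phi> (\<lambda>z. ennreal (f z)) = \<Psi> (\<lambda>z. ennreal (f z))" if "f \<in> test_closure D" for f
  using that
 proof (induction rule: test_closure.induct)
  case (Lim f p g)
  have m: "(\<lambda>z. ennreal (f n z)) \<in> borel_measurable borel" for n using test_closure_measurable[OF Lim.hyps(1)[of n]] by simp
  have b: "ennreal (f n z) \<le> of_nat p * indicator (D p) z" for n z
  proof -
   have "f n z \<le> real p * indicator (D p) z" using Lim.hyps(2)[of n z] by linarith
   then have "ennreal (f n z) \<le> ennreal (real p * indicator (D p) z)" by (rule ennreal_leI)
   also have "\<dots> = of_nat p * indicator (D p) z" by (auto simp: indicator_def ennreal_of_nat_eq_real_of_nat)
   finally show ?thesis .
  qed
  have l: "(\<lambda>n. ennreal (f n z)) \<longlonglongrightarrow> ennreal (g z)" for z by (intro tendsto_ennrealI Lim.hyps(3))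
  have "(\<lambda>n. \<Phi> (\<lambda>z. ennreal (f n z))) \<longlonglongrightarrow> \<Phi> (\<lambda>z. ennreal (g z))"
   by (rule laplace_contD(1)[OF cont(1) m l b])
  moreover have "(\<lambda>n. \<Psi> (\<lambda>z. ennreal (f n z))) \<longlonglongrightarrow> \<Psi> (\<lambda>z. ennreal (g z))"
   by (rule laplace_contD(1)[OF cont(2) m l b])
  ultimately show ?case unfolding Lim.IH by (rule LIMSEQ_unique)
 qed (rule eq)
 define W where "W p z = min (F z) (of_nat p) * indicator (D p) z" for p :: nat and z
 have W: "W p = (\<lambda>z. ennreal (min (enn2real (min (F z) (of_nat p))) (real p) * indicator (D p) z))" for p
 proof
  fix z
  have "min (F z) (of_nat p) < \<top>" by (simp add: min_less_iff_disj of_nat_less_top)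
  then obtain r where r: "0 \<le> r" "min (F z) (of_nat p) = ennreal r" by (cases "min (F z) (of_nat p)") auto
  have "ennreal r \<le> of_nat p" using r(2) by (metis min.cobounded2)
  then have "r \<le> real p" by (simp add: ennreal_of_nat_eq_real_of_nat)
  with r show "W p z = ennreal (min (enn2real (min (F z) (of_nat p))) (real p) * indicator (D p) z)"
   by (auto simp: W_def indicator_def)
 qed
 have EW: "\<Phi> (W p) = \<Psi> (W p)" for p
  unfolding W using F by (intro C closure_truncate) auto
 have Wm: "W p \<in> borel_measurable borel" for p unfolding W_def[abs_def] using F by measurable
 have Wi: "incseq W"
  unfolding incseq_def le_fun_def W_def using D_mono
  by (intro allI impI mult_mono min.mono order_refl of_nat_mono) (auto simp: incseq_def indicator_def)
 have sup: "(\<lambda>p. W p z) \<longlonglongrightarrow> F z * indicator (\<Union>n. D n) z" for z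
 proof -
  have "(\<lambda>p. of_nat p :: ennreal) \<longlonglongrightarrow> \<top>" by (rule of_nat_tendsto_top_ennreal)
  then have "(\<lambda>p. min (F z) (of_nat p)) \<longlonglongrightarrow> min (F z) \<top>" by (intro tendsto_min tendsto_const)
  then have l1: "(\<lambda>p. min (F z) (of_nat p)) \<longlonglongrightarrow> F z" by simp
  show ?thesis
  proof (cases "z \<in> (\<Union>n. D n)")
   case True
   then obtain n0 where n0: "z \<in> D n0" by blast
   have "eventually (\<lambda>p. min (F z) (of_nat p) = W p z) sequentially"
    using D_mono n0 by (intro eventually_sequentiallyI[of n0]) (auto simp: W_def incseq_def indicator_def)
   from Lim_transform_eventually[OF l1 this] True show ?thesis by simp
  qed (simp add: W_def)
 qed
 have "(\<lambda>p. \<Phi> (W p)) \<longlonglongrightarrow> \<Phi> (\<lambda>z. F z * indicator (\<Union>n. D n) z)"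
  by (rule laplace_contD(2)[OF cont(1) Wm sup Wi])
 moreover have "(\<lambda>p. \<Psi> (W p)) \<longlonglongrightarrow> \<Psi> (\<lambda>z. F z * indicator (\<Union>n. D n) z)"
  by (rule laplace_contD(2)[OF cont(2) Wm sup Wi])
 ultimately show ?thesis unfolding EW by (rule LIMSEQ_unique)
qed

end

section \<open>The joint Laplace functional of prior and data\<close>

context posterior_model
begin

text \<open>The constant \<open>cc s v\<close> normalises the posterior density \<open>ulik s \<cdot> v\<close> of the weight of an atom at \<open>s\<close>
with observations \<open>v\<close>, and \<open>bb f s v\<close> is the Laplace transform of that density.\<close>

definition "cc s v = (NN t|lborel. ulik s t v)"

definition "bb f s v = (NN t|lborel. eneg (f (s, t)) * ulik s t v) / cc s v"

text \<open>The Laplace functional of a Poisson process with the prior intensity thinned by the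
  probability of \<open>m\<close> zero observations.\<close>

definition "cf f = eneg (NN s|G. NN t|lborel. (1 - eneg (f (s, t))) * (g0 t * emeasure (Hord t) {0} ^ m))"

lemma cc_meas [measurable (raw)]:
 assumes [measurable]: "f \<in> N \<rightarrow>\<^sub>M borel" "h \<in> N \<rightarrow>\<^sub>M RV"
 shows "(\<lambda>z. cc (f z) (h z)) \<in> borel_measurable N"
 unfolding cc_def by measurable

lemma bb_meas [measurable (raw)]:
 assumes [measurable]: "f \<in> borel_measurable pair_borel" "e \<in> N \<rightarrow>\<^sub>M borel" "h \<in> N \<rightarrow>\<^sub>M RV"
 shows "(\<lambda>z. bb f (e z) (h z)) \<in> borel_measurable N"
 unfolding bb_def by measurable

lemma numer_le_cc: "(NN t|lborel. eneg (f (s, t)) * ulik s t v) \<le> cc s v"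
proof -
 have "(NN t|lborel. eneg (f (s, t)) * ulik s t v) \<le> (NN t|lborel. 1 * ulik s t v)"
  by (intro nn_integral_mono mult_right_mono) simp_all
 then show ?thesis by (simp add: cc_def)
qed

lemma bb_cc: "cc s v < \<top> \<Longrightarrow> bb f s v * cc s v = (NN t|lborel. eneg (f (s, t)) * ulik s t v)"
proof (cases "cc s v = 0")
 case True
 with numer_le_cc[of f s v] show ?thesis by simp
next
 case False
 assume "cc s v < \<top>"
 with False show ?thesis unfolding bb_def by (simp add: ennreal_divide_times ennreal_divide_self)
qed

text \<open>In the degenerate cases the numerator is divided by 0 or by infinity and the quotient is
  0, so the bound needs no condition on the constant.\<close>

lemma bb_le_1: "bb f s v \<le> 1"
proof (cases "cc s v = 0 \<or> cc s v = \<top>")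
 case True
 with numer_le_cc[of f s v] show ?thesis by (auto simp: bb_def)
next
 case False
 then have "bb f s v \<le> cc s v / cc s v" unfolding bb_def by (intro divide_right_mono_ennreal numer_le_cc)
 also have "\<dots> = 1" using False by (simp add: ennreal_divide_self less_top)
 finally show ?thesis .
qed

lemma zero_marks_eq: "zero_marks = (\<Pi>\<^sub>E j\<in>{..<m}. {0})"
 by (auto simp: zero_marks_def space_RV PiE_iff extensional_def fun_eq_iff)

lemma space_Hord: "space (Hord t) = UNIV"
 using sets_eq_imp_space_eq[OF Hord_sets, of t] by simp

lemma Hord_emeasure_meas [measurable]: "A \<in> sets borel \<Longrightarrow> (\<lambda>t. emeasure (Hord t) A) \<in> borel_measurable borel"
 by (rule measurable_compose[OF measurable_prob_algebraD[OF Hord_kernel] measurable_emeasure_subprob_algebra]) simp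

text \<open>The inner integral of A2' is the probability of a nonzero observation; the assumption
  thus bounds the mean number of ordinary atoms seen in a single observation.\<close>

lemma A2'_Hord: "(NN t|lborel. emeasure (Hord t) (- {0}) * g0 t) < \<top>"
proof -
 have s: "sets nonzero_lborel = sets nonzero_borel" by (simp add: nonzero_lborel_def nonzero_borel_def sets_restrict_space)
 have "(NN y|nonzero_lborel. ennreal (hord t y)) = emeasure (Hord t) (- {0})" for t
 proof -
  have "(\<lambda>y. hord t y) \<in> borel_measurable nonzero_borel"
   using measurable_compose[OF measurable_Pair1' hord_measurable, of t] by simp
  then have m: "(\<lambda>y. ennreal (hord t y)) \<in> borel_measurable nonzero_lborel" using s by (simp cong: measurable_cong_sets)
  have "(NN y|nonzero_lborel. ennreal (hord t y)) = emeasure (density nonzero_lborel (\<lambda>y. ennreal (hord t y))) (space nonzero_lborel)"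
   by (subst emeasure_density[OF m]) (auto intro!: nn_integral_cong)
  also have "\<dots> = emeasure (restrict_space (Hord t) (- {0})) (- {0})"
   by (simp add: hord_density nonzero_lborel_def space_restrict_space)
  also have "\<dots> = emeasure (Hord t) (- {0})" by (rule emeasure_restrict_space) (auto simp: Hord_sets)
  finally show ?thesis .
 qed
 then show ?thesis using A2' by (simp add: nn_integral_nu)
qed

lemma lik_rectangle:
 assumes s: "s \<notin> S" and E: "\<And>j. j < m \<Longrightarrow> E j \<in> sets borel"
 shows "(NN v|lam. indicator (vec_box m E) v * (\<Prod>j<m. lik s t (v j))) = (\<Prod>j<m. emeasure (Hord t) (E j))"
 using s hv_rectangle[of E "kof s" t, OF E] by (simp add: lik_hv kof_def)

lemma likp_meas_lam [measurable]: "(\<lambda>v. \<Prod>j<m. lik s t (v j)) \<in> borel_measurable lam"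
 by (rule likp_meas_v)

lemma ulik_meas_lam [measurable]: "(\<lambda>v. ulik s t v) \<in> borel_measurable lam"
 unfolding ulik_def by measurable

lemma ulik_t [measurable]: "v \<in> space lam \<Longrightarrow> (\<lambda>t. ulik s t v) \<in> borel_measurable borel"
 by (rule ulik_meas) (simp_all add: space_lam)

lemma Fubini_ulik:
 assumes [measurable]: "f \<in> borel_measurable borel" "A \<in> sets RV"
 shows "(NN v|lam. NN t|lborel. f t * indicator A v * ulik s t v) =
  (NN t|lborel. f t * wt s t * (NN v|lam. indicator A v * (\<Prod>j<m. lik s t (v j))))"
proof -
 have "(\<lambda>(t, v). f t * indicator A v * ulik s t v) \<in> borel_measurable (borel \<Otimes>\<^sub>M RV)"
  unfolding split_beta' by measurable
 from Fubini_lam[OF this]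
 have "(NN v|lam. NN t|lborel. f t * indicator A v * ulik s t v) = (NN t|lborel. NN v|lam. f t * indicator A v * ulik s t v)" ..
 also have "\<dots> = (NN t|lborel. NN v|lam. (f t * wt s t) * (indicator A v * (\<Prod>j<m. lik s t (v j))))"
  by (intro nn_integral_cong) (simp add: ulik_def mult_ac)
 also have "\<dots> = (NN t|lborel. f t * wt s t * (NN v|lam. indicator A v * (\<Prod>j<m. lik s t (v j))))"
 proof (intro nn_integral_cong nn_integral_cmult)
  have [measurable]: "(indicator A :: _ \<Rightarrow> ennreal) \<in> borel_measurable lam" using assms(2) by (intro borel_measurable_indicator) (simp add: sets_lam)
  show "(\<lambda>v. indicator A v * (\<Prod>j<m. lik s t (v j))) \<in> borel_measurable lam" for t
   by measurable
 qed
 finally show ?thesis .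
qed

text \<open>A nonzero mark vector has a nonzero coordinate, and for each of the \<open>m\<close>
  coordinates the total mass of the vectors that do not vanish there is the integral in A2'.\<close>

lemma cc_ord_finite:
 assumes s: "s \<notin> S"
 shows "(NN v|lam. indicator (space RV - zero_marks) v * cc s v) \<le> of_nat m * (NN t|lborel. emeasure (Hord t) (- {0}) * g0 t)"
proof -
 define E where "E i j = (if j = i then - {0} else UNIV :: real set)" for i j :: nat
 define A where "A i = (\<Pi>\<^sub>E j\<in>{..<m}. E i j)" for i
 have E: "E i j \<in> sets borel" for i j by (simp add: E_def)
 have A [measurable]: "A i \<in> sets RV" for i unfolding A_def RV_def using E by (intro sets_PiM_I_finite) auto
 have cov: "indicator (space RV - zero_marks) v \<le> (\<Sum>i<m. indicator (A i) v :: ennreal)" for v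
 proof (cases "v \<in> space RV - zero_marks")
  case True
  then obtain i where i: "i < m" "v j \<noteq> 0 \<or> j \<noteq> i" for j by (auto simp: zero_marks_def)
  then have "v \<in> A i" using True by (auto simp: A_def E_def space_RV PiE_iff)
  then have "1 \<le> (\<Sum>i\<in>{i}. indicator (A i) v :: ennreal)" by simp
  also have "\<dots> \<le> (\<Sum>i<m. indicator (A i) v)" using i by (intro sum_mono2) auto
  finally show ?thesis using True by simp
 qed simp
 have I: "(NN v|lam. NN t|lborel. 1 * indicator (A i) v * ulik s t v) = (NN t|lborel. emeasure (Hord t) (- {0}) * g0 t)" if i: "i < m" for i
 proof -
  have "(NN v|lam. indicator (A i) v * (\<Prod>j<m. lik s t (v j))) = emeasure (Hord t) (- {0})" for t
  proof -
   interpret Ht: prob_space "Hord t" by (rule Hord_prob)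
   have "(\<Prod>j<m. emeasure (Hord t) (E i j)) = (\<Prod>j\<in>{i}. emeasure (Hord t) (E i j))"
    using i Ht.emeasure_space_1 by (intro prod.mono_neutral_right) (auto simp: E_def space_Hord)
   then show ?thesis unfolding A_def by (subst lik_rectangle[OF s E]) (simp add: E_def)
  qed
  then show ?thesis by (subst Fubini_ulik) (simp_all add: wt_ord[OF s] mult_ac)
 qed
 have "(NN v|lam. indicator (space RV - zero_marks) v * cc s v) \<le> (NN v|lam. (\<Sum>i<m. indicator (A i) v * cc s v))"
  unfolding sum_distrib_right[symmetric] by (intro nn_integral_mono mult_right_mono cov) simp
 also have "\<dots> = (\<Sum>i<m. NN v|lam. indicator (A i) v * cc s v)"
 proof (rule nn_integral_sum)
  fix i
  have "indicator (A i) \<in> borel_measurable lam" using A by (intro borel_measurable_indicator) (simp add: sets_lam)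
  then show "(\<lambda>v. indicator (A i) v * cc s v) \<in> borel_measurable lam" by measurable
 qed
 also have "\<dots> = (\<Sum>i<m. NN v|lam. NN t|lborel. 1 * indicator (A i) v * ulik s t v)"
  unfolding cc_def by (intro sum.cong nn_integral_cong refl) (simp add: nn_integral_cmult ulik_t)
 also have "\<dots> = of_nat m * (NN t|lborel. emeasure (Hord t) (- {0}) * g0 t)"
  using I by simp
 finally show ?thesis .
qed

text \<open>At a fixed location \<open>cc s\<close> is the marginal density of the marks.\<close>

lemma cc_fix_integral:
 assumes s: "s \<in> S"
 shows "(NN v|lam. cc s v) = 1"
proof -
 have "(NN v|lam. cc s v) = (NN v|lam. NN t|lborel. 1 * indicator (space RV) v * ulik s t v)"
  unfolding cc_def by (intro nn_integral_cong) (simp add: space_lam)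
 also have "\<dots> = (NN t|lborel. 1 * wt s t * (NN v|lam. indicator (space RV) v * (\<Prod>j<m. lik s t (v j))))"
  by (rule Fubini_ulik) simp_all
 also have "\<dots> = (NN t|lborel. wt s t)"
 proof (intro nn_integral_cong)
  fix t
  have "(NN v|lam. indicator (space RV) v * (\<Prod>j<m. lik s t (v j))) = (NN v|lam. hv (kof s) t v)"
   by (intro nn_integral_cong) (simp add: space_lam lik_hv)
  then show "1 * wt s t * (NN v|lam. indicator (space RV) v * (\<Prod>j<m. lik s t (v j))) = wt s t" by (simp add: hv_integral)
 qed
 also have "\<dots> = (NN t|(L s). 1)" using nn_integral_L[OF s, of "\<lambda>_. 1"] by simp
 also have "\<dots> = 1" using prob_space.emeasure_space_1[OF L_prob[OF s]] by simp
 finally show ?thesis .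
qed

text \<open>For an ordinary location the zero marks are excluded: their constant is the mass of the
  thinned weight measure, which may be infinite. Elsewhere a finite integral over the marks gives
  finiteness almost everywhere.\<close>

lemma AE_cc_finite: "AE v in lam. s \<in> S \<or> v \<notin> zero_marks \<longrightarrow> cc s v < \<top>"
proof (cases "s \<in> S")
 case True
 have "AE v in lam. cc s v \<noteq> \<infinity>"
  using cc_fix_integral[OF True] by (intro nn_integral_noteq_infinite) auto
 then show ?thesis by eventually_elim (simp add: less_top)
next
 case False
 have i: "indicator (space RV - zero_marks) \<in> borel_measurable lam"
  by (intro borel_measurable_indicator) (simp add: sets_lam zero_marks_sets sets.compl_sets)
 have "(NN v|lam. indicator (space RV - zero_marks) v * cc s v) < \<top>"
  using le_less_trans[OF cc_ord_finite[OF False]] A2'_Hord by (simp add: ennreal_mult_less_top of_nat_less_top)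
 then have "AE v in lam. indicator (space RV - zero_marks) v * cc s v \<noteq> \<infinity>"
  by (intro nn_integral_noteq_infinite borel_measurable_times i) auto
 with AE_space show ?thesis
  by eventually_elim (use False in \<open>auto simp: less_top space_lam indicator_def split: if_splits\<close>)
qed

lemma ulik_fix_zero: "s \<in> S \<Longrightarrow> j < m \<Longrightarrow> v j = 0 \<Longrightarrow> ulik s t v = 0"
 by (auto simp: ulik_def lik_fix lfix_def intro!: prod_zero)

section \<open>Replacing the prior weights by their posterior averages\<close>

context
 fixes a :: "'a \<times> (nat \<Rightarrow> real) \<Rightarrow> ennreal" and f :: "'a \<times> real \<Rightarrow> ennreal"
 assumes a [measurable]: "a \<in> borel_measurable (borel \<Otimes>\<^sub>M RV)" and f [measurable]: "f \<in> borel_measurable pair_borel"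
begin

text \<open>The test function that codes \<open>a\<close> on the data and \<open>f\<close> on the
  prior in one functional of the marked atoms.\<close>

definition "mark1 z = (if snd z \<in> zero_marks then 0 else a (fst (fst z), snd z)) + f (fst z)"

text \<open>The same with \<open>f\<close> averaged over the posterior weight, which removes the
  dependence on the weight. It vanishes on zero marks and is therefore a function of the observed
  atoms only.\<close>

definition "mark2 z = (if snd z \<in> zero_marks then 0 else a (fst (fst z), snd z) + lneg (bb f (fst (fst z)) (snd z)))"

lemma mark_meas [measurable]:
 "mark1 \<in> borel_measurable (pair_borel \<Otimes>\<^sub>M RV)" "mark2 \<in> borel_measurable (pair_borel \<Otimes>\<^sub>M RV)"
 unfolding mark1_def[abs_def] mark2_def[abs_def] by measurable

lemma fm [measurable]: "(\<lambda>t. f (s, t)) \<in> borel_measurable borel"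
 by measurable

text \<open>The average of \<open>eneg f\<close> under the unnormalised posterior density is
  \<open>bb\<close> times the normalising constant; a finite constant makes this an
  identity.\<close>

lemma mark_eq:
 assumes v: "v \<in> space lam" "v \<notin> zero_marks" and fin: "cc s v < \<top>"
 shows "(NN t|lborel. eneg (mark1 ((s, t), v)) * ulik s t v) = (NN t|lborel. eneg (mark2 ((s, t), v)) * ulik s t v)"
proof -
 have "(NN t|lborel. eneg (mark1 ((s, t), v)) * ulik s t v) = (NN t|lborel. eneg (a (s, v)) * (eneg (f (s, t)) * ulik s t v))"
  using v(2) by (simp add: mark1_def eneg_add mult.assoc)
 also have "\<dots> = eneg (a (s, v)) * (NN t|lborel. eneg (f (s, t)) * ulik s t v)"
  using v(1) by (intro nn_integral_cmult) measurable
 also have "\<dots> = eneg (a (s, v)) * (bb f s v * cc s v)" using fin by (simp add: bb_cc)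
 also have "\<dots> = (NN t|lborel. (eneg (a (s, v)) * bb f s v) * ulik s t v)"
  using v(1) by (subst nn_integral_cmult) (auto simp: cc_def mult.assoc)
 also have "\<dots> = (NN t|lborel. eneg (mark2 ((s, t), v)) * ulik s t v)"
  using v(2) by (simp add: mark2_def eneg_add bb_le_1)
 finally show ?thesis .
qed

lemma mark_fix:
 assumes s: "s \<in> S"
 shows "(mark_mass mark1 s) = (mark_mass mark2 s)"
proof (rule nn_integral_cong_AE)
 show "AE v in lam. (NN t|lborel. eneg (mark1 ((s, t), v)) * ulik s t v) = (NN t|lborel. eneg (mark2 ((s, t), v)) * ulik s t v)"
  using AE_cc_finite[of s] AE_space
 proof eventually_elim
  case (elim v)
  show ?case
  proof (cases "v \<in> zero_marks")
   case True
   \<comment> \<open>The fixed likelihood density is set to 0 at the point 0, and \<open>m\<close>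
     is positive, so zero marks carry no density at a fixed location.\<close>
   then have "ulik s t v = 0" for t using ulik_fix_zero[OF s, of 0 v t] m_pos by (auto simp: zero_marks_def)
   then show ?thesis by simp
  next
   case False
   with elim s show ?thesis by (intro mark_eq) auto
  qed
 qed
qed

text \<open>Nonzero marks have a finite constant, which allows passing to the complement of
  \<open>mark_eq\<close>. On zero marks \<open>mark2\<close> has no gap, and what
  \<open>mark1\<close> leaves there is the extra term, the exponent of \<open>cf\<close>.\<close>

lemma mark_ord:
 assumes s: "s \<notin> S"
 shows "(mark_gap mark1 s) =
  (mark_gap mark2 s) +
  (NN t|lborel. (1 - eneg (f (s, t))) * (g0 t * emeasure (Hord t) {0} ^ m))"
proof -
 have "(mark_gap mark1 s) =
  (NN v|lam. (NN t|lborel. (1 - eneg (mark2 ((s, t), v))) * ulik s t v) + (NN t|lborel. (1 - eneg (f (s, t))) * indicator zero_marks v * ulik s t v))"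
 proof (rule nn_integral_cong_AE)
  show "AE v in lam. (NN t|lborel. (1 - eneg (mark1 ((s, t), v))) * ulik s t v) =
    (NN t|lborel. (1 - eneg (mark2 ((s, t), v))) * ulik s t v) + (NN t|lborel. (1 - eneg (f (s, t))) * indicator zero_marks v * ulik s t v)"
   using AE_cc_finite[of s] AE_space
  proof eventually_elim
   case (elim v)
   show ?case
   proof (cases "v \<in> zero_marks")
    case True
    then show ?thesis by (simp add: mark1_def mark2_def)
   next
    case False
    then have fin: "cc s v < \<top>" using elim by simp
    have m: "(\<lambda>t. ulik s t v) \<in> borel_measurable lborel" using ulik_t[OF elim(2), of s] by simp
    have "(NN t|lborel. (1 - eneg (mark1 ((s, t), v))) * ulik s t v) = cc s v - (NN t|lborel. eneg (mark1 ((s, t), v)) * ulik s t v)"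
     unfolding cc_def using fin elim(2) False by (intro nn_integral_one_minus m) (simp_all add: cc_def mark1_def)
    also have "(NN t|lborel. eneg (mark1 ((s, t), v)) * ulik s t v) = (NN t|lborel. eneg (mark2 ((s, t), v)) * ulik s t v)"
     by (rule mark_eq[OF elim(2) False fin])
    also have "cc s v - \<dots> = (NN t|lborel. (1 - eneg (mark2 ((s, t), v))) * ulik s t v)"
     unfolding cc_def using fin elim(2) False by (intro nn_integral_one_minus[symmetric] m) (simp_all add: cc_def mark2_def)
    finally show ?thesis using False by simp
   qed
  qed
 qed
 also have "\<dots> = (mark_gap mark2 s) +
   (NN v|lam. NN t|lborel. (1 - eneg (f (s, t))) * indicator zero_marks v * ulik s t v)"
  by (intro nn_integral_add) measurable
 also have "(NN v|lam. NN t|lborel. (1 - eneg (f (s, t))) * indicator zero_marks v * ulik s t v) =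
   (NN t|lborel. (1 - eneg (f (s, t))) * wt s t * (NN v|lam. indicator zero_marks v * (\<Prod>j<m. lik s t (v j))))"
  by (rule Fubini_ulik) measurable
 also have "\<dots> = (NN t|lborel. (1 - eneg (f (s, t))) * (g0 t * emeasure (Hord t) {0} ^ m))"
  unfolding zero_marks_eq by (subst lik_rectangle[OF s]) (simp_all add: wt_ord[OF s] mult_ac)
 finally show ?thesis .
qed

text \<open>Bayes' formula in Laplace form: against every test \<open>a\<close> of the data, the
  prior functional of \<open>f\<close> acts as a factor that depends on the observed atoms
  only.\<close>

lemma posterior_identity:
 "(NN w|M. eneg (NN p|(obs w). a p) * eneg (NN p|(atom_process (\<Theta> w)). f p)) =
  cf f * (NN w|M. eneg (NN p|(obs w). a p + lneg (bb f (fst p) (snd p))))"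
proof -
 have "(NN w|M. eneg (NN p|(obs w). a p) * eneg (NN p|(atom_process (\<Theta> w)). f p)) =
  (NN w|M. eneg (\<Sum>k. if enat k < K w then mark1 (marked_atom k w) else 0))"
 proof (rule nn_integral_cong_AE)
  show "AE w in M. eneg (NN p|(obs w). a p) * eneg (NN p|(atom_process (\<Theta> w)). f p) =
   eneg (\<Sum>k. if enat k < K w then mark1 (marked_atom k w) else 0)"
   using AE_good
  proof eventually_elim
   case (elim w)
   show ?case
    unfolding good_X[OF elim a] good_Theta[OF elim f] eneg_add[symmetric]
    by (subst suminf_add) (auto intro!: arg_cong[where f = eneg] suminf_cong simp: mark1_def)
  qed
 qed
 also have "\<dots> = eneg (NN s|G. mark_gap mark1 s) *
  (\<Prod>s\<in>S. mark_mass mark1 s)"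
  by (rule marked_laplace) measurable
 also have "(\<Prod>s\<in>S. mark_mass mark1 s) =
   (\<Prod>s\<in>S. mark_mass mark2 s)"
  by (intro prod.cong mark_fix refl)
 also have "(NN s|G. mark_gap mark1 s) =
   (NN s|G. (mark_gap mark2 s) +
   (NN t|lborel. (1 - eneg (f (s, t))) * (g0 t * emeasure (Hord t) {0} ^ m)))"
 proof (rule nn_integral_cong_AE)
  show "AE s in G. (mark_gap mark1 s) =
   (mark_gap mark2 s) +
   (NN t|lborel. (1 - eneg (f (s, t))) * (g0 t * emeasure (Hord t) {0} ^ m))"
   using AE_G_notin_S by eventually_elim (rule mark_ord)
 qed
 also have "\<dots> = (NN s|G. mark_gap mark2 s) +
   (NN s|G. NN t|lborel. (1 - eneg (f (s, t))) * (g0 t * emeasure (Hord t) {0} ^ m))"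
 proof (rule nn_integral_add)
  interpret lam: sigma_finite_measure lam by (rule sigma_finite_lam)
  have [measurable]: "snd \<in> (borel :: 'a measure) \<Otimes>\<^sub>M lam \<rightarrow>\<^sub>M RV"
   using measurable_snd[of "borel :: 'a measure" lam] by (simp cong: measurable_cong_sets add: sets_lam)
  have "(\<lambda>s. mark_gap mark2 s) \<in> borel_measurable borel"
   by (rule lam.borel_measurable_nn_integral) (unfold split_beta', measurable)
  then show "(\<lambda>s. mark_gap mark2 s) \<in> borel_measurable G"
   using G_sets by (simp cong: measurable_cong_sets)
  have "(\<lambda>s. NN t|lborel. (1 - eneg (f (s, t))) * (g0 t * emeasure (Hord t) {0} ^ m)) \<in> borel_measurable borel" by measurable
  then show "(\<lambda>s. NN t|lborel. (1 - eneg (f (s, t))) * (g0 t * emeasure (Hord t) {0} ^ m)) \<in> borel_measurable G"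
   using G_sets by (simp cong: measurable_cong_sets)
 qed
 also have "eneg (\<dots>) * (\<Prod>s\<in>S. mark_mass mark2 s) =
   cf f * (eneg (NN s|G. mark_gap mark2 s) *
    (\<Prod>s\<in>S. mark_mass mark2 s))"
  by (simp add: eneg_add cf_def mult_ac)
 also have "eneg (NN s|G. mark_gap mark2 s) *
    (\<Prod>s\<in>S. mark_mass mark2 s) =
   (NN w|M. eneg (\<Sum>k. if enat k < K w then mark2 (marked_atom k w) else 0))"
  by (rule marked_laplace[symmetric]) measurable
 also have "\<dots> = (NN w|M. eneg (NN p|(obs w). a p + lneg (bb f (fst p) (snd p))))"
 proof (rule nn_integral_cong_AE)
  have m: "(\<lambda>p. a p + lneg (bb f (fst p) (snd p))) \<in> borel_measurable (borel \<Otimes>\<^sub>M RV)" by measurable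
  show "AE w in M. eneg (\<Sum>k. if enat k < K w then mark2 (marked_atom k w) else 0) =
   eneg (NN p|(obs w). a p + lneg (bb f (fst p) (snd p)))"
   using AE_good
  proof eventually_elim
   case (elim w)
   show ?case
    unfolding good_X[OF elim m]
    by (auto intro!: arg_cong[where f = eneg] suminf_cong simp: mark2_def)
  qed
 qed
 finally show ?thesis .
qed

end

end

section \<open>Independence from factorising Laplace functionals\<close>

lemma tendsto_prod_le_1:
 fixes f :: "'i \<Rightarrow> nat \<Rightarrow> ennreal"
 assumes "\<And>i. i \<in> I \<Longrightarrow> f i \<longlonglongrightarrow> l i" "\<And>i. i \<in> I \<Longrightarrow> l i \<le> 1"
 shows "(\<lambda>n. \<Prod>i\<in>I. f i n) \<longlonglongrightarrow> (\<Prod>i\<in>I. l i)"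
 using assms
proof (induction I rule: infinite_finite_induct)
 case (insert i I)
 have "(\<Prod>i\<in>I. l i) \<le> 1" using insert.prems(2) by (intro prod_le_1) auto
 then have "(\<Prod>i\<in>I. l i) \<noteq> \<infinity>" by (auto simp: top_unique)
 moreover have "l i \<noteq> \<infinity>" using insert.prems(2)[of i] by (auto simp: top_unique)
 ultimately show ?case using insert by (simp add: tendsto_mult_ennreal)
qed auto

lemma borel_pair_nonzero:
 fixes f :: "'a::{second_countable_topology} \<times> real \<Rightarrow> ennreal"
 assumes "f \<in> borel_measurable borel"
 shows "f \<in> borel_measurable point_borel"
 using assms by (intro measurable_pair_nonzero_borel) (simp add: borel_prod)

lemma nn_integral_tendsto_bounded:
 assumes Q: "finite_measure Q" and u: "\<And>n::nat. u n \<in> borel_measurable Q" and v: "v \<in> borel_measurable Q"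
  and le: "\<And>n z. u n z \<le> (1::ennreal)" and lim: "\<And>z. z \<in> space Q \<Longrightarrow> (\<lambda>n. u n z) \<longlonglongrightarrow> v z"
 shows "(\<lambda>n. NN z|Q. u n z) \<longlonglongrightarrow> (NN z|Q. v z)"
proof (rule nn_integral_dominated_convergence[where w = "\<lambda>_. 1"])
 show "(NN z|Q. 1) < \<infinity>" using finite_measure.emeasure_finite[OF Q] by (simp add: less_top)
qed (use u v le lim in auto)

text \<open>Finite counts in a window permit dominated convergence for each outcome; the expectation
  then converges under the bound 1.\<close>

lemma laplace_cont_process:
 fixes N :: "'w \<Rightarrow> ('a::second_countable_topology \<times> real) measure"
 assumes Q: "finite_measure Q"
  and setsN: "\<And>w. w \<in> space Q \<Longrightarrow> sets (N w) = sets point_borel"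
  and meas: "\<And>A. A \<in> sets point_borel \<Longrightarrow> (\<lambda>w. emeasure (N w) A) \<in> borel_measurable Q"
  and D: "\<And>p. D p \<in> sets point_borel"
  and fin: "\<And>w p. w \<in> space Q \<Longrightarrow> emeasure (N w) (D p) < \<top>"
 shows "laplace_cont D (\<lambda>f. NN w|Q. eneg (NN p|(N w). f p))"
proof -
 have Nm: "f \<in> borel_measurable (N w)" if "f \<in> borel_measurable borel" "w \<in> space Q" for f :: "'a \<times> real \<Rightarrow> ennreal" and w
  using borel_pair_nonzero[OF that(1)] setsN[OF that(2)] by (simp cong: measurable_cong_sets)
 have Em: "(\<lambda>w. eneg (NN p|(N w). f p)) \<in> borel_measurable Q" if "f \<in> borel_measurable borel" for f :: "'a \<times> real \<Rightarrow> ennreal"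
  by (rule measurable_compose[OF measurable_nn_integral_kernel[OF setsN meas borel_pair_nonzero[OF that]] measurable_eneg])
 show ?thesis unfolding laplace_cont_def
 proof (intro allI impI; elim conjE)
  fix f :: "nat \<Rightarrow> 'a \<times> real \<Rightarrow> ennreal" and g
  assume f: "\<forall>n. f n \<in> borel_measurable borel" and l: "\<forall>z. (\<lambda>n. f n z) \<longlonglongrightarrow> g z"
   and b: "(\<exists>p. \<forall>n z. f n z \<le> of_nat p * indicator (D p) z) \<or> incseq f"
  have g: "g \<in> borel_measurable borel" by (rule borel_measurable_LIMSEQ_order[of borel f]) (use f l in auto)
  show "(\<lambda>n. NN w|Q. eneg (NN p|(N w). f n p)) \<longlonglongrightarrow> (NN w|Q. eneg (NN p|(N w). g p))"
  proof (rule nn_integral_tendsto_bounded[OF Q Em Em])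
   fix w assume w: "w \<in> space Q"
   have fn: "f n \<in> borel_measurable (N w)" for n using f by (intro Nm w) blast
   show "(\<lambda>n. eneg (NN p|(N w). f n p)) \<longlonglongrightarrow> eneg (NN p|(N w). g p)"
    using b
   proof (elim disjE exE)
    fix p assume b: "\<forall>n z. f n z \<le> of_nat p * indicator (D p) z"
    have [measurable]: "D p \<in> sets (N w)" using D setsN[OF w] by simp
    show ?thesis
    proof (intro tendsto_eneg nn_integral_dominated_convergence[where w = "\<lambda>z. of_nat p * indicator (D p) z"] fn Nm[OF g w])
     show "(\<lambda>z. of_nat p * indicator (D p) z :: ennreal) \<in> borel_measurable (N w)" by measurable
     show "(NN z|(N w). of_nat p * indicator (D p) z) < \<infinity>"
      using fin[OF w] by (simp add: nn_integral_cmult ennreal_mult_less_top of_nat_less_top)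
     show "AE z in N w. f n z \<le> of_nat p * indicator (D p) z" for n using b by (intro AE_I2) blast
     show "AE z in N w. (\<lambda>n. f n z) \<longlonglongrightarrow> g z" using l by (intro AE_I2) blast
    qed
   next
    assume "incseq f"
    from nn_integral_LIMSEQ[OF this fn] l show ?thesis by (intro tendsto_eneg) blast
   qed
  qed (use f g in auto)
 qed
qed

text \<open>If \<open>f\<close> vanishes outside a window, then \<open>1 - eneg f\<close> is at most
  the indicator of the window, whose intensity is finite.\<close>

lemma laplace_cont_product:
 fixes F :: "('a::second_countable_topology \<times> real) measure"
 assumes setsF: "sets F = sets point_borel"
  and D: "\<And>p. D p \<in> sets point_borel" and fin: "\<And>p. emeasure F (D p) < \<top>"
  and L: "\<And>s. s \<in> S \<Longrightarrow> prob_space (L s)" "\<And>s. s \<in> S \<Longrightarrow> sets (L s) = sets borel"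
 shows "laplace_cont D (\<lambda>f. eneg (NN p|F. 1 - eneg (f p)) * (\<Prod>s\<in>S. NN t|(L s). eneg (f (s, t))))"
proof -
 have Fm: "f \<in> borel_measurable F" if "f \<in> borel_measurable borel" for f :: "'a \<times> real \<Rightarrow> ennreal"
  using borel_pair_nonzero[OF that] setsF by (simp cong: measurable_cong_sets)
 have Fm1: "(\<lambda>p. 1 - eneg (f p)) \<in> borel_measurable F" if "f \<in> borel_measurable borel" for f :: "'a \<times> real \<Rightarrow> ennreal"
 proof -
  have "(\<lambda>y. 1 - eneg y) \<in> borel_measurable borel" by measurable
  from measurable_compose[OF Fm[OF that] this] show ?thesis .
 qed
 have prod: "(\<lambda>n. \<Prod>s\<in>S. NN t|(L s). eneg (f n (s, t))) \<longlonglongrightarrow> (\<Prod>s\<in>S. NN t|(L s). eneg (g (s, t)))"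
  "(\<Prod>s\<in>S. NN t|(L s). eneg (g (s, t))) \<le> 1"
  if f: "\<And>n. f n \<in> borel_measurable borel" and g: "g \<in> borel_measurable borel" and l: "\<And>z. (\<lambda>n. f n z) \<longlonglongrightarrow> g z"
  for f :: "nat \<Rightarrow> 'a \<times> real \<Rightarrow> ennreal" and g
 proof -
  have m: "(\<lambda>t. eneg (h (s, t))) \<in> borel_measurable (L s)" if "s \<in> S" "h \<in> borel_measurable borel" for s and h :: "'a \<times> real \<Rightarrow> ennreal"
  proof -
   have "h \<in> borel_measurable pair_borel" using that(2) by (simp add: borel_prod)
   from measurable_compose[OF measurable_compose[OF measurable_Pair1' this, of s] measurable_eneg]
   show ?thesis using L(2)[OF that(1)] by (simp cong: measurable_cong_sets)
  qed
  have le: "(NN t|(L s). eneg (g (s, t))) \<le> 1" if "s \<in> S" for s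
  proof -
   have "(NN t|(L s). eneg (g (s, t))) \<le> (NN t|(L s). 1)" by (intro nn_integral_mono) simp
   then show ?thesis using prob_space.emeasure_space_1[OF L(1)[OF that]] by simp
  qed
  show "(\<lambda>n. \<Prod>s\<in>S. NN t|(L s). eneg (f n (s, t))) \<longlonglongrightarrow> (\<Prod>s\<in>S. NN t|(L s). eneg (g (s, t)))"
  proof (rule tendsto_prod_le_1)
   fix s assume s: "s \<in> S"
   show "(\<lambda>n. NN t|(L s). eneg (f n (s, t))) \<longlonglongrightarrow> (NN t|(L s). eneg (g (s, t)))"
    by (rule nn_integral_tendsto_bounded[OF prob_space.finite_measure[OF L(1)[OF s]] m[OF s f] m[OF s g]]) (auto intro: tendsto_eneg l)
  qed (rule le)
  show "(\<Prod>s\<in>S. NN t|(L s). eneg (g (s, t))) \<le> 1" by (intro prod_le_1) (auto intro: le)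
 qed
 show ?thesis unfolding laplace_cont_def
 proof (intro allI impI; elim conjE)
  fix f :: "nat \<Rightarrow> 'a \<times> real \<Rightarrow> ennreal" and g
  assume f: "\<forall>n. f n \<in> borel_measurable borel" and l: "\<forall>z. (\<lambda>n. f n z) \<longlonglongrightarrow> g z"
   and b: "(\<exists>p. \<forall>n z. f n z \<le> of_nat p * indicator (D p) z) \<or> incseq f"
  have g: "g \<in> borel_measurable borel" by (rule borel_measurable_LIMSEQ_order[of borel f]) (use f l in auto)
  have fn: "(\<lambda>p. 1 - eneg (f n p)) \<in> borel_measurable F" for n using f by (intro Fm1) blast
  have ln: "(\<lambda>n. 1 - eneg (f n z)) \<longlonglongrightarrow> 1 - eneg (g z)" for z
   by (intro tendsto_diff_ennreal tendsto_eneg tendsto_const l[rule_format]) auto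
  have i: "(\<lambda>n. NN p|F. 1 - eneg (f n p)) \<longlonglongrightarrow> (NN p|F. 1 - eneg (g p))"
   using b
  proof (elim disjE exE)
   fix p assume b: "\<forall>n z. f n z \<le> of_nat p * indicator (D p) z"
   show ?thesis
   proof (rule nn_integral_dominated_convergence[where w = "indicator (D p)", OF fn Fm1[OF g]])
    have "D p \<in> sets F" using D setsF by simp
    then show "(indicator (D p) :: _ \<Rightarrow> ennreal) \<in> borel_measurable F" "(NN z|F. indicator (D p) z) < \<infinity>"
     using fin by auto
    have "1 - eneg (f n z) \<le> indicator (D p) z" for n z
    proof (cases "z \<in> D p")
     case False
     then have "f n z = 0" using b[rule_format, of n z] by simp
     then show ?thesis by simp
    qed (simp add: diff_le_self_ennreal)
    then show "AE z in F. 1 - eneg (f n z) \<le> indicator (D p) z" for n by simp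
    show "AE z in F. (\<lambda>n. 1 - eneg (f n z)) \<longlonglongrightarrow> 1 - eneg (g z)" by (intro AE_I2 ln)
   qed
  next
   assume "incseq f"
   then have "incseq (\<lambda>n p. 1 - eneg (f n p))" by (auto simp: incseq_def le_fun_def intro!: ennreal_minus_mono eneg_mono)
   from nn_integral_LIMSEQ[OF this fn ln] show ?thesis .
  qed
  show "(\<lambda>n. eneg (NN p|F. 1 - eneg (f n p)) * (\<Prod>s\<in>S. NN t|(L s). eneg (f n (s, t)))) \<longlonglongrightarrow>
   eneg (NN p|F. 1 - eneg (g p)) * (\<Prod>s\<in>S. NN t|(L s). eneg (g (s, t)))"
   using f l prod(2)[OF _ g, of f] by (intro tendsto_mult_ennreal tendsto_eneg i prod(1)[OF _ g]) (auto simp: top_unique)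
 qed
qed

lemma emeasure_density_indicator:
 assumes "A \<in> sets N" "B \<in> sets N"
 shows "emeasure (density N (indicator A)) B = emeasure N (A \<inter> B)"
proof -
 have "emeasure (density N (indicator A)) B = (NN z|N. indicator A z * indicator B z)"
  using assms by (simp add: emeasure_density)
 also have "\<dots> = (NN z|N. indicator (A \<inter> B) z)" by (simp add: indicator_inter_arith)
 finally show ?thesis using assms by (simp add: sets.Int)
qed

lemma nn_integral_density_indicator:
 assumes "A \<in> sets N" "h \<in> borel_measurable N"
 shows "(NN p|(density N (indicator A)). h p) = (NN p|N. h p * indicator A p)"
 using assms by (subst nn_integral_density) (auto simp: mult.commute)

context prob_space
begin

text \<open>Factorisation of the Laplace functional over \<open>A i\<close> and its complement is
  assumed one set at a time; joint independence follows by adding the events one by one.\<close>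

lemma indep_restrictions:
 fixes N :: "'a \<Rightarrow> 'b measure" and A :: "'i \<Rightarrow> 'b set"
 assumes setsN: "\<And>w. w \<in> space M \<Longrightarrow> sets (N w) = sets F"
  and meas: "\<And>A. A \<in> sets F \<Longrightarrow> (\<lambda>w. emeasure (N w) A) \<in> borel_measurable M"
  and vals: "\<And>w A. w \<in> space M \<Longrightarrow> A \<in> sets F \<Longrightarrow> enat_valued (emeasure (N w) A)"
  and A: "\<And>i. i \<in> I \<Longrightarrow> A i \<in> sets F" and disj: "disjoint_family_on A I"
  and factor: "\<And>i f h. i \<in> I \<Longrightarrow> f \<in> borel_measurable F \<Longrightarrow> h \<in> borel_measurable F \<Longrightarrow>
    (\<And>p. p \<in> A i \<Longrightarrow> f p = 0) \<Longrightarrow> (\<And>p. p \<notin> A i \<Longrightarrow> h p = 0) \<Longrightarrow>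
    (NN w|M. eneg (NN p|(N w). f p + h p)) = (NN w|M. eneg (NN p|(N w). f p)) * (NN w|M. eneg (NN p|(N w). h p))"
 shows "indep_sets (\<lambda>i. sets (process_sigma M (\<lambda>w. density (N w) (indicator (A i))) F)) I"
  (is "indep_sets (\<lambda>i. sets (?V i)) I")
proof (rule indep_setsI)
 define Na where "Na i w = density (N w) (indicator (A i))" for i w
 have Na_em: "emeasure (Na i w) B = emeasure (N w) (A i \<inter> B)" if "i \<in> I" "w \<in> space M" "B \<in> sets F" for i w B
  unfolding Na_def using that A setsN by (intro emeasure_density_indicator) auto
 have Na_meas: "(\<lambda>w. emeasure (Na i w) B) \<in> borel_measurable M" if "i \<in> I" "B \<in> sets F" for i B
  using meas[of "A i \<inter> B"] A that by (subst measurable_cong[OF Na_em]) auto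
 have Em: "(\<lambda>w. eneg (NN p|(N w). f p)) \<in> borel_measurable M" if "f \<in> borel_measurable F" for f
  by (rule measurable_compose[OF measurable_nn_integral_kernel[OF setsN meas that] measurable_eneg])
 have ev: "sets (?V i) \<subseteq> events" if i: "i \<in> I" for i
 proof -
  have "(\<lambda>w. \<lambda>B\<in>sets F. emeasure (Na i w) B) \<in> M \<rightarrow>\<^sub>M (\<Pi>\<^sub>M B\<in>sets F. borel)"
   by (rule measurable_restrict) (rule Na_meas[OF i])
  from measurable_sets[OF this] show ?thesis
   by (auto simp: Na_def sets_vimage_algebra2 space_PiM)
 qed
 then show "\<And>i. i \<in> I \<Longrightarrow> sets (?V i) \<subseteq> events" .
 fix W J assume J: "J \<noteq> {}" "J \<subseteq> I" "finite J" and W: "\<forall>j\<in>J. W j \<in> sets (?V j)"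
 define \<Phi> where "\<Phi> f = (NN w|M. eneg (NN p|(N w). f p))" for f
 have \<Phi>_top: "\<Phi> f \<noteq> \<top>" for f
 proof -
  have "\<Phi> f \<le> (NN w|M. 1)" unfolding \<Phi>_def by (intro nn_integral_mono) simp
  then show ?thesis by (auto simp: emeasure_space_1 top_unique)
 qed
 \<comment> \<open>The test function \<open>f\<close> must vanish on the sets already treated; it
   keeps the remaining ones accessible to the induction.\<close>
 have claim: "(NN w|M. (\<Prod>j\<in>J'. indicator (W j) w) * eneg (NN p|(N w). f p)) = (\<Prod>j\<in>J'. emeasure M (W j)) * \<Phi> f"
  if "finite J'" "J' \<subseteq> J" "f \<in> borel_measurable F" "\<And>p. p \<in> (\<Union>j\<in>J'. A j) \<Longrightarrow> f p = 0" for J' f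
  using that
 proof (induction J' arbitrary: f rule: finite_induct)
  case empty
  then show ?case by (simp add: \<Phi>_def)
 next
  case (insert i J')
  have i: "i \<in> I" "W i \<in> sets (?V i)" and J': "J' \<subseteq> I" using insert.prems(1) J W by auto
  have Wm: "W j \<in> events" if "j \<in> insert i J'" for j
   using that insert.prems(1) J W ev[of j] by blast
  have fm: "f \<in> borel_measurable F" by fact
  define c where "c = (\<Prod>j\<in>J'. emeasure M (W j)) * \<Phi> f"
  have c: "c \<noteq> \<top>" unfolding c_def by (simp add: emeasure_eq_measure prod_ennreal measure_nonneg ennreal_mult_eq_top_iff \<Phi>_top)
  define u where "u w = (\<Prod>j\<in>J'. indicator (W j) w) * eneg (NN p|(N w). f p)" for w
  have um: "u \<in> borel_measurable M"
   unfolding u_def[abs_def] using Wm Em[OF fm] by (intro borel_measurable_times_ennreal borel_measurable_prod_ennreal borel_measurable_indicator) auto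
  \<comment> \<open>Factorisation says that \<open>u\<close> has the same effect as its mean
    \<open>c\<close> on every Laplace functional of the process restricted to \<open>A i\<close>,
    hence on every event generated by it.\<close>
  have "emeasure (density M u) (W i) = emeasure (density M (\<lambda>_. c)) (W i)"
  proof (rule counting_laplace_unique[where N = "Na i" and F = F])
   have "(NN w|M. u w) = c" unfolding u_def c_def using insert by auto
   then show "finite_measure (density M u)"
    using c um by (intro finite_measureI) (simp add: emeasure_density nn_integral_set_ennreal[symmetric] cong: nn_integral_cong)
   show "finite_measure (density M (\<lambda>_. c))"
    using c by (intro finite_measureI) (simp add: emeasure_density emeasure_space_1 nn_integral_cmult)
   show "(\<lambda>w. emeasure (Na i w) B) \<in> borel_measurable (density M u)" if "B \<in> sets F" for B using Na_meas[OF i(1) that] by simp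
   show "enat_valued (emeasure (Na i w) B)" if "w \<in> space (density M u)" "B \<in> sets F" for w B
    using that vals[of w "A i \<inter> B"] A i by (simp add: Na_em sets.Int)
   show "W i \<in> sets (process_sigma (density M u) (Na i) F)"
    using i(2) by (simp add: Na_def)
   fix h :: "'b \<Rightarrow> ennreal" assume hm: "h \<in> borel_measurable F"
   define h' where "h' p = h p * indicator (A i) p" for p
   have h'm: "h' \<in> borel_measurable F" unfolding h'_def[abs_def] using hm A i by (intro borel_measurable_times_ennreal borel_measurable_indicator) auto
   have mN: "k \<in> borel_measurable (N w)" if "k \<in> borel_measurable F" "w \<in> space M" for k :: "'b \<Rightarrow> ennreal" and w
    using that(1) setsN[OF that(2)] by (simp cong: measurable_cong_sets)
   have Nah: "(NN p|(Na i w). h p) = (NN p|(N w). h' p)" if "w \<in> space M" for w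
    unfolding Na_def h'_def using that A i setsN mN[OF hm that] by (intro nn_integral_density_indicator) auto
   have Nam: "(\<lambda>w. eneg (NN p|(Na i w). h p)) \<in> borel_measurable M"
    using Em[OF h'm] by (subst measurable_cong[of M _ "\<lambda>w. eneg (NN p|(N w). h' p)"]) (simp_all add: Nah)
   have "(NN w|(density M u). eneg (NN p|(Na i w). h p)) = (NN w|M. u w * eneg (NN p|(Na i w). h p))"
    by (rule nn_integral_density[OF um Nam])
   also have "\<dots> = (NN w|M. (\<Prod>j\<in>J'. indicator (W j) w) * eneg (NN p|(N w). f p + h' p))"
   proof (rule nn_integral_cong)
    fix w assume w: "w \<in> space M"
    show "u w * eneg (NN p|(Na i w). h p) = (\<Prod>j\<in>J'. indicator (W j) w) * eneg (NN p|(N w). f p + h' p)"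
     unfolding u_def Nah[OF w] nn_integral_add[OF mN[OF fm w] mN[OF h'm w]] eneg_add by (simp add: mult.assoc)
   qed
   also have "\<dots> = (\<Prod>j\<in>J'. emeasure M (W j)) * \<Phi> (\<lambda>p. f p + h' p)"
   proof (rule insert.IH)
    fix p assume p: "p \<in> (\<Union>j\<in>J'. A j)"
    then obtain j where j: "j \<in> J'" "p \<in> A j" by blast
    with J' i(1) insert.hyps(2) have "j \<in> I" "j \<noteq> i" by auto
    then have "A j \<inter> A i = {}" using disj i(1) by (simp add: disjoint_family_on_def)
    with j have "p \<notin> A i" by blast
    with p insert.prems(3)[of p] show "f p + h' p = 0" by (simp add: h'_def)
   qed (use insert.prems fm h'm in auto)
   also have "\<Phi> (\<lambda>p. f p + h' p) = \<Phi> f * \<Phi> h'"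
    unfolding \<Phi>_def by (rule factor[OF i(1) fm h'm]) (use insert.prems(3) in \<open>auto simp: h'_def\<close>)
   also have "(\<Prod>j\<in>J'. emeasure M (W j)) * (\<Phi> f * \<Phi> h') = c * (NN w|M. eneg (NN p|(Na i w). h p))"
    unfolding c_def \<Phi>_def[of h'] by (simp add: Nah mult.assoc cong: nn_integral_cong)
   also have "\<dots> = (NN w|(density M (\<lambda>_. c)). eneg (NN p|(Na i w). h p))"
    using Nam by (simp add: nn_integral_density nn_integral_cmult)
   finally show "(NN w|(density M u). eneg (NN p|(Na i w). h p)) = (NN w|(density M (\<lambda>_. c)). eneg (NN p|(Na i w). h p))" .
  qed (use setsN in \<open>auto simp: Na_def\<close>)
  moreover have "emeasure (density M u) (W i) = (NN w|M. (\<Prod>j\<in>insert i J'. indicator (W j) w) * eneg (NN p|(N w). f p))"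
   using um Wm[of i] insert.hyps by (subst emeasure_density) (auto simp: u_def mult_ac intro!: nn_integral_cong)
  moreover have "emeasure (density M (\<lambda>_. c)) (W i) = (\<Prod>j\<in>insert i J'. emeasure M (W j)) * \<Phi> f"
   using Wm[of i] insert.hyps by (simp add: emeasure_density_const c_def mult_ac)
  ultimately show ?case by simp
 qed
 have Wm: "W j \<in> events" if "j \<in> J" for j using that J W ev[of j] by blast
 have ind: "(\<Prod>j\<in>J. indicator (W j) w :: ennreal) = indicator (\<Inter>j\<in>J. W j) w" for w
 proof (cases "w \<in> (\<Inter>j\<in>J. W j)")
  case False
  then obtain j where "j \<in> J" "w \<notin> W j" by auto
  then show ?thesis using J(3) False by (auto intro!: prod_zero bexI[of _ j])
 qed simp
 have "emeasure M (\<Inter>j\<in>J. W j) = (NN w|M. (\<Prod>j\<in>J. indicator (W j) w) * eneg (NN p|(N w). 0))"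
  using Wm J by (simp add: ind sets.finite_INT)
 also have "\<dots> = (\<Prod>j\<in>J. emeasure M (W j))"
  using claim[of J "\<lambda>_. 0"] J by (simp add: \<Phi>_def emeasure_space_1)
 finally show "prob (\<Inter>j\<in>J. W j) = (\<Prod>j\<in>J. prob (W j))"
  by (simp add: emeasure_eq_measure prod_ennreal measure_nonneg prod_nonneg)
qed

lemma indep_vars_cong_AE:
 assumes ind: "indep_vars M' Y I" and X: "\<And>i. i \<in> I \<Longrightarrow> random_variable (M' i) (X i)"
  and eq: "\<And>i. i \<in> I \<Longrightarrow> AE w in M. X i w = Y i w"
 shows "indep_vars M' X I"
 unfolding indep_vars_def2
proof (intro conjI ballI X indep_setsI)
 fix i assume "i \<in> I"
 then show "{X i -` A \<inter> space M |A. A \<in> sets (M' i)} \<subseteq> events" using X by (auto intro: measurable_sets)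
next
 fix A J assume J: "J \<noteq> {}" "J \<subseteq> I" "finite J" and "\<forall>j\<in>J. A j \<in> {X j -` A \<inter> space M |A. A \<in> sets (M' j)}"
 then obtain B where B: "\<And>j. j \<in> J \<Longrightarrow> A j = X j -` B j \<inter> space M" "\<And>j. j \<in> J \<Longrightarrow> B j \<in> sets (M' j)"
  by (simp add: Bex_def) metis
 have Y: "random_variable (M' i) (Y i)" if "i \<in> I" for i using ind that by (simp add: indep_vars_def2)
 define A' where "A' j = Y j -` B j \<inter> space M" for j
 have Am: "A j \<in> events" "A' j \<in> events" if "j \<in> J" for j
  using that B J X Y by (auto simp: A'_def intro!: measurable_sets)
 have AA: "AE w in M. w \<in> A j \<longleftrightarrow> w \<in> A' j" if j: "j \<in> J" for j
 proof -
  have "AE w in M. X j w = Y j w" using eq j J by blast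
  then show ?thesis by eventually_elim (simp add: B(1)[OF j] A'_def)
 qed
 have "AE w in M. \<forall>j\<in>J. w \<in> A j \<longleftrightarrow> w \<in> A' j" using J AA by (intro AE_finite_allI) auto
 then have "prob (\<Inter>j\<in>J. A j) = prob (\<Inter>j\<in>J. A' j)"
  using Am J by (intro measure_eq_AE) (auto elim!: AE_mp)
 also have "\<dots> = (\<Prod>j\<in>J. prob (A' j))"
  using ind J B(2) unfolding indep_vars_def2 by (intro indep_setsD[of _ I]) (auto simp: A'_def)
 also have "\<dots> = (\<Prod>j\<in>J. prob (A j))"
 proof (intro prod.cong refl measure_eq_AE)
  fix j assume j: "j \<in> J"
  show "AE w in M. w \<in> A' j \<longleftrightarrow> w \<in> A j" using AA[OF j] by eventually_elim blast
 qed (use Am in auto)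
 finally show "prob (\<Inter>j\<in>J. A j) = (\<Prod>j\<in>J. prob (A j))" .
qed

end

section \<open>Completely random signed measures from their Laplace functional\<close>

lemma extend_zero_measurable:
 fixes f :: "'a::topological_space \<times> real \<Rightarrow> ennreal"
 assumes f: "f \<in> borel_measurable point_borel"
 shows "(\<lambda>p. if snd p = 0 then 0 else f p) \<in> borel_measurable pair_borel"
proof (rule measurableI)
 fix B :: "ennreal set" assume B: "B \<in> sets borel"
 have "f -` B \<inter> space point_borel \<in> sets point_borel" by (rule measurable_sets[OF f B])
 then have 1: "f -` B \<inter> UNIV \<times> - {0} \<in> sets pair_borel" by (simp add: sets_pair_nonzero_borel space_pair_measure)
 have 2: "UNIV \<times> {0} \<in> sets ((borel :: 'a measure) \<Otimes>\<^sub>M (borel :: real measure))" by (intro pair_measureI) auto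
 have "(\<lambda>p. if snd p = 0 then 0 else f p) -` B = (f -` B \<inter> UNIV \<times> - {0}) \<union> (if 0 \<in> B then UNIV \<times> {0} else {})"
  by (auto split: if_splits)
 then show "(\<lambda>p. if snd p = 0 then 0 else f p) -` B \<inter> space pair_borel \<in> sets pair_borel"
  using 1 2 by (auto simp: space_pair_measure)
qed simp

lemma signed_measure_finite_sum:
 fixes \<xi> :: "'a::metric_space set \<Rightarrow> real"
 assumes \<xi>: "\<xi> \<in> space signed_measure_space" and T: "finite T"
 shows "\<xi> T = (\<Sum>s\<in>T. \<xi> {s})"
 using T
proof (induction T rule: finite_induct)
 case empty
 then show ?case using signed_measure_empty[OF \<xi>] by simp
next
 case (insert s T)
 have "T \<in> bounded_borel" using insert(1) by (auto simp: bounded_borel_def finite_imp_bounded intro: borel_closed finite_imp_closed)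
 then have "\<xi> ({s} \<union> T) = \<xi> {s} + \<xi> T" using insert(2) by (intro signed_measure_Un[OF \<xi>]) auto
 with insert show ?case by simp
qed

lemma zero_signed_measure_space: "zero_signed_measure \<in> space signed_measure_space"
 by (auto simp: space_signed_measure_space zero_signed_measure_def range_subsetD)

text \<open>An almost surely purely atomic signed measure whose Laplace functional is that of
  independent weights with laws \<open>L s\<close> at \<open>S\<close> and an independent Poisson
  process of intensity \<open>F\<close>. The locale recovers the representation from this formula
  alone.\<close>

locale laplace_crsm = prob_space M for M :: "'w measure" +
 fixes Z :: "'w \<Rightarrow> 'b::{metric_space, second_countable_topology} set \<Rightarrow> real"
  and S :: "'b set" and L :: "'b \<Rightarrow> real measure" and F :: "('b \<times> real) measure"
 assumes Zm: "Z \<in> M \<rightarrow>\<^sub>M signed_measure_space"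
  and atomic: "AE w in M. atomic_part (Z w) = Z w"
  and levy: "levy_measure F" and S: "finite S"
  and L: "\<And>s. s \<in> S \<Longrightarrow> prob_space (L s)" "\<And>s. s \<in> S \<Longrightarrow> sets (L s) = sets borel"
  and lap: "\<And>f. f \<in> borel_measurable pair_borel \<Longrightarrow>
   (NN w|M. eneg (NN p|(atom_process (Z w)). f p)) =
   eneg (NN p|F. 1 - eneg (f p)) * (\<Prod>s\<in>S. NN t|(L s). eneg (f (s, t)))"
begin

lemma setsF: "sets F = sets point_borel"
 using levy by (simp add: levy_measure_def)

lemma spaceF: "space F = UNIV \<times> - {0}"
 using sets_eq_imp_space_eq[OF setsF] by (simp add: space_pair_measure)

lemma Z_space: "w \<in> space M \<Longrightarrow> Z w \<in> space signed_measure_space"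
 using measurable_space[OF Zm] .

lemma setsAP: "sets (atom_process (Z w)) = sets F"
 by (simp add: setsF)

lemma measAP: "A \<in> sets F \<Longrightarrow> (\<lambda>w. emeasure (atom_process (Z w)) A) \<in> borel_measurable M"
 unfolding setsF by (rule measurable_compose[OF Zm measurable_emeasure_atom_process])

lemma valsAP: "A \<in> sets F \<Longrightarrow> enat_valued (emeasure (atom_process (Z w)) A)"
 unfolding setsF by (simp add: emeasure_atom_process enat_valued_emeasure_count_space)

definition "strip C = C \<times> - {0 :: real}" for C :: "'b set"

lemma strip_sets: "C \<in> sets borel \<Longrightarrow> strip C \<in> sets F"
 unfolding setsF strip_def by (rule pair_nonzero_setsI) auto

lemma finite_borel: "finite T \<Longrightarrow> T \<in> sets (borel :: 'b measure)"
 by (intro borel_closed finite_imp_closed)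

lemma F_strip: "finite T \<Longrightarrow> emeasure F (strip T) = 0"
proof -
 assume T: "finite T"
 have "strip T = (\<Union>s\<in>T. {s} \<times> - {0})" by (auto simp: strip_def)
 also have "emeasure F \<dots> = 0"
 proof -
  have "{s} \<times> - {0} \<in> null_sets F" for s
   using levy strip_sets[of "{s}"] by (auto simp: levy_measure_def null_sets_def strip_def)
  then have "(\<Union>s\<in>T. {s} \<times> - {0}) \<in> null_sets F" using T by (intro null_sets.finite_UN) auto
  then show ?thesis by (rule null_setsD1)
 qed
 finally show ?thesis .
qed

lemma L_le_1: "s \<in> S \<Longrightarrow> (NN t|(L s). 1) = 1"
 using prob_space.emeasure_space_1[OF L(1)] by simp

text \<open>Test functions measurable for \<open>F\<close> are uncontrolled at weight 0, where the
  formula of the locale still evaluates them; the value 0 there changes neither the atom process nor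
  \<open>F\<close>.\<close>

definition "extz f p = (if snd p = 0 then 0 else f p)" for f :: "'b \<times> real \<Rightarrow> ennreal"

lemma extz_meas: "f \<in> borel_measurable F \<Longrightarrow> extz f \<in> borel_measurable pair_borel"
 unfolding extz_def[abs_def] using setsF by (intro extend_zero_measurable) (simp cong: measurable_cong_sets)

lemma lap': "f \<in> borel_measurable F \<Longrightarrow>
 (NN w|M. eneg (NN p|(atom_process (Z w)). f p)) =
 eneg (NN p|F. 1 - eneg (f p)) * (\<Prod>s\<in>S. NN t|(L s). eneg (extz f (s, t)))"
proof -
 assume f: "f \<in> borel_measurable F"
 have "(NN p|(atom_process (Z w)). extz f p) = (NN p|(atom_process (Z w)). f p)" for w
  by (intro nn_integral_cong) (auto simp: extz_def space_atom_process)
 moreover have "(NN p|F. 1 - eneg (extz f p)) = (NN p|F. 1 - eneg (f p))"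
  by (intro nn_integral_cong) (auto simp: extz_def spaceF)
 ultimately show ?thesis using lap[OF extz_meas[OF f]] by simp
qed

lemma eneg_split: "f p = 0 \<or> h p = 0 \<Longrightarrow> 1 - eneg (f p + h p) = (1 - eneg (f p)) + (1 - eneg (h p))"
 by auto

lemma F_split:
 assumes "f \<in> borel_measurable F" "h \<in> borel_measurable F" "\<And>p. f p = 0 \<or> h p = 0"
 shows "eneg (NN p|F. 1 - eneg (f p + h p)) = eneg (NN p|F. 1 - eneg (f p)) * eneg (NN p|F. 1 - eneg (h p))"
proof -
 have "(NN p|F. 1 - eneg (f p + h p)) = (NN p|F. (1 - eneg (f p)) + (1 - eneg (h p)))"
  by (intro nn_integral_cong eneg_split assms(3))
 also have "\<dots> = (NN p|F. 1 - eneg (f p)) + (NN p|F. 1 - eneg (h p))"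
 proof (rule nn_integral_add)
  note [measurable] = assms(1,2)
  show "(\<lambda>p. 1 - eneg (f p)) \<in> borel_measurable F" "(\<lambda>p. 1 - eneg (h p)) \<in> borel_measurable F" by measurable
 qed
 finally show ?thesis by (simp only: eneg_add)
qed

text \<open>All information on the atoms located in \<open>C\<close>.\<close>

definition "local_sigma C = process_sigma M (\<lambda>w. density (atom_process (Z w)) (indicator (strip C))) F"

text \<open>A test function split by location splits the Poisson exponent additively, and each fixed
  location lies on one side of the split, so the functional factors.\<close>

lemma indep_local_sigma:
 fixes C :: "'i \<Rightarrow> 'b set"
 assumes C: "\<And>i. i \<in> I \<Longrightarrow> C i \<in> sets borel" and disj: "disjoint_family_on C I"
 shows "indep_sets (\<lambda>i. sets (local_sigma (C i))) I"
 unfolding local_sigma_def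
proof (rule indep_restrictions[where N = "\<lambda>w. atom_process (Z w)" and A = "\<lambda>i. strip (C i)"])
 show "disjoint_family_on (\<lambda>i. strip (C i)) I" using disj by (auto simp: disjoint_family_on_def strip_def)
 fix i and f h :: "'b \<times> real \<Rightarrow> ennreal"
 assume i: "i \<in> I" and f: "f \<in> borel_measurable F" and h: "h \<in> borel_measurable F"
  and f0: "\<And>p. p \<in> strip (C i) \<Longrightarrow> f p = 0" and h0: "\<And>p. p \<notin> strip (C i) \<Longrightarrow> h p = 0"
 have fh: "(\<lambda>p. f p + h p) \<in> borel_measurable F" using f h by measurable
 have "(NN t|(L s). eneg (extz (\<lambda>p. f p + h p) (s, t))) = (NN t|(L s). eneg (extz f (s, t))) * (NN t|(L s). eneg (extz h (s, t)))"
  if "s \<in> S" for s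
 proof (cases "s \<in> C i")
  case True
  then have f0': "f (s, t) = 0" if "t \<noteq> 0" for t using that by (intro f0) (simp add: strip_def)
  then have "extz f (s, t) = 0" "extz (\<lambda>p. f p + h p) (s, t) = extz h (s, t)" for t by (auto simp: extz_def)
  then show ?thesis using L_le_1[OF that] by simp
 next
  case False
  then have h0': "h (s, t) = 0" for t by (intro h0) (simp add: strip_def)
  then have "extz h (s, t) = 0" "extz (\<lambda>p. f p + h p) (s, t) = extz f (s, t)" for t by (auto simp: extz_def)
  then show ?thesis using L_le_1[OF that] by simp
 qed
 then have P: "(\<Prod>s\<in>S. NN t|(L s). eneg (extz (\<lambda>p. f p + h p) (s, t))) =
   (\<Prod>s\<in>S. NN t|(L s). eneg (extz f (s, t))) * (\<Prod>s\<in>S. NN t|(L s). eneg (extz h (s, t)))"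
  by (simp add: prod.distrib)
 have z: "f p = 0 \<or> h p = 0" for p using f0 h0 by blast
 show "(NN w|M. eneg (NN p|(atom_process (Z w)). f p + h p)) =
  (NN w|M. eneg (NN p|(atom_process (Z w)). f p)) * (NN w|M. eneg (NN p|(atom_process (Z w)). h p))"
  unfolding lap'[OF fh] lap'[OF f] lap'[OF h] F_split[OF f h z] P by (simp only: mult_ac)
qed (use C strip_sets setsAP measAP valsAP in auto)

lemma local_sigma_nn_integral:
 assumes C: "C \<in> sets borel" and f: "f \<in> borel_measurable F" and f0: "\<And>p. p \<notin> strip C \<Longrightarrow> f p = 0"
 shows "(\<lambda>w. NN p|(atom_process (Z w)). f p) \<in> borel_measurable (local_sigma C)"
proof -
 have "(NN p|(density (atom_process (Z w)) (indicator (strip C))). f p) = (NN p|(atom_process (Z w)). f p)" for w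
 proof -
  have "f \<in> borel_measurable (atom_process (Z w))" using f setsAP by (simp cong: measurable_cong_sets)
  then have "(NN p|(density (atom_process (Z w)) (indicator (strip C))). f p) = (NN p|(atom_process (Z w)). f p * indicator (strip C) p)"
   using strip_sets[OF C] setsAP by (intro nn_integral_density_indicator) auto
  also have "\<dots> = (NN p|(atom_process (Z w)). f p)"
   using f0 by (intro nn_integral_cong) (auto simp: indicator_def)
  finally show ?thesis .
 qed
 moreover have "(\<lambda>w. NN p|(density (atom_process (Z w)) (indicator (strip C))). f p) \<in> borel_measurable (local_sigma C)"
  unfolding local_sigma_def by (rule sigma_nn_integral_process) (use f setsAP in auto)
 ultimately show ?thesis by simp
qed

lemma space_local_sigma [simp]: "space (local_sigma C) = space M"
 by (simp add: local_sigma_def)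

lemma local_sigma_atomic_part:
 assumes C: "C \<in> sets borel" and B: "B \<in> bounded_borel" "B \<subseteq> C"
 shows "(\<lambda>w. atomic_part (Z w) B) \<in> borel_measurable (local_sigma C)"
proof -
 let ?w = "\<lambda>p. indicator B (fst p) * snd p :: real"
 have w: "?w \<in> borel_measurable F"
  using measurable_weight[OF bounded_borel_sets[OF B(1)]] setsF by (simp cong: measurable_cong_sets)
 have "(\<lambda>w. enn2real (NN p|(atom_process (Z w)). ennreal (?w p)) - enn2real (NN p|(atom_process (Z w)). ennreal (- ?w p)))
   \<in> borel_measurable (local_sigma C)"
  using w B(2) by (intro borel_measurable_diff borel_measurable_enn2real local_sigma_nn_integral[OF C])
   (auto simp: strip_def indicator_def)
 moreover have "atomic_part (Z w) B = enn2real (NN p|(atom_process (Z w)). ennreal (?w p)) - enn2real (NN p|(atom_process (Z w)). ennreal (- ?w p))"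
  if "w \<in> space (local_sigma C)" for w
  using B(1) real_lebesgue_integral_def[OF integrable_atom_process[OF Z_space[of w] B(1)]] that by (simp add: atomic_part_def)
 ultimately show ?thesis by (subst measurable_cong) auto
qed

lemma local_sigma_events: "C \<in> sets borel \<Longrightarrow> sets (local_sigma C) \<subseteq> events"
 using indep_local_sigma[of "{()}" "\<lambda>_. C"] by (auto simp: indep_sets_def disjoint_family_on_def)

lemma measurable_local_sigma:
 assumes "C \<in> sets borel" "f \<in> local_sigma C \<rightarrow>\<^sub>M N"
 shows "f \<in> M \<rightarrow>\<^sub>M N"
proof (rule measurableI)
 show "f x \<in> space N" if "x \<in> space M" for x using measurable_space[OF assms(2)] that by simp
 show "f -` A \<inter> space M \<in> sets M" if "A \<in> sets N" for A
  using measurable_sets[OF assms(2) that] local_sigma_events[OF assms(1)] by auto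
qed

lemma indep_vars_atomic_part:
 assumes A: "\<And>i. i \<in> I \<Longrightarrow> A i \<in> bounded_borel" and disj: "disjoint_family_on A I"
 shows "indep_vars (\<lambda>_. borel) (\<lambda>i w. atomic_part (Z w) (A i)) I"
 unfolding indep_vars_def2
proof (intro conjI ballI)
 have m: "(\<lambda>w. atomic_part (Z w) (A i)) \<in> borel_measurable (local_sigma (A i))" if "i \<in> I" for i
  using A[OF that] by (intro local_sigma_atomic_part bounded_borel_sets) auto
 show "random_variable borel (\<lambda>w. atomic_part (Z w) (A i))" if "i \<in> I" for i
  by (rule measurable_local_sigma[OF bounded_borel_sets[OF A[OF that]] m[OF that]])
 show "indep_sets (\<lambda>i. {(\<lambda>w. atomic_part (Z w) (A i)) -` B \<inter> space M |B. B \<in> sets borel}) I"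
 proof (rule indep_sets_mono_sets)
  show "indep_sets (\<lambda>i. sets (local_sigma (A i))) I"
   using A disj by (intro indep_local_sigma bounded_borel_sets) auto
  show "{(\<lambda>w. atomic_part (Z w) (A i)) -` B \<inter> space M |B. B \<in> sets borel} \<subseteq> sets (local_sigma (A i))" if "i \<in> I" for i
   using measurable_sets[OF m[OF that]] by auto
 qed
qed

lemma crsm: "crsm M Z"
 unfolding crsm_def
proof (intro conjI allI impI prob_space_axioms Zm)
 fix A :: "nat \<Rightarrow> 'b set" assume A: "range A \<subseteq> bounded_borel \<and> disjoint_family A"
 show "indep_vars (\<lambda>_. borel) (\<lambda>i w. Z w (A i)) UNIV"
 proof (rule indep_vars_cong_AE)
  show "indep_vars (\<lambda>_. borel) (\<lambda>i w. atomic_part (Z w) (A i)) UNIV"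
   using A by (intro indep_vars_atomic_part) auto
  show "random_variable borel (\<lambda>w. Z w (A i))" for i
   using A by (intro measurable_compose[OF Zm measurable_signed_measure_eval]) auto
  show "AE w in M. Z w (A i) = atomic_part (Z w) (A i)" for i
   using atomic by eventually_elim simp
 qed
qed

text \<open>A test function that is infinite over \<open>s\<close> for weights outside
  \<open>B\<close> turns the functional into the probability that no atom is there. A missing atom
  is counted along, as the atom process cannot see it; the empty \<open>B\<close> then shows that it
  has probability 0.\<close>

lemma atoms_present: "s \<in> S \<Longrightarrow> B \<in> sets borel \<Longrightarrow> emeasure M {w\<in>space M. Z w {s} = 0 \<or> Z w {s} \<in> B} = emeasure (L s) B"
proof -
 assume s: "s \<in> S" and B: "B \<in> sets borel"
 define A where "A = {s} \<times> (- B \<inter> - {0 :: real})"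
 have A: "A \<in> sets F" unfolding setsF A_def using B by (intro pair_nonzero_setsI) auto
 have Am: "A \<in> sets pair_borel" using A by (simp add: setsF sets_pair_nonzero_borel)
 \<comment> \<open>Unlike \<open>A\<close>, this set may contain the weight 0, so that the factor of
   \<open>s\<close> in the product is exactly the indicator of \<open>B\<close>.\<close>
 define Bm where "Bm = {s} \<times> (- B)"
 have Bmm: "Bm \<in> sets pair_borel" unfolding Bm_def using B by (intro pair_measureI) auto
 define f where "f p = (\<top> :: ennreal) * indicator Bm p" for p :: "'b \<times> real"
 have fm: "f \<in> borel_measurable pair_borel" unfolding f_def[abs_def] using Bmm by measurable
 have e: "eneg (NN p|(atom_process (Z w)). f p) = indicator {w\<in>space M. Z w {s} = 0 \<or> Z w {s} \<in> B} w" if "w \<in> space M" for w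
 proof -
  have "(NN p|(atom_process (Z w)). f p) = (NN p|(atom_process (Z w)). \<top> * indicator A p)"
   by (intro nn_integral_cong) (auto simp: f_def A_def Bm_def space_atom_process indicator_def)
  also have "\<dots> = \<top> * emeasure (atom_process (Z w)) A"
   using A setsAP by (intro nn_integral_cmult_indicator) auto
  also have "emeasure (atom_process (Z w)) A = emeasure (count_space UNIV) {s'. (s', Z w {s'}) \<in> A}"
   using A by (intro emeasure_atom_process) (simp add: setsF)
  also have "{s'. (s', Z w {s'}) \<in> A} = (if Z w {s} = 0 \<or> Z w {s} \<in> B then {} else {s})"
   by (auto simp: A_def)
  finally show ?thesis using that by (auto simp: indicator_def)
 qed
 have m: "{w\<in>space M. Z w {s} = 0 \<or> Z w {s} \<in> B} \<in> events"
 proof -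
  have [measurable]: "(\<lambda>w. Z w {s}) \<in> borel_measurable M" by (rule measurable_compose[OF Zm measurable_signed_measure_eval]) simp
  show ?thesis using B by measurable
 qed
 have "emeasure M {w\<in>space M. Z w {s} = 0 \<or> Z w {s} \<in> B} = (NN w|M. eneg (NN p|(atom_process (Z w)). f p))"
  using m by (simp add: e cong: nn_integral_cong)
 also have "\<dots> = eneg (NN p|F. 1 - eneg (f p)) * (\<Prod>s\<in>S. NN t|(L s). eneg (f (s, t)))" by (rule lap[OF fm])
 also have "(NN p|F. 1 - eneg (f p)) = 0"
 proof -
  have "strip {s} \<in> null_sets F" using F_strip[of "{s}"] strip_sets[of "{s}"] by (auto simp: null_sets_def)
  then have "AE p in F. p \<notin> strip {s}" by (rule AE_not_in)
  then have "AE p in F. 1 - eneg (f p) = 0" using AE_space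
   by eventually_elim (auto simp: spaceF strip_def f_def Bm_def indicator_def)
  then have "(NN p|F. 1 - eneg (f p)) = (NN p|F. 0)" by (rule nn_integral_cong_AE)
  then show ?thesis by simp
 qed
 also have "(\<Prod>s'\<in>S. NN t|(L s'). eneg (f (s', t))) = (\<Prod>s'\<in>{s}. NN t|(L s'). eneg (f (s', t)))"
  using s S L_le_1 by (intro prod.mono_neutral_right) (auto simp: f_def Bm_def)
 also have "\<dots> = (NN t|(L s). indicator B t)"
  by (auto simp: f_def Bm_def indicator_def intro!: nn_integral_cong)
 also have "\<dots> = emeasure (L s) B" using B L(2)[OF s] by simp
 finally show ?thesis by simp
qed

lemma AE_atoms_present: "s \<in> S \<Longrightarrow> AE w in M. Z w {s} \<noteq> 0"
proof -
 assume s: "s \<in> S"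
 have [measurable]: "(\<lambda>w. Z w {s}) \<in> borel_measurable M" by (rule measurable_compose[OF Zm measurable_signed_measure_eval]) simp
 have "{w\<in>space M. Z w {s} = 0} \<in> null_sets M"
  using atoms_present[OF s, of "{}"] by (auto simp: null_sets_def)
 from AE_not_in[OF this] AE_space show ?thesis by eventually_elim simp
qed

lemma distr_atom:
 assumes s: "s \<in> S"
 shows "distr M borel (\<lambda>w. atomic_part (Z w) {s}) = L s"
proof (rule measure_eqI)
 have am: "(\<lambda>w. atomic_part (Z w) {s}) \<in> borel_measurable M"
  by (rule measurable_local_sigma[OF _ local_sigma_atomic_part[of "{s}"]]) auto
 fix B assume "B \<in> sets (distr M borel (\<lambda>w. atomic_part (Z w) {s}))"
 then have B [measurable]: "B \<in> sets borel" by simp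
 have [measurable]: "(\<lambda>w. Z w {s}) \<in> borel_measurable M" by (rule measurable_compose[OF Zm measurable_signed_measure_eval]) simp
 have "emeasure (distr M borel (\<lambda>w. atomic_part (Z w) {s})) B = emeasure M ((\<lambda>w. atomic_part (Z w) {s}) -` B \<inter> space M)"
  by (rule emeasure_distr[OF am B])
 also have "\<dots> = emeasure M {w\<in>space M. Z w {s} = 0 \<or> Z w {s} \<in> B}"
 proof (rule emeasure_eq_AE)
  show "AE w in M. w \<in> (\<lambda>w. atomic_part (Z w) {s}) -` B \<inter> space M \<longleftrightarrow> w \<in> {w\<in>space M. Z w {s} = 0 \<or> Z w {s} \<in> B}"
   using atomic AE_atoms_present[OF s] by eventually_elim auto
  show "(\<lambda>w. atomic_part (Z w) {s}) -` B \<inter> space M \<in> events" by (rule measurable_sets[OF am B])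
 qed measurable
 also have "\<dots> = emeasure (L s) B" by (rule atoms_present[OF s B])
 finally show "emeasure (distr M borel (\<lambda>w. atomic_part (Z w) {s})) B = emeasure (L s) B" .
qed (simp add: L(2)[OF s])

text \<open>The candidate for the Poisson process of the representation: the atoms off the fixed
  locations.\<close>

definition "ord_process w = density (atom_process (Z w)) (indicator (strip (- S)))"

lemma S_sets: "- S \<in> sets (borel :: 'b measure)"
 using finite_borel[OF S] by (simp add: borel_comp)

lemma sets_ord: "sets (ord_process w) = sets F"
 by (simp add: ord_process_def setsAP setsF)

lemma emeasure_ord: "A \<in> sets F \<Longrightarrow> emeasure (ord_process w) A = emeasure (atom_process (Z w)) (strip (- S) \<inter> A)"
 unfolding ord_process_def using strip_sets[OF S_sets] setsAP by (intro emeasure_density_indicator) auto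

lemma meas_ord: "A \<in> sets F \<Longrightarrow> (\<lambda>w. emeasure (ord_process w) A) \<in> borel_measurable M"
 using strip_sets[OF S_sets] by (simp add: emeasure_ord measAP sets.Int)

lemma vals_ord: "A \<in> sets F \<Longrightarrow> enat_valued (emeasure (ord_process w) A)"
 using strip_sets[OF S_sets] by (simp add: emeasure_ord valsAP sets.Int)

lemma lap_ord:
 assumes f: "f \<in> borel_measurable F"
 shows "(NN w|M. eneg (NN p|(ord_process w). f p)) = eneg (NN p|F. 1 - eneg (f p))"
proof -
 define h where "h p = f p * indicator (strip (- S)) p" for p
 have hm: "h \<in> borel_measurable F" unfolding h_def[abs_def]
  using f strip_sets[OF S_sets] by (intro borel_measurable_times_ennreal borel_measurable_indicator) auto
 have "(NN p|(ord_process w). f p) = (NN p|(atom_process (Z w)). h p)" for w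
 proof -
  have "f \<in> borel_measurable (atom_process (Z w))" using f setsAP by (simp cong: measurable_cong_sets)
  then show ?thesis unfolding ord_process_def h_def
   using strip_sets[OF S_sets] setsAP by (intro nn_integral_density_indicator) auto
 qed
 then have "(NN w|M. eneg (NN p|(ord_process w). f p)) =
   eneg (NN p|F. 1 - eneg (h p)) * (\<Prod>s\<in>S. NN t|(L s). eneg (extz h (s, t)))"
  using lap'[OF hm] by simp
 also have "(\<Prod>s\<in>S. NN t|(L s). eneg (extz h (s, t))) = 1"
 proof (rule prod.neutral, rule ballI)
  fix s assume s: "s \<in> S"
  then have "extz h (s, t) = 0" for t by (auto simp: extz_def h_def strip_def)
  then show "(NN t|(L s). eneg (extz h (s, t))) = 1" using L_le_1[OF s] by simp
 qed
 also have "(NN p|F. 1 - eneg (h p)) = (NN p|F. 1 - eneg (f p))"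
 proof (rule nn_integral_cong_AE)
  have "strip S \<in> null_sets F" using F_strip[OF S] strip_sets[OF finite_borel[OF S]] by (auto simp: null_sets_def)
  then have "AE p in F. p \<notin> strip S" by (rule AE_not_in)
  then show "AE p in F. 1 - eneg (h p) = 1 - eneg (f p)" using AE_space
   by eventually_elim (auto simp: h_def spaceF strip_def indicator_def)
 qed
 finally show ?thesis by simp
qed

text \<open>The Laplace transform of the count is the generating function of the Poisson law, and
  the coefficients of bounded power series are unique.\<close>

lemma poisson_count:
 assumes A: "A \<in> sets F" and fin: "emeasure F A < \<infinity>"
 shows "prob {w\<in>space M. emeasure (ord_process w) A = of_nat n} = exp (- measure F A) * measure F A ^ n / fact n"
proof -
 define r where "r = measure F A"
 have r: "emeasure F A = ennreal r" "0 \<le> r" unfolding r_def using fin by (auto simp: emeasure_eq_ennreal_measure less_top)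
 define p where "p n = prob {w\<in>space M. emeasure (ord_process w) A = of_nat n}" for n :: nat
 define q where "q n = exp (- r) * r ^ n / fact n" for n :: nat
 have "p n - q n = 0"
 proof (rule power_series_zero_coeff[where d = "\<lambda>n. p n - q n"])
  have qs: "(\<lambda>n. q n * u ^ n) sums exp (- r * (1 - u))" for u
  proof -
   have "(\<lambda>n. exp (- r) * ((r * u) ^ n /\<^sub>R fact n)) sums (exp (- r) * exp (r * u))" by (intro sums_mult exp_converges)
   moreover have "exp (- r) * exp (r * u) = exp (- r * (1 - u))" by (simp add: exp_add[symmetric] algebra_simps)
   ultimately show ?thesis by (simp add: q_def power_mult_distrib divide_inverse mult_ac)
  qed
  have q0: "0 \<le> q n" for n using r by (simp add: q_def)
  have "q n \<le> 1" for n
  proof -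
   have "q n = (\<Sum>i\<in>{n}. q i * 1 ^ i)" by simp
   also have "\<dots> \<le> (\<Sum>i. q i * 1 ^ i)" using qs[of 1] q0 by (intro sum_le_suminf) (auto simp: sums_iff)
   also have "\<dots> = 1" using qs[of 1] by (simp add: sums_iff)
   finally show ?thesis .
  qed
  moreover have "0 \<le> p n" "p n \<le> 1" for n by (auto simp: p_def)
  ultimately show "\<bar>p n - q n\<bar> \<le> 2" for n using q0[of n] by (smt (verit))
  fix u :: real assume u: "0 < u" "u < 1"
  define c where "c = - ln u"
  have c: "0 < c" "exp (- c) = u" using u by (auto simp: c_def)
  have "(NN w|M. eneg (ennreal c * emeasure (ord_process w) A)) =
    (\<Sum>n. eneg (ennreal c * of_nat n) * emeasure M {w\<in>space M. emeasure (ord_process w) A = of_nat n})"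
   using c by (intro nn_integral_eneg_enat_valued meas_ord[OF A]) (auto simp: vals_ord[OF A])
  also have "\<dots> = (\<Sum>n. ennreal (p n * u ^ n))"
   using c u by (simp add: eneg_of_nat p_def emeasure_eq_measure ennreal_mult'' mult.commute)
  finally have 1: "(NN w|M. eneg (ennreal c * emeasure (ord_process w) A)) = (\<Sum>n. ennreal (p n * u ^ n))" .
  have Am: "(\<lambda>p. ennreal c * indicator A p) \<in> borel_measurable F" using A by measurable
  have "(NN w|M. eneg (ennreal c * emeasure (ord_process w) A)) = (NN w|M. eneg (NN p|(ord_process w). ennreal c * indicator A p))"
   using A by (simp add: nn_integral_cmult_indicator sets_ord)
  also have "\<dots> = eneg (NN p|F. 1 - eneg (ennreal c * indicator A p))" by (rule lap_ord[OF Am])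
  also have "(NN p|F. 1 - eneg (ennreal c * indicator A p)) = (NN p|F. ennreal (1 - u) * indicator A p)"
   using c by (intro nn_integral_cong) (auto simp: indicator_def eneg_ennreal ennreal_minus[symmetric])
  also have "\<dots> = ennreal ((1 - u) * r)" using A u r by (simp add: nn_integral_cmult_indicator ennreal_mult')
  also have "eneg \<dots> = ennreal (exp (- r * (1 - u)))" using u r by (simp add: eneg_ennreal mult.commute)
  finally have "(\<Sum>n. ennreal (p n * u ^ n)) = ennreal (exp (- r * (1 - u)))" using 1 by simp
  moreover have "(\<lambda>n. ennreal (p n * u ^ n)) sums (\<Sum>n. ennreal (p n * u ^ n))" by (simp add: summable_sums)
  ultimately have "(\<lambda>n. p n * u ^ n) sums exp (- r * (1 - u))"
   using u by (subst sums_ennreal[symmetric]) (auto simp: p_def)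
  from sums_diff[OF this qs[of u]] show "(\<lambda>n. (p n - q n) * u ^ n) sums 0" by (simp add: left_diff_distrib)
 qed
 then show ?thesis by (simp add: p_def q_def r_def)
qed

text \<open>The exponent for the indicator of \<open>A\<close> is a positive constant times an
  infinite mass, so the expected \<open>eneg\<close> of the count is 0.\<close>

lemma poisson_infinite:
 assumes A: "A \<in> sets F" and inf: "emeasure F A = \<infinity>"
 shows "AE w in M. emeasure (ord_process w) A = \<infinity>"
proof -
 have [measurable]: "(\<lambda>w. emeasure (ord_process w) A) \<in> borel_measurable M" by (rule meas_ord[OF A])
 have e1: "1 - eneg 1 \<noteq> 0" using eneg_lt_1[of 1] by (simp add: diff_eq_0_iff_ennreal)
 have Am: "indicator A \<in> borel_measurable F" using A by measurable
 have "(NN w|M. eneg (emeasure (ord_process w) A)) = (NN w|M. eneg (NN p|(ord_process w). indicator A p))"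
  using A by (simp add: sets_ord)
 also have "\<dots> = eneg (NN p|F. 1 - eneg (indicator A p))" by (rule lap_ord[OF Am])
 also have "(NN p|F. 1 - eneg (indicator A p)) = (NN p|F. (1 - eneg 1) * indicator A p)"
  by (intro nn_integral_cong) (auto simp: indicator_def)
 also have "\<dots> = (1 - eneg 1) * \<top>" using A inf by (simp add: nn_integral_cmult_indicator)
 also have "\<dots> = \<top>" using e1 by (simp add: ennreal_mult_top)
 finally have "(NN w|M. eneg (emeasure (ord_process w) A)) = 0" by simp
 then have "AE w in M. eneg (emeasure (ord_process w) A) = 0" by (subst (asm) nn_integral_0_iff_AE) auto
 then show ?thesis by simp
qed

lemma poisson_indep:
 fixes A :: "nat \<Rightarrow> ('b \<times> real) set"
 assumes A: "range A \<subseteq> sets F" "disjoint_family A"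
 shows "indep_vars (\<lambda>_. borel) (\<lambda>i w. emeasure (ord_process w) (A i)) UNIV"
 unfolding indep_vars_def2
proof (intro conjI ballI)
 let ?V = "\<lambda>i. process_sigma M (\<lambda>w. density (ord_process w) (indicator (A i))) F"
 have Ai: "A i \<in> sets F" for i using A by auto
 show "random_variable borel (\<lambda>w. emeasure (ord_process w) (A i))" for i by (rule meas_ord[OF Ai])
 have ind: "indep_sets (\<lambda>i. sets (?V i)) UNIV"
 proof (rule indep_restrictions[where N = ord_process])
  fix i and f h :: "'b \<times> real \<Rightarrow> ennreal"
  assume f: "f \<in> borel_measurable F" and h: "h \<in> borel_measurable F"
   and f0: "\<And>p. p \<in> A i \<Longrightarrow> f p = 0" and h0: "\<And>p. p \<notin> A i \<Longrightarrow> h p = 0"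
  have fh: "(\<lambda>p. f p + h p) \<in> borel_measurable F" using f h by measurable
  have z: "f p = 0 \<or> h p = 0" for p using f0 h0 by blast
  show "(NN w|M. eneg (NN p|(ord_process w). f p + h p)) =
   (NN w|M. eneg (NN p|(ord_process w). f p)) * (NN w|M. eneg (NN p|(ord_process w). h p))"
   unfolding lap_ord[OF fh] lap_ord[OF f] lap_ord[OF h] by (rule F_split[OF f h z])
 qed (use sets_ord meas_ord vals_ord Ai A in auto)
 show "indep_sets (\<lambda>i. {(\<lambda>w. emeasure (ord_process w) (A i)) -` B \<inter> space M |B. B \<in> sets borel}) UNIV"
 proof (rule indep_sets_mono_sets[OF ind])
  fix i
  have "(\<lambda>w. NN p|(density (ord_process w) (indicator (A i))). indicator (A i) p) \<in> borel_measurable (?V i)"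
   by (rule sigma_nn_integral_process) (use Ai sets_ord in auto)
  moreover have "(NN p|(density (ord_process w) (indicator (A i))). indicator (A i) p) = emeasure (ord_process w) (A i)" for w
   using Ai[of i] sets_ord[of w] by (simp add: emeasure_density_indicator)
  ultimately have "(\<lambda>w. emeasure (ord_process w) (A i)) \<in> borel_measurable (?V i)" by simp
  from measurable_sets[OF this] show "{(\<lambda>w. emeasure (ord_process w) (A i)) -` B \<inter> space M |B. B \<in> sets borel} \<subseteq> sets (?V i)" by auto
 qed
qed

text \<open>The weights are measurable with respect to the atoms over \<open>S\<close>, the Poisson
  process with respect to those over the complement, so their independence is that of two local
  sigma-algebras. Additivity over \<open>B \<inter> S\<close> and \<open>B - S\<close> gives the sum
  formula.\<close>

lemma representation: "crsm_representation M Z S L zero_signed_measure F"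
 unfolding crsm_representation_def
proof (intro conjI)
 show "countable S" using S by (rule countable_finite)
 show "zero_signed_measure \<in> space (signed_measure_space :: ('b set \<Rightarrow> real) measure)" by (rule zero_signed_measure_space)
 show "\<forall>s. (zero_signed_measure :: 'b set \<Rightarrow> real) {s} = 0" by (simp add: zero_signed_measure_def)
 show "levy_measure F" by (rule levy)
 define Y where "Y s w = atomic_part (Z w) {s}" for s w
 have bb: "AE w in M. \<forall>B\<in>bounded_borel.
      (\<lambda>s. Y s w) summable_on (S \<inter> B) \<and>
      integrable (ord_process w) (\<lambda>p. indicator B (fst p) * snd p) \<and>
      Z w B = (\<Sum>\<^sub>\<infinity>s\<in>S \<inter> B. Y s w) + zero_signed_measure B + (\<integral>p. indicator B (fst p) * snd p \<partial>ord_process w)"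
  using atomic AE_space
 proof eventually_elim
  case (elim w)
  note Zs = Z_space[OF elim(2)]
  show ?case
  proof (intro ballI conjI)
   fix B :: "'b set" assume B: "B \<in> bounded_borel"
   have BS: "B - S \<in> bounded_borel" "B \<inter> S \<in> bounded_borel"
    using bounded_borel_sets[OF B] finite_borel[OF S] by (auto intro!: bounded_borel_subset[OF B])
   show "(\<lambda>s. Y s w) summable_on (S \<inter> B)" using S by (intro summable_on_finite) auto
   have w: "(\<lambda>p. indicator B (fst p) * snd p :: real) \<in> borel_measurable (atom_process (Z w))"
    using measurable_weight[OF bounded_borel_sets[OF B]] by (simp cong: measurable_cong_sets)
   have im: "(indicator (strip (- S)) :: _ \<Rightarrow> real) \<in> borel_measurable (atom_process (Z w))"
    using strip_sets[OF S_sets] setsAP by (intro borel_measurable_indicator) auto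
   have eq: "indicator (strip (- S)) p *\<^sub>R (indicator B (fst p) * snd p) = indicator (B - S) (fst p) * snd p" for p :: "'b \<times> real"
    by (cases p) (auto simp: indicator_def strip_def)
   have od: "ord_process w = density (atom_process (Z w)) (\<lambda>p. ennreal (indicator (strip (- S)) p))"
    by (simp add: ord_process_def ennreal_indicator)
   show "integrable (ord_process w) (\<lambda>p. indicator B (fst p) * snd p)"
    unfolding od by (subst integrable_density[OF w im]) (simp_all only: eq integrable_atom_process[OF Zs BS(1)], simp)
   have "(\<integral>p. indicator B (fst p) * snd p \<partial>ord_process w) = (\<integral>p. indicator (B - S) (fst p) * snd p \<partial>atom_process (Z w))"
    unfolding od by (subst integral_density[OF w im]) (simp_all only: eq, simp)
   also have "\<dots> = atomic_part (Z w) (B - S)" using BS(1) by (simp add: atomic_part_def)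
   also have "\<dots> = Z w (B - S)" using elim(1) by simp
   finally have o: "(\<integral>p. indicator B (fst p) * snd p \<partial>ord_process w) = Z w (B - S)" .
   have "(\<Sum>\<^sub>\<infinity>s\<in>S \<inter> B. Y s w) = (\<Sum>s\<in>S \<inter> B. Z w {s})"
    using S elim(1) by (simp add: Y_def)
   also have "\<dots> = Z w (B \<inter> S)" using S by (subst signed_measure_finite_sum[OF Zs, of "B \<inter> S"]) (auto simp: Int_commute)
   finally have f: "(\<Sum>\<^sub>\<infinity>s\<in>S \<inter> B. Y s w) = Z w (B \<inter> S)" .
   have "Z w ((B \<inter> S) \<union> (B - S)) = Z w (B \<inter> S) + Z w (B - S)" by (intro signed_measure_Un[OF Zs] BS) auto
   moreover have "(B \<inter> S) \<union> (B - S) = B" by auto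
   ultimately show "Z w B = (\<Sum>\<^sub>\<infinity>s\<in>S \<inter> B. Y s w) + zero_signed_measure B + (\<integral>p. indicator B (fst p) * snd p \<partial>ord_process w)"
    using B by (simp add: o f zero_signed_measure_def)
  qed
 qed
 have iv: "indep_vars (\<lambda>_. borel) Y S"
  unfolding Y_def[abs_def] by (rule indep_vars_atomic_part) (auto simp: disjoint_family_on_def)
 have pp: "poisson_process M ord_process F"
  unfolding poisson_process_def
  by (intro conjI ballI allI impI sets_ord meas_ord poisson_count poisson_infinite poisson_indep) auto
 have ist: "indep_set
     (sets (vimage_algebra (space M) (\<lambda>w. \<lambda>s\<in>S. Y s w) (\<Pi>\<^sub>M s\<in>S. borel)))
     (sets (process_sigma M ord_process F))"
  unfolding indep_set_def
 proof (rule indep_sets_mono_sets)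
  show "indep_sets (\<lambda>b. sets (local_sigma (if b then S else - S))) UNIV"
   using finite_borel[OF S] S_sets by (intro indep_local_sigma) (auto simp: disjoint_family_on_def)
  fix b :: bool
  have "(\<lambda>w. \<lambda>s\<in>S. Y s w) \<in> local_sigma S \<rightarrow>\<^sub>M (\<Pi>\<^sub>M s\<in>S. borel)"
   unfolding Y_def by (rule measurable_restrict, rule local_sigma_atomic_part) (use finite_borel[OF S] in auto)
  then have "sets (vimage_algebra (space M) (\<lambda>w. \<lambda>s\<in>S. Y s w) (\<Pi>\<^sub>M s\<in>S. borel)) \<subseteq> sets (local_sigma S)"
   using measurable_sets[of _ "local_sigma S"] by (auto simp: sets_vimage_algebra2 space_PiM)
  moreover have "process_sigma M ord_process F = local_sigma (- S)"
   by (simp add: local_sigma_def ord_process_def)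
  ultimately show "(case b of True \<Rightarrow> sets (vimage_algebra (space M) (\<lambda>w. \<lambda>s\<in>S. Y s w) (\<Pi>\<^sub>M s\<in>S. borel))
    | False \<Rightarrow> sets (process_sigma M ord_process F))
   \<subseteq> sets (local_sigma (if b then S else - S))"
   by (cases b) simp_all
 qed
 show "\<exists>Y N. indep_vars (\<lambda>_. borel) Y S \<and> (\<forall>s\<in>S. distr M borel (Y s) = L s) \<and> poisson_process M N F \<and>
    indep_set (sets (vimage_algebra (space M) (\<lambda>w. \<lambda>s\<in>S. Y s w) (\<Pi>\<^sub>M s\<in>S. borel)))
     (sets (process_sigma M N F)) \<and>
    (AE w in M. \<forall>B\<in>bounded_borel.
      (\<lambda>s. Y s w) summable_on (S \<inter> B) \<and>
      integrable (N w) (\<lambda>p. indicator B (fst p) * snd p) \<and>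
      Z w B = (\<Sum>\<^sub>\<infinity>s\<in>S \<inter> B. Y s w) + zero_signed_measure B + (\<integral>p. indicator B (fst p) * snd p \<partial>N w))"
  using iv distr_atom pp ist bb unfolding Y_def[abs_def] by (intro exI[of _ "\<lambda>s w. atomic_part (Z w) {s}"] exI[of _ ord_process]) auto
qed

end

lemma prod_mono_ennreal: "(\<And>i. i \<in> I \<Longrightarrow> f i \<le> (g i :: ennreal)) \<Longrightarrow> prod f I \<le> prod g I"
 by (induction I rule: infinite_finite_induct) (auto intro: mult_mono)

section \<open>Almost sure properties of the observed atoms\<close>

context posterior_model
begin

definition "some_zero = {v \<in> space RV. \<exists>j<m. v j = 0}"

lemma some_zero_sets [measurable]: "some_zero \<in> sets RV"
 unfolding some_zero_def RV_def by measurable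

text \<open>The marks that must not occur: a vanishing observation at a fixed location, or a nonzero
  mark vector whose normalising constant does not allow division.\<close>

definition "bad s v \<longleftrightarrow> s \<in> S \<and> v \<in> some_zero \<or> v \<notin> zero_marks \<and> (cc s v = 0 \<or> cc s v = \<top>)"

lemma bad_fix:
 assumes "s \<in> S" "bad s v" "cc s v < \<top>"
 shows "cc s v = 0"
proof (cases "v \<in> some_zero")
 case True
 then obtain j where "j < m" "v j = 0" by (auto simp: some_zero_def)
 then have "ulik s t v = 0" for t using ulik_fix_zero[OF assms(1)] by blast
 then show ?thesis by (simp add: cc_def)
qed (use assms in \<open>auto simp: bad_def\<close>)

definition "bad_mark z = (if bad (fst (fst z)) (snd z) then \<top> else 0 :: ennreal)" for z :: "('a \<times> real) \<times> (nat \<Rightarrow> real)"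

lemma bad_mark_meas [measurable]: "bad_mark \<in> borel_measurable (pair_borel \<Otimes>\<^sub>M RV)"
 unfolding bad_mark_def[abs_def] bad_def by measurable

lemma AE_eneg_eq_1:
 assumes [measurable]: "u \<in> borel_measurable M" and E: "(NN w|M. eneg (u w)) = 1"
 shows "AE w in M. u w = 0"
proof -
 have "(NN w|M. (1 - eneg (u w)) * 1) = (NN w|M. 1) - (NN w|M. eneg (u w) * 1)"
  by (rule nn_integral_one_minus) (simp_all add: emeasure_space_1)
 then have "(NN w|M. 1 - eneg (u w)) = 0" by (simp add: E emeasure_space_1)
 then have "AE w in M. 1 - eneg (u w) = 0" by (subst (asm) nn_integral_0_iff_AE) auto
 then show ?thesis
 proof eventually_elim
  case (elim w)
  then have "\<not> eneg (u w) < 1" by (simp add: diff_eq_0_iff_ennreal)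
  then have "\<not> 0 < u w" using eneg_lt_1 by blast
  then show ?case by simp
 qed
qed

text \<open>Since \<open>bad_mark\<close> is infinite on bad marks, its Laplace functional is the
  probability that none occurs. Bad marks carry no joint density of weight and marks, apart from
  null sets of marks, so the functional equals 1.\<close>

lemma AE_no_bad: "AE w in M. \<forall>k. enat k < K w \<longrightarrow> \<not> bad (\<psi> k w) (xv k w)"
proof -
 let ?u = "\<lambda>w. \<Sum>k. if enat k < K w then bad_mark (marked_atom k w) else 0"
 have [measurable]: "Measurable.pred M (\<lambda>w. enat k < K w)" for k
  using K_meas by measurable
 have um: "?u \<in> borel_measurable M" by measurable
 have "(NN w|M. eneg (?u w)) =
  eneg (NN s|G. mark_gap bad_mark s) *
  (\<Prod>s\<in>S. mark_mass bad_mark s)"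
  by (rule marked_laplace) measurable
 also have "(NN s|G. mark_gap bad_mark s) = (NN s|G. 0)"
 proof (rule nn_integral_cong_AE)
  show "AE s in G. (mark_gap bad_mark s) = 0"
   using AE_G_notin_S
  proof eventually_elim
   case (elim s)
   have "(mark_gap bad_mark s) = (NN v|lam. 0)"
   proof (rule nn_integral_cong_AE)
    show "AE v in lam. (NN t|lborel. (1 - eneg (bad_mark ((s, t), v))) * ulik s t v) = 0"
     using AE_cc_finite[of s]
    proof eventually_elim
     case (elim v)
     then show ?case using \<open>s \<notin> S\<close> by (cases "bad s v") (auto simp: bad_mark_def bad_def cc_def)
    qed
   qed
   then show ?case by simp
  qed
 qed
 also have "(\<Prod>s\<in>S. mark_mass bad_mark s) = 1"
 proof (rule prod.neutral, rule ballI)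
  fix s assume s: "s \<in> S"
  have "(mark_mass bad_mark s) = (NN v|lam. cc s v)"
  proof (rule nn_integral_cong_AE)
   show "AE v in lam. (NN t|lborel. eneg (bad_mark ((s, t), v)) * ulik s t v) = cc s v"
    using AE_cc_finite[of s]
   proof eventually_elim
    case (elim v)
    then have "cc s v < \<top>" using s by blast
    with bad_fix[OF s, of v] show ?case by (cases "bad s v") (auto simp: bad_mark_def cc_def)
   qed
  qed
  then show "(mark_mass bad_mark s) = 1"
   by (simp add: cc_fix_integral[OF s])
 qed
 finally have "AE w in M. ?u w = 0" by (intro AE_eneg_eq_1[OF um]) simp
 then show ?thesis
 proof eventually_elim
  case (elim w)
  then have "(if enat k < K w then bad_mark (marked_atom k w) else 0) = 0" for k
   by (subst (asm) suminf_eq_zero_iff) auto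
  show ?case
  proof (intro allI impI)
   fix k assume "enat k < K w"
   with \<open>\<And>k. (if enat k < K w then bad_mark (marked_atom k w) else 0) = 0\<close>[of k]
   show "\<not> bad (\<psi> k w) (xv k w)" by (auto simp: bad_mark_def split: if_splits)
  qed
 qed
qed

text \<open>The probability that finitely many atoms are observed dominates the Laplace transform of
  their number at every \<open>c > 0\<close>, and an explicit lower bound of the transform tends to
  1 as \<open>c\<close> tends to 0.\<close>

lemma AE_finite_atoms: "AE w in M. finite {s. \<exists>j<m. X j w {s} \<noteq> 0}"
proof -
 interpret GP: prob_space G by (rule G_prob)
 have [measurable]: "Measurable.pred M (\<lambda>w. enat k < K w)" for k
  using K_meas by measurable
 define cnt where "cnt w = (\<Sum>k. if enat k < K w then if xv k w \<in> zero_marks then 0 else 1 else 0 :: ennreal)" for w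
 have cm [measurable]: "cnt \<in> borel_measurable M" unfolding cnt_def[abs_def] by measurable
 define B where "B = of_nat m * (NN t|lborel. emeasure (Hord t) (- {0}) * g0 t)"
 have B: "B < \<top>" unfolding B_def using A2'_Hord by (simp add: ennreal_mult_less_top of_nat_less_top)
 have bound: "eneg ((1 - eneg c) * B) * eneg c ^ card S \<le> emeasure M {w\<in>space M. cnt w \<noteq> \<top>}" if c: "0 < c" for c
 proof -
  \<comment> \<open>\<open>c\<close> per observed atom. The ordinary atoms add at most
    \<open>(1 - eneg c) * B\<close> to the exponent, and each fixed atom contributes a factor of at
    least \<open>eneg c\<close>.\<close>
  define Fc where "Fc z = (if snd z \<in> zero_marks then 0 else c)" for z :: "('a \<times> real) \<times> (nat \<Rightarrow> real)"
  have Fm: "Fc \<in> borel_measurable (pair_borel \<Otimes>\<^sub>M RV)" unfolding Fc_def[abs_def] by measurable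
  have I: "(mark_gap Fc s) \<le> (1 - eneg c) * B" if s: "s \<notin> S" for s
  proof -
   have "(mark_gap Fc s) = (NN v|lam. (1 - eneg c) * (indicator (space RV - zero_marks) v * cc s v))"
   proof (rule nn_integral_cong)
    fix v assume v: "v \<in> space lam"
    then show "(NN t|lborel. (1 - eneg (Fc ((s, t), v))) * ulik s t v) = (1 - eneg c) * (indicator (space RV - zero_marks) v * cc s v)"
     using ulik_t[OF v, of s] by (cases "v \<in> zero_marks") (simp_all add: Fc_def cc_def nn_integral_cmult space_lam)
   qed
   also have "\<dots> = (1 - eneg c) * (NN v|lam. indicator (space RV - zero_marks) v * cc s v)"
   proof (rule nn_integral_cmult)
    have "(indicator (space RV - zero_marks) :: _ \<Rightarrow> ennreal) \<in> borel_measurable lam"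
     by (intro borel_measurable_indicator) (simp add: sets_lam zero_marks_sets sets.compl_sets)
    then show "(\<lambda>v. indicator (space RV - zero_marks) v * cc s v) \<in> borel_measurable lam" by measurable
   qed
   also have "\<dots> \<le> (1 - eneg c) * B" unfolding B_def by (intro mult_left_mono cc_ord_finite[OF s]) simp
   finally show ?thesis .
  qed
  have J: "eneg c \<le> (mark_mass Fc s)" if s: "s \<in> S" for s
  proof -
   have "eneg c = eneg c * (NN v|lam. cc s v)" by (simp add: cc_fix_integral[OF s])
   also have "\<dots> = (NN v|lam. eneg c * cc s v)" by (rule nn_integral_cmult[symmetric]) measurable
   also have "\<dots> = (NN v|lam. NN t|lborel. eneg c * ulik s t v)"
    unfolding cc_def by (intro nn_integral_cong nn_integral_cmult[symmetric]) (simp add: ulik_t)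
   also have "\<dots> \<le> (mark_mass Fc s)"
    by (intro nn_integral_mono mult_right_mono) (auto simp: Fc_def)
   finally show ?thesis .
  qed
  have "(NN s|G. mark_gap Fc s) \<le> (NN s|G. (1 - eneg c) * B)"
  proof (rule nn_integral_mono_AE)
   show "AE s in G. (mark_gap Fc s) \<le> (1 - eneg c) * B"
    using AE_G_notin_S by eventually_elim (rule I)
  qed
  then have E: "eneg ((1 - eneg c) * B) \<le> eneg (NN s|G. mark_gap Fc s)"
   by (intro eneg_mono) (simp add: GP.emeasure_space_1)
  have P: "eneg c ^ card S \<le> (\<Prod>s\<in>S. mark_mass Fc s)"
   unfolding prod_constant[symmetric] by (intro prod_mono_ennreal J)
  have "eneg ((1 - eneg c) * B) * eneg c ^ card S \<le> (NN w|M. eneg (\<Sum>k. if enat k < K w then Fc (marked_atom k w) else 0))"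
   unfolding marked_laplace[OF Fm] by (intro mult_mono E P) simp_all
  also have "\<dots> \<le> (NN w|M. indicator {w\<in>space M. cnt w \<noteq> \<top>} w)"
  proof (rule nn_integral_mono)
   fix w assume w: "w \<in> space M"
   have "(\<Sum>k. if enat k < K w then Fc (marked_atom k w) else 0) = c * cnt w"
    unfolding cnt_def ennreal_suminf_cmult[symmetric] by (intro suminf_cong) (simp add: Fc_def)
   then show "eneg (\<Sum>k. if enat k < K w then Fc (marked_atom k w) else 0) \<le> indicator {w\<in>space M. cnt w \<noteq> \<top>} w"
    using c w by (cases "cnt w = \<top>") (auto simp: ennreal_mult_top)
  qed
  also have "\<dots> = emeasure M {w\<in>space M. cnt w \<noteq> \<top>}" by (intro nn_integral_indicator) measurable
  finally show ?thesis .
 qed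
 define c where "c n = ennreal (inverse (real (Suc n)))" for n
 have "c \<longlonglongrightarrow> ennreal 0" unfolding c_def[abs_def] by (intro tendsto_ennrealI LIMSEQ_inverse_real_of_nat)
 then have c0: "c \<longlonglongrightarrow> 0" by simp
 have "(\<lambda>n. eneg ((1 - eneg (c n)) * B)) \<longlonglongrightarrow> eneg ((1 - eneg 0) * B)"
  using B by (intro tendsto_eneg tendsto_mult_ennreal tendsto_diff_ennreal tendsto_const tendsto_eneg c0) auto
 moreover have "(\<lambda>n. \<Prod>s\<in>S. eneg (c n)) \<longlonglongrightarrow> (\<Prod>s\<in>S. eneg 0)"
  by (intro tendsto_prod_le_1 tendsto_eneg c0) simp
 ultimately have "(\<lambda>n. eneg ((1 - eneg (c n)) * B) * (\<Prod>s\<in>S. eneg (c n))) \<longlonglongrightarrow> eneg ((1 - eneg 0) * B) * (\<Prod>s\<in>S. eneg 0)"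
  by (intro tendsto_mult_ennreal) auto
 then have lim: "(\<lambda>n. eneg ((1 - eneg (c n)) * B) * eneg (c n) ^ card S) \<longlonglongrightarrow> 1" by simp
 have "1 \<le> emeasure M {w\<in>space M. cnt w \<noteq> \<top>}"
  by (rule LIMSEQ_le_const2[OF lim]) (intro exI[of _ 0] allI impI bound, simp add: c_def)
 then have "prob {w\<in>space M. cnt w \<noteq> \<top>} = 1" by (simp add: emeasure_eq_measure antisym)
 then have "AE w in M. cnt w \<noteq> \<top>" by (subst (asm) prob_Collect_eq_1) measurable
 with AE_good show ?thesis
 proof eventually_elim
  case (elim w)
  have "(NN p|(obs w). 1) = cnt w"
   unfolding cnt_def by (rule good_X[OF elim(1)]) simp
  moreover have "(NN p|(obs w). 1) = emeasure (count_space UNIV) {s. \<exists>j<m. X j w {s} \<noteq> 0}"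
   by (subst nn_integral_vector_atoms) (auto simp: emeasure_count_space intro!: arg_cong[where f = card] cong: conj_cong)
  ultimately have "emeasure (count_space UNIV) {s. \<exists>j<m. X j w {s} \<noteq> 0} \<noteq> \<infinity>" using elim(2) by simp
  then show ?case using emeasure_count_space_infinite[of "{s. \<exists>j<m. X j w {s} \<noteq> 0}" UNIV] by (cases "finite {s. \<exists>j<m. X j w {s} \<noteq> 0}") simp_all
 qed
qed

definition "mark_at w s = (\<lambda>j\<in>{..<m}. X j w {s})"

lemma AE_data:
 "AE w in M. finite {s. \<exists>j<m. X j w {s} \<noteq> 0} \<and> (\<forall>s\<in>S. \<forall>j<m. X j w {s} \<noteq> 0) \<and>
   (\<forall>s. (\<exists>j<m. X j w {s} \<noteq> 0) \<longrightarrow> 0 < cc s (mark_at w s) \<and> cc s (mark_at w s) < \<top>)"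
 using AE_good AE_no_bad AE_finite_atoms
proof eventually_elim
 case (elim w)
 let ?I = "{k. enat k < K w}"
 have hs: "\<forall>B\<in>bounded_borel. ((\<lambda>k. x j k w) has_sum X j w B) {k\<in>?I. \<psi> k w \<in> B}" if "j < m" for j
  using elim(1) that unfolding good_def by blast
 have inj: "inj_on (\<lambda>k. \<psi> k w) ?I" using elim(1) unfolding good_def by blast
 have at: "X j w {\<psi> k w} = x j k w" if "j < m" "enat k < K w" for j k
  using has_sum_enum_singleton(1)[OF hs[OF that(1)] inj] that(2) by simp
 have off: "X j w {s} = 0" if "j < m" "s \<notin> (\<lambda>k. \<psi> k w) ` ?I" for j s
  using has_sum_enum_singleton(2)[OF hs[OF that(1)] inj that(2)] .
 have mark: "mark_at w (\<psi> k w) = xv k w" if "enat k < K w" for k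
  using at[OF _ that] by (auto simp: mark_at_def xv_def)
 have "X j w {s} \<noteq> 0" if s: "s \<in> S" and j: "j < m" for s j
 proof -
  obtain k where k: "k < Kfix" "s = \<psi>fix k" using s by auto
  have kK: "enat k < K w" using elim(1) k(1) unfolding good_def by (metis enat_ord_simps(2) order_less_le_trans)
  have sk: "s = \<psi> k w" using elim(1) k unfolding good_def by simp
  then have "xv k w \<notin> some_zero" using elim(2) kK s unfolding bad_def by blast
  then have "x j k w \<noteq> 0" using j by (auto simp: some_zero_def space_RV xv_def)
  then show ?thesis using at[OF j kK] sk by simp
 qed
 moreover have "0 < cc s (mark_at w s) \<and> cc s (mark_at w s) < \<top>" if s: "\<exists>j<m. X j w {s} \<noteq> 0" for s
 proof -
  obtain k where k: "enat k < K w" "s = \<psi> k w" using s off by blast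
  have "xv k w \<notin> zero_marks" using s at[OF _ k(1)] by (auto simp: xv_zero k(2))
  then have "cc s (xv k w) \<noteq> 0" "cc s (xv k w) \<noteq> \<top>" using elim(2) k unfolding bad_def by blast+
  then show ?thesis using mark[OF k(1)] k(2) by (simp add: less_top zero_less_iff_neq_zero)
 qed
 ultimately show ?case using elim(3) by blast
qed

end

section \<open>The conditional distribution\<close>

text \<open>Restricted to the event that \<open>X\<close> lies in \<open>A\<close>, the law of
  \<open>Y\<close> is the law of \<open>X\<close> composed with the kernel; integration against this
  composition extends the defining identity from sets to functions.\<close>

lemma (in prob_space) rcd_nn_integral:
 assumes rcd: "regular_conditional_distribution M MX X MY Y \<kappa>"
  and A: "A \<in> sets MX" and u: "u \<in> borel_measurable MY"
 shows "(NN w|M. indicator A (X w) * u (Y w)) = (NN w|M. indicator A (X w) * (NN y|(\<kappa> (X w)). u y))"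
proof -
 have X [measurable]: "X \<in> M \<rightarrow>\<^sub>M MX" and Y [measurable]: "Y \<in> M \<rightarrow>\<^sub>M MY" and \<kappa>: "\<kappa> \<in> MX \<rightarrow>\<^sub>M prob_algebra MY"
  using rcd by (auto simp: regular_conditional_distribution_def)
 note [measurable] = A
 have iA: "(\<lambda>w. indicator A (X w) :: ennreal) \<in> borel_measurable M" by measurable
 define D where "D = distr (density M (\<lambda>w. indicator A (X w))) MX X"
 have D: "(NN y|D. h y) = (NN w|M. indicator A (X w) * h (X w))" if "h \<in> borel_measurable MX" for h
  unfolding D_def using that measurable_compose[OF X that] iA by (simp add: nn_integral_distr nn_integral_density)
 have \<kappa>s: "\<kappa> \<in> MX \<rightarrow>\<^sub>M subprob_algebra MY" by (rule measurable_prob_algebraD[OF \<kappa>])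
 then have \<kappa>D: "\<kappa> \<in> D \<rightarrow>\<^sub>M subprob_algebra MY" by (simp add: D_def cong: measurable_cong_sets)
 have spD: "space D \<noteq> {}" using not_empty measurable_space[OF X] by (auto simp: D_def)
 have "distr (density M (\<lambda>w. indicator A (X w))) MY Y = D \<bind> \<kappa>"
 proof (rule measure_eqI)
  have sb: "sets (D \<bind> \<kappa>) = sets MY" using spD \<kappa>D by (intro sets_bind) (auto dest: measurable_space simp: space_subprob_algebra)
  then show "sets (distr (density M (\<lambda>w. indicator A (X w))) MY Y) = sets (D \<bind> \<kappa>)" by simp
  fix B assume "B \<in> sets (distr (density M (\<lambda>w. indicator A (X w))) MY Y)"
  then have B [measurable]: "B \<in> sets MY" by simp
  have "emeasure (distr (density M (\<lambda>w. indicator A (X w))) MY Y) B = (NN w|M. indicator A (X w) * indicator (Y -` B \<inter> space M) w)"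
   by (simp add: emeasure_distr emeasure_density)
  also have "\<dots> = (NN w|M. indicator {w\<in>space M. X w \<in> A \<and> Y w \<in> B} w)"
   by (intro nn_integral_cong) (auto simp: indicator_def)
  also have "\<dots> = emeasure M {w\<in>space M. X w \<in> A \<and> Y w \<in> B}" by (intro nn_integral_indicator) measurable
  also have "\<dots> = (NN w|M. indicator A (X w) * emeasure (\<kappa> (X w)) B)"
   using rcd A B by (simp add: regular_conditional_distribution_def)
  also have "\<dots> = (NN y|D. emeasure (\<kappa> y) B)"
   by (rule D[symmetric], rule measurable_compose[OF \<kappa>s measurable_emeasure_subprob_algebra[OF B]])
  also have "\<dots> = emeasure (D \<bind> \<kappa>) B" by (rule emeasure_bind[OF spD \<kappa>D B, symmetric])
  finally show "emeasure (distr (density M (\<lambda>w. indicator A (X w))) MY Y) B = emeasure (D \<bind> \<kappa>) B" .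
 qed
 moreover have "(NN y|(distr (density M (\<lambda>w. indicator A (X w))) MY Y). u y) = (NN w|M. indicator A (X w) * u (Y w))"
  using u measurable_compose[OF Y u] iA by (simp add: nn_integral_distr nn_integral_density)
 moreover have "(NN y|(D \<bind> \<kappa>). u y) = (NN w|M. indicator A (X w) * (NN y|(\<kappa> (X w)). u y))"
  unfolding nn_integral_bind[OF u \<kappa>D] by (rule D, rule measurable_compose[OF \<kappa>s nn_integral_measurable_subprob_algebra[OF u]])
 ultimately show ?thesis by simp
qed

lemma (in prob_space) AE_eq_of_integrals:
 assumes X: "X \<in> M \<rightarrow>\<^sub>M MX" and U: "U \<in> borel_measurable MX" "U' \<in> borel_measurable MX"
  and eq: "\<And>A. A \<in> sets MX \<Longrightarrow> (NN w|M. indicator A (X w) * U (X w)) = (NN w|M. indicator A (X w) * (U' (X w) :: ennreal))"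
 shows "AE w in M. U (X w) = U' (X w)"
proof -
 interpret D: prob_space "distr M MX X" by (rule prob_space_distr[OF X])
 have "density (distr M MX X) U = density (distr M MX X) U'"
 proof (rule measure_eqI)
  fix A assume "A \<in> sets (density (distr M MX X) U)"
  then have A: "A \<in> sets MX" by simp
  have e: "emeasure (density (distr M MX X) V) A = (NN w|M. indicator A (X w) * V (X w))" if V: "V \<in> borel_measurable MX" for V
   using A V X by (subst emeasure_density) (auto simp: nn_integral_distr mult.commute)
  show "emeasure (density (distr M MX X) U) A = emeasure (density (distr M MX X) U') A"
   unfolding e[OF U(1)] e[OF U(2)] by (rule eq[OF A])
 qed simp
 then have "AE y in distr M MX X. U y = U' y" using U by (intro D.density_unique) auto
 then show ?thesis by (rule AE_distrD[OF X])
qed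

text \<open>By \<open>signed_measure_eqI\<close>, equality with the atomic part is a condition on
  countably many evaluations.\<close>

lemma sets_atomic_fixpoints:
 "{\<xi> \<in> space signed_measure_space. atomic_part \<xi> = \<xi>} \<in> sets (signed_measure_space :: ('a::{metric_space, second_countable_topology} set \<Rightarrow> real) measure)"
proof -
 obtain x0 :: 'a where True by simp
 let ?C = "\<lambda>n I r. cell base_seq n I \<inter> ball x0 (real r)"
 have am: "(\<lambda>\<xi>. atomic_part \<xi>) \<in> signed_measure_space \<rightarrow>\<^sub>M (signed_measure_space :: ('a set \<Rightarrow> real) measure)"
  by (rule measurable_atomic_part[OF measurable_emeasure_atom_process])
 have C: "?C n I r \<in> bounded_borel" for n I r by (auto simp: bounded_borel_def intro!: bounded_Int)
 have "{\<xi> \<in> space signed_measure_space. atomic_part \<xi> = \<xi>} =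
  {\<xi> \<in> space (signed_measure_space :: ('a set \<Rightarrow> real) measure). \<forall>n r. \<forall>I\<in>Pow {..<n}. atomic_part \<xi> (?C n I r) = \<xi> (?C n I r)}"
  by (auto intro!: signed_measure_eqI atomic_part_space)
 also have "\<dots> \<in> sets signed_measure_space"
 proof (intro sets.sets_Collect_countable_All sets.sets_Collect_finite_All')
  fix n r and I :: "nat set"
  have [measurable]: "(\<lambda>\<xi>. atomic_part \<xi> (?C n I r)) \<in> borel_measurable signed_measure_space" "(\<lambda>\<xi>. \<xi> (?C n I r)) \<in> borel_measurable signed_measure_space"
   using measurable_compose[OF am measurable_signed_measure_eval[OF C]] measurable_signed_measure_eval[OF C] by auto
  show "{\<xi> \<in> space signed_measure_space. atomic_part \<xi> (?C n I r) = \<xi> (?C n I r)} \<in> sets signed_measure_space" by measurable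
 qed auto
 finally show ?thesis .
qed

lemma (in prob_space) rcd_AE:
 assumes rcd: "regular_conditional_distribution M MX X MY Y \<kappa>" and E: "E \<in> sets MY" and Y: "AE w in M. Y w \<in> E"
 shows "AE w in M. AE y in \<kappa> (X w). y \<in> E"
proof -
 have X: "X \<in> M \<rightarrow>\<^sub>M MX" and Ym: "Y \<in> M \<rightarrow>\<^sub>M MY" and \<kappa>: "\<kappa> \<in> MX \<rightarrow>\<^sub>M prob_algebra MY"
  using rcd by (auto simp: regular_conditional_distribution_def)
 have em: "(\<lambda>w. emeasure (\<kappa> (X w)) E') \<in> borel_measurable M" if "E' \<in> sets MY" for E'
  by (rule measurable_compose[OF X measurable_compose[OF measurable_prob_algebraD[OF \<kappa>] measurable_emeasure_subprob_algebra[OF that]]])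
 have cE: "space MY - E \<in> sets MY" using E by auto
 have "(NN w|M. emeasure (\<kappa> (X w)) (space MY - E)) = (NN w|M. indicator (space MX) (X w) * emeasure (\<kappa> (X w)) (space MY - E))"
  using measurable_space[OF X] by (intro nn_integral_cong) simp
 also have "\<dots> = emeasure M {w\<in>space M. X w \<in> space MX \<and> Y w \<in> space MY - E}"
  using rcd cE sets.top[of MX] by (simp add: regular_conditional_distribution_def del: Diff_iff)
 also have "\<dots> = 0"
 proof (rule emeasure_eq_0_AE)
  show "AE w in M. \<not> (X w \<in> space MX \<and> Y w \<in> space MY - E)" using Y by eventually_elim simp
 qed
 finally have "AE w in M. emeasure (\<kappa> (X w)) (space MY - E) = 0"
  using em[OF cE] by (subst (asm) nn_integral_0_iff_AE) auto
 with AE_space show ?thesis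
 proof eventually_elim
  case (elim w)
  have "\<kappa> (X w) \<in> space (prob_algebra MY)" by (rule measurable_space[OF \<kappa> measurable_space[OF X elim(1)]])
  then have s: "sets (\<kappa> (X w)) = sets MY" by (simp add: space_prob_algebra)
  then have "space MY - E \<in> null_sets (\<kappa> (X w))" using elim(2) cE by (auto simp: null_sets_def)
  then have "AE y in \<kappa> (X w). y \<notin> space MY - E" by (rule AE_not_in)
  with AE_space show ?case by eventually_elim (use sets_eq_imp_space_eq[OF s] in simp)
 qed
qed

context posterior_model
begin

abbreviation "MX \<equiv> \<Pi>\<^sub>M j\<in>{..<m}. (signed_measure_space :: ('a set \<Rightarrow> real) measure)"

lemma X_meas: "j < m \<Longrightarrow> X j \<in> M \<rightarrow>\<^sub>M signed_measure_space"
 using X_series by (simp add: atomic_series_def)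

lemma Theta_meas: "\<Theta> \<in> M \<rightarrow>\<^sub>M signed_measure_space"
 using series by (simp add: atomic_series_def)

lemma data_meas: "data \<in> M \<rightarrow>\<^sub>M MX"
 by (rule measurable_restrict) (simp add: X_meas)

lemma AE_atomic_data: "AE w in M. atomic_part (\<Theta> w) = \<Theta> w \<and> (\<forall>j<m. atomic_part (X j w) = X j w)"
 using AE_good AE_space
proof eventually_elim
 case (elim w)
 let ?I = "{k. enat k < K w}"
 have inj: "inj_on (\<lambda>k. \<psi> k w) ?I" using elim(1) unfolding good_def by blast
 have "atomic_part (\<Theta> w) = \<Theta> w"
 proof (rule atomic_part_enum[OF measurable_space[OF Theta_meas elim(2)] _ inj])
  show "\<forall>B\<in>bounded_borel. ((\<lambda>k. \<theta> k w) has_sum \<Theta> w B) {k\<in>?I. \<psi> k w \<in> B}" using elim(1) unfolding good_def by blast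
 qed
 moreover have "atomic_part (X j w) = X j w" if "j < m" for j
 proof (rule atomic_part_enum[OF measurable_space[OF X_meas[OF that] elim(2)] _ inj])
  show "\<forall>B\<in>bounded_borel. ((\<lambda>k. x j k w) has_sum X j w B) {k\<in>?I. \<psi> k w \<in> B}" using elim(1) that unfolding good_def by blast
 qed
 ultimately show ?case by blast
qed

text \<open>The Laplace functional that the posterior ought to have, as a function of the
  data.\<close>

definition "post_lap f \<xi> = cf f * eneg (NN p|(vector_atoms m \<xi>). lneg (bb f (fst p) (snd p)))"

definition "data_sigma = process_sigma M (\<lambda>w. obs w) (borel \<Otimes>\<^sub>M RV)"

lemma sets_va: "sets (vector_atoms m \<xi>) = sets (borel \<Otimes>\<^sub>M RV)"
 by (simp add: RV_def)

lemma va_meas: "A \<in> sets (borel \<Otimes>\<^sub>M RV) \<Longrightarrow> (\<lambda>\<xi>. emeasure (vector_atoms m \<xi>) A) \<in> borel_measurable MX"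
 unfolding RV_def by (rule measurable_emeasure_vector_atoms)

lemma post_lap_meas: "f \<in> borel_measurable pair_borel \<Longrightarrow> post_lap f \<in> borel_measurable MX"
proof -
 assume [measurable]: "f \<in> borel_measurable pair_borel"
 have "(\<lambda>p. lneg (bb f (fst p) (snd p))) \<in> borel_measurable (borel \<Otimes>\<^sub>M RV)" by measurable
 from measurable_compose[OF measurable_nn_integral_kernel[OF sets_va va_meas this] measurable_eneg]
 have [measurable]: "(\<lambda>\<xi>. eneg (NN p|(vector_atoms m \<xi>). lneg (bb f (fst p) (snd p)))) \<in> borel_measurable MX" .
 show ?thesis unfolding post_lap_def[abs_def] by measurable
qed

lemma cf_le_1: "cf f \<le> 1"
 by (simp add: cf_def)

lemma post_lap_le_1: "post_lap f \<xi> \<le> 1"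
 unfolding post_lap_def using mult_mono[OF cf_le_1 eneg_le_1] by fastforce

text \<open>The counts of the observed atoms determine the atomic part of each observation. Almost
  surely this is the observation itself, so events of the data agree with events of the counts up to
  null sets.\<close>

lemma atomic_data_sigma: "(\<lambda>w. \<lambda>j\<in>{..<m}. atomic_part (X j w)) \<in> data_sigma \<rightarrow>\<^sub>M MX"
proof (rule measurable_restrict)
 fix j assume j: "j \<in> {..<m}"
 show "(\<lambda>w. atomic_part (X j w)) \<in> data_sigma \<rightarrow>\<^sub>M signed_measure_space"
 proof (rule measurable_atomic_part)
  show "X j w \<in> space signed_measure_space" if "w \<in> space data_sigma" for w
   using measurable_space[OF X_meas, of j w] that j by (simp add: data_sigma_def)
  fix A :: "('a \<times> real) set" assume A: "A \<in> sets point_borel"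
  have [measurable]: "(\<lambda>p. snd p j) \<in> borel_measurable ((borel :: 'a measure) \<Otimes>\<^sub>M RV)"
   using j measurable_compose[OF measurable_snd component_meas[of j]] by simp
  have Am [measurable]: "A \<in> sets pair_borel" and A0: "A \<subseteq> UNIV \<times> - {0}" using A by (auto simp: sets_pair_nonzero_borel)
  \<comment> \<open>Locations where observation \<open>j\<close> is 0 do not enter, because
    \<open>A\<close> contains no point of weight 0.\<close>
  define A' where "A' = {p \<in> space ((borel :: 'a measure) \<Otimes>\<^sub>M RV). (fst p, snd p j) \<in> A}"
  have A': "A' \<in> sets (borel \<Otimes>\<^sub>M RV)" unfolding A'_def by measurable
  have "(\<lambda>w. NN p|(obs w). indicator A' p) \<in> borel_measurable data_sigma"
   unfolding data_sigma_def by (rule sigma_nn_integral_process) (use A' sets_va in auto)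
  moreover have "(NN p|(obs w). indicator A' p) = emeasure (atom_process (X j w)) A" for w
  proof -
   have "(NN p|(obs w). indicator A' p) = emeasure (obs w) A'"
    using A' by (intro nn_integral_indicator) (simp only: sets_va)
   also have "\<dots> = emeasure (count_space UNIV) {s. (\<exists>j<m. data w j {s} \<noteq> 0) \<and> (s, \<lambda>j\<in>{..<m}. data w j {s}) \<in> A'}"
    by (rule emeasure_vector_atoms[OF A'[unfolded RV_def]])
   also have "{s. (\<exists>j<m. data w j {s} \<noteq> 0) \<and> (s, \<lambda>j\<in>{..<m}. data w j {s}) \<in> A'} = {s. (s, X j w {s}) \<in> A}"
    using A0 j by (auto simp: A'_def space_pair_measure space_RV)
   also have "emeasure (count_space UNIV) \<dots> = emeasure (atom_process (X j w)) A" by (rule emeasure_atom_process[OF A, symmetric])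
   finally show ?thesis .
  qed
  ultimately show "(\<lambda>w. emeasure (atom_process (X j w)) A) \<in> borel_measurable data_sigma" by simp
 qed
qed

text \<open>On an event of the data, the kernel integrates to the expectation of the prior
  functional. This expectation and the one of \<open>post_lap\<close> are two measures on the events
  generated by the observed atoms; \<open>posterior_identity\<close> equates their Laplace
  functionals, hence the measures.\<close>

lemma kernel_laplace:
 assumes rcd: "regular_conditional_distribution M MX data signed_measure_space \<Theta> \<kappa>"
  and f: "f \<in> borel_measurable pair_borel"
 shows "AE w in M. (NN \<xi>|(\<kappa> (data w)). eneg (NN p|(atom_process \<xi>). f p)) = post_lap f (data w)"
proof -
 have \<kappa>: "\<kappa> \<in> MX \<rightarrow>\<^sub>M prob_algebra signed_measure_space"
  using rcd by (auto simp: regular_conditional_distribution_def)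
 define u where "u \<xi> = eneg (NN p|(atom_process \<xi>). f p)" for \<xi> :: "'a set \<Rightarrow> real"
 have um: "u \<in> borel_measurable signed_measure_space"
  unfolding u_def[abs_def]
  by (rule measurable_compose[OF measurable_nn_integral_kernel[OF sets_atom_process measurable_emeasure_atom_process measurable_pair_nonzero_borel[OF f]] measurable_eneg])
 have u\<Theta>: "(\<lambda>w. u (\<Theta> w)) \<in> borel_measurable M" by (rule measurable_compose[OF Theta_meas um])
 have pX: "(\<lambda>w. post_lap f (data w)) \<in> borel_measurable M" by (rule measurable_compose[OF data_meas post_lap_meas[OF f]])
 have "AE w in M. (NN \<xi>|(\<kappa> (data w)). u \<xi>) = post_lap f (data w)"
 proof (rule AE_eq_of_integrals[OF data_meas _ post_lap_meas[OF f]])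
  show "(\<lambda>\<xi>. NN \<xi>'|(\<kappa> \<xi>). u \<xi>') \<in> borel_measurable MX"
   by (rule measurable_compose[OF measurable_prob_algebraD[OF \<kappa>] nn_integral_measurable_subprob_algebra[OF um]])
  fix A assume A: "A \<in> sets MX"
  define W where "W = (\<lambda>w. \<lambda>j\<in>{..<m}. atomic_part (X j w)) -` A \<inter> space M"
  have W: "W \<in> sets data_sigma" using measurable_sets[OF atomic_data_sigma A] by (simp add: W_def data_sigma_def)
  have fin: "finite_measure (density M h)" if "h \<in> borel_measurable M" "\<And>w. h w \<le> 1" for h
  proof (rule finite_measureI)
   have "emeasure (density M h) (space (density M h)) = (NN w|M. h w)"
    using that(1) by (simp add: emeasure_density cong: nn_integral_cong)
   also have "\<dots> \<le> (NN w|M. 1)" by (intro nn_integral_mono that(2))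
   finally show "emeasure (density M h) (space (density M h)) \<noteq> \<infinity>" by (auto simp: emeasure_space_1 top_unique)
  qed
  have dm: "(\<lambda>w. eneg (NN p|(obs w). a p)) \<in> borel_measurable M" if "a \<in> borel_measurable (borel \<Otimes>\<^sub>M RV)" for a
   by (rule measurable_compose[OF measurable_compose[OF data_meas measurable_nn_integral_kernel[OF sets_va va_meas that]] measurable_eneg])
  have eqW: "emeasure (density M (\<lambda>w. u (\<Theta> w))) W = emeasure (density M (\<lambda>w. post_lap f (data w))) W"
  proof (rule counting_laplace_unique[where N = "\<lambda>w. obs w" and F = "borel \<Otimes>\<^sub>M RV"])
   show "finite_measure (density M (\<lambda>w. u (\<Theta> w)))" by (rule fin[OF u\<Theta>]) (simp add: u_def)
   show "finite_measure (density M (\<lambda>w. post_lap f (data w)))" by (rule fin[OF pX post_lap_le_1])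
   show "(\<lambda>w. emeasure (obs w) B) \<in> borel_measurable (density M (\<lambda>w. u (\<Theta> w)))" if "B \<in> sets (borel \<Otimes>\<^sub>M RV)" for B
    using measurable_compose[OF data_meas va_meas[OF that]] by simp
   show "enat_valued (emeasure (obs w) B)" if "B \<in> sets (borel \<Otimes>\<^sub>M RV)" for B w
    using that by (subst emeasure_vector_atoms) (auto simp: RV_def intro: enat_valued_emeasure_count_space)
   show "W \<in> sets (process_sigma (density M (\<lambda>w. u (\<Theta> w))) (\<lambda>w. obs w) (borel \<Otimes>\<^sub>M RV))"
    using W by (simp add: data_sigma_def)
   show "sets (obs w) = sets (borel \<Otimes>\<^sub>M RV)" for w by (rule sets_va)
   fix a :: "'a \<times> (nat \<Rightarrow> real) \<Rightarrow> ennreal" assume a: "a \<in> borel_measurable (borel \<Otimes>\<^sub>M RV)"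
   have lm: "(\<lambda>p. lneg (bb f (fst p) (snd p))) \<in> borel_measurable (borel \<Otimes>\<^sub>M RV)" using f by measurable
   have va: "(NN p|(obs w). a p + lneg (bb f (fst p) (snd p))) =
     (NN p|(obs w). a p) + (NN p|(obs w). lneg (bb f (fst p) (snd p)))" for w
    using a lm by (intro nn_integral_add) (simp_all only: measurable_cong_sets[OF sets_va refl])
   have "(NN w|(density M (\<lambda>w. u (\<Theta> w))). eneg (NN p|(obs w). a p)) =
     (NN w|M. eneg (NN p|(obs w). a p) * u (\<Theta> w))"
    by (subst nn_integral_density[OF u\<Theta> dm[OF a]]) (simp add: mult.commute)
   also have "\<dots> = cf f * (NN w|M. eneg (NN p|(obs w). a p + lneg (bb f (fst p) (snd p))))"
    unfolding u_def by (rule posterior_identity[OF a f])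
   also have "\<dots> = (NN w|M. cf f * eneg (NN p|(obs w). a p + lneg (bb f (fst p) (snd p))))"
   proof (rule nn_integral_cmult[symmetric], rule dm)
    show "(\<lambda>p. a p + lneg (bb f (fst p) (snd p))) \<in> borel_measurable (borel \<Otimes>\<^sub>M RV)" using a lm by measurable
   qed
   also have "\<dots> = (NN w|M. post_lap f (data w) * eneg (NN p|(obs w). a p))"
    by (intro nn_integral_cong) (simp add: va eneg_add post_lap_def mult_ac)
   also have "\<dots> = (NN w|(density M (\<lambda>w. post_lap f (data w))). eneg (NN p|(obs w). a p))"
    by (rule nn_integral_density[OF pX dm[OF a], symmetric])
   finally show "(NN w|(density M (\<lambda>w. u (\<Theta> w))). eneg (NN p|(obs w). a p)) =
    (NN w|(density M (\<lambda>w. post_lap f (data w))). eneg (NN p|(obs w). a p))" .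
  qed simp
  have Wev: "W \<in> events"
  proof -
   have "(\<lambda>w. \<lambda>A\<in>sets (borel \<Otimes>\<^sub>M RV). emeasure (obs w) A) \<in> M \<rightarrow>\<^sub>M (\<Pi>\<^sub>M A\<in>sets (borel \<Otimes>\<^sub>M RV). borel)"
    by (rule measurable_restrict) (rule measurable_compose[OF data_meas va_meas])
   from measurable_sets[OF this] W show ?thesis
    by (auto simp: data_sigma_def sets_vimage_algebra2 space_PiM)
  qed
  \<comment> \<open>The event \<open>A\<close> of the raw data is exchanged for \<open>W\<close>,
    which is generated by the counts and to which \<open>counting_laplace_unique\<close>
    applies.\<close>
  have ind: "AE w in M. indicator A (data w) = (indicator W w :: ennreal)"
   using AE_atomic_data AE_space
  proof eventually_elim
   case (elim w)
   then have "(\<lambda>j\<in>{..<m}. atomic_part (X j w)) = data w" by (intro restrict_ext) simp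
   with elim(2) show ?case by (simp add: W_def indicator_def)
  qed
  have eW: "emeasure (density M h) W = (NN w|M. indicator A (data w) * h w)" if "h \<in> borel_measurable M" for h
  proof -
   have "emeasure (density M h) W = (NN w|M. h w * indicator W w)" by (rule emeasure_density[OF that Wev])
   also have "\<dots> = (NN w|M. indicator A (data w) * h w)"
   proof (rule nn_integral_cong_AE)
    show "AE w in M. h w * indicator W w = indicator A (data w) * h w"
     using ind by eventually_elim (simp add: mult.commute)
   qed
   finally show ?thesis .
  qed
  have "(NN w|M. indicator A (data w) * (NN \<xi>|(\<kappa> (data w)). u \<xi>)) = (NN w|M. indicator A (data w) * u (\<Theta> w))"
   by (rule rcd_nn_integral[OF rcd A um, symmetric])
  also have "\<dots> = (NN w|M. indicator A (data w) * post_lap f (data w))"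
   using eqW unfolding eW[OF u\<Theta>] eW[OF pX] .
  finally show "(NN w|M. indicator A (data w) * (NN \<xi>|(\<kappa> (data w)). u \<xi>)) = (NN w|M. indicator A (data w) * post_lap f (data w))" .
 qed
 then show ?thesis by (simp only: u_def)
qed

lemma kernel_atomic:
 assumes rcd: "regular_conditional_distribution M MX data signed_measure_space \<Theta> \<kappa>"
 shows "AE w in M. AE \<xi> in \<kappa> (data w). atomic_part \<xi> = \<xi>"
proof -
 have "AE w in M. \<Theta> w \<in> {\<xi> \<in> space signed_measure_space. atomic_part \<xi> = \<xi>}"
  using AE_atomic_data AE_space by eventually_elim (use measurable_space[OF Theta_meas] in simp)
 from rcd_AE[OF rcd sets_atomic_fixpoints this] show ?thesis
  by eventually_elim (auto elim!: eventually_mono)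
qed

end

section \<open>Posterior weights and the posterior law\<close>

lemma finite_atom_process_away:
 fixes \<xi> :: "'a::{metric_space, second_countable_topology} set \<Rightarrow> real"
 assumes \<xi>: "\<xi> \<in> space signed_measure_space"
 shows "emeasure (atom_process \<xi>) (ball x0 r \<times> away p) < \<top>"
proof -
 have B: "ball x0 r \<in> bounded_borel" by (simp add: bounded_borel_def)
 have "finite {s\<in>ball x0 r. 1 / Suc p \<le> \<bar>\<xi> {s}\<bar>}" by (rule finite_large_atoms[OF \<xi> B]) simp
 moreover have "{s. (s, \<xi> {s}) \<in> ball x0 r \<times> away p} = {s\<in>ball x0 r. 1 / Suc p \<le> \<bar>\<xi> {s}\<bar>}" by (auto simp: away_def)
 moreover have "ball x0 r \<times> away p \<in> sets point_borel"
  using away_nonzero by (intro pair_nonzero_setsI) auto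
 ultimately show ?thesis by (simp add: emeasure_atom_process emeasure_count_space of_nat_less_top)
qed

context posterior_model
begin

definition "nu_post = density \<nu> (\<lambda>t. emeasure (Hord t) {0} ^ m)"

text \<open>Bayes' formula for a single atom: the joint density divided by its integral over the
  weight. It is a probability law only when the constant is positive and finite.\<close>

definition "weight_law w s = density lborel (\<lambda>t. ulik s t (mark_at w s) / cc s (mark_at w s))"

lemma sets_nu_post: "sets nu_post = sets nonzero_borel"
 by (simp add: nu_post_def nu_sets)

lemma H0_nu: "(\<lambda>t. emeasure (Hord t) {0} ^ m) \<in> borel_measurable \<nu>"
proof -
 have "(\<lambda>t. emeasure (Hord t) {0} ^ m) \<in> borel_measurable borel" by measurable
 then have "(\<lambda>t. emeasure (Hord t) {0} ^ m) \<in> borel_measurable nonzero_borel"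
  unfolding nonzero_borel_def by (rule measurable_restrict_space1)
 then show ?thesis by (simp only: measurable_cong_sets[OF nu_sets refl])
qed

lemma H0_le_1: "emeasure (Hord t) {0} ^ m \<le> 1"
proof -
 interpret Ht: prob_space "Hord t" by (rule Hord_prob)
 show ?thesis by (intro power_le_one) (simp_all add: Ht.emeasure_le_1)
qed

lemma sigma_finite_nu_post: "sigma_finite_measure nu_post"
proof -
 interpret nu: sigma_finite_measure \<nu> by (rule nu_sigma_finite)
 have "emeasure (Hord t) {0} ^ m \<noteq> \<infinity>" for t using H0_le_1[of t] by (auto simp: top_unique)
 then show ?thesis unfolding nu_post_def by (subst nu.sigma_finite_iff_density_finite[OF H0_nu]) auto
qed

lemma sets_G_nu_post: "sets (G \<Otimes>\<^sub>M nu_post) = sets point_borel"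
 using G_sets sets_nu_post by (intro sets_pair_measure_cong) auto

lemma nn_integral_G_nu_post:
 assumes f: "f \<in> borel_measurable pair_borel"
 shows "(NN p|(G \<Otimes>\<^sub>M nu_post). f p) = (NN s|G. NN t|lborel. f (s, t) * (g0 t * emeasure (Hord t) {0} ^ m))"
proof -
 interpret np: sigma_finite_measure nu_post by (rule sigma_finite_nu_post)
 note [measurable] = f
 have fm: "f \<in> borel_measurable (G \<Otimes>\<^sub>M nu_post)"
  using measurable_pair_nonzero_borel[OF f] sets_G_nu_post by (simp cong: measurable_cong_sets)
 have "(NN p|(G \<Otimes>\<^sub>M nu_post). f p) = (NN s|G. NN t|nu_post. f (s, t))"
  by (rule np.nn_integral_fst[OF fm, symmetric])
 also have "\<dots> = (NN s|G. NN t|lborel. f (s, t) * (g0 t * emeasure (Hord t) {0} ^ m))"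
 proof (rule nn_integral_cong)
  fix s
  have fs: "(\<lambda>t. f (s, t)) \<in> borel_measurable borel" by measurable
  then have "(\<lambda>t. f (s, t)) \<in> borel_measurable nonzero_borel" unfolding nonzero_borel_def by (rule measurable_restrict_space1)
  then have fn: "(\<lambda>t. f (s, t)) \<in> borel_measurable \<nu>" by (simp only: measurable_cong_sets[OF nu_sets refl])
  have "(NN t|nu_post. f (s, t)) = (NN t|\<nu>. emeasure (Hord t) {0} ^ m * f (s, t))"
   unfolding nu_post_def by (rule nn_integral_density[OF H0_nu fn])
  also have "\<dots> = (NN t|lborel. (emeasure (Hord t) {0} ^ m * f (s, t)) * g0 t)"
   by (rule nn_integral_nu) measurable
  finally show "(NN t|nu_post. f (s, t)) = (NN t|lborel. f (s, t) * (g0 t * emeasure (Hord t) {0} ^ m))"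
   by (simp only: mult_ac)
 qed
 finally show ?thesis .
qed

lemma levy_G_nu: "levy_measure (G \<Otimes>\<^sub>M \<nu>)"
 using rep by (simp add: crsm_representation_def)

lemma levy_G_nu_post: "levy_measure (G \<Otimes>\<^sub>M nu_post)"
 unfolding levy_measure_def
proof (intro conjI ballI allI)
 show "sets (G \<Otimes>\<^sub>M nu_post) = sets point_borel" by (rule sets_G_nu_post)
 interpret np: sigma_finite_measure nu_post by (rule sigma_finite_nu_post)
 fix B :: "'a set" assume B: "B \<in> bounded_borel"
 have [measurable]: "B \<in> sets borel" using B by (rule bounded_borel_sets)
 have m: "(\<lambda>p. indicator B (fst p) * ennreal (min 1 \<bar>snd p\<bar>)) \<in> borel_measurable pair_borel" by measurable
 have "(NN p|(G \<Otimes>\<^sub>M nu_post). indicator B (fst p) * ennreal (min 1 \<bar>snd p\<bar>)) \<le> (NN p|(G \<Otimes>\<^sub>M \<nu>). indicator B (fst p) * ennreal (min 1 \<bar>snd p\<bar>))"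
  unfolding nn_integral_G_nu_post[OF m] nn_integral_G_nu[OF m]
  using H0_le_1 by (intro nn_integral_mono mult_left_mono mult_left_le) auto
 also have "\<dots> < \<infinity>" using levy_G_nu B by (simp add: levy_measure_def)
 finally show "(NN p|(G \<Otimes>\<^sub>M nu_post). indicator B (fst p) * ennreal (min 1 \<bar>snd p\<bar>)) < \<infinity>" .
next
 interpret np: sigma_finite_measure nu_post by (rule sigma_finite_nu_post)
 fix s :: 'a
 have "emeasure (G \<Otimes>\<^sub>M nu_post) ({s} \<times> - {0}) = emeasure G {s} * emeasure nu_post (- {0})"
  by (rule np.emeasure_pair_measure_Times) (auto simp: G_sets sets_nu_post sets_nonzero_borel)
 then show "emeasure (G \<Otimes>\<^sub>M nu_post) ({s} \<times> - {0}) = 0" by (simp add: G_atomless)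
qed

lemma weight_law_sets: "sets (weight_law w s) = sets borel"
 by (simp add: weight_law_def)

lemma mark_at_RV: "mark_at w s \<in> space RV"
 by (simp add: mark_at_def space_RV)

lemma ulik_mark_meas [measurable]: "(\<lambda>t. ulik s t (mark_at w s)) \<in> borel_measurable borel"
 by (rule ulik_t) (simp add: space_lam mark_at_RV)

lemma nn_integral_weight_law:
 assumes [measurable]: "f \<in> borel_measurable borel"
 shows "(NN t|(weight_law w s). f t) = (NN t|lborel. f t * ulik s t (mark_at w s)) / cc s (mark_at w s)"
proof -
 have "(NN t|(weight_law w s). f t) = (NN t|lborel. (ulik s t (mark_at w s) / cc s (mark_at w s)) * f t)"
  unfolding weight_law_def by (rule nn_integral_density) measurable
 also have "\<dots> = (NN t|lborel. (f t * ulik s t (mark_at w s)) / cc s (mark_at w s))"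
  by (simp add: divide_ennreal_def mult_ac)
 also have "\<dots> = (NN t|lborel. f t * ulik s t (mark_at w s)) / cc s (mark_at w s)"
  by (rule nn_integral_divide) measurable
 finally show ?thesis .
qed

lemma weight_law_prob:
 assumes "0 < cc s (mark_at w s)" "cc s (mark_at w s) < \<top>"
 shows "prob_space (weight_law w s)"
proof (rule prob_spaceI)
 have "emeasure (weight_law w s) (space (weight_law w s)) = (NN t|(weight_law w s). 1)" by simp
 also have "\<dots> = cc s (mark_at w s) / cc s (mark_at w s)" by (subst nn_integral_weight_law) (simp_all add: cc_def)
 also have "\<dots> = 1" using assms by (intro ennreal_divide_self) auto
 finally show "emeasure (weight_law w s) (space (weight_law w s)) = 1" .
qed

lemma weight_law_density:
 assumes cc: "0 < cc s (mark_at w s)" "cc s (mark_at w s) < \<top>"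
  and u: "\<And>t. ulik s t (mark_at w s) = ennreal (u t)" "\<And>t. 0 \<le> u t"
 shows "has_density_proportional_to (weight_law w s) u"
 unfolding has_density_proportional_to_def
proof (intro conjI allI)
 show "prob_space (weight_law w s)" by (rule weight_law_prob[OF cc])
 have "u = (\<lambda>t. enn2real (ulik s t (mark_at w s)))" using u by (auto simp: fun_eq_iff)
 then show "u \<in> borel_measurable borel" by simp
 show "0 \<le> u t" for t by (rule u(2))
 obtain r where r: "0 \<le> r" "cc s (mark_at w s) = ennreal r" using cc(2) by (cases "cc s (mark_at w s)") auto
 with cc(1) have r0: "0 < r" by simp
 have "ulik s t (mark_at w s) / cc s (mark_at w s) = ennreal (1 / r * u t)" for t
  using r0 u(2)[of t] by (simp add: u(1) r(2) divide_ennreal)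
 then have "weight_law w s = density lborel (\<lambda>t. ennreal (1 / r * u t))" by (simp add: weight_law_def)
 then show "\<exists>c>0. weight_law w s = density lborel (\<lambda>\<theta>. ennreal (c * u \<theta>))" using r0 by (intro exI[of _ "1 / r"]) simp
qed

lemma weight_law_fix:
 assumes k: "k < Kfix" and nz: "\<And>j. j < m \<Longrightarrow> X j w {\<psi>fix k} \<noteq> 0"
  and cc: "0 < cc (\<psi>fix k) (mark_at w (\<psi>fix k))" "cc (\<psi>fix k) (mark_at w (\<psi>fix k)) < \<top>"
 shows "has_density_proportional_to (weight_law w (\<psi>fix k)) (\<lambda>t. ffix k t * (\<Prod>j<m. hfix t (X j w {\<psi>fix k})))"
proof (rule weight_law_density[OF cc])
 fix t
 have kS: "\<psi>fix k \<in> S" using k by blast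
 have f0: "0 \<le> ffix k t" using fixed_density[OF k] by blast
 have "(\<Prod>j<m. lik (\<psi>fix k) t (mark_at w (\<psi>fix k) j)) = (\<Prod>j<m. ennreal (hfix t (X j w {\<psi>fix k})))"
  using nz by (intro prod.cong refl) (simp add: lik_fix[OF kS] lfix_def mark_at_def)
 also have "\<dots> = ennreal (\<Prod>j<m. hfix t (X j w {\<psi>fix k}))" by (rule prod_ennreal) (rule hfix_nonneg)
 finally show "ulik (\<psi>fix k) t (mark_at w (\<psi>fix k)) = ennreal (ffix k t * (\<Prod>j<m. hfix t (X j w {\<psi>fix k})))"
  using f0 by (simp add: ulik_def wt_fix[OF k] ennreal_mult prod_nonneg hfix_nonneg)
 show "0 \<le> ffix k t * (\<Prod>j<m. hfix t (X j w {\<psi>fix k}))" using f0 by (simp add: prod_nonneg hfix_nonneg)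
qed

lemma weight_law_new:
 assumes s: "s \<notin> S" and cc: "0 < cc s (mark_at w s)" "cc s (mark_at w s) < \<top>"
 shows "has_density_proportional_to (weight_law w s) (\<lambda>t. if t = 0 then 0 else g t * (\<Prod>j<m. mixed_density Hord hord t (X j w {s})))"
proof (rule weight_law_density[OF cc])
 fix t
 have mn: "0 \<le> mixed_density Hord hord t y" for y by (simp add: mixed_density_def hord_nonneg)
 have g0: "t \<noteq> 0 \<Longrightarrow> 0 \<le> g t" using g_pos[of t] by simp
 have "(\<Prod>j<m. lik s t (mark_at w s j)) = (\<Prod>j<m. ennreal (mixed_density Hord hord t (X j w {s})))"
  by (intro prod.cong refl) (simp add: lik_ord[OF s] lord_def mark_at_def)
 also have "\<dots> = ennreal (\<Prod>j<m. mixed_density Hord hord t (X j w {s}))" by (rule prod_ennreal) (rule mn)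
 finally show "ulik s t (mark_at w s) = ennreal (if t = 0 then 0 else g t * (\<Prod>j<m. mixed_density Hord hord t (X j w {s})))"
  using g0 by (simp add: ulik_def wt_ord[OF s] g0_def ennreal_mult prod_nonneg mn)
 show "0 \<le> (if t = 0 then 0 else g t * (\<Prod>j<m. mixed_density Hord hord t (X j w {s})))" using g0 by (simp add: prod_nonneg mn)
qed

definition "atoms_at w = {s. \<exists>j<m. X j w {s} \<noteq> 0}"

text \<open>Finitely many observed atoms turn the exponential of the integral into a product of the
  averages \<open>bb\<close>, each an integral with respect to \<open>weight_law\<close>.\<close>

lemma post_lap_eq:
 assumes f: "f \<in> borel_measurable pair_borel" and fin: "finite (atoms_at w)"
 shows "post_lap f (data w) = eneg (NN p|(G \<Otimes>\<^sub>M nu_post). 1 - eneg (f p)) * (\<Prod>s\<in>atoms_at w. NN t|(weight_law w s). eneg (f (s, t)))"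
proof -
 note [measurable] = f
 have "(\<lambda>p. 1 - eneg (f p)) \<in> borel_measurable pair_borel" by measurable
 from nn_integral_G_nu_post[OF this] have c: "cf f = eneg (NN p|(G \<Otimes>\<^sub>M nu_post). 1 - eneg (f p))" by (simp add: cf_def)
 have lm: "(\<lambda>p. lneg (bb f (fst p) (snd p))) \<in> borel_measurable (borel \<Otimes>\<^sub>M RV)" by measurable
 have mk: "(\<lambda>j\<in>{..<m}. data w j {s}) = mark_at w s" for s by (auto simp: mark_at_def)
 have at: "{s. \<exists>j<m. data w j {s} \<noteq> 0} = atoms_at w" by (auto simp: atoms_at_def)
 have "(NN p|(obs w). lneg (bb f (fst p) (snd p))) = (NN s|(count_space (atoms_at w)). lneg (bb f s (mark_at w s)))"
  using nn_integral_vector_atoms[OF lm[unfolded RV_def], of "data w"] unfolding mk at by simp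
 also have "\<dots> = (\<Sum>s\<in>atoms_at w. lneg (bb f s (mark_at w s)))"
  using fin by (rule nn_integral_count_space_finite)
 finally have "eneg (NN p|(obs w). lneg (bb f (fst p) (snd p))) = (\<Prod>s\<in>atoms_at w. bb f s (mark_at w s))"
  using fin by (simp add: eneg_sum bb_le_1)
 also have "\<dots> = (\<Prod>s\<in>atoms_at w. NN t|(weight_law w s). eneg (f (s, t)))"
 proof (intro prod.cong refl)
  fix s
  have "(\<lambda>t. eneg (f (s, t))) \<in> borel_measurable borel" by measurable
  from nn_integral_weight_law[OF this] show "bb f s (mark_at w s) = (NN t|(weight_law w s). eneg (f (s, t)))"
   by (simp add: bb_def)
 qed
 finally show ?thesis by (simp add: post_lap_def c)
qed

text \<open>Equality is only available for the countably many named functions, at a fixed outcome of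
  the data. The windows are balls times \<open>away p\<close>; both functionals are continuous in
  them, so \<open>laplace_extend\<close> reaches every test function.\<close>

lemma kernel_laplace_all:
 fixes x0 :: 'a
 assumes kern: "prob_space \<mu>" "sets \<mu> = sets signed_measure_space"
  and fin: "finite (atoms_at w)" and cc: "\<And>s. s \<in> atoms_at w \<Longrightarrow> 0 < cc s (mark_at w s) \<and> cc s (mark_at w s) < \<top>"
  and test: "\<And>t. (NN \<xi>|\<mu>. eneg (NN p|(atom_process \<xi>). ennreal (test_fun (\<lambda>p. ball x0 (real p) \<times> away p) t p))) =
    post_lap (\<lambda>p. ennreal (test_fun (\<lambda>p. ball x0 (real p) \<times> away p) t p)) (data w)"
  and f: "f \<in> borel_measurable pair_borel"
 shows "(NN \<xi>|\<mu>. eneg (NN p|(atom_process \<xi>). f p)) =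
  eneg (NN p|(G \<Otimes>\<^sub>M nu_post). 1 - eneg (f p)) * (\<Prod>s\<in>atoms_at w. NN t|(weight_law w s). eneg (f (s, t)))"
proof -
 define D where "D p = ball x0 (real p) \<times> away p" for p :: nat
 have space_\<mu>: "space \<mu> = space signed_measure_space" using kern(2) by (rule sets_eq_imp_space_eq)
 have Dn: "D p \<in> sets point_borel" for p
  unfolding D_def using away_nonzero by (intro pair_nonzero_setsI) auto
 have Db: "D p \<in> sets borel" for p using Dn[of p] unfolding sets_pair_nonzero_borel borel_prod by (rule conjunct1)
 interpret E: exhaustion D
 proof
  show "D n \<in> sets borel" for n by (rule Db)
  show "incseq D"
  proof (rule incseq_SucI)
   fix n
   have "ball x0 (real n) \<subseteq> ball x0 (real (Suc n))" by (rule subset_ball) simp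
   moreover have "away n \<subseteq> away (Suc n)" by (rule away_mono) simp
   ultimately show "D n \<subseteq> D (Suc n)" unfolding D_def by (intro Sigma_mono)
  qed
 qed
 have UD: "(\<Union>n. D n) = UNIV \<times> - {0}"
 proof (intro equalityI subsetI)
  fix z :: "'a \<times> real" assume z: "z \<in> UNIV \<times> - {0}"
  have "snd z \<noteq> 0" using z by auto
  then obtain p where p: "snd z \<in> away p" using in_away by blast
  obtain q where q: "dist x0 (fst z) < real q" using reals_Archimedean2 by blast
  have "snd z \<in> away (max p q)" using p away_mono[of p "max p q"] by auto
  then have "z \<in> D (max p q)" using q by (cases z) (auto simp: D_def)
  then show "z \<in> (\<Union>n. D n)" by blast
 qed (use away_nonzero in \<open>auto simp: D_def\<close>)
 define \<Phi> where "\<Phi> f = (NN \<xi>|\<mu>. eneg (NN p|(atom_process \<xi>). f p))" for f :: "'a \<times> real \<Rightarrow> ennreal"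
 define \<Psi> where "\<Psi> f = eneg (NN p|(G \<Otimes>\<^sub>M nu_post). 1 - eneg (f p)) * (\<Prod>s\<in>atoms_at w. NN t|(weight_law w s). eneg (f (s, t)))" for f
 have c1: "laplace_cont D \<Phi>"
  unfolding \<Phi>_def[abs_def]
 proof (rule laplace_cont_process[OF prob_space.finite_measure[OF kern(1)] sets_atom_process _ Dn])
  show "(\<lambda>\<xi>. emeasure (atom_process \<xi>) A) \<in> borel_measurable \<mu>" if "A \<in> sets point_borel" for A :: "('a \<times> real) set"
   using measurable_emeasure_atom_process[OF that] kern(2) by (simp cong: measurable_cong_sets)
  show "emeasure (atom_process \<xi>) (D p) < \<top>" if "\<xi> \<in> space \<mu>" for \<xi> p
   unfolding D_def by (rule finite_atom_process_away) (use that space_\<mu> in simp)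
 qed
 have c2: "laplace_cont D \<Psi>"
  unfolding \<Psi>_def[abs_def]
 proof (rule laplace_cont_product[OF sets_G_nu_post Dn])
  show "emeasure (G \<Otimes>\<^sub>M nu_post) (D p) < \<top>" for p
  proof -
   interpret np: sigma_finite_measure nu_post by (rule sigma_finite_nu_post)
   interpret GP: prob_space G by (rule G_prob)
   have "emeasure (G \<Otimes>\<^sub>M nu_post) (D p) = emeasure G (ball x0 (real p)) * emeasure nu_post (away p)"
    unfolding D_def using away_nonzero by (intro np.emeasure_pair_measure_Times) (auto simp: G_sets sets_nu_post sets_nonzero_borel)
   moreover have "emeasure nu_post (away p) < \<infinity>"
    by (rule levy_measure_pair_finite_away[OF levy_G_nu_post G_sets G_prob sets_nu_post sigma_finite_nu_post])
   ultimately show ?thesis by (simp add: ennreal_mult_less_top GP.emeasure_eq_measure)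
  qed
  show "prob_space (weight_law w s)" if "s \<in> atoms_at w" for s using cc[OF that] by (intro weight_law_prob) auto
 qed (rule weight_law_sets)
 have eq: "\<Phi> (\<lambda>z. ennreal (test_fun D t z)) = \<Psi> (\<lambda>z. ennreal (test_fun D t z))" for t
 proof -
  have m: "(\<lambda>z. ennreal (test_fun D t z)) \<in> borel_measurable pair_borel"
   using E.test_fun_measurable[of t] by (simp add: borel_prod)
  show ?thesis unfolding \<Phi>_def \<Psi>_def post_lap_eq[OF m fin, symmetric] using test[of t] by (simp add: D_def[abs_def])
 qed
 have "\<Phi> (\<lambda>z. f z * indicator (\<Union>n. D n) z) = \<Psi> (\<lambda>z. f z * indicator (\<Union>n. D n) z)"
  using f by (intro E.laplace_extend[OF c1 c2 eq]) (simp add: borel_prod)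
 moreover have "\<Phi> (\<lambda>z. f z * indicator (\<Union>n. D n) z) = \<Phi> f"
 proof -
  have "(NN p|(atom_process \<xi>). f p * indicator (\<Union>n. D n) p) = (NN p|(atom_process \<xi>). f p)" for \<xi> :: "'a set \<Rightarrow> real"
   unfolding UD by (intro nn_integral_cong) (simp add: space_atom_process)
  then show ?thesis by (simp add: \<Phi>_def)
 qed
 moreover have "\<Psi> (\<lambda>z. f z * indicator (\<Union>n. D n) z) = \<Psi> f"
 proof -
  have sp: "space (G \<Otimes>\<^sub>M nu_post) = UNIV \<times> - {0}"
   using sets_eq_imp_space_eq[OF sets_G_nu_post] by (simp add: space_pair_measure)
  have 1: "(NN p|(G \<Otimes>\<^sub>M nu_post). 1 - eneg (f p * indicator (\<Union>n. D n) p)) = (NN p|(G \<Otimes>\<^sub>M nu_post). 1 - eneg (f p))"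
   unfolding UD by (intro nn_integral_cong) (simp add: sp)
  have 2: "(NN t|(weight_law w s). eneg (f (s, t) * indicator (\<Union>n. D n) (s, t))) = (NN t|(weight_law w s). eneg (f (s, t)))" for s
  proof (rule nn_integral_cong_AE)
   \<comment> \<open>The windows miss the weight 0. The laws of the fixed weights do not see it
     either, having Lebesgue densities.\<close>
   have "AE t in weight_law w s. t \<noteq> 0"
    unfolding weight_law_def using AE_lborel_nonzero by (subst AE_density) (auto elim!: eventually_mono)
   then show "AE t in weight_law w s. eneg (f (s, t) * indicator (\<Union>n. D n) (s, t)) = eneg (f (s, t))"
    unfolding UD by eventually_elim simp
  qed
  show ?thesis unfolding \<Psi>_def 1 2 ..
 qed
 ultimately show ?thesis unfolding \<Phi>_def \<Psi>_def by simp
qed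

text \<open>The exceptional null set depends on the kernel and the data alone, which is why all
  realisations \<open>Q\<close>, \<open>\<Theta>post\<close> of the conditional law can be treated
  outside it. Their Laplace functional is that of the kernel, and \<open>laplace_crsm\<close> yields
  the rest.\<close>

lemma posterior_law:
 assumes rcd: "regular_conditional_distribution M MX data signed_measure_space \<Theta> \<kappa>"
 shows "AE w in M. finite (atoms_at w - S) \<and>
  (\<forall>(Q :: 'v measure) \<Theta>post.
    prob_space Q \<and> \<Theta>post \<in> Q \<rightarrow>\<^sub>M signed_measure_space \<and> distr Q signed_measure_space \<Theta>post = \<kappa> (data w) \<longrightarrow>
    crsm Q \<Theta>post \<and>
    (\<exists>Lpost.
     crsm_representation Q \<Theta>post (S \<union> (atoms_at w - S)) Lpost zero_signed_measure (G \<Otimes>\<^sub>M nu_post) \<and>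
     (\<forall>k<Kfix. has_density_proportional_to (Lpost (\<psi>fix k)) (\<lambda>t. ffix k t * (\<Prod>j<m. hfix t (X j w {\<psi>fix k})))) \<and>
     (\<forall>s\<in>atoms_at w - S. has_density_proportional_to (Lpost s)
       (\<lambda>t. if t = 0 then 0 else g t * (\<Prod>j<m. mixed_density Hord hord t (X j w {s}))))))"
proof -
 obtain x0 :: 'a where True by simp
 define D where "D p = ball x0 (real p) \<times> away p" for p :: nat
 have Db: "D p \<in> sets borel" for p
  unfolding D_def borel_prod[symmetric] by (intro pair_measureI) auto
 have tm: "(\<lambda>z. ennreal (test_fun D t z)) \<in> borel_measurable pair_borel" for t
 proof -
  have "test_fun D t \<in> borel_measurable borel" by (induction t) (use Db in simp_all)
  then show ?thesis by (simp add: borel_prod)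
 qed
 have "AE w in M. \<forall>t. (NN \<xi>|(\<kappa> (data w)). eneg (NN p|(atom_process \<xi>). ennreal (test_fun D t p))) = post_lap (\<lambda>p. ennreal (test_fun D t p)) (data w)"
  unfolding AE_all_countable by (intro allI kernel_laplace[OF rcd tm])
 then show ?thesis using AE_data kernel_atomic[OF rcd] AE_space
 proof eventually_elim
  case (elim w)
  note test = elim(1)
  have fin: "finite (atoms_at w)" and nz: "\<And>s j. s \<in> S \<Longrightarrow> j < m \<Longrightarrow> X j w {s} \<noteq> 0"
   and cc: "\<And>s. s \<in> atoms_at w \<Longrightarrow> 0 < cc s (mark_at w s) \<and> cc s (mark_at w s) < \<top>"
   using elim(2) unfolding atoms_at_def by blast+
  \<comment> \<open>Every fixed location is observed, because \<open>m\<close> is positive and its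
    observations are nonzero; the fixed locations and the new ones together are all the observed
    atoms.\<close>
  have SA: "S \<subseteq> atoms_at w"
  proof
   fix s assume "s \<in> S"
   then have "X 0 w {s} \<noteq> 0" using nz[of s 0] m_pos by simp
   then show "s \<in> atoms_at w" unfolding atoms_at_def using m_pos by (intro CollectI exI[of _ 0]) simp
  qed
  have \<kappa>: "\<kappa> \<in> MX \<rightarrow>\<^sub>M prob_algebra signed_measure_space"
   using rcd by (auto simp: regular_conditional_distribution_def)
  have "\<kappa> (data w) \<in> space (prob_algebra signed_measure_space)"
   by (rule measurable_space[OF \<kappa> measurable_space[OF data_meas elim(4)]])
  then have kp: "prob_space (\<kappa> (data w))" "sets (\<kappa> (data w)) = sets signed_measure_space" by (auto simp: space_prob_algebra)
  show ?case
  proof (intro conjI allI impI; (elim conjE)?)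
   show "finite (atoms_at w - S)" using fin by simp
   fix Q :: "'v measure" and \<Theta>post
   assume Q: "prob_space Q" and Tm: "\<Theta>post \<in> Q \<rightarrow>\<^sub>M signed_measure_space" and d: "distr Q signed_measure_space \<Theta>post = \<kappa> (data w)"
   have "laplace_crsm Q \<Theta>post (atoms_at w) (weight_law w) (G \<Otimes>\<^sub>M nu_post)"
   proof (intro laplace_crsm.intro laplace_crsm_axioms.intro)
    show "AE w' in Q. atomic_part (\<Theta>post w') = \<Theta>post w'"
     using elim(3) unfolding d[symmetric] by (rule AE_distrD[OF Tm])
    show "prob_space (weight_law w s)" if "s \<in> atoms_at w" for s using cc[OF that] by (intro weight_law_prob) auto
    fix f :: "'a \<times> real \<Rightarrow> ennreal" assume f: "f \<in> borel_measurable pair_borel"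
    have um: "(\<lambda>\<xi>. eneg (NN p|(atom_process \<xi>). f p)) \<in> borel_measurable signed_measure_space"
     by (rule measurable_compose[OF measurable_nn_integral_kernel[OF sets_atom_process measurable_emeasure_atom_process measurable_pair_nonzero_borel[OF f]] measurable_eneg])
    have "(NN w'|Q. eneg (NN p|(atom_process (\<Theta>post w')). f p)) = (NN \<xi>|(\<kappa> (data w)). eneg (NN p|(atom_process \<xi>). f p))"
     unfolding d[symmetric] using um by (subst nn_integral_distr[OF Tm]) simp_all
    also have "\<dots> = eneg (NN p|(G \<Otimes>\<^sub>M nu_post). 1 - eneg (f p)) * (\<Prod>s\<in>atoms_at w. NN t|(weight_law w s). eneg (f (s, t)))"
     by (rule kernel_laplace_all[OF kp fin cc _ f]) (use test in \<open>auto simp: D_def[abs_def]\<close>)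
    finally show "(NN w'|Q. eneg (NN p|(atom_process (\<Theta>post w')). f p)) = \<dots>" .
   qed (rule Q Tm levy_G_nu_post fin weight_law_sets)+
   then interpret lc: laplace_crsm Q \<Theta>post "atoms_at w" "weight_law w" "G \<Otimes>\<^sub>M nu_post" .
   show "crsm Q \<Theta>post" by (rule lc.crsm)
   show "\<exists>Lpost.
     crsm_representation Q \<Theta>post (S \<union> (atoms_at w - S)) Lpost zero_signed_measure (G \<Otimes>\<^sub>M nu_post) \<and>
     (\<forall>k<Kfix. has_density_proportional_to (Lpost (\<psi>fix k)) (\<lambda>t. ffix k t * (\<Prod>j<m. hfix t (X j w {\<psi>fix k})))) \<and>
     (\<forall>s\<in>atoms_at w - S. has_density_proportional_to (Lpost s)
       (\<lambda>t. if t = 0 then 0 else g t * (\<Prod>j<m. mixed_density Hord hord t (X j w {s}))))"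
   proof (intro exI[of _ "weight_law w"] conjI allI impI ballI)
    have "S \<union> (atoms_at w - S) = atoms_at w" using SA by blast
    then show "crsm_representation Q \<Theta>post (S \<union> (atoms_at w - S)) (weight_law w) zero_signed_measure (G \<Otimes>\<^sub>M nu_post)"
     using lc.representation by simp
    show "has_density_proportional_to (weight_law w (\<psi>fix k)) (\<lambda>t. ffix k t * (\<Prod>j<m. hfix t (X j w {\<psi>fix k})))" if "k < Kfix" for k
    proof -
     have "\<psi>fix k \<in> S" using that by blast
     then show ?thesis using that nz cc SA by (intro weight_law_fix) blast+
    qed
    show "has_density_proportional_to (weight_law w s) (\<lambda>t. if t = 0 then 0 else g t * (\<Prod>j<m. mixed_density Hord hord t (X j w {s})))" if "s \<in> atoms_at w - S" for s
     using that cc by (intro weight_law_new) blast+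
   qed
  qed
 qed
qed

end

theorem proposition4p2:
  fixes M :: "'w measure"
    and \<Theta> :: "'w \<Rightarrow> 'a::polish_space set \<Rightarrow> real"
    and K :: "'w \<Rightarrow> enat" and \<psi> :: "nat \<Rightarrow> 'w \<Rightarrow> 'a" and \<theta> :: "nat \<Rightarrow> 'w \<Rightarrow> real"
    and Kfix :: nat and \<psi>fix :: "nat \<Rightarrow> 'a" and ffix :: "nat \<Rightarrow> real \<Rightarrow> real"
    and L :: "'a \<Rightarrow> real measure"
    and \<nu> :: "real measure" and g :: "real \<Rightarrow> real" and G :: "'a measure"
    and Hfix Hord :: "real \<Rightarrow> real measure" and hfix hord :: "real \<Rightarrow> real \<Rightarrow> real"
    and m :: nat and x :: "nat \<Rightarrow> nat \<Rightarrow> 'w \<Rightarrow> real" and X :: "nat \<Rightarrow> 'w \<Rightarrow> 'a set \<Rightarrow> real"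
    and \<kappa> :: "(nat \<Rightarrow> 'a set \<Rightarrow> real) \<Rightarrow> ('a set \<Rightarrow> real) measure"
  defines "new \<equiv> (\<lambda>\<omega>. {s. \<exists>j<m. X j \<omega> {s} \<noteq> 0} - \<psi>fix ` {..<Kfix})"
    and "\<nu>post \<equiv> density \<nu> (\<lambda>t. emeasure (Hord t) {0} ^ m)"
  \<comment> \<open>prior: A00, A0, A1\<close>
  assumes crsm: "crsm M \<Theta>"
    and fixed_inj: "inj_on \<psi>fix {..<Kfix}"
    and fixed_density: "\<And>k. k < Kfix \<Longrightarrow> ffix k \<in> borel_measurable borel \<and> (\<forall>t. 0 \<le> ffix k t)
          \<and> L (\<psi>fix k) = density lborel (\<lambda>t. ennreal (ffix k t))"
    and rep: "crsm_representation M \<Theta> (\<psi>fix ` {..<Kfix}) L zero_signed_measure (G \<Otimes>\<^sub>M \<nu>)"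
    and nu_sets: "sets \<nu> = sets nonzero_borel" and nu_sigma_finite: "sigma_finite_measure \<nu>"
    and G_sets: "sets G = sets borel" and G_prob: "prob_space G" and G_atomless: "\<And>s. emeasure G {s} = 0"
    and A1: "emeasure \<nu> (space \<nu>) = \<infinity>"
    and g_measurable: "g \<in> borel_measurable nonzero_borel" and g_pos: "\<And>t. t \<noteq> 0 \<Longrightarrow> 0 < g t"
    and nu_density: "\<nu> = density nonzero_lborel (\<lambda>t. ennreal (g t))"
  \<comment> \<open>enumeration of the atoms of the prior, fixed ones first\<close>
    and series: "atomic_series M K \<psi> \<theta> \<Theta>"
    and atoms: "AE \<omega> in M. enat Kfix \<le> K \<omega> \<and> inj_on (\<lambda>k. \<psi> k \<omega>) {k. enat k < K \<omega>}
          \<and> (\<forall>k<Kfix. \<psi> k \<omega> = \<psi>fix k) \<and> (\<forall>k\<ge>Kfix. enat k < K \<omega> \<longrightarrow> \<theta> k \<omega> \<noteq> 0)"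
  \<comment> \<open>likelihood\<close>
    and Hfix_kernel: "Hfix \<in> borel \<rightarrow>\<^sub>M prob_algebra borel"
    and hfix_measurable: "(\<lambda>(t, y). hfix t y) \<in> borel_measurable (borel \<Otimes>\<^sub>M borel)"
    and hfix_nonneg: "\<And>t y. 0 \<le> hfix t y"
    and hfix_density: "\<And>t. Hfix t = density lborel (\<lambda>y. ennreal (hfix t y))"
    and Hord_kernel: "Hord \<in> borel \<rightarrow>\<^sub>M prob_algebra borel"
    and hord_measurable: "(\<lambda>(t, y). hord t y) \<in> borel_measurable (borel \<Otimes>\<^sub>M nonzero_borel)"
    and hord_nonneg: "\<And>t y. y \<noteq> 0 \<Longrightarrow> 0 \<le> hord t y"
    and hord_density: "\<And>t. restrict_space (Hord t) (- {0}) = density nonzero_lborel (\<lambda>y. ennreal (hord t y))"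
    and A2': "(\<integral>\<^sup>+ t. (\<integral>\<^sup>+ y. ennreal (hord t y) \<partial>nonzero_lborel) \<partial>\<nu>) < \<infinity>"
  \<comment> \<open>data\<close>
    and m_pos: "1 \<le> m"
    and X_series: "\<And>j. j < m \<Longrightarrow> atomic_series M K \<psi> (x j) (X j)"
    and x_cond: "conditionally_independent_weights M m K \<psi> \<theta> (\<lambda>k. if k < Kfix then Hfix else Hord) x"
  \<comment> \<open>conditional distribution of the prior measure given the data\<close>
    and posterior: "regular_conditional_distribution M
          (\<Pi>\<^sub>M j\<in>{..<m}. signed_measure_space) (\<lambda>\<omega>. \<lambda>j\<in>{..<m}. X j \<omega>) signed_measure_space \<Theta> \<kappa>"
  shows "AE \<omega> in M. finite (new \<omega>) \<and>
    (\<forall>(Q :: 'v measure) \<Theta>post.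
       prob_space Q \<and> \<Theta>post \<in> Q \<rightarrow>\<^sub>M signed_measure_space \<and>
       distr Q signed_measure_space \<Theta>post = \<kappa> (\<lambda>j\<in>{..<m}. X j \<omega>) \<longrightarrow>
       crsm Q \<Theta>post \<and>
       (\<exists>Lpost.
          crsm_representation Q \<Theta>post (\<psi>fix ` {..<Kfix} \<union> new \<omega>) Lpost zero_signed_measure (G \<Otimes>\<^sub>M \<nu>post) \<and>
          (\<forall>k<Kfix. has_density_proportional_to (Lpost (\<psi>fix k))
             (\<lambda>t. ffix k t * (\<Prod>j<m. hfix t (X j \<omega> {\<psi>fix k})))) \<and>
          (\<forall>s\<in>new \<omega>. has_density_proportional_to (Lpost s)
             (\<lambda>t. if t = 0 then 0 else g t * (\<Prod>j<m. mixed_density Hord hord t (X j \<omega> {s}))))))"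
proof -
 interpret prob_space M using crsm by (simp add: crsm_def)
 interpret posterior_model M \<Theta> K \<psi> \<theta> Kfix \<psi>fix ffix L \<nu> g G Hfix Hord hfix hord m x X
  by (rule posterior_model.intro[OF prob_space_axioms posterior_model_axioms.intro[OF fixed_inj fixed_density rep nu_sets nu_sigma_finite
    G_sets G_prob G_atomless g_measurable g_pos nu_density series atoms Hfix_kernel hfix_measurable hfix_nonneg hfix_density
    Hord_kernel hord_measurable hord_nonneg hord_density A2' m_pos X_series x_cond]])
 show ?thesis
  using posterior_law[OF posterior] unfolding new_def \<nu>post_def atoms_at_def nu_post_def .
qed

end
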